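(* Let $M\subset\mathbb{R}^2$ be a bounded simply connected domain with smooth boundary. Let $\psi\in W^{4,p}(M)$, for some $p>1$, be a streamfunction of a steady solution $u_e=\nabla^\perp\psi$ of the Euler equations in $M$ with $u_e\cdot\hat n=0$ on $\partial M$. Suppose $u_e$ has a single stagnation point, which is non-degenerate in the sense that the period of revolution of a particle is a differentiable function of the streamline. Suppose $\{u^\nu\}_{\nu>0}$ is a family of stationary solutions of the Navier–Stokes equations $$u^\nu\cdot\nabla u^\nu=-\nabla p^\nu+\nu\Delta u^\nu,\qquad\nabla\cdot u^\nu=0\qquad\text{in }M,$$ such that for some $\sigma>5/2$, $$\lim_{\nu\to0}\|u^\nu-u_e\|_{H^{\sigma}(U)}=0$$ for all interior open subsets $U\subset M$. Then $u_e=\omega_0u_*$ for some constant $\omega_0\in\mathbb{R}$, where $u_*=\nabla^\perp\Delta_D^{-1}[1]$.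
   Context: $\nabla^\perp=(-\partial_2,\partial_1)$; $\Delta_D^{-1}$ is the inverse of the Laplacian on $M$ with homogeneous Dirichlet boundary conditions, so $u_*=\nabla^\perp\psi_*$ with $\Delta\psi_*=1$ in $M$ and $\psi_*=0$ on $\partial M$ (the velocity field with constant unit vorticity). Streamlines are the level sets $\{\psi=c\}$; the period of revolution along a closed streamline $\{\psi=c\}$ is $T(c)=\oint_{\{\psi=c\}}\frac{d\ell}{|\nabla\psi|}$, regarded as a function of $c$. A stagnation point is a zero of $u_e$ (a critical point of $\psi$). An interior open subset is an open $U$ with compact closure contained in $M$. *)

theory Defs
  imports "HOL-Analysis.Analysis"
begin

section \<open>Classical differential operators in the plane\<close>

definition partial :: "2 \<Rightarrow> (real^2 \<Rightarrow> 'b::real_normed_vector) \<Rightarrow> real^2 \<Rightarrow> 'b" where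
  "partial i f x = frechet_derivative f (at x) (axis i 1)"

text \<open>\<open>C_on k S f\<close>: \<open>f\<close> is \<open>k\<close> times continuously differentiable on the open set \<open>S\<close>.\<close>

fun C_on :: "nat \<Rightarrow> (real^2) set \<Rightarrow> (real^2 \<Rightarrow> 'b::real_normed_vector) \<Rightarrow> bool" where
  "C_on 0 S f \<longleftrightarrow> continuous_on S f"
| "C_on (Suc k) S f \<longleftrightarrow> (\<forall>x\<in>S. f differentiable (at x)) \<and> (\<forall>i. C_on k S (partial i f))"

definition smooth_on :: "(real^2) set \<Rightarrow> (real^2 \<Rightarrow> 'b::real_normed_vector) \<Rightarrow> bool" where
  "smooth_on S f \<longleftrightarrow> (\<forall>k. C_on k S f)"

definition grad :: "(real^2 \<Rightarrow> real) \<Rightarrow> real^2 \<Rightarrow> real^2" where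
  "grad f x = (\<chi> i. partial i f x)"

definition perp_grad :: "(real^2 \<Rightarrow> real) \<Rightarrow> real^2 \<Rightarrow> real^2" where
  "perp_grad f x = vector [- partial 2 f x, partial 1 f x]"

definition divergence :: "(real^2 \<Rightarrow> real^2) \<Rightarrow> real^2 \<Rightarrow> real" where
  "divergence u x = (\<Sum>i\<in>UNIV. partial i u x $ i)"

definition laplacian :: "(real^2 \<Rightarrow> 'b::real_normed_vector) \<Rightarrow> real^2 \<Rightarrow> 'b" where
  "laplacian f x = (\<Sum>i\<in>UNIV. partial i (partial i f) x)"

definition convection :: "(real^2 \<Rightarrow> real^2) \<Rightarrow> (real^2 \<Rightarrow> real^2) \<Rightarrow> real^2 \<Rightarrow> real^2" where
  "convection u v x = (\<Sum>i\<in>UNIV. u x $ i *\<^sub>R partial i v x)"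


section \<open>Domains with smooth boundary\<close>

definition local_defining_function ::
  "(real^2) set \<Rightarrow> real^2 \<Rightarrow> (real^2) set \<Rightarrow> (real^2 \<Rightarrow> real) \<Rightarrow> bool" where
  "local_defining_function M x V \<rho> \<longleftrightarrow>
     open V \<and> x \<in> V \<and> smooth_on V \<rho> \<and> (\<forall>y\<in>V. grad \<rho> y \<noteq> 0) \<and>
     M \<inter> V = {y\<in>V. \<rho> y < 0}"

definition smooth_boundary :: "(real^2) set \<Rightarrow> bool" where
  "smooth_boundary M \<longleftrightarrow> (\<forall>x\<in>frontier M. \<exists>V \<rho>. local_defining_function M x V \<rho>)"

text \<open>The normalised gradient does not depend on the choice of the defining function.\<close>

definition outward_normal :: "(real^2) set \<Rightarrow> real^2 \<Rightarrow> real^2" where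
  "outward_normal M x =
     (THE n. \<exists>V \<rho>. local_defining_function M x V \<rho> \<and> n = grad \<rho> x /\<^sub>R norm (grad \<rho> x))"


section \<open>Weak derivatives and Sobolev spaces\<close>

text \<open>A pair \<open>(a, b)\<close> of natural numbers is a multi-index.\<close>

definition mpartial :: "nat \<times> nat \<Rightarrow> (real^2 \<Rightarrow> real) \<Rightarrow> real^2 \<Rightarrow> real" where
  "mpartial \<alpha> \<phi> = (partial 1 ^^ fst \<alpha>) ((partial 2 ^^ snd \<alpha>) \<phi>)"

definition test_function :: "(real^2) set \<Rightarrow> (real^2 \<Rightarrow> real) \<Rightarrow> bool" where
  "test_function U \<phi> \<longleftrightarrow>
     smooth_on UNIV \<phi> \<and> (\<exists>K. compact K \<and> K \<subseteq> U \<and> (\<forall>x. x \<notin> K \<longrightarrow> \<phi> x = 0))"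

definition locally_integrable_on ::
  "(real^2 \<Rightarrow> 'b::euclidean_space) \<Rightarrow> (real^2) set \<Rightarrow> bool" where
  "locally_integrable_on f U \<longleftrightarrow>
     (\<forall>K. compact K \<and> K \<subseteq> U \<longrightarrow> set_integrable lebesgue K f)"

definition has_weak_partial ::
  "(real^2) set \<Rightarrow> nat \<times> nat \<Rightarrow> (real^2 \<Rightarrow> 'b::euclidean_space) \<Rightarrow> (real^2 \<Rightarrow> 'b) \<Rightarrow> bool" where
  "has_weak_partial U \<alpha> f g \<longleftrightarrow>
     locally_integrable_on f U \<and> locally_integrable_on g U \<and>
     (\<forall>\<phi>. test_function U \<phi> \<longrightarrow>
        (LINT x:U|lebesgue. mpartial \<alpha> \<phi> x *\<^sub>R f x) =
        (- 1) ^ (fst \<alpha> + snd \<alpha>) *\<^sub>R (LINT x:U|lebesgue. \<phi> x *\<^sub>R g x))"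

definition Lp_on :: "real \<Rightarrow> (real^2) set \<Rightarrow> (real^2 \<Rightarrow> 'b::euclidean_space) \<Rightarrow> bool" where
  "Lp_on p U f \<longleftrightarrow>
     set_borel_measurable lebesgue U f \<and> set_integrable lebesgue U (\<lambda>x. norm (f x) powr p)"

definition W_space ::
  "nat \<Rightarrow> real \<Rightarrow> (real^2) set \<Rightarrow> (real^2 \<Rightarrow> 'b::euclidean_space) \<Rightarrow> bool" where
  "W_space k p U f \<longleftrightarrow>
     (\<forall>\<alpha>. fst \<alpha> + snd \<alpha> \<le> k \<longrightarrow> (\<exists>g. has_weak_partial U \<alpha> f g \<and> Lp_on p U g))"

text \<open>The weak derivative, meaningful only if one exists; it is unique almost everywhere.\<close>

definition weak_partial ::
  "(real^2) set \<Rightarrow> nat \<times> nat \<Rightarrow> (real^2 \<Rightarrow> 'b::euclidean_space) \<Rightarrow> real^2 \<Rightarrow> 'b" where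
  "weak_partial U \<alpha> f = (SOME g. has_weak_partial U \<alpha> f g)"

text \<open>
  The norm of \<open>H\<^sup>\<sigma>(U)\<close> for real \<open>\<sigma> \<ge> 0\<close> in the Sobolev--Slobodeckij form: writing
  \<open>\<sigma> = k + s\<close> with \<open>k\<close> a natural number and \<open>0 \<le> s < 1\<close>, it consists of the \<open>L\<^sup>2\<close> norms of the
  weak derivatives of order at most \<open>k\<close> and, if \<open>s > 0\<close>, of the Gagliardo seminorms of those of
  order \<open>k\<close> (in dimension \<open>2\<close> the kernel is \<open>|x - y|\<close> to the power \<open>-(2 + 2 s)\<close>). The value is
  \<open>\<infinity>\<close> for functions outside \<open>H\<^sup>\<sigma>(U)\<close>.
\<close>

definition H_energy ::
  "real \<Rightarrow> (real^2) set \<Rightarrow> (real^2 \<Rightarrow> 'b::euclidean_space) \<Rightarrow> ennreal" where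
  "H_energy \<sigma> U f =
     (let k = nat \<lfloor>\<sigma>\<rfloor>; s = frac \<sigma> in
       (\<Sum>\<alpha> | fst \<alpha> + snd \<alpha> \<le> k.
          \<integral>\<^sup>+x\<in>U. ennreal ((norm (weak_partial U \<alpha> f x))\<^sup>2) \<partial>lebesgue) +
       (if s = 0 then 0
        else (\<Sum>\<alpha> | fst \<alpha> + snd \<alpha> = k.
          \<integral>\<^sup>+x\<in>U. (\<integral>\<^sup>+y\<in>U.
             ennreal ((norm (weak_partial U \<alpha> f x - weak_partial U \<alpha> f y))\<^sup>2
                        / norm (x - y) powr (2 + 2 * s)) \<partial>lebesgue) \<partial>lebesgue)))"

definition H_norm ::
  "real \<Rightarrow> (real^2) set \<Rightarrow> (real^2 \<Rightarrow> 'b::euclidean_space) \<Rightarrow> ennreal" where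
  "H_norm \<sigma> U f =
     (if (\<forall>\<alpha>. fst \<alpha> + snd \<alpha> \<le> nat \<lfloor>\<sigma>\<rfloor> \<longrightarrow> (\<exists>g. has_weak_partial U \<alpha> f g)) \<and>
         H_energy \<sigma> U f < \<infinity>
      then ennreal (sqrt (enn2real (H_energy \<sigma> U f))) else \<infinity>)"


section \<open>Stationary flows\<close>

definition steady_euler ::
  "(real^2) set \<Rightarrow> (real^2 \<Rightarrow> real^2) \<Rightarrow> (real^2 \<Rightarrow> real) \<Rightarrow> bool" where
  "steady_euler M u q \<longleftrightarrow>
     C_on 1 M u \<and> C_on 1 M q \<and>
     (\<forall>x\<in>M. convection u u x = - grad q x \<and> divergence u x = 0)"

definition stationary_navier_stokes ::
  "(real^2) set \<Rightarrow> real \<Rightarrow> (real^2 \<Rightarrow> real^2) \<Rightarrow> (real^2 \<Rightarrow> real) \<Rightarrow> bool" where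
  "stationary_navier_stokes M \<nu> u q \<longleftrightarrow>
     C_on 2 M u \<and> C_on 1 M q \<and>
     (\<forall>x\<in>M. convection u u x = - grad q x + \<nu> *\<^sub>R laplacian u x \<and> divergence u x = 0)"

definition streamfunction ::
  "(real^2) set \<Rightarrow> (real^2 \<Rightarrow> real) \<Rightarrow> (real^2 \<Rightarrow> real^2) \<Rightarrow> bool" where
  "streamfunction M \<psi> u \<longleftrightarrow>
     (\<forall>x\<in>M. \<psi> differentiable (at x) \<and> u x = perp_grad \<psi> x)"

text \<open>The velocity is continuous up to the boundary, which gives it its boundary values.\<close>

definition tangential_boundary :: "(real^2) set \<Rightarrow> (real^2 \<Rightarrow> real^2) \<Rightarrow> bool" where
  "tangential_boundary M u \<longleftrightarrow>
     continuous_on (closure M) u \<and> (\<forall>x\<in>frontier M. u x \<bullet> outward_normal M x = 0)"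

text \<open>
  The arclength integral over the closed streamline \<open>\<psi> = c\<close> is computed along an injective
  closed parametrisation; its value does not depend on the parametrisation.
\<close>

definition parametrises_closed_curve :: "(real \<Rightarrow> real^2) \<Rightarrow> (real^2) set \<Rightarrow> bool" where
  "parametrises_closed_curve \<gamma> \<Gamma> \<longleftrightarrow>
     valid_path \<gamma> \<and> simple_path \<gamma> \<and> pathfinish \<gamma> = pathstart \<gamma> \<and> path_image \<gamma> = \<Gamma>"

definition period :: "(real^2) set \<Rightarrow> (real^2 \<Rightarrow> real) \<Rightarrow> real \<Rightarrow> real" where
  "period M \<psi> c =
     (THE T. \<exists>\<gamma>. parametrises_closed_curve \<gamma> {x\<in>M. \<psi> x = c} \<and>
        ((\<lambda>t. norm (vector_derivative \<gamma> (at t)) / norm (grad \<psi> (\<gamma> t)))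
           has_integral T) {0..1})"

text \<open>The value \<open>0\<close> outside the closure of \<open>M\<close> is a normalisation that makes the solution unique.\<close>

definition inv_dirichlet_laplacian ::
  "(real^2) set \<Rightarrow> (real^2 \<Rightarrow> real) \<Rightarrow> real^2 \<Rightarrow> real" where
  "inv_dirichlet_laplacian M f =
     (THE \<phi>. C_on 2 M \<phi> \<and> continuous_on (closure M) \<phi> \<and>
        (\<forall>x\<in>M. laplacian \<phi> x = f x) \<and> (\<forall>x. x \<notin> M \<longrightarrow> \<phi> x = 0))"

definition u_star :: "(real^2) set \<Rightarrow> real^2 \<Rightarrow> real^2" where
  "u_star M = perp_grad (inv_dirichlet_laplacian M (\<lambda>_. 1))"

end

theory Submission
  imports Defs "HOL-Complex_Analysis.Riemann_Mapping"
begin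

text \<open>
  Since \<open>u\<^sub>e\<close> is tangential, \<open>\<psi>\<close> has a constant boundary value, and as there is a single stagnation
  point, \<open>\<psi>\<close> or \<open>-\<psi>\<close> lies below this value with a unique critical point, its minimum. Hence the level
  sets \<open>\<psi> = b\<close> are connected. With \<open>B = q\<^sub>e + |u\<^sub>e|\<^sup>2/2\<close> the Euler equations read \<open>\<nabla>B = \<omega> \<nabla>\<psi>\<close>, so that
  locally \<open>B\<close> is a function of \<open>\<psi>\<close>, with derivative \<open>\<omega>\<close>; thus the vorticity \<open>\<omega> = \<Delta>\<psi>\<close> is constant on
  each level set.

  For a Navier--Stokes flow \<open>u\<close> with streamfunction \<open>\<Psi>\<close>, testing with \<open>g(\<Psi>) u\<close> removes convection and
  pressure and leaves \<open>\<integral> g(\<Psi>) \<Delta>u \<bullet> u = 0\<close>. After an integration by parts this passes to the limit and gives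
  \<open>\<integral> \<omega> (g(\<psi>) \<omega> + g'(\<psi>) |\<nabla>\<psi>|\<^sup>2) = 0\<close>, while \<open>\<integral> (g(\<psi>) \<omega> + g'(\<psi>) |\<nabla>\<psi>|\<^sup>2) = 0\<close> holds for every \<open>\<psi>\<close>.
  Subtracting \<open>\<omega>(b)\<close> times the second identity and letting \<open>g\<close> tend to the indicator function of
  \<open>t \<le> b\<close> yields \<open>\<integral>\<^bsub>\<psi> \<le> b\<^esub> (\<omega> - \<omega>(b)) \<omega> = 0\<close>: the value of \<open>\<omega>\<close> on a level set is a weighted mean of
  its values inside. Applied at the points where \<open>\<omega>\<close> attains its extrema over \<open>\<psi> \<le> b\<close>, this forces both
  extrema to equal the value at the stagnation point.
\<close>

text \<open>Convergence is known on interior sets only, so nothing controls the viscous flows near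
  the boundary, and their streamfunctions are fixed only up to constants. Test functions are
  therefore cut off at a level of \<psi> short of its boundary value, and the streamfunction of a
  viscous flow is built as \<psi> plus that of the velocity difference. A bound on compact sets,
  uniform in the flow, makes this correction small; it comes from the explicit potential along rays
  of the unit disc, to which the Riemann map carries \<open>M\<close>. The weight in the weighted
  mean is \<omega> itself, so its sign must be settled first: its integral over a sublevel set is a
  limit of integrals of nonnegative functions, and the mean value identity at \<open>y\<close> then
  excludes a nonpositive value there. Thin shells between two levels stand in for level curves; no
  arclength integral or coarea formula occurs. The Sobolev norm consists of arbitrarily chosen weak
  derivatives and the limit flow is only once differentiable. Uniform convergence is thus derived
  from a Sobolev bound for differences of two viscous flows, which are twice differentiable.\<close>

section \<open>Calculus of \<open>partial\<close> and of the classes \<open>C_on\<close>\<close>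

lemma partial_eq:
  "(f has_derivative f') (at x) \<Longrightarrow> partial i f x = f' (axis i 1)"
  unfolding partial_def by (simp add: frechet_derivative_at [symmetric])

lemma vec2_expand: "h = h $ 1 *\<^sub>R axis 1 1 + h $ 2 *\<^sub>R axis 2 (1::real)" for h :: "real^2"
  by (simp add: vec_eq_iff forall_2 axis_def)

lemma differentiable_partials:
  assumes "f differentiable (at x)"
  shows "(f has_derivative (\<lambda>h. h $ 1 *\<^sub>R partial 1 f x + h $ 2 *\<^sub>R partial 2 f x)) (at x)"
proof -
  let ?D = "frechet_derivative f (at x)"
  have D: "(f has_derivative ?D) (at x)"
    using assms by (simp add: frechet_derivative_works)
  then interpret bounded_linear ?D by (rule has_derivative_bounded_linear)
  have "?D = (\<lambda>h. h $ 1 *\<^sub>R partial 1 f x + h $ 2 *\<^sub>R partial 2 f x)"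
  proof
    fix h :: "real^2"
    show "?D h = h $ 1 *\<^sub>R partial 1 f x + h $ 2 *\<^sub>R partial 2 f x"
      by (subst vec2_expand[of h]) (simp only: add scaleR partial_def)
  qed
  with D show ?thesis by simp
qed

lemma has_derivative_eqI_open:
  assumes "(f has_derivative D) (at x)" "open S" "x \<in> S" "\<And>y. y \<in> S \<Longrightarrow> f y = g y"
  shows "(g has_derivative D) (at x)"
  using has_derivative_transform_within_open[OF assms(1-3)] assms(4) by metis

lemma differentiable_eqI_open:
  assumes "f differentiable (at x)" "open S" "x \<in> S" "\<And>y. y \<in> S \<Longrightarrow> f y = g y"
  shows "g differentiable (at x)"
  using assms(1) has_derivative_eqI_open[of f _ x S g, OF _ assms(2,3)] assms(4) 
  unfolding differentiable_def by blast

text \<open>No differentiability is required: \<open>frechet_derivative\<close> selects from the set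
  of all derivatives at the point, and this set depends only on the germ of the function.\<close>

lemma partial_cong_open:
  assumes "open S" "x \<in> S" "\<And>y. y \<in> S \<Longrightarrow> f y = g y"
  shows "partial i f x = partial i g x"
proof -
  have "(f has_derivative D) (at x) \<longleftrightarrow> (g has_derivative D) (at x)" for D
    using has_derivative_eqI_open[OF _ assms(1,2), of f D g] 
      has_derivative_eqI_open[OF _ assms(1,2), of g D f] assms(3) by force
  then show ?thesis unfolding partial_def frechet_derivative_def by simp
qed

lemma C_on_cong:
  assumes "open S" "C_on k S f" "\<And>y. y \<in> S \<Longrightarrow> f y = g y"
  shows "C_on k S g"
  using assms(2,3)
proof (induction k arbitrary: f g)
  case 0
  then show ?case using continuous_on_cong[of S S f g] by simp
next
  case (Suc k)
  have "C_on k S (partial i g)" for i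
  proof (rule Suc.IH)
    show "C_on k S (partial i f)" using Suc.prems(1) by simp
    show "partial i f y = partial i g y" if "y \<in> S" for y
      by (rule partial_cong_open[OF assms(1) that Suc.prems(2)])
  qed
  moreover have "g differentiable (at x)" if "x \<in> S" for x
    using differentiable_eqI_open[of f x S g, OF _ assms(1) that] Suc.prems that by simp
  ultimately show ?case by simp
qed

lemma C_on_subset: "C_on k S f \<Longrightarrow> T \<subseteq> S \<Longrightarrow> C_on k T f"
  by (induction k arbitrary: f) (auto intro: continuous_on_subset)

lemma C_on_continuous_on: "C_on k S f \<Longrightarrow> continuous_on S f"
  by (cases k) (auto intro!: continuous_at_imp_continuous_on differentiable_imp_continuous_within)

lemma C_on_Suc_D: "C_on (Suc k) S f \<Longrightarrow> C_on k S f"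
proof (induction k arbitrary: f)
  case 0
  then show ?case using C_on_continuous_on[of "Suc 0" S f] by simp
next
  case (Suc k)
  then show ?case by (metis C_on.simps(2))
qed

lemma C_on_le: "C_on k S f \<Longrightarrow> j \<le> k \<Longrightarrow> C_on j S f"
  by (induction k) (auto simp: le_Suc_eq dest: C_on_Suc_D simp del: C_on.simps)

lemma C_on_1:
  "C_on 1 S f \<longleftrightarrow> (\<forall>x\<in>S. f differentiable (at x)) \<and> (\<forall>i. continuous_on S (partial i f))"
  unfolding One_nat_def by simp

lemma C_on_2: 
  "C_on 2 S f \<longleftrightarrow> (\<forall>x\<in>S. f differentiable (at x)) \<and> (\<forall>i. C_on 1 S (partial i f))"
  unfolding numeral_2_eq_2 by simp

section \<open>Partial derivatives\<close>

lemma partial_add: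
  assumes "f differentiable (at x)" "g differentiable (at x)"
  shows "partial i (\<lambda>x. f x + g x) x = partial i f x + partial i g x"
  using partial_eq[OF has_derivative_add[OF assms[unfolded frechet_derivative_works]]] by (simp add: partial_def)

lemma partial_diff:
  assumes "f differentiable (at x)" "g differentiable (at x)"
  shows "partial i (\<lambda>x. f x - g x) x = partial i f x - partial i g x"
  using partial_eq[OF has_derivative_diff[OF assms[unfolded frechet_derivative_works]]] by (simp add: partial_def)

lemma partial_bounded_linear:
  assumes "bounded_linear L" "f differentiable (at x)"
  shows "partial i (\<lambda>x. L (f x)) x = L (partial i f x)"
  using partial_eq[OF bounded_linear.has_derivative[OF assms(1) assms(2)[unfolded frechet_derivative_works]]]
  by (simp add: partial_def)

lemma differentiable_bounded_linear:
  assumes "bounded_linear L" "f differentiable (at x)"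
  shows "(\<lambda>x. L (f x)) differentiable (at x)"
proof -
  from assms(2) obtain D where "(f has_derivative D) (at x)" unfolding differentiable_def ..
  from bounded_linear.has_derivative[OF assms(1) this] show ?thesis unfolding differentiable_def by blast
qed

lemma partial_scaleR:
  assumes "f differentiable (at x)" "g differentiable (at x)"
  shows "partial i (\<lambda>x. f x *\<^sub>R g x) x = f x *\<^sub>R partial i g x + partial i f x *\<^sub>R g x"
  using partial_eq[OF has_derivative_scaleR[OF assms[unfolded frechet_derivative_works]]]
  by (simp add: partial_def)

lemma partial_mult:
  fixes f g :: "real^2 \<Rightarrow> real"
  assumes "f differentiable (at x)" "g differentiable (at x)"
  shows "partial i (\<lambda>x. f x * g x) x = f x * partial i g x + partial i f x * g x"
  using partial_scaleR[OF assms] by simp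

lemma partial_compose:
  assumes "f differentiable (at x)" "(g has_real_derivative g') (at (f x))"
  shows "partial i (\<lambda>x. g (f x)) x = g' * partial i f x"
proof -
  have "((\<lambda>x. g (f x)) has_derivative (\<lambda>h. g' * frechet_derivative f (at x) h)) (at x)"
    using has_derivative_compose[OF assms(1)[unfolded frechet_derivative_works] 
        assms(2)[unfolded has_field_derivative_def]] .
  from partial_eq[OF this] show ?thesis by (simp add: partial_def)
qed

text \<open>One induction serves components, negation and scalar multiples alike.\<close>

lemma C_on_bounded_linear:
  assumes L: "bounded_linear L" and "open S"
  shows "C_on k S f \<Longrightarrow> C_on k S (\<lambda>x. L (f x))"
proof (induction k arbitrary: f)
  case 0
  then show ?case using bounded_linear.continuous_on[OF L] by simp
next
  case (Suc k)
  then have "C_on k S (\<lambda>x. L (partial i f x))" for i by simp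
  then have "C_on k S (partial i (\<lambda>x. L (f x)))" for i
    by (rule C_on_cong[OF \<open>open S\<close>]) (use Suc.prems in \<open>simp add: partial_bounded_linear[OF L]\<close>)
  moreover have "(\<lambda>x. L (f x)) differentiable (at x)" if "x \<in> S" for x
    using Suc.prems that by (simp add: differentiable_bounded_linear[OF L])
  ultimately show ?case by simp
qed

lemma C_on_nth: "open S \<Longrightarrow> C_on k S f \<Longrightarrow> C_on k S (\<lambda>x. f x $ i)" for f :: "_ \<Rightarrow> real^2"
  by (rule C_on_bounded_linear[OF bounded_linear_vec_nth])

lemma partial_nth: "f differentiable (at x) \<Longrightarrow> partial i (\<lambda>x. f x $ j) x = partial i f x $ j"
  for f :: "_ \<Rightarrow> real^2"
  by (rule partial_bounded_linear[OF bounded_linear_vec_nth])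

lemma differentiable_nth: "f differentiable (at x) \<Longrightarrow> (\<lambda>x. f x $ j) differentiable (at x)"
  for f :: "_ \<Rightarrow> real^2"
  by (rule differentiable_bounded_linear[OF bounded_linear_vec_nth])

lemma C_on_add: "open S \<Longrightarrow> C_on k S f \<Longrightarrow> C_on k S g \<Longrightarrow> C_on k S (\<lambda>x. f x + g x)"
proof (induction k arbitrary: f g)
  case (Suc k)
  then have "C_on k S (\<lambda>x. partial i f x + partial i g x)" for i by simp
  then have "C_on k S (partial i (\<lambda>x. f x + g x))" for i
    by (rule C_on_cong[OF \<open>open S\<close>]) (use Suc.prems in \<open>simp add: partial_add\<close>)
  then show ?case using Suc.prems by simp
qed (auto intro: continuous_intros)

lemma C_on_scaleR:
  assumes "open S" shows "C_on k S f \<Longrightarrow> C_on k S g \<Longrightarrow> C_on k S (\<lambda>x. f x *\<^sub>R g x)"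
proof (induction k arbitrary: f g)
  case (Suc k)
  have "C_on k S f" "C_on k S g" using Suc.prems C_on_Suc_D by blast+
  with Suc have "C_on k S (\<lambda>x. f x *\<^sub>R partial i g x + partial i f x *\<^sub>R g x)" for i
    by (intro C_on_add \<open>open S\<close> Suc.IH) auto
  then have "C_on k S (partial i (\<lambda>x. f x *\<^sub>R g x))" for i
    by (rule C_on_cong[OF \<open>open S\<close>]) (use Suc.prems in \<open>simp add: partial_scaleR\<close>)
  then show ?case using Suc.prems by simp
qed (auto intro: continuous_intros)

lemma C_on_mult:
  "open S \<Longrightarrow> C_on k S f \<Longrightarrow> C_on k S g \<Longrightarrow> C_on k S (\<lambda>x. f x * g x)" for g :: "_ \<Rightarrow> real"
  using C_on_scaleR[of S k f g] by simp

lemma partial_const [simp]: "partial i (\<lambda>x. c) x = 0"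
  by (rule partial_eq[OF has_derivative_const])

lemma C_on_const [simp]: "C_on k S (\<lambda>x. c)"
proof (induction k arbitrary: c)
  case (Suc k)
  have "partial i (\<lambda>x. c) = (\<lambda>x. 0)" for i :: 2 and c :: 'a by auto
  then show ?case using Suc by simp
qed simp

lemma C_on_minus: "open S \<Longrightarrow> C_on k S f \<Longrightarrow> C_on k S (\<lambda>x. - f x)"
  by (rule C_on_bounded_linear[OF bounded_linear_minus[OF bounded_linear_ident]])

lemma C_on_diff: "open S \<Longrightarrow> C_on k S f \<Longrightarrow> C_on k S g \<Longrightarrow> C_on k S (\<lambda>x. f x - g x)"
  using C_on_add[of S k f "\<lambda>x. - g x"] C_on_minus[of S k g] by simp

lemma C_on_compose_1:
  assumes f: "C_on 1 S f" and g: "\<And>t. (g has_real_derivative g' t) (at t)" "continuous_on UNIV g'"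
  shows "C_on 1 S (\<lambda>x. g (f x))"
proof -
  have cf: "continuous_on S f" using f by (rule C_on_continuous_on)
  have "continuous_on S (\<lambda>x. g' (f x) * partial i f x)" for i
    using f cf continuous_on_compose2[OF g(2) cf] unfolding C_on_1 by (auto intro!: continuous_intros)
  moreover have "partial i (\<lambda>x. g (f x)) x = g' (f x) * partial i f x" if "x \<in> S" for x i
    using f that by (intro partial_compose g) (auto simp: C_on_1)
  moreover have "(\<lambda>x. g (f x)) differentiable (at x)" if "x \<in> S" for x
    using f that g(1)[of "f x"] differentiable_chain_at[of f x g]
    unfolding C_on_1 o_def differentiable_def has_field_derivative_def by auto
  ultimately show ?thesis unfolding C_on_1 by (simp cong: continuous_on_cong)
qed

section \<open>Integration by parts\<close>

lemma has_vector_derivative_along_axis: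
  assumes "F differentiable (at (x + t *\<^sub>R axis i 1))"
  shows "((\<lambda>t. F (x + t *\<^sub>R axis i 1)) has_vector_derivative partial i F (x + t *\<^sub>R axis i 1)) (at t)"
proof -
  let ?y = "x + t *\<^sub>R axis i 1" and ?e = "axis i 1 :: real^2"
  have "(F has_derivative frechet_derivative F (at ?y)) (at ?y)"
    using assms by (simp add: frechet_derivative_works[symmetric])
  moreover have "((\<lambda>t. x + t *\<^sub>R ?e) has_derivative (\<lambda>t. t *\<^sub>R ?e)) (at t)"
    by (auto intro!: derivative_eq_intros)
  ultimately have "((\<lambda>t. F (x + t *\<^sub>R ?e)) has_derivative (\<lambda>t. frechet_derivative F (at ?y) (t *\<^sub>R ?e))) (at t)"
    by (rule has_derivative_compose[rotated])
  moreover have "linear (frechet_derivative F (at ?y))"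
    using assms by (simp add: linear_frechet_derivative)
  ultimately show ?thesis
    unfolding has_vector_derivative_def partial_def by (simp add: linear_scale)
qed

lemma has_real_derivative_along_axis:
  fixes F :: "real^2 \<Rightarrow> real"
  assumes "F differentiable (at (x + t *\<^sub>R axis i 1))"
  shows "((\<lambda>t. F (x + t *\<^sub>R axis i 1)) has_real_derivative partial i F (x + t *\<^sub>R axis i 1)) (at t)"
  using has_vector_derivative_along_axis[OF assms] by (simp add: has_real_derivative_iff_has_vector_derivative)

text \<open>Fubini is avoided: difference quotients along the axis have integral 0 because Lebesgue
  measure is translation invariant, and dominated convergence carries this over to the
  derivative.\<close>

lemma integral_partial_eq_0:
  fixes F :: "real^2 \<Rightarrow> real"
  assumes F: "C_on 1 UNIV F" and K: "compact K" and F0: "\<And>x. x \<notin> K \<Longrightarrow> F x = 0"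
  shows "integrable lborel (partial i F)" "integral\<^sup>L lborel (partial i F) = 0"
proof -
  let ?e = "axis i 1 :: real^2"
  have cF: "continuous_on UNIV F" using F by (rule C_on_continuous_on)
  have cP: "continuous_on UNIV (partial i F)" using F unfolding C_on_1 by simp
  have P0: "partial i F x = 0" if "x \<notin> K" for x
  proof -
    have "partial i F x = partial i (\<lambda>x. 0) x"
      by (rule partial_cong_open[of "- K"]) (use K that F0 compact_imp_closed in auto)
    then show ?thesis by simp
  qed
  have int_c: "integrable lborel f" if "continuous_on UNIV f" "\<And>x. x \<notin> K \<Longrightarrow> f x = 0"
    for f :: "real^2 \<Rightarrow> real"
  proof -
    have "integrable lborel (\<lambda>x. indicator K x *\<^sub>R f x)"
      by (rule borel_integrable_compact[OF K continuous_on_subset[OF that(1)]]) auto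
    moreover have "(\<lambda>x. indicator K x *\<^sub>R f x) = f"
      using that(2) by (force simp: indicator_def)
    ultimately show ?thesis by simp
  qed
  show intP: "integrable lborel (partial i F)" using int_c[OF cP P0] .
  have intF: "integrable lborel F" using int_c[OF cF F0] .
  define s where "s n x = (F (x + inverse (Suc n) *\<^sub>R ?e) - F x) / inverse (Suc n)" for n x
  have zero: "integral\<^sup>L lborel (s n) = 0" for n
  proof -
    let ?t = "inverse (Suc n) *\<^sub>R ?e"
    have i2: "integrable lborel (\<lambda>x. F (x + ?t))"
      using integrable_distr_eq[of "(+) ?t" lborel borel F] intF 
        lborel_distr_plus[of ?t] by (simp add: add.commute)
    have "integral\<^sup>L lborel (\<lambda>x. F (x + ?t)) = integral\<^sup>L (distr lborel borel ((+) ?t)) F"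
      using intF by (subst integral_distr) (auto simp: add.commute)
    also have "\<dots> = integral\<^sup>L lborel F" by (simp only: lborel_distr_plus)
    finally show ?thesis using i2 intF unfolding s_def by simp
  qed
  have along: "((\<lambda>t. F (x + t *\<^sub>R ?e)) has_real_derivative partial i F (x + t *\<^sub>R ?e)) (at t)" for x t
    using F by (intro has_real_derivative_along_axis) (simp add: C_on_1)
  have lim: "(\<lambda>n. s n x) \<longlonglongrightarrow> partial i F x" for x
  proof -
    have "((\<lambda>t. F (x + t *\<^sub>R ?e)) has_real_derivative partial i F x) (at 0)"
      using along[of x 0] by simp
    then have "((\<lambda>t. (F (x + t *\<^sub>R ?e) - F x) / t) \<longlongrightarrow> partial i F x) (at 0)"
      unfolding has_field_derivative_iff by simp
    moreover have "filterlim (\<lambda>n. inverse (real (Suc n))) (at 0) sequentially"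
      using LIMSEQ_inverse_real_of_nat by (auto simp: filterlim_at)
    ultimately show ?thesis unfolding s_def by (rule filterlim_compose)
  qed
  obtain C where C: "\<And>x. x \<in> K \<Longrightarrow> \<bar>partial i F x\<bar> \<le> C"
    using compact_imp_bounded[OF compact_continuous_image[OF continuous_on_subset[OF cP] K]]
    unfolding bounded_iff by force
  obtain R where R: "\<And>x. x \<in> K \<Longrightarrow> norm x \<le> R" 
    using compact_imp_bounded[OF K] unfolding bounded_iff by force
  define C' where "C' = max C 0"
  have C': "\<bar>partial i F x\<bar> \<le> C'" for x using C P0 unfolding C'_def by (cases "x \<in> K") force+
  have bnd: "norm (s n x) \<le> indicator (cball 0 (R+1)) x * C'" for n x
  \<comment> \<open>The shifts have length at most 1, so all quotients vanish outside the ball of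
    radius \<open>R + 1\<close>. Inside it the mean value theorem bounds them by the maximum of the
    derivative.\<close>
  proof (cases "x \<in> cball 0 (R+1)")
    case False
    then have "norm x > R + 1" by simp
    moreover have "norm (inverse (Suc n) *\<^sub>R ?e) \<le> 1"
      by (simp add: norm_axis_1 divide_simps)
    ultimately have "x \<notin> K" "x + inverse (Suc n) *\<^sub>R ?e \<notin> K"
      using R[of x] R[of "x + inverse (Suc n) *\<^sub>R ?e"] norm_diff_ineq[of x "inverse (Suc n) *\<^sub>R ?e"]
      by (force simp del: norm_scaleR)+
    then show ?thesis using False F0 by (simp add: s_def)
  next
    case True
    obtain z where "F (x + inverse (Suc n) *\<^sub>R ?e) - F (x + 0 *\<^sub>R ?e) = (inverse (Suc n) - 0) * partial i F (x + z *\<^sub>R ?e)"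
      using MVT2[of 0 "inverse (Suc n)" "\<lambda>t. F (x + t *\<^sub>R ?e)" "\<lambda>t. partial i F (x + t *\<^sub>R ?e)"] along
      by auto
    then have "s n x = partial i F (x + z *\<^sub>R ?e)" unfolding s_def by simp
    then have "\<bar>s n x\<bar> \<le> C'" using C' by simp
    then show ?thesis using True by simp
  qed
  have "(\<lambda>n. integral\<^sup>L lborel (s n)) \<longlonglongrightarrow> integral\<^sup>L lborel (partial i F)"
  proof (rule integral_dominated_convergence[where w="\<lambda>x. indicator (cball 0 (R+1)) x * C'"])
    show "integrable lborel (\<lambda>x. indicator (cball (0::real^2) (R+1)) x * C' :: real)"
      using emeasure_compact_finite[OF compact_cball[of "0::real^2" "R+1"]]
      by (intro integrable_mult_left integrable_real_indicator) (auto simp: infinity_ennreal_def)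
    have [measurable]: "F \<in> borel_measurable borel" "partial i F \<in> borel_measurable borel"
      using borel_measurable_continuous_onI cF cP by blast+
    show "partial i F \<in> borel_measurable lborel" "s n \<in> borel_measurable lborel" for n
      unfolding s_def by measurable
  qed (use lim bnd in auto)
  then show "integral\<^sup>L lborel (partial i F) = 0" using zero LIMSEQ_unique[OF _ tendsto_const] by auto
qed

text \<open>The mean value theorem is applied first in direction \<open>i\<close> to a difference of
  values of \<open>f\<close>, then in direction \<open>j\<close> to \<open>partial i f\<close>. The
  left side is symmetric in \<open>i\<close> and \<open>j\<close>, the right side is not: this is
  what the symmetry of second derivatives rests on.\<close>

lemma second_difference_mvt:
  fixes f :: "real^2 \<Rightarrow> real"
  assumes S: "ball x r \<subseteq> S" and f: "C_on 2 S f" and s: "0 < s" "2 * s < r"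
  obtains \<xi> \<eta> where "0 < \<xi>" "\<xi> < s" "0 < \<eta>" "\<eta> < s"
    "f (x + s *\<^sub>R axis i 1 + s *\<^sub>R axis j 1) - f (x + s *\<^sub>R axis i 1) - f (x + s *\<^sub>R axis j 1) + f x
      = s * s * partial j (partial i f) (x + \<xi> *\<^sub>R axis i 1 + \<eta> *\<^sub>R axis j 1)"
proof -
  let ?i = "axis i 1 :: real^2" and ?j = "axis j 1 :: real^2"
  have inS: "x + t *\<^sub>R ?i + t' *\<^sub>R ?j \<in> S" if "0 \<le> t" "t \<le> s" "0 \<le> t'" "t' \<le> s" for t t'
  proof -
    have "norm (t *\<^sub>R ?i + t' *\<^sub>R ?j) \<le> t + t'"
      using norm_triangle_ineq[of "t *\<^sub>R ?i" "t' *\<^sub>R ?j"] that by (simp add: norm_axis_1)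
    moreover have "dist x (x + t *\<^sub>R ?i + t' *\<^sub>R ?j) = norm (t *\<^sub>R ?i + t' *\<^sub>R ?j)"
      using norm_minus_cancel[of "t *\<^sub>R ?i + t' *\<^sub>R ?j"] by (simp add: dist_norm add.assoc)
    ultimately show ?thesis using S s that by (force simp: subset_iff)
  qed
  have d1: "f differentiable (at y)" "partial i f differentiable (at y)" if "y \<in> S" for y
    using f that by (auto simp: C_on_2 C_on_1)
  define \<phi> where "\<phi> t = f (x + s *\<^sub>R ?j + t *\<^sub>R ?i) - f (x + t *\<^sub>R ?i)" for t
  have inS': "x + s *\<^sub>R ?j + t *\<^sub>R ?i \<in> S" "x + t *\<^sub>R ?i \<in> S" if "0 \<le> t" "t \<le> s" for t
    using inS[of t s] inS[of t 0] that s by (auto simp: algebra_simps)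
  have "(\<phi> has_real_derivative (partial i f (x + s *\<^sub>R ?j + t *\<^sub>R ?i) - partial i f (x + t *\<^sub>R ?i))) (at t)"
    if "0 \<le> t" "t \<le> s" for t
    unfolding \<phi>_def using that by (intro DERIV_diff has_real_derivative_along_axis d1(1) inS') auto
  from MVT2[OF s(1), of \<phi> "\<lambda>t. partial i f (x + s *\<^sub>R ?j + t *\<^sub>R ?i) - partial i f (x + t *\<^sub>R ?i)", OF this] obtain \<xi> where xi: "0 < \<xi>" "\<xi> < s"
    "\<phi> s - \<phi> 0 = (s - 0) * (partial i f (x + s *\<^sub>R ?j + \<xi> *\<^sub>R ?i) - partial i f (x + \<xi> *\<^sub>R ?i))"
    by auto
  have "((\<lambda>t. partial i f (x + \<xi> *\<^sub>R ?i + t *\<^sub>R ?j)) has_real_derivative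
      partial j (partial i f) (x + \<xi> *\<^sub>R ?i + t *\<^sub>R ?j)) (at t)" if "0 \<le> t" "t \<le> s" for t
    using that xi by (intro has_real_derivative_along_axis d1(2) inS) auto
  from MVT2[OF s(1), of _ "\<lambda>t. partial j (partial i f) (x + \<xi> *\<^sub>R ?i + t *\<^sub>R ?j)", OF this] obtain \<eta> where eta: "0 < \<eta>" "\<eta> < s"
    "partial i f (x + \<xi> *\<^sub>R ?i + s *\<^sub>R ?j) - partial i f (x + \<xi> *\<^sub>R ?i + 0 *\<^sub>R ?j)
      = (s - 0) * partial j (partial i f) (x + \<xi> *\<^sub>R ?i + \<eta> *\<^sub>R ?j)"
    by auto
  have sw: "x + s *\<^sub>R ?j + \<xi> *\<^sub>R ?i = x + \<xi> *\<^sub>R ?i + s *\<^sub>R ?j" "x + s *\<^sub>R ?j + s *\<^sub>R ?i = x + s *\<^sub>R ?i + s *\<^sub>R ?j"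
    by (simp_all add: algebra_simps)
  show ?thesis
  proof (rule that[OF xi(1,2) eta(1,2)])
    show "f (x + s *\<^sub>R ?i + s *\<^sub>R ?j) - f (x + s *\<^sub>R ?i) - f (x + s *\<^sub>R ?j) + f x
      = s * s * partial j (partial i f) (x + \<xi> *\<^sub>R ?i + \<eta> *\<^sub>R ?j)"
      using xi(3) eta(3) unfolding \<phi>_def sw by simp
  qed
qed

text \<open>Schwarz's theorem: one and the same second difference is represented by either mixed
  derivative at points near \<open>x\<close>, and continuity brings both back to
  \<open>x\<close>.\<close>

lemma partial_commute:
  fixes f :: "real^2 \<Rightarrow> real"
  assumes "open S" "C_on 2 S f" "x \<in> S"
  shows "partial i (partial j f) x = partial j (partial i f) x"
proof (rule ccontr)
  assume ne: "partial i (partial j f) x \<noteq> partial j (partial i f) x"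
  define e where "e = \<bar>partial i (partial j f) x - partial j (partial i f) x\<bar> / 2"
  have e: "e > 0" using ne by (simp add: e_def)
  have "isCont (partial i (partial j f)) x" "isCont (partial j (partial i f)) x"
    using assms by (auto simp: C_on_2 C_on_1 continuous_on_eq_continuous_at)
  then obtain d1 d2 where d: "d1 > 0" "\<And>y. dist y x < d1 \<Longrightarrow> dist (partial i (partial j f) y) (partial i (partial j f) x) < e"
     "d2 > 0" "\<And>y. dist y x < d2 \<Longrightarrow> dist (partial j (partial i f) y) (partial j (partial i f) x) < e"
    using e unfolding continuous_at_eps_delta by metis
  obtain r where r: "r > 0" "ball x r \<subseteq> S" using assms openE by blast
  \<comment> \<open>The intermediate points lie within \<open>2 * s\<close> of \<open>x\<close>,
    hence the division by 3.\<close>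
  define s where "s = Min {d1, d2, r} / 3"
  have s: "s > 0" "2 * s < r" "2 * s < d1" "2 * s < d2" using d(1,3) r(1) by (auto simp: s_def min_def)
  have near: "dist (x + t *\<^sub>R axis k 1 + t' *\<^sub>R axis l 1) x < 2 * s" 
    if "0 < t" "t < s" "0 < t'" "t' < s" for t t' and k l :: 2
    using that norm_triangle_ineq[of "t *\<^sub>R axis k 1" "t' *\<^sub>R axis l 1 :: real^2"]
    by (simp add: dist_norm norm_axis_1 add.assoc)
  obtain \<xi> \<eta> where 1: "0 < \<xi>" "\<xi> < s" "0 < \<eta>" "\<eta> < s"
    "f (x + s *\<^sub>R axis i 1 + s *\<^sub>R axis j 1) - f (x + s *\<^sub>R axis i 1) - f (x + s *\<^sub>R axis j 1) + f x
      = s * s * partial j (partial i f) (x + \<xi> *\<^sub>R axis i 1 + \<eta> *\<^sub>R axis j 1)"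
    using second_difference_mvt[OF r(2) assms(2) s(1,2)] by metis
  obtain \<xi>' \<eta>' where 2: "0 < \<xi>'" "\<xi>' < s" "0 < \<eta>'" "\<eta>' < s"
    "f (x + s *\<^sub>R axis j 1 + s *\<^sub>R axis i 1) - f (x + s *\<^sub>R axis j 1) - f (x + s *\<^sub>R axis i 1) + f x
      = s * s * partial i (partial j f) (x + \<xi>' *\<^sub>R axis j 1 + \<eta>' *\<^sub>R axis i 1)"
    using second_difference_mvt[OF r(2) assms(2) s(1,2)] by metis
  have sw: "x + s *\<^sub>R axis j 1 + s *\<^sub>R axis i 1 = x + s *\<^sub>R axis i 1 + s *\<^sub>R axis j 1"
    by (simp add: algebra_simps)
  have "s * s * partial j (partial i f) (x + \<xi> *\<^sub>R axis i 1 + \<eta> *\<^sub>R axis j 1)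
    = s * s * partial i (partial j f) (x + \<xi>' *\<^sub>R axis j 1 + \<eta>' *\<^sub>R axis i 1)"
    using 1(5) 2(5)[unfolded sw] by linarith
  then have "partial j (partial i f) (x + \<xi> *\<^sub>R axis i 1 + \<eta> *\<^sub>R axis j 1)
    = partial i (partial j f) (x + \<xi>' *\<^sub>R axis j 1 + \<eta>' *\<^sub>R axis i 1)" using s(1) by simp
  moreover have "dist (partial j (partial i f) (x + \<xi> *\<^sub>R axis i 1 + \<eta> *\<^sub>R axis j 1)) (partial j (partial i f) x) < e"
    using near[OF 1(1-4), of i j] s by (intro d(4)) linarith
  moreover have "dist (partial i (partial j f) (x + \<xi>' *\<^sub>R axis j 1 + \<eta>' *\<^sub>R axis i 1)) (partial i (partial j f) x) < e"
    using near[OF 2(1-4), of j i] s by (intro d(2)) linarith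
  ultimately have "\<bar>partial i (partial j f) x - partial j (partial i f) x\<bar> < 2 * e"
    by (simp add: dist_real_def)
  then show False by (simp add: e_def)
qed

section \<open>Streamfunctions\<close>

text \<open>Poincare lemma for the closed 1-form with coefficients \<open>A\<close>. The explicit
  potential, an integral along the ray from 0, is kept in the statement because it bounds the
  potential by the values of \<open>A\<close> on that ray.\<close>

lemma poincare_convex:
  fixes A :: "'a::euclidean_space \<Rightarrow> 'a"
  assumes S: "convex S" "open S" "0 \<in> S"
    and A: "\<And>z. z \<in> S \<Longrightarrow> (A has_derivative A' z) (at z)"
    and cont: "\<And>h. continuous_on S (\<lambda>z. A' z h)"
    and sym: "\<And>z h k. z \<in> S \<Longrightarrow> A' z h \<bullet> k = A' z k \<bullet> h"
    and z: "z \<in> S"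
  shows "((\<lambda>z. integral {0..1} (\<lambda>t. A (t *\<^sub>R z) \<bullet> z)) has_derivative (\<lambda>h. A z \<bullet> h)) (at z)"
proof -
  \<comment> \<open>The derivative of the integrand in \<open>z\<close>, packed as a bounded linear
    map so that differentiation under the integral sign applies.\<close>
  define D where "D z t = Blinfun (\<lambda>h. t * (A' (t *\<^sub>R z) h \<bullet> z) + A (t *\<^sub>R z) \<bullet> h)" for z t
  have star: "t *\<^sub>R y \<in> S" if "y \<in> S" "t \<in> {0..1}" for y and t :: real
    using convexD[OF S(1,3) that(1), of "1 - t" t] that by simp
  have bl: "bounded_linear (\<lambda>h. t * (A' y h \<bullet> x) + A y \<bullet> h)" if "y \<in> S" for x y and t :: real
    using has_derivative_bounded_linear[OF A[OF that]]
    by (intro bounded_linear_add bounded_linear_const_mult bounded_linear_inner_right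
        bounded_linear_compose[OF bounded_linear_inner_left])
  have D: "blinfun_apply (D y t) h = t * (A' (t *\<^sub>R y) h \<bullet> y) + A (t *\<^sub>R y) \<bullet> h"
    if "y \<in> S" "t \<in> {0..1}" for y t h
    unfolding D_def using bounded_linear_Blinfun_apply[OF bl[OF star[OF that]]] by simp
  have cA: "continuous_on S A"
    using A by (meson continuous_at_imp_continuous_on has_derivative_continuous)
  have cline: "continuous_on {0..1} (\<lambda>t. A (t *\<^sub>R y) \<bullet> h)" if "y \<in> S" for y h
    by (intro continuous_intros continuous_on_compose2[OF cA]) (use star[OF that] in auto)
  have der: "((\<lambda>z. integral (cbox 0 1) (\<lambda>t. A (t *\<^sub>R z) \<bullet> z)) has_derivative
       blinfun_apply (integral (cbox 0 1) (D z))) (at z within S)"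
  proof (rule leibniz_rule[OF _ _ _ z S(1)])
    fix y :: 'a and t :: real assume y: "y \<in> S" and t: "t \<in> cbox 0 1"
    have ty: "t *\<^sub>R y \<in> S" using star y t by auto
    have "((\<lambda>z. A (t *\<^sub>R z)) has_derivative (\<lambda>h. A' (t *\<^sub>R y) (t *\<^sub>R h))) (at y)"
      by (rule has_derivative_compose[of "\<lambda>z. t *\<^sub>R z" "\<lambda>h. t *\<^sub>R h" y UNIV A "A' (t *\<^sub>R y)", OF _ A[OF ty]])
        (auto intro!: derivative_eq_intros)
    then have "((\<lambda>z. A (t *\<^sub>R z) \<bullet> z) has_derivative (\<lambda>h. A (t *\<^sub>R y) \<bullet> h + A' (t *\<^sub>R y) (t *\<^sub>R h) \<bullet> y)) (at y)"
      by (rule has_derivative_inner[OF _ has_derivative_ident])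
    moreover have "(\<lambda>h. A (t *\<^sub>R y) \<bullet> h + A' (t *\<^sub>R y) (t *\<^sub>R h) \<bullet> y) = blinfun_apply (D y t)"
      using linear_scale[OF has_derivative_linear[OF A[OF ty]]] D y t by (auto simp: fun_eq_iff)
    ultimately show "((\<lambda>z. A (t *\<^sub>R z) \<bullet> z) has_derivative blinfun_apply (D y t)) (at y within S)"
      by (simp add: has_derivative_at_withinI)
  next
    fix y assume "y \<in> S"
    then show "(\<lambda>t. A (t *\<^sub>R y) \<bullet> y) integrable_on cbox 0 1"
      using cline[of y y] integrable_continuous_real by simp
  next
    show "continuous_on (S \<times> cbox 0 1) (\<lambda>(x, t). D x t)"
    proof (rule continuous_on_blinfun_componentwise)
      fix h :: 'a
      have "continuous_on (S \<times> cbox 0 1) (\<lambda>p. snd p * (A' (snd p *\<^sub>R fst p) h \<bullet> fst p) + A (snd p *\<^sub>R fst p) \<bullet> h)"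
        by (intro continuous_intros continuous_on_compose2[OF cA] continuous_on_compose2[OF cont[of h]])
          (use star in auto)
      then show "continuous_on (S \<times> cbox 0 1) (\<lambda>p. blinfun_apply (case p of (x, t) \<Rightarrow> D x t) h)"
        by (rule continuous_on_eq) (use D in auto)
    qed
  qed
  have cD: "continuous_on {0..1} (D z)"
  proof (rule continuous_on_blinfun_componentwise)
    fix h :: 'a
    have "continuous_on {0..1} (\<lambda>t. t * (A' (t *\<^sub>R z) h \<bullet> z) + A (t *\<^sub>R z) \<bullet> h)"
      by (intro continuous_intros continuous_on_compose2[OF cA] continuous_on_compose2[OF cont[of h]])
          (use star[OF z] in auto)
    then show "continuous_on {0..1} (\<lambda>t. blinfun_apply (D z t) h)"
      by (rule continuous_on_eq) (use D[OF z] in auto)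
  qed
  have "blinfun_apply (integral (cbox 0 1) (D z)) h = A z \<bullet> h" for h
  proof -
    have "blinfun_apply (integral (cbox 0 1) (D z)) h = integral {0..1} (\<lambda>t. blinfun_apply (D z t) h)"
      using integrable_continuous_real[OF cD] by (simp add: blinfun_apply_integral)
    \<comment> \<open>By the symmetry of \<open>A'\<close> the integrand is the derivative of
      \<open>t * (A (t z) \<bullet> h)\<close> in \<open>t\<close>, which telescopes to the value at
      1.\<close>
    moreover have "((\<lambda>t. blinfun_apply (D z t) h) has_integral (1 *\<^sub>R (A (1 *\<^sub>R z) \<bullet> h) - 0 *\<^sub>R (A (0 *\<^sub>R z) \<bullet> h))) {0..1}"
    proof (rule fundamental_theorem_of_calculus)
      fix t :: real assume t: "t \<in> {0..1}"
      have tz: "t *\<^sub>R z \<in> S" using star z t by auto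
      have "((\<lambda>t. A (t *\<^sub>R z)) has_derivative (\<lambda>s. A' (t *\<^sub>R z) (s *\<^sub>R z))) (at t)"
        by (rule has_derivative_compose[of "\<lambda>t. t *\<^sub>R z" "\<lambda>s. s *\<^sub>R z" t UNIV A "A' (t *\<^sub>R z)", OF _ A[OF tz]])
          (auto intro!: derivative_eq_intros)
      then have "((\<lambda>t. A (t *\<^sub>R z)) has_vector_derivative A' (t *\<^sub>R z) z) (at t)"
        using linear_scale[OF has_derivative_linear[OF A[OF tz]]] by (simp add: has_vector_derivative_def)
      then have "((\<lambda>t. A (t *\<^sub>R z) \<bullet> h) has_vector_derivative A' (t *\<^sub>R z) z \<bullet> h) (at t)"
        by (rule bounded_linear.has_vector_derivative[OF bounded_linear_inner_left])
      from has_vector_derivative_scaleR[OF DERIV_ident this]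
      have "((\<lambda>t. t *\<^sub>R (A (t *\<^sub>R z) \<bullet> h)) has_vector_derivative (t * (A' (t *\<^sub>R z) z \<bullet> h) + A (t *\<^sub>R z) \<bullet> h)) (at t)"
        by simp
      moreover have "t * (A' (t *\<^sub>R z) z \<bullet> h) + A (t *\<^sub>R z) \<bullet> h = blinfun_apply (D z t) h"
        using D[OF z t] sym[OF tz] by simp
      ultimately show "((\<lambda>t. t *\<^sub>R (A (t *\<^sub>R z) \<bullet> h)) has_vector_derivative blinfun_apply (D z t) h) (at t within {0..1})"
        by (simp add: has_vector_derivative_at_within)
    qed simp
    ultimately show ?thesis by (simp add: integral_unique)
  qed
  then have "blinfun_apply (integral (cbox 0 1) (D z)) = (\<lambda>h. A z \<bullet> h)" by auto
  with der show ?thesis using at_within_open[OF z S(2)] by simp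
qed

section \<open>Passage to the complex plane and the Riemann map\<close>

definition toC :: "real^2 \<Rightarrow> complex" where "toC x = Complex (x $ 1) (x $ 2)"
definition ofC :: "complex \<Rightarrow> real^2" where "ofC z = vector [Re z, Im z]"

lemma ofC_nth [simp]: "ofC z $ 1 = Re z" "ofC z $ 2 = Im z"
  by (simp_all add: ofC_def)

lemma toC_sel [simp]: "Re (toC x) = x $ 1" "Im (toC x) = x $ 2"
  by (simp_all add: toC_def)

lemma toC_ofC [simp]: "toC (ofC z) = z" "ofC (toC x) = x"
  by (simp_all add: complex_eq_iff vec_eq_iff forall_2)

lemma bounded_linear_toC: "bounded_linear toC" and bounded_linear_ofC: "bounded_linear ofC"
  by (auto intro!: linearI simp: linear_conv_bounded_linear[symmetric] complex_eq_iff vec_eq_iff forall_2)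

lemma homeomorphism_toC: "homeomorphism M (toC ` M) toC ofC"
  using bounded_linear_toC bounded_linear_ofC
  by (intro homeomorphismI) (auto intro: linear_continuous_on)

text \<open>Multiplication by \<open>cnj c\<close> is the adjoint of multiplication by
  \<open>c\<close>; this is how a holomorphic map pulls back a covector field.\<close>

lemma inner_cnj_mult: "(cnj c * x) \<bullet> y = x \<bullet> (c * y)"
  by (simp add: inner_complex_def algebra_simps)

lemma open_toC: "open M \<Longrightarrow> open (toC ` M)"
proof -
  assume "open M"
  moreover have "toC ` M = ofC -` M" by (force simp: image_iff)
  moreover have "continuous_on UNIV ofC" by (rule linear_continuous_on[OF bounded_linear_ofC])
  ultimately show ?thesis using continuous_on_open_vimage[of UNIV ofC] by (simp add: open_vimage)
qed

lemma has_derivative_differentiable_partials: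
  "f differentiable (at x) \<Longrightarrow> (f has_derivative (\<lambda>h. \<Sum>i\<in>UNIV. h $ i *\<^sub>R partial i f x)) (at x)"
  using differentiable_partials by (simp add: sum_2)

text \<open>The order of the quantifiers matters: \<open>K'\<close> and \<open>C\<close> depend on
  \<open>M\<close> and \<open>K\<close> but not on \<open>w\<close>, so a field that is small on
  \<open>K'\<close> has a streamfunction that is small on \<open>K\<close>. The Riemann map carries
  the problem to the disc, where the potential along rays is available.\<close>

lemma streamfunction_exists:
  fixes M :: "(real^2) set"
  assumes M: "open M" "simply_connected M" "bounded M" and K: "compact K" "K \<subseteq> M"
  obtains K' C where "compact K'" "K' \<subseteq> M"
    "\<And>w. C_on 1 M w \<Longrightarrow> (\<And>x. x \<in> M \<Longrightarrow> divergence w x = 0) \<Longrightarrow>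
      \<exists>\<phi>. (\<forall>x\<in>M. \<phi> differentiable (at x) \<and> perp_grad \<phi> x = w x) \<and>
          (\<forall>e. (\<forall>y\<in>K'. norm (w y) \<le> e) \<longrightarrow> (\<forall>x\<in>K. \<bar>\<phi> x\<bar> \<le> C * e))"
proof -
  define S where "S = toC ` M"
  have S: "open S" "simply_connected S" "bounded S"
    using M open_toC homeomorphic_simply_connected_eq[of M S] homeomorphism_toC[of M] 
      bounded_linear_image[OF _ bounded_linear_toC]
    unfolding S_def homeomorphic_def by blast+
  show ?thesis
  proof (cases "M = {}")
    case True
    show ?thesis by (rule that[of "{}" 0]) (use True K in auto)
  next
    case False
    then have "S \<noteq> {}" "S \<noteq> UNIV" using S(3) not_bounded_UNIV by (auto simp: S_def)
    then obtain f g where f: "f holomorphic_on S" and g: "g holomorphic_on ball 0 1"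
      and fg: "\<And>z. z \<in> S \<Longrightarrow> f z \<in> ball 0 1 \<and> g (f z) = z"
      and gf: "\<And>z. z \<in> ball 0 1 \<Longrightarrow> g z \<in> S \<and> f (g z) = z"
      using S(2) simply_connected_eq_biholomorphic_to_disc[OF S(1)] by metis
    let ?B = "ball (0::complex) 1"
    \<comment> \<open>All rays from 0 to the image of \<open>K\<close> in the disc. The potential at
      a point of \<open>K\<close> sees the field only over \<open>T\<close>, which dictates
      \<open>K'\<close>, and the bound \<open>C\<close> of the conformal factor there is the
      constant.\<close>
    define T where "T = (\<lambda>p. fst p *\<^sub>R snd p) ` ({0..1::real} \<times> (f ` toC ` K))"
    have cf: "continuous_on S f" and cg: "continuous_on ?B g"
      using f g holomorphic_on_imp_continuous_on by auto
    have fK: "f ` toC ` K \<subseteq> ?B" using K fg unfolding S_def by blast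
    have "compact (toC ` K)"
      using K by (intro compact_continuous_image linear_continuous_on[OF bounded_linear_toC])
    then have "compact (f ` toC ` K)"
      by (rule compact_continuous_image[rotated]) (use cf K in \<open>auto simp: S_def intro: continuous_on_subset\<close>)
    then have "compact ({0..1::real} \<times> (f ` toC ` K))" by (intro compact_Times) auto
    then have T: "compact T"
      unfolding T_def by (rule compact_continuous_image[rotated]) (intro continuous_intros)
    have TB: "T \<subseteq> ?B"
    proof -
      have "norm (t *\<^sub>R z) < 1" if "t \<in> {0..1}" "z \<in> ?B" for t :: real and z :: complex
        using that mult_le_one[of t "norm z"] mult_left_le_one_le[of "norm z" t] by (auto simp: abs_of_nonneg)
      then show ?thesis unfolding T_def using fK by force
    qed
    define K' where "K' = ofC ` g ` T"
    have K': "compact K'" unfolding K'_def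
      using T TB cg by (intro compact_continuous_image linear_continuous_on[OF bounded_linear_ofC])
       (auto intro: continuous_on_subset)
    have K'M: "K' \<subseteq> M" using gf TB unfolding K'_def S_def by force
    have g1: "deriv g holomorphic_on ?B" using g by (rule holomorphic_deriv) simp
    have g2: "deriv (deriv g) holomorphic_on ?B" using g1 by (rule holomorphic_deriv) simp
    note cg1 = holomorphic_on_imp_continuous_on[OF g1] and cg2 = holomorphic_on_imp_continuous_on[OF g2]
    obtain C where C: "\<And>z. z \<in> T \<Longrightarrow> norm (deriv g z) \<le> C"
      using compact_imp_bounded[OF compact_continuous_image[OF continuous_on_subset[OF cg1 TB] T]]
      unfolding bounded_iff by blast
    show ?thesis
    proof (rule that[OF K' K'M, of C])
      fix w assume w: "C_on 1 M w" and div: "\<And>x. x \<in> M \<Longrightarrow> divergence w x = 0"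
      \<comment> \<open>With this rotation, \<open>grad \<phi> = rot w\<close> says the same as
        \<open>perp_grad \<phi> = w\<close>.\<close>
      define rot where "rot v = Complex (v $ 2) (- v $ 1)" for v :: "real^2"
      have rot: "bounded_linear rot"
        unfolding linear_conv_bounded_linear[symmetric] rot_def by (rule linearI) (auto simp: complex_eq_iff)
      define a where "a \<zeta> = rot (w (ofC \<zeta>))" for \<zeta>
      define a' where "a' \<zeta> h = rot (\<Sum>i\<in>UNIV. ofC h $ i *\<^sub>R partial i w (ofC \<zeta>))" for \<zeta> h
      have inM: "ofC z \<in> M" if "z \<in> S" for z using that by (auto simp: S_def)
      have a': "(a has_derivative a' \<zeta>) (at \<zeta>)" if "\<zeta> \<in> S" for \<zeta>
      proof -
        have "w differentiable (at (ofC \<zeta>))" using w inM[OF that] by (simp add: C_on_1)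
        from has_derivative_compose[OF bounded_linear_imp_has_derivative[OF bounded_linear_ofC] 
            has_derivative_differentiable_partials[OF this]]
        show ?thesis unfolding a_def a'_def by (rule bounded_linear.has_derivative[OF rot])
      qed
      have ca': "continuous_on T (\<lambda>z. a' (p z) (q z))" if "continuous_on T p" "continuous_on T q" "p ` T \<subseteq> S" for T :: "complex set" and p q
      proof -
        have 1: "continuous_on T (\<lambda>z. ofC (p z))" and 2: "continuous_on T (\<lambda>z. ofC (q z))"
          using that by (auto intro: bounded_linear.continuous_on[OF bounded_linear_ofC])
        have "continuous_on M (partial i w)" for i using w by (simp add: C_on_1)
        then have 3: "continuous_on T (\<lambda>z. partial i w (ofC (p z)))" for i
          by (rule continuous_on_compose2[OF _ 1]) (use that(3) inM in auto)
        show ?thesis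
          unfolding a'_def sum_2
          by (intro bounded_linear.continuous_on[OF rot] continuous_on_add continuous_on_scaleR 
              continuous_on_component 2 3)
      qed
      \<comment> \<open>The Jacobian of the rotated field is symmetric precisely because
        \<open>w\<close> is divergence free.\<close>
      have symm: "a' \<zeta> h \<bullet> k = a' \<zeta> k \<bullet> h" if "\<zeta> \<in> S" for \<zeta> h k
      proof -
        have "partial 1 w (ofC \<zeta>) $ 1 + partial 2 w (ofC \<zeta>) $ 2 = 0"
          using div[OF inM[OF that]] by (simp add: divergence_def sum_2)
        then have "partial 2 w (ofC \<zeta>) $ 2 = - partial 1 w (ofC \<zeta>) $ 1" by linarith
        then show ?thesis by (simp add: a'_def sum_2 inner_complex_def rot_def algebra_simps)
      qed
      \<comment> \<open>The pullback of the covector field \<open>a\<close> under \<open>g\<close>,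
        written with the adjoint \<open>cnj\<close> of the complex derivative.\<close>
      define A where "A z = cnj (deriv g z) * a (g z)" for z
      define A' where "A' z h = cnj (deriv g z) * a' (g z) (deriv g z * h) + cnj (deriv (deriv g) z * h) * a (g z)" for z h
      have dA: "(A has_derivative A' z) (at z)" if "z \<in> ?B" for z
      proof -
        have dg: "(g has_derivative (*) (deriv g z)) (at z)" "(deriv g has_derivative (*) (deriv (deriv g) z)) (at z)"
          using g g1 that holomorphic_derivI[OF _ open_ball] by (auto simp: has_field_derivative_def[symmetric])
        show ?thesis unfolding A_def A'_def
          by (rule has_derivative_mult[OF bounded_linear.has_derivative[OF bounded_linear_cnj dg(2)]
            has_derivative_compose[OF dg(1) a']]) (use gf that in auto)
      qed
      have ca: "continuous_on S a"
        using a' by (meson continuous_at_imp_continuous_on has_derivative_continuous)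
      have cA': "continuous_on ?B (\<lambda>z. A' z h)" for h
        unfolding A'_def using gf
        by (intro continuous_intros cg1 cg2 ca' cg continuous_on_compose2[OF ca cg]) auto
      \<comment> \<open>The term with the second derivative of \<open>g\<close> pairs
        \<open>a (g z)\<close> with the product of that derivative, \<open>h\<close> and
        \<open>k\<close>, and so is symmetric by itself.\<close>
      have symA: "A' z h \<bullet> k = A' z k \<bullet> h" if "z \<in> ?B" for z h k
        using symm[of "g z" "deriv g z * h" "deriv g z * k"] gf that
        by (simp add: A'_def inner_add_left inner_cnj_mult mult.assoc mult.left_commute mult.commute[of h k]
            del: complex_cnj_mult)
      define P where "P z = integral {0..1} (\<lambda>t. A (t *\<^sub>R z) \<bullet> z)" for z
      have dP: "(P has_derivative (\<lambda>h. A z \<bullet> h)) (at z)" if "z \<in> ?B" for z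
        unfolding P_def by (rule poincare_convex[OF convex_ball open_ball _ dA cA' symA that]) auto
      \<comment> \<open>As \<open>P\<close> vanishes at 0, this choice also fixes the additive
        constant, without which no bound on \<phi> could hold.\<close>
      define \<phi> where "\<phi> x = P (f (toC x))" for x
      have d\<phi>: "(\<phi> has_derivative (\<lambda>h. rot (w x) \<bullet> toC h)) (at x)" if x: "x \<in> M" for x
      proof -
        let ?z = "toC x"
        have z: "?z \<in> S" using x by (simp add: S_def)
        have df: "(f has_field_derivative deriv f ?z) (at ?z)" using holomorphic_derivI[OF f S(1) z] .
        have dg: "(g has_field_derivative deriv g (f ?z)) (at (f ?z))" 
          using holomorphic_derivI[OF g open_ball] fg[OF z] by blast
        have "((\<lambda>\<zeta>. g (f \<zeta>)) has_field_derivative deriv g (f ?z) * deriv f ?z) (at ?z)"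
          by (rule DERIV_chain2[OF dg df])
        moreover have "((\<lambda>\<zeta>. g (f \<zeta>)) has_field_derivative 1) (at ?z)"
          by (rule has_field_derivative_transform_within_open[OF DERIV_ident S(1) z]) (use fg in auto)
        ultimately have 1: "deriv g (f ?z) * deriv f ?z = 1" by (rule DERIV_unique)
        have "((\<lambda>x. f (toC x)) has_derivative (\<lambda>h. deriv f ?z * toC h)) (at x)"
          using has_derivative_compose[OF bounded_linear_imp_has_derivative[OF bounded_linear_toC] 
            df[unfolded has_field_derivative_def]] .
        from has_derivative_compose[OF this dP]
        have "(\<phi> has_derivative (\<lambda>h. A (f ?z) \<bullet> (deriv f ?z * toC h))) (at x)"
          unfolding \<phi>_def using fg[OF z] by blast
        moreover have "A (f ?z) \<bullet> (deriv f ?z * toC h) = rot (w x) \<bullet> toC h" for h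
          using fg[OF z] 1 by (simp add: A_def a_def inner_cnj_mult mult.assoc[symmetric])
        ultimately show ?thesis by simp
      qed
      have "\<phi> differentiable (at x) \<and> perp_grad \<phi> x = w x" if "x \<in> M" for x
      proof
        show "\<phi> differentiable (at x)" using d\<phi>[OF that] by (auto simp: differentiable_def)
        have "partial i \<phi> x = rot (w x) \<bullet> toC (axis i 1)" for i
          by (rule partial_eq[OF d\<phi>[OF that]])
        then show "perp_grad \<phi> x = w x"
          by (simp add: perp_grad_def vec_eq_iff forall_2 rot_def inner_complex_def axis_def)
      qed
      moreover have "\<bar>\<phi> x\<bar> \<le> C * e" if e: "\<And>y. y \<in> K' \<Longrightarrow> norm (w y) \<le> e" and x: "x \<in> K" for x e
      proof -
        let ?z = "f (toC x)"
        have z: "?z \<in> ?B" using x fK by blast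
        have inT: "t *\<^sub>R ?z \<in> T" if "t \<in> {0..1}" for t using that x unfolding T_def by force
        have nA: "norm (A y) \<le> C * e" if "y \<in> T" for y
        proof -
          have "norm (a (g y)) = norm (w (ofC (g y)))"
            by (simp add: a_def rot_def cmod_def norm_vec_def L2_set_def sum_2 add.commute)
          also have "\<dots> \<le> e" using that by (intro e) (auto simp: K'_def)
          finally have "norm (deriv g y) * norm (a (g y)) \<le> C * e"
            using C[OF that] by (intro mult_mono) (auto intro: order_trans[OF norm_ge_zero])
          then show ?thesis by (simp add: A_def norm_mult)
        qed
        have cA: "continuous_on ?B A"
          using dA by (meson continuous_at_imp_continuous_on has_derivative_continuous)
        have "norm (integral {0..1} (\<lambda>t. A (t *\<^sub>R ?z) \<bullet> ?z)) \<le> (C * e) * (1 - 0)"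
        proof (rule integral_bound)
          show "continuous_on {0..1} (\<lambda>t. A (t *\<^sub>R ?z) \<bullet> ?z)"
            using inT TB by (intro continuous_intros continuous_on_compose2[OF cA]) auto
          fix t :: real assume t: "t \<in> {0..1}"
          have "norm (A (t *\<^sub>R ?z) \<bullet> ?z) \<le> norm (A (t *\<^sub>R ?z)) * norm ?z"
            by (rule Cauchy_Schwarz_ineq2[folded real_norm_def])
          also have "\<dots> \<le> (C * e) * 1"
            using nA[OF inT[OF t]] z by (intro mult_mono) (auto intro: order_trans[OF norm_ge_zero])
          finally show "norm (A (t *\<^sub>R ?z) \<bullet> ?z) \<le> C * e" by simp
        qed simp
        then show ?thesis by (simp add: \<phi>_def P_def)
      qed
      ultimately show "\<exists>\<phi>. (\<forall>x\<in>M. \<phi> differentiable (at x) \<and> perp_grad \<phi> x = w x) \<and>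
          (\<forall>e. (\<forall>y\<in>K'. norm (w y) \<le> e) \<longrightarrow> (\<forall>x\<in>K. \<bar>\<phi> x\<bar> \<le> C * e))" by blast
    qed
  qed
qed

section \<open>Boundary values of the streamfunction\<close>

lemma grad_nth [simp]: "grad f x $ i = partial i f x"
  by (simp add: grad_def)

lemma perp_grad_nth [simp]: "perp_grad f x $ 1 = - partial 2 f x" "perp_grad f x $ 2 = partial 1 f x"
  by (simp_all add: perp_grad_def)

lemma inner_2: "x \<bullet> y = x $ 1 * y $ 1 + x $ 2 * y $ 2" for x y :: "real^2"
  by (simp add: inner_vec_def sum_2)

lemma differentiable_grad:
  "f differentiable (at x) \<Longrightarrow> (f has_derivative (\<lambda>h. grad f x \<bullet> h)) (at x)"
  using differentiable_partials[of f x] by (simp add: inner_2 mult.commute)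

lemma continuous_on_vec2:
  fixes f :: "'a::topological_space \<Rightarrow> real^2"
  assumes "continuous_on S (\<lambda>x. f x $ 1)" "continuous_on S (\<lambda>x. f x $ 2)"
  shows "continuous_on S f"
proof -
  have "f x = (\<chi> i. if i = 1 then f x $ 1 else f x $ 2)" for x by (simp add: vec_eq_iff forall_2)
  moreover have "continuous_on S (\<lambda>x. if i = 1 then f x $ 1 else f x $ 2)" for i :: 2
    using assms by (cases "i = 1") auto
  then have "continuous_on S (\<lambda>x. (\<chi> i. if i = 1 then f x $ 1 else f x $ 2) :: real^2)"
    by (intro continuous_on_vec_lambda)
  ultimately show ?thesis by simp
qed

text \<open>The second coordinate is \<open>f\<close>; the first is a linear function whose gradient
  is orthogonal to \<open>grad f z\<close>. The Jacobian determinant at \<open>x\<close> is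
  \<open>grad f z \<bullet> grad f x\<close>, positive near \<open>z\<close>. The derivative of the
  inverse is recorded: raising the first coordinate moves along the level curve of \<open>f\<close>,
  raising the second moves along \<open>grad f z\<close>.\<close>

lemma straightening_chart:
  fixes f :: "real^2 \<Rightarrow> real"
  assumes V: "open V" "C_on 1 V f" "z \<in> V" "grad f z \<noteq> 0"
  obtains N and T \<Theta> :: "real^2 \<Rightarrow> real^2" and e :: real where "open N" "z \<in> N" "N \<subseteq> V" "e > 0" "homeomorphism N (ball (T z) e) T \<Theta>"
    "\<And>x. x \<in> N \<Longrightarrow> T x $ 2 = f x" "\<And>x. x \<in> N \<Longrightarrow> grad f z \<bullet> grad f x > 0"
    "\<And>y. y \<in> ball (T z) e \<Longrightarrow> (\<Theta> has_derivative
        (\<lambda>k. (k $ 1 *\<^sub>R - perp_grad f (\<Theta> y) + k $ 2 *\<^sub>R grad f z) /\<^sub>R (grad f z \<bullet> grad f (\<Theta> y)))) (at y)"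
proof -
  define a b where "a = partial 1 f z" and "b = partial 2 f z"
  define T where "T x = (vector [b * x $ 1 - a * x $ 2, f x] :: real^2)" for x
  define L where "L x h = (vector [b * h $ 1 - a * h $ 2, grad f x \<bullet> h] :: real^2)" for x h
  define W where "W = {x \<in> V. grad f z \<bullet> grad f x > 0}"
  have cp: "continuous_on V (partial i f)" for i using V by (simp add: C_on_1)
  have "continuous_on V (grad f)"
    by (rule continuous_on_vec2) (auto intro: cp)
  then have "continuous_on V (\<lambda>x. grad f z \<bullet> grad f x)" by (intro continuous_intros)
  moreover have "W = V \<inter> (\<lambda>x. grad f z \<bullet> grad f x) -` {0<..}" by (auto simp: W_def)
  ultimately have oW: "open W"
    using V(1) continuous_open_preimage open_greaterThan by metis
  have zW: "z \<in> W" using V by (simp add: W_def)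
  have bl: "bounded_linear (L x)" for x
    unfolding linear_conv_bounded_linear[symmetric] L_def
    by (rule linearI) (auto simp: vec_eq_iff forall_2 algebra_simps inner_add_right)
  have dT: "(T has_derivative L x) (at x)" if "x \<in> V" for x
  proof -
    have "f differentiable (at x)" using V that by (simp add: C_on_1)
    note df = differentiable_grad[OF this]
    have "((\<lambda>x. b * x $ 1 - a * x $ 2) has_derivative (\<lambda>h. b * h $ 1 - a * h $ 2)) (at x)"
      by (intro bounded_linear_imp_has_derivative bounded_linear_sub bounded_linear_const_mult bounded_linear_vec_nth)
    then have "((\<lambda>x. (b * x $ 1 - a * x $ 2) *\<^sub>R axis 1 1 + f x *\<^sub>R axis 2 1 :: real^2) has_derivative
        (\<lambda>h. (b * h $ 1 - a * h $ 2) *\<^sub>R axis 1 1 + (grad f x \<bullet> h) *\<^sub>R axis 2 1)) (at x)"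
      using df by (intro has_derivative_add has_derivative_scaleR_left)
    moreover have "(vector [s, t] :: real^2) = s *\<^sub>R axis 1 1 + t *\<^sub>R axis 2 1" for s t
      by (simp add: vec_eq_iff forall_2 axis_def)
    ultimately show ?thesis unfolding T_def L_def by simp
  qed
  define L' where "L' x = Blinfun (L x)" for x
  have L': "blinfun_apply (L' x) = L x" for x
    unfolding L'_def by (rule bounded_linear_Blinfun_apply[OF bl])
  \<comment> \<open>The inverse of \<open>L x\<close> by Cramer's rule.\<close>
  define I where "I x k = (k $ 1 *\<^sub>R - perp_grad f x + k $ 2 *\<^sub>R grad f z) /\<^sub>R (grad f z \<bullet> grad f x)" for x and k :: "real^2"
  have LI: "L x (I x k) = k" if "x \<in> W" for x k
  proof -
    define d where "d = grad f z \<bullet> grad f x"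
    have d: "d > 0" "d = a * partial 1 f x + b * partial 2 f x"
      using that by (auto simp: d_def W_def inner_2 a_def b_def)
    have Id: "I x k = (k $ 1 *\<^sub>R - perp_grad f x + k $ 2 *\<^sub>R grad f z) /\<^sub>R d" for k
      by (simp add: I_def d_def)
    have "L x (I x k) $ 1 = k $ 1 * (a * partial 1 f x + b * partial 2 f x) / d"
      using d(1) by (simp add: L_def Id inner_2 a_def b_def field_simps)
    moreover have "L x (I x k) $ 2 = k $ 2 * (a * partial 1 f x + b * partial 2 f x) / d"
      using d(1) by (simp add: L_def Id inner_2 a_def b_def field_simps)
    ultimately show ?thesis using d by (simp add: vec_eq_iff forall_2)
  qed
  have IL: "I x (L x h) = h" if "x \<in> W" for x h
  proof -
    define d where "d = grad f z \<bullet> grad f x"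
    have d: "d > 0" "d = a * partial 1 f x + b * partial 2 f x"
      using that by (auto simp: d_def W_def inner_2 a_def b_def)
    have Id: "I x k = (k $ 1 *\<^sub>R - perp_grad f x + k $ 2 *\<^sub>R grad f z) /\<^sub>R d" for k
      by (simp add: I_def d_def)
    have "I x (L x h) $ 1 = h $ 1 * (a * partial 1 f x + b * partial 2 f x) / d"
      using d(1) by (simp add: L_def Id inner_2 a_def b_def field_simps)
    moreover have "I x (L x h) $ 2 = h $ 2 * (a * partial 1 f x + b * partial 2 f x) / d"
      using d(1) by (simp add: L_def Id inner_2 a_def b_def field_simps)
    ultimately show ?thesis using d by (simp add: vec_eq_iff forall_2)
  qed
  have blI: "bounded_linear (I x)" for x
    unfolding linear_conv_bounded_linear[symmetric] I_def
    by (rule linearI) (auto simp: vec_eq_iff algebra_simps)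
  have cL': "continuous_on W L'"
  proof (rule continuous_on_blinfun_componentwise)
    fix h :: "real^2"
    have "W \<subseteq> V" by (auto simp: W_def)
    note cW = continuous_on_subset[OF cp this]
    show "continuous_on W (\<lambda>x. blinfun_apply (L' x) h)"
      unfolding L' by (rule continuous_on_vec2) (auto simp: L_def inner_2 intro!: continuous_intros cW)
  qed
  have "Blinfun (I z) o\<^sub>L L' z = id_blinfun"
    by (rule blinfun_eqI) (simp add: bounded_linear_Blinfun_apply[OF blI] L' IL[OF zW])
  then obtain U' V' \<Theta> \<Theta>' where U': "open U'" "U' \<subseteq> W" "z \<in> U'" and V': "open V'" "T z \<in> V'"
    and hom: "homeomorphism U' V' T \<Theta>"
    and d\<Theta>: "\<And>y. y \<in> V' \<Longrightarrow> (\<Theta> has_derivative \<Theta>' y) (at y)"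
    and inv: "\<And>y. y \<in> V' \<Longrightarrow> \<Theta>' y = inv (blinfun_apply (L' (\<Theta> y)))"
    using inverse_function_theorem[OF oW _ cL' zW, of T "Blinfun (I z)"] dT L' W_def by (metis (no_types, lifting) mem_Collect_eq)
  obtain e where e: "e > 0" "ball (T z) e \<subseteq> V'" using V' openE by blast
  \<comment> \<open>Restricting to the preimage of a ball makes the coordinate domain convex, so
    that segments between points of the chart stay in it.\<close>
  define N where "N = \<Theta> ` ball (T z) e"
  have hom': "homeomorphism N (ball (T z) e) T \<Theta>"
    unfolding N_def 
    by (rule homeomorphism_symD[OF homeomorphism_of_subsets[OF homeomorphism_symD[OF hom] e(2) empty_subsetI refl]])
  have img: "\<Theta> ` V' = U'" "T ` U' = V'" and TT: "\<And>x. x \<in> U' \<Longrightarrow> \<Theta> (T x) = x"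
      "\<And>y. y \<in> V' \<Longrightarrow> T (\<Theta> y) = y" and cT: "continuous_on U' T"
    using hom by (simp_all add: homeomorphism_def)
  have NU: "N \<subseteq> U'" unfolding N_def img(1)[symmetric] using e(2) by (rule image_mono)
  have "N = U' \<inter> T -` ball (T z) e"
  proof (intro equalityI subsetI)
    fix x assume "x \<in> N"
    then obtain y where "y \<in> ball (T z) e" "x = \<Theta> y" unfolding N_def by (elim imageE)
    moreover from this have "T x = y" using TT(2) e(2) by auto
    ultimately show "x \<in> U' \<inter> T -` ball (T z) e" using NU \<open>x \<in> N\<close> by auto
  next
    fix x assume "x \<in> U' \<inter> T -` ball (T z) e"
    then have "T x \<in> ball (T z) e" "\<Theta> (T x) = x" using TT(1) by simp_all
    then show "x \<in> N" unfolding N_def by (metis imageI)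
  qed
  then have oN: "open N" using continuous_open_preimage[OF cT U'(1) open_ball, of "T z" e] by simp
  have "\<Theta> (T z) \<in> N" unfolding N_def using e(1) by (intro imageI) simp
  then have zN: "z \<in> N" using TT(1)[OF U'(3)] by simp
  show ?thesis
  proof (rule that[OF oN zN _ e(1) hom'])
    show "N \<subseteq> V" using NU U' unfolding W_def by blast
    show "T x $ 2 = f x" if "x \<in> N" for x by (simp add: T_def)
    show "grad f z \<bullet> grad f x > 0" if "x \<in> N" for x using NU U' that unfolding W_def by blast
    fix y assume y: "y \<in> ball (T z) e"
    then have yW: "\<Theta> y \<in> W" using NU U'(2) unfolding N_def by blast
    have "inv (L (\<Theta> y)) = I (\<Theta> y)"
      by (rule inv_equality) (use IL[OF yW] LI[OF yW] in auto)
    then have "(\<Theta> has_derivative I (\<Theta> y)) (at y)"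
      using d\<Theta>[of y] inv[of y] y e(2) L' by auto
    then show "(\<Theta> has_derivative
        (\<lambda>k. (k $ 1 *\<^sub>R - perp_grad f (\<Theta> y) + k $ 2 *\<^sub>R grad f z) /\<^sub>R (grad f z \<bullet> grad f (\<Theta> y)))) (at y)"
      unfolding I_def .
  qed
qed

text \<open>In the straightened chart \<open>b\<close> depends on the height, that is on the value
  of \<open>f\<close>, alone, and \<open>g\<close> is its derivative in the height. Points of equal
  height therefore see the same derivative.\<close>

lemma factor_constant_on_level_sets:
  fixes f b g :: "real^2 \<Rightarrow> real"
  assumes V: "open V" "C_on 1 V f" "z \<in> V" "grad f z \<noteq> 0"
    and b: "\<And>x. x \<in> V \<Longrightarrow> (b has_derivative (\<lambda>h. g x * (grad f x \<bullet> h))) (at x)"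
  obtains N where "open N" "z \<in> N" "N \<subseteq> V" "\<And>x y. x \<in> N \<Longrightarrow> y \<in> N \<Longrightarrow> f x = f y \<Longrightarrow> g x = g y"
proof -
  obtain N and T \<Theta> :: "real^2 \<Rightarrow> real^2" and e :: real where N: "open N" "z \<in> N" "N \<subseteq> V" "e > 0" and hom: "homeomorphism N (ball (T z) e) T \<Theta>"
    and T2: "\<And>x. x \<in> N \<Longrightarrow> T x $ 2 = f x" and pos: "\<And>x. x \<in> N \<Longrightarrow> grad f z \<bullet> grad f x > 0"
    and d\<Theta>: "\<And>y. y \<in> ball (T z) e \<Longrightarrow> (\<Theta> has_derivative
        (\<lambda>k. (k $ 1 *\<^sub>R - perp_grad f (\<Theta> y) + k $ 2 *\<^sub>R grad f z) /\<^sub>R (grad f z \<bullet> grad f (\<Theta> y)))) (at y)"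
    by (rule straightening_chart[OF V]) blast
  let ?Q = "ball (T z) e"
  have \<Theta>N: "\<Theta> y \<in> N" if "y \<in> ?Q" for y using homeomorphism_image2[OF hom] that by (metis imageI)
  define B where "B y = b (\<Theta> y)" for y
  have dB: "(B has_derivative (\<lambda>k. g (\<Theta> y) * k $ 2)) (at y)" if "y \<in> ?Q" for y
  proof -
    let ?d = "grad f z \<bullet> grad f (\<Theta> y)"
    have "?d > 0" using pos[OF \<Theta>N[OF that]] .
    have "(B has_derivative (\<lambda>k. g (\<Theta> y) * (grad f (\<Theta> y) \<bullet> 
        ((k $ 1 *\<^sub>R - perp_grad f (\<Theta> y) + k $ 2 *\<^sub>R grad f z) /\<^sub>R ?d)))) (at y)"
      unfolding B_def by (rule has_derivative_compose[OF d\<Theta>[OF that] b]) (use \<Theta>N[OF that] N(3) in auto)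
    moreover have "grad f (\<Theta> y) \<bullet> ((k $ 1 *\<^sub>R - perp_grad f (\<Theta> y) + k $ 2 *\<^sub>R grad f z) /\<^sub>R ?d) = k $ 2" for k :: "real^2"
    proof -
      have "grad f (\<Theta> y) \<bullet> perp_grad f (\<Theta> y) = 0" by (simp add: inner_2)
      then show ?thesis using \<open>?d > 0\<close> by (simp add: inner_add_right inner_diff_right inner_commute[of "grad f (\<Theta> y)" "grad f z"])
    qed
    ultimately show ?thesis by simp
  qed
  have horiz: "B y = B y'" if "y \<in> ?Q" "y' \<in> ?Q" "y $ 2 = y' $ 2" for y y'
  proof -
    have seg: "y + t *\<^sub>R (y' - y) \<in> ?Q" if "t \<in> {0..1}" for t
      using convexD[OF convex_ball \<open>y \<in> ?Q\<close> \<open>y' \<in> ?Q\<close>, of "1-t" t] that by (simp add: algebra_simps)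
    have "((\<lambda>t. B (y + t *\<^sub>R (y' - y))) has_real_derivative 0) (at t)" if "t \<in> {0..1}" for t
    proof -
      have "((\<lambda>t. y + t *\<^sub>R (y' - y)) has_derivative (\<lambda>s. s *\<^sub>R (y' - y))) (at t)"
        by (auto intro!: derivative_eq_intros)
      from has_derivative_compose[OF this dB[OF seg[OF that]]] \<open>y $ 2 = y' $ 2\<close>
      show ?thesis by (simp add: has_field_derivative_def lambda_zero)
    qed
    then have "B (y + 1 *\<^sub>R (y' - y)) - B (y + 0 *\<^sub>R (y' - y)) = 0"
      using MVT2[of 0 1 "\<lambda>t. B (y + t *\<^sub>R (y' - y))" "\<lambda>t. 0"] by auto
    then show ?thesis by simp
  qed
  show ?thesis
  proof (rule that[OF N(1-3)])
    fix x x' assume x: "x \<in> N" "x' \<in> N" "f x = f x'"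
    define y y' where "y = T x" and "y' = T x'"
    have y: "y \<in> ?Q" "y' \<in> ?Q" "\<Theta> y = x" "\<Theta> y' = x'" "y $ 2 = y' $ 2"
      using homeomorphism_apply1[OF hom] homeomorphism_image1[OF hom] x T2 unfolding y_def y'_def
      by (simp_all add: image_subset_iff set_eq_iff image_iff) (metis+)
    have deriv: "((\<lambda>t. B (w + t *\<^sub>R axis 2 1)) has_real_derivative g (\<Theta> w)) (at 0)" if "w \<in> ?Q" for w
    proof -
      have "((\<lambda>t. w + t *\<^sub>R axis 2 1) has_derivative (\<lambda>s. s *\<^sub>R axis 2 1)) (at 0)"
        by (auto intro!: derivative_eq_intros)
      from has_derivative_compose[OF this, of B "\<lambda>k. g (\<Theta> w) * k $ 2"] dB[OF that]
      show ?thesis by (simp add: has_field_derivative_def axis_def)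
    qed
    \<comment> \<open>Small vertical shifts of \<open>y\<close> and \<open>y'\<close> stay in the
      ball and keep equal heights, so \<open>B\<close> agrees along both vertical lines near
      0.\<close>
    have "\<forall>\<^sub>F t in nhds 0. w + t *\<^sub>R axis 2 1 \<in> ?Q" if "w \<in> ?Q" for w
    proof -
      have "((\<lambda>t. w + t *\<^sub>R axis 2 1 :: real^2) \<longlongrightarrow> w + 0 *\<^sub>R axis 2 1) (nhds 0)"
        by (intro tendsto_intros filterlim_ident)
      from topological_tendstoD[OF this open_ball, of "T z" e] that show ?thesis by simp
    qed
    from this[OF y(1)] this[OF y(2)]
    have "\<forall>\<^sub>F t in nhds 0. B (y + t *\<^sub>R axis 2 1) = B (y' + t *\<^sub>R axis 2 1)"
      by eventually_elim (use y(5) in \<open>auto intro: horiz\<close>)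
    from deriv[OF y(1)] DERIV_cong_ev[OF refl this refl] deriv[OF y(2)] 
    have "g (\<Theta> y) = g (\<Theta> y')" by (metis DERIV_unique)
    then show "g x = g x'" using y by simp
  qed
qed

lemma local_defining_function_frontier:
  assumes "open M" "local_defining_function M x V \<rho>" "y \<in> V" "y \<in> frontier M"
  shows "\<rho> y = 0"
proof (rule ccontr)
  assume ne: "\<rho> y \<noteq> 0"
  have V: "open V" "M \<inter> V = {y\<in>V. \<rho> y < 0}" and "C_on 0 V \<rho>"
    using assms(2) unfolding local_defining_function_def smooth_on_def by blast+
  then have c: "continuous_on V \<rho>" by simp
  have "y \<notin> M" using assms(1,4) by (simp add: frontier_def interior_open)
  then have "\<rho> y > 0" using ne V(2) assms(3) by force
  have "open (V \<inter> \<rho> -` {0<..})" using continuous_open_preimage[OF c V(1) open_greaterThan] .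
  moreover have "y \<in> V \<inter> \<rho> -` {0<..}" using \<open>\<rho> y > 0\<close> assms(3) by simp
  moreover have "y \<in> closure M" using assms(4) by (simp add: frontier_def)
  ultimately have "(V \<inter> \<rho> -` {0<..}) \<inter> M \<noteq> {}"
    using open_Int_closure_eq_empty by blast
  then obtain w where "w \<in> V" "\<rho> w > 0" "w \<in> M" by auto
  then show False using V(2) by force
qed

text \<open>If the unit normals differed, then along their difference \<open>v\<close> one defining
  function would decrease and the other increase, placing \<open>x + h v\<close> both inside and
  outside \<open>M\<close> for small positive \<open>h\<close>.\<close>

lemma local_defining_function_normal_unique:
  assumes M: "open M" and x: "x \<in> frontier M"
    and 1: "local_defining_function M x V1 \<rho>1" and 2: "local_defining_function M x V2 \<rho>2"
  shows "grad \<rho>1 x /\<^sub>R norm (grad \<rho>1 x) = grad \<rho>2 x /\<^sub>R norm (grad \<rho>2 x)"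
proof (rule ccontr)
  define n1 n2 where "n1 = grad \<rho>1 x /\<^sub>R norm (grad \<rho>1 x)" and "n2 = grad \<rho>2 x /\<^sub>R norm (grad \<rho>2 x)"
  assume "\<not> ?thesis"
  then have ne: "n1 \<noteq> n2" by (simp add: n1_def n2_def)
  have V: "open V1" "x \<in> V1" "M \<inter> V1 = {y\<in>V1. \<rho>1 y < 0}" "grad \<rho>1 x \<noteq> 0" "C_on 1 V1 \<rho>1"
      "open V2" "x \<in> V2" "M \<inter> V2 = {y\<in>V2. \<rho>2 y < 0}" "grad \<rho>2 x \<noteq> 0" "C_on 1 V2 \<rho>2"
    using 1 2 unfolding local_defining_function_def smooth_on_def by blast+
  have z: "\<rho>1 x = 0" "\<rho>2 x = 0"
    using local_defining_function_frontier[OF M 1 V(2) x] local_defining_function_frontier[OF M 2 V(7) x] by auto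
  have n: "n1 \<bullet> n1 = 1" "n2 \<bullet> n2 = 1"
    using V(4,9) by (auto simp: n1_def n2_def dot_square_norm power2_eq_square)
  have "(n2 - n1) \<bullet> (n2 - n1) > 0" using ne by simp
  then have lt: "n1 \<bullet> n2 < 1" using n by (simp add: inner_diff_left inner_diff_right inner_commute)
  define v where "v = n2 - n1"
  have v: "n1 \<bullet> v < 0" "n2 \<bullet> v > 0" using lt n by (auto simp: v_def inner_diff_right inner_commute)
  have g: "grad \<rho>1 x = norm (grad \<rho>1 x) *\<^sub>R n1" "grad \<rho>2 x = norm (grad \<rho>2 x) *\<^sub>R n2"
    using V(4,9) by (auto simp: n1_def n2_def)
  have g1: "grad \<rho>1 x \<bullet> v < 0"
    using v(1) V(4) by (subst g(1)) (simp add: mult_pos_neg)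
  have g2: "grad \<rho>2 x \<bullet> v > 0"
    using v(2) V(9) by (subst g(2)) simp
  have der: "((\<lambda>t. \<rho> (x + t *\<^sub>R v)) has_real_derivative grad \<rho> x \<bullet> v) (at 0)"
    if "C_on 1 V \<rho>" "x \<in> V" for \<rho> V
  proof -
    have "(\<rho> has_derivative (\<lambda>h. grad \<rho> x \<bullet> h)) (at (x + 0 *\<^sub>R v))"
      using that by (simp add: C_on_1 differentiable_grad)
    moreover have "((\<lambda>t. x + t *\<^sub>R v) has_derivative (\<lambda>s. s *\<^sub>R v)) (at 0)"
      by (auto intro!: derivative_eq_intros)
    ultimately have "((\<lambda>t. \<rho> (x + t *\<^sub>R v)) has_derivative (\<lambda>s. grad \<rho> x \<bullet> (s *\<^sub>R v))) (at 0)"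
      by (rule has_derivative_compose[rotated])
    then show ?thesis by (simp add: has_field_derivative_def mult_commute_abs)
  qed
  obtain d1 where d1: "d1 > 0" "\<And>h. 0 < h \<Longrightarrow> h < d1 \<Longrightarrow> \<rho>1 (x + h *\<^sub>R v) < 0"
    using DERIV_neg_dec_right[OF der[OF V(5,2)] g1] z by auto
  obtain d2 where d2: "d2 > 0" "\<And>h. 0 < h \<Longrightarrow> h < d2 \<Longrightarrow> \<rho>2 (x + h *\<^sub>R v) > 0"
    using DERIV_pos_inc_right[OF der[OF V(10,7)] g2] z by auto
  have "open (V1 \<inter> V2)" "x \<in> V1 \<inter> V2" using V by auto
  then obtain r where r: "r > 0" "ball x r \<subseteq> V1 \<inter> V2" using openE by blast
  define m where "m = Min {d1, d2, r / (norm v + 1)}"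
  have "m > 0" "m \<le> d1" "m \<le> d2" "m \<le> r / (norm v + 1)" using d1 d2 r by (auto simp: m_def add_nonneg_pos)
  moreover define h where "h = m / 2"
  ultimately have h: "h > 0" "h < d1" "h < d2" "h < r / (norm v + 1)" by linarith+
  have "h * norm v \<le> h * (norm v + 1)" using h(1) by simp
  also have "\<dots> < r" using h(4) by (simp add: pos_less_divide_eq add_nonneg_pos)
  finally have "x + h *\<^sub>R v \<in> ball x r" using h(1) by (simp add: dist_norm)
  then have "x + h *\<^sub>R v \<in> V1" "x + h *\<^sub>R v \<in> V2" using r by auto
  moreover have "\<rho>1 (x + h *\<^sub>R v) < 0" "\<rho>2 (x + h *\<^sub>R v) > 0" using d1 d2 h by auto
  ultimately show False using V(3,8) by force
qed

lemma outward_normal_eq: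
  assumes "open M" "x \<in> frontier M" "local_defining_function M x V \<rho>"
  shows "outward_normal M x = grad \<rho> x /\<^sub>R norm (grad \<rho> x)"
  unfolding outward_normal_def
proof (rule the_equality)
  show "\<exists>V' \<rho>'. local_defining_function M x V' \<rho>' \<and> grad \<rho> x /\<^sub>R norm (grad \<rho> x) = grad \<rho>' x /\<^sub>R norm (grad \<rho>' x)"
    using assms by blast
next
  fix n assume "\<exists>V \<rho>. local_defining_function M x V \<rho> \<and> n = grad \<rho> x /\<^sub>R norm (grad \<rho> x)"
  then obtain V' \<rho>' where "local_defining_function M x V' \<rho>'" "n = grad \<rho>' x /\<^sub>R norm (grad \<rho>' x)" by blast
  then show "n = grad \<rho> x /\<^sub>R norm (grad \<rho> x)"
    using local_defining_function_normal_unique[OF assms(1,2) _ assms(3)] by simp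
qed

text \<open>\<psi> is controlled only inside \<open>M\<close>, so its boundary value has to be
  produced as a limit. In a chart flattening the boundary the gradient is bounded, which gives the
  limit. The tangential derivative tends to 0 at the boundary because the velocity is tangential
  there, which makes the limit locally constant.\<close>

lemma streamfunction_boundary_local:
  fixes \<psi> :: "real^2 \<Rightarrow> real"
  assumes M: "open M" and u: "\<And>x. x \<in> M \<Longrightarrow> \<psi> differentiable (at x)" "\<And>x. x \<in> M \<Longrightarrow> u x = perp_grad \<psi> x"
    and cu: "continuous_on (closure M) u"
    and tang: "\<And>x. x \<in> frontier M \<Longrightarrow> u x \<bullet> outward_normal M x = 0"
    and z: "z \<in> frontier M" "local_defining_function M z V \<rho>"
  obtains N c where "open N" "z \<in> N" "\<And>x. x \<in> frontier M \<Longrightarrow> x \<in> N \<Longrightarrow> (\<psi> \<longlongrightarrow> c) (at x within M)"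
proof -
  have V: "open V" "C_on 1 V \<rho>" "z \<in> V" "grad \<rho> z \<noteq> 0" and MV: "M \<inter> V = {y\<in>V. \<rho> y < 0}"
    and gV: "\<And>y. y \<in> V \<Longrightarrow> grad \<rho> y \<noteq> 0"
    using z(2) unfolding local_defining_function_def smooth_on_def by blast+
  obtain N and T \<Theta> :: "real^2 \<Rightarrow> real^2" and e :: real where N: "open N" "z \<in> N" "N \<subseteq> V" "e > 0"
    and hom: "homeomorphism N (ball (T z) e) T \<Theta>"
    and T2: "\<And>x. x \<in> N \<Longrightarrow> T x $ 2 = \<rho> x" and pos: "\<And>x. x \<in> N \<Longrightarrow> grad \<rho> z \<bullet> grad \<rho> x > 0"
    and d\<Theta>: "\<And>y. y \<in> ball (T z) e \<Longrightarrow> (\<Theta> has_derivative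
        (\<lambda>k. (k $ 1 *\<^sub>R - perp_grad \<rho> (\<Theta> y) + k $ 2 *\<^sub>R grad \<rho> z) /\<^sub>R (grad \<rho> z \<bullet> grad \<rho> (\<Theta> y)))) (at y)"
    by (rule straightening_chart[OF V]) blast
  let ?Q = "ball (T z) e" and ?Q2 = "ball (T z) (e/2)"
  have T\<Theta>: "T (\<Theta> y) = y" and \<Theta>N: "\<Theta> y \<in> N" if "y \<in> ?Q" for y
    using homeomorphism_apply2[OF hom that] homeomorphism_image2[OF hom] that by (auto intro: imageI)
  have \<Theta>T: "\<Theta> (T x) = x" and TQ: "T x \<in> ?Q" if "x \<in> N" for x
    using homeomorphism_apply1[OF hom that] homeomorphism_image1[OF hom] that by (auto intro: imageI)
  have c\<Theta>: "continuous_on ?Q \<Theta>" and cT: "continuous_on N T"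
    using hom by (simp_all add: homeomorphism_def)
  have \<rho>\<Theta>: "\<rho> (\<Theta> y) = y $ 2" if "y \<in> ?Q" for y using T2[OF \<Theta>N[OF that]] T\<Theta>[OF that] by simp
  have Tz: "T z $ 2 = 0" using T2[OF N(2)] local_defining_function_frontier[OF M z(2) V(3) z(1)] by simp
  have inM: "\<Theta> y \<in> M \<longleftrightarrow> y $ 2 < 0" if "y \<in> ?Q" for y
  proof -
    have "\<Theta> y \<in> V" using \<Theta>N[OF that] N(3) by blast
    then have "\<Theta> y \<in> M \<longleftrightarrow> \<Theta> y \<in> M \<inter> V" by simp
    also have "\<dots> \<longleftrightarrow> y $ 2 < 0" unfolding MV using \<open>\<Theta> y \<in> V\<close> \<rho>\<Theta>[OF that] by simp
    finally show ?thesis .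
  qed
  \<comment> \<open>The closed half disc \<open>R\<close> is compact, which yields bounds and
    uniform continuity; the open half disc \<open>D\<close> is convex and its image lies in
    \<open>M\<close>, where \<psi> can be differentiated.\<close>
  define R where "R = cball (T z) (e/2) \<inter> {y. y $ 2 \<le> 0}"
  define D where "D = ?Q2 \<inter> {y. y $ 2 < 0}"
  have Q2: "?Q2 \<subseteq> ?Q" "cball (T z) (e/2) \<subseteq> ?Q" using N(4) by auto
  have RQ: "R \<subseteq> ?Q" using Q2 by (auto simp: R_def)
  have DR: "D \<subseteq> R" by (auto simp: D_def R_def)
  have cR: "compact R" unfolding R_def
    by (intro compact_Int_closed compact_cball closed_Collect_le continuous_intros)
  have shift: "(\<lambda>n. y - inverse (Suc n) *\<^sub>R axis 2 1 :: real^2) \<longlonglongrightarrow> y" for y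
  proof -
    have "(\<lambda>n. y - inverse (Suc n) *\<^sub>R axis 2 1 :: real^2) \<longlonglongrightarrow> y - 0 *\<^sub>R axis 2 1"
      by (intro tendsto_intros LIMSEQ_inverse_real_of_nat)
    then show ?thesis by simp
  qed
  have inclM: "\<Theta> y \<in> closure M" if "y \<in> R" for y
  proof (cases "y $ 2 = 0")
    case False
    then have "y $ 2 < 0" using that by (simp add: R_def)
    then have "\<Theta> y \<in> M" using inM[of y] that RQ by blast
    then show ?thesis using closure_subset by blast
  next
    case True
    have yQ: "y \<in> ?Q" using that RQ by blast
    have ev: "\<forall>\<^sub>F n in sequentially. y - inverse (Suc n) *\<^sub>R axis 2 1 \<in> ?Q"
      using topological_tendstoD[OF shift open_ball yQ] .
    have "isCont \<Theta> y" using c\<Theta> yQ by (simp add: continuous_on_eq_continuous_at)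
    then have "(\<lambda>n. \<Theta> (y - inverse (Suc n) *\<^sub>R axis 2 1)) \<longlonglongrightarrow> \<Theta> y"
      by (rule isCont_tendsto_compose) (rule shift)
    moreover have "\<forall>\<^sub>F n in sequentially. \<Theta> (y - inverse (Suc n) *\<^sub>R axis 2 1) \<in> closure M"
      using ev
    proof eventually_elim
      case (elim n)
      have "(y - inverse (Suc n) *\<^sub>R axis 2 1) $ 2 < 0" using True by simp
      then show ?case using inM[OF elim] closure_subset by blast
    qed
    ultimately show ?thesis
      by (rule Lim_in_closed_set[OF closed_closure _ sequentially_bot, rotated])
  qed
  define dd where "dd x = grad \<rho> z \<bullet> grad \<rho> x" for x
  \<comment> \<open>\<open>F\<close> and \<open>E\<close> are the partial derivatives of \<psi> in
    chart coordinates, expressed through the velocity so that they remain meaningful up to the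
    boundary.\<close>
  define F where "F y = (u (\<Theta> y) \<bullet> grad \<rho> (\<Theta> y)) / dd (\<Theta> y)" for y
  define E where "E y = (u (\<Theta> y) $ 2 * grad \<rho> z $ 1 - u (\<Theta> y) $ 1 * grad \<rho> z $ 2) / dd (\<Theta> y)" for y
  \<comment> \<open>The same \<rho> is a local defining function at all nearby boundary points, so
    its normalised gradient is the outward normal at each of them.\<close>
  have F0: "F y = 0" if "y \<in> R" "y $ 2 = 0" for y
  proof -
    have yQ: "y \<in> ?Q" using that RQ by blast
    have "\<Theta> y \<in> frontier M"
      using inclM[OF that(1)] inM[OF yQ] that(2) M by (simp add: frontier_def interior_open)
    moreover have "\<Theta> y \<in> V" using \<Theta>N[OF yQ] N(3) by blast
    moreover from this have "local_defining_function M (\<Theta> y) V \<rho>"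
      using z(2) unfolding local_defining_function_def by blast
    ultimately have "u (\<Theta> y) \<bullet> (grad \<rho> (\<Theta> y) /\<^sub>R norm (grad \<rho> (\<Theta> y))) = 0"
      using tang outward_normal_eq[OF M] by metis
    then show ?thesis using gV[OF \<open>\<Theta> y \<in> V\<close>] by (simp add: F_def)
  qed
  have "continuous_on N (grad \<rho>)"
    using V(2) N(3) by (intro continuous_on_vec2) (auto simp: C_on_1 intro: continuous_on_subset)
  moreover have cR\<Theta>: "continuous_on R \<Theta>" using c\<Theta> RQ by (rule continuous_on_subset)
  ultimately have c1: "continuous_on R (\<lambda>y. grad \<rho> (\<Theta> y))"
    by (rule continuous_on_compose2) (use \<Theta>N RQ in auto)
  have c2: "continuous_on R (\<lambda>y. u (\<Theta> y))"
    by (rule continuous_on_compose2[OF cu cR\<Theta>]) (use inclM in auto)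
  have ddpos: "dd (\<Theta> y) > 0" if "y \<in> R" for y
    using pos[OF \<Theta>N] that RQ by (auto simp: dd_def)
  have c3: "continuous_on R (\<lambda>y. dd (\<Theta> y))" unfolding dd_def by (intro continuous_intros c1)
  have cF: "continuous_on R F" unfolding F_def
    by (intro continuous_on_divide continuous_on_inner c1 c2 c3) (use ddpos in force)
  have cE: "continuous_on R E" unfolding E_def
    by (intro continuous_on_divide continuous_on_diff continuous_on_mult continuous_on_const continuous_on_component c2 c3)
      (use ddpos in force)
  obtain L1 where L1: "\<And>y. y \<in> R \<Longrightarrow> \<bar>F y\<bar> \<le> L1"
    using compact_imp_bounded[OF compact_continuous_image[OF cF cR]] unfolding bounded_iff by force
  obtain L2 where L2: "\<And>y. y \<in> R \<Longrightarrow> \<bar>E y\<bar> \<le> L2"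
    using compact_imp_bounded[OF compact_continuous_image[OF cE cR]] unfolding bounded_iff by force
  define \<phi> where "\<phi> y = \<psi> (\<Theta> y)" for y
  have d\<phi>: "(\<phi> has_derivative (\<lambda>k. k $ 1 * F y + k $ 2 * E y)) (at y)" if y: "y \<in> D" for y
  proof -
    have yR: "y \<in> R" and yQ: "y \<in> ?Q" using y DR RQ by auto
    have xM: "\<Theta> y \<in> M" using inM[OF yQ] y by (simp add: D_def)
    have "(\<phi> has_derivative (\<lambda>k. grad \<psi> (\<Theta> y) \<bullet> 
       ((k $ 1 *\<^sub>R - perp_grad \<rho> (\<Theta> y) + k $ 2 *\<^sub>R grad \<rho> z) /\<^sub>R (grad \<rho> z \<bullet> grad \<rho> (\<Theta> y))))) (at y)"
      unfolding \<phi>_def by (rule has_derivative_compose[OF d\<Theta>[OF yQ] differentiable_grad[OF u(1)[OF xM]]])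
    moreover have "grad \<psi> (\<Theta> y) $ 1 = u (\<Theta> y) $ 2" "grad \<psi> (\<Theta> y) $ 2 = - u (\<Theta> y) $ 1"
      using u(2)[OF xM] by simp_all
    then have "grad \<psi> (\<Theta> y) \<bullet> 
       ((k $ 1 *\<^sub>R - perp_grad \<rho> (\<Theta> y) + k $ 2 *\<^sub>R grad \<rho> z) /\<^sub>R (grad \<rho> z \<bullet> grad \<rho> (\<Theta> y)))
       = k $ 1 * F y + k $ 2 * E y" for k :: "real^2"
      using ddpos[OF yR] unfolding F_def E_def dd_def[symmetric]
      by (simp add: inner_2 field_simps del: grad_nth) (simp add: field_simps)
    ultimately show ?thesis by simp
  qed
  have cD: "convex D" unfolding D_def
    using convex_halfspace_lt[of "axis 2 1 :: real^2" 0] 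
    by (intro convex_Int convex_ball) (simp add: inner_axis' )
  have lip: "norm (\<phi> y - \<phi> y') \<le> (L1 + L2) * norm (y - y')" if "y \<in> D" "y' \<in> D" for y y'
  proof (rule differentiable_bound[OF cD _ _ that])
    fix w assume w: "w \<in> D"
    show "(\<phi> has_derivative (\<lambda>k. k $ 1 * F w + k $ 2 * E w)) (at w within D)"
      using d\<phi>[OF w] by (rule has_derivative_at_withinI)
    have "norm (k $ 1 * F w + k $ 2 * E w) \<le> (L1 + L2) * norm k" for k
    proof -
      have "\<bar>k $ 1 * F w\<bar> \<le> norm k * L1" "\<bar>k $ 2 * E w\<bar> \<le> norm k * L2"
        unfolding abs_mult using L1 L2 w DR component_le_norm_cart[of k]
        by (intro mult_mono; force)+
      then show ?thesis by (simp add: algebra_simps)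
    qed
    then show "onorm (\<lambda>k. k $ 1 * F w + k $ 2 * E w) \<le> L1 + L2"
      by (rule onorm_le)
  qed
  have "uniformly_continuous_on D \<phi>"
    unfolding uniformly_continuous_on_def
  proof (intro allI impI)
    fix \<epsilon> :: real assume "\<epsilon> > 0"
    \<comment> \<open>The maximum with 1 only makes the Lipschitz constant positive, so that it may
      serve as a divisor.\<close>
    define L where "L = max (L1 + L2) 1"
    have L: "norm (\<phi> y - \<phi> y') \<le> L * norm (y - y')" if "y \<in> D" "y' \<in> D" for y y'
      using lip[OF that] mult_right_mono[of "L1 + L2" L "norm (y - y')"] by (simp add: L_def)
    have "L > 0" by (simp add: L_def)
    then have "dist (\<phi> y') (\<phi> y) < \<epsilon>" if "y \<in> D" "y' \<in> D" "dist y' y < \<epsilon> / L" for y y'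
      using L[OF that(2,1)] that(3) by (simp add: dist_norm field_simps)
    then show "\<exists>d>0. \<forall>x\<in>D. \<forall>x'\<in>D. dist x' x < d \<longrightarrow> dist (\<phi> x') (\<phi> x) < \<epsilon>"
      using \<open>L > 0\<close> \<open>\<epsilon> > 0\<close> by (intro exI[of _ "\<epsilon> / L"]) auto
  qed
  \<comment> \<open>The Lipschitz bound lets \<psi>, read in the chart, extend continuously to the
    closed half disc; the extension supplies the boundary values.\<close>
  then obtain g where g: "uniformly_continuous_on (closure D) g" "\<And>y. y \<in> D \<Longrightarrow> \<phi> y = g y"
    using uniformly_continuous_on_extension_on_closure by metis
  have cg: "continuous_on (closure D) g" using g(1) by (rule uniformly_continuous_imp_continuous)
  have inD: "\<forall>\<^sub>F n in sequentially. y - inverse (Suc n) *\<^sub>R axis 2 1 \<in> D" if "y \<in> ?Q2" "y $ 2 = 0" for y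
  proof -
    have "\<forall>\<^sub>F n in sequentially. y - inverse (Suc n) *\<^sub>R axis 2 1 \<in> ?Q2"
      using topological_tendstoD[OF shift open_ball that(1)] .
    then show ?thesis by eventually_elim (use that in \<open>auto simp: D_def\<close>)
  qed
  have inclD: "\<forall>\<^sub>F n in sequentially. y - inverse (Suc n) *\<^sub>R axis 2 1 \<in> closure D" if "y \<in> ?Q2" "y $ 2 = 0" for y
    by (rule eventually_mono[OF inD[OF that]]) (rule subsetD[OF closure_subset])
  have clD: "y \<in> closure D" if "y \<in> ?Q2" "y $ 2 = 0" for y
    by (rule Lim_in_closed_set[OF closed_closure inclD[OF that] sequentially_bot shift])
  have lim\<phi>: "(\<lambda>n. \<phi> (y - inverse (Suc n) *\<^sub>R axis 2 1)) \<longlonglongrightarrow> g y" if "y \<in> ?Q2" "y $ 2 = 0" for y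
  proof -
    have "(\<lambda>n. g (y - inverse (Suc n) *\<^sub>R axis 2 1)) \<longlonglongrightarrow> g y"
      by (rule continuous_on_tendsto_compose[OF cg shift clD[OF that] inclD[OF that]])
    then show ?thesis
      by (rule Lim_transform_eventually) (use inD[OF that] in eventually_elim, use g(2) in simp)
  qed
  have gc: "g y = g (T z)" if y: "y \<in> ?Q2" "y $ 2 = 0" for y
  proof -
    define p where "p n t = (T z + t *\<^sub>R (y - T z)) - inverse (Suc n) *\<^sub>R axis 2 1" for n :: nat and t :: real
    have Tz2: "T z \<in> ?Q2" using N(4) by simp
    define q where "q t = T z + t *\<^sub>R (y - T z)" for t
    have q: "q t \<in> ?Q2" "q t $ 2 = 0" if "t \<in> {0..1}" for t
      using convexD[OF convex_ball Tz2 y(1), of "1-t" t] that Tz y(2) by (simp_all add: q_def algebra_simps)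
    \<comment> \<open>The two boundary points are compared along the segment between them pushed
      inwards by \<open>inverse (Suc n)\<close>. On it \<phi> changes at the rate \<open>F\<close>,
      which is uniformly small since \<open>F\<close> vanishes on the flat side.\<close>
    have "(\<lambda>n. \<phi> (y - inverse (Suc n) *\<^sub>R axis 2 1) - \<phi> (T z - inverse (Suc n) *\<^sub>R axis 2 1)) \<longlonglongrightarrow> 0"
      unfolding tendsto_iff
    proof (intro allI impI)
      fix \<epsilon> :: real assume e0: "\<epsilon> > 0"
      define s where "s = \<bar>(y - T z) $ 1\<bar> + 1"
      have s: "s > 0" by (simp add: s_def add_nonneg_pos)
      have "uniformly_continuous_on R F" using cF cR by (rule compact_uniformly_continuous)
      then obtain \<delta> where \<delta>: "\<delta> > 0" "\<And>a b. a \<in> R \<Longrightarrow> b \<in> R \<Longrightarrow> dist b a < \<delta> \<Longrightarrow> dist (F b) (F a) < \<epsilon> / s"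
        using e0 s unfolding uniformly_continuous_on_def by (metis divide_pos_pos)
      have "\<forall>\<^sub>F n in sequentially. dist (inverse (real (Suc n))) 0 < \<delta>"
        using LIMSEQ_inverse_real_of_nat \<delta>(1) unfolding tendsto_iff by blast
      then show "\<forall>\<^sub>F n in sequentially. dist (\<phi> (y - inverse (Suc n) *\<^sub>R axis 2 1) - \<phi> (T z - inverse (Suc n) *\<^sub>R axis 2 1)) 0 < \<epsilon>"
        using inD[OF y] inD[OF Tz2 Tz]
      proof eventually_elim
        case (elim n)
        define pt where "pt t = q t - inverse (Suc n) *\<^sub>R axis 2 1" for t
        have pD: "pt t \<in> D" if "t \<in> {0..1}" for t
        proof -
          have "pt t = (1 - t) *\<^sub>R (T z - inverse (Suc n) *\<^sub>R axis 2 1) + t *\<^sub>R (y - inverse (Suc n) *\<^sub>R axis 2 1)"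
            unfolding pt_def q_def by (simp add: vec_eq_iff algebra_simps)
          moreover have "\<dots> \<in> D" by (rule convexD[OF cD elim(3,2)]) (use that in auto)
          ultimately show ?thesis by (simp only:)
        qed
        have der: "((\<lambda>t. \<phi> (pt t)) has_real_derivative (y - T z) $ 1 * F (pt t)) (at t)" if "t \<in> {0..1}" for t
        proof -
          have "(pt has_derivative (\<lambda>s. s *\<^sub>R (y - T z))) (at t)"
            unfolding pt_def q_def by (auto intro!: derivative_eq_intros)
          from has_derivative_compose[OF this d\<phi>[OF pD[OF that]]] 
          show ?thesis using y(2) Tz by (simp add: has_field_derivative_def mult.assoc mult_commute_abs)
        qed
        obtain t where t: "0 < t" "t < 1" "\<phi> (pt 1) - \<phi> (pt 0) = (1 - 0) * ((y - T z) $ 1 * F (pt t))"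
          using MVT2[of 0 1 "\<lambda>t. \<phi> (pt t)" "\<lambda>t. (y - T z) $ 1 * F (pt t)"] der by auto
        have tI: "t \<in> {0..1}" using t by simp
        have qR: "q t \<in> R" using q[OF tI] by (auto simp: R_def)
        have "dist (pt t) (q t) = inverse (real (Suc n))" by (simp add: pt_def dist_norm norm_axis_1)
        then have "dist (F (pt t)) (F (q t)) < \<epsilon> / s" using pD[OF tI] DR qR elim(1) by (intro \<delta>(2)) auto
        then have Fs: "\<bar>F (pt t)\<bar> < \<epsilon> / s" using F0[OF qR q(2)[OF tI]] by simp
        have "\<bar>\<phi> (pt 1) - \<phi> (pt 0)\<bar> = \<bar>(y - T z) $ 1\<bar> * \<bar>F (pt t)\<bar>" using t(3) by (simp add: abs_mult)
        also have "\<dots> \<le> s * \<bar>F (pt t)\<bar>" by (intro mult_right_mono) (auto simp: s_def)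
        also have "\<dots> < s * (\<epsilon> / s)" using Fs s by (rule mult_strict_left_mono)
        also have "\<dots> = \<epsilon>" using s by simp
        finally show ?case by (simp add: pt_def q_def)
      qed
    qed
    moreover have "(\<lambda>n. \<phi> (y - inverse (Suc n) *\<^sub>R axis 2 1) - \<phi> (T z - inverse (Suc n) *\<^sub>R axis 2 1)) \<longlonglongrightarrow> g y - g (T z)"
      by (intro tendsto_diff lim\<phi> y Tz2 Tz)
    ultimately have "g y - g (T z) = 0" by (rule LIMSEQ_unique[rotated])
    then show ?thesis by simp
  qed
  define N' where "N' = N \<inter> T -` ?Q2"
  show ?thesis
  proof (rule that[of N' "g (T z)"])
    show "open N'" unfolding N'_def using continuous_open_preimage[OF cT N(1) open_ball] .
    then have "open N'" .
    show "z \<in> N'" using N by (simp add: N'_def)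
    fix x assume x: "x \<in> frontier M" "x \<in> N'"
    have xN: "x \<in> N" "T x \<in> ?Q2" using x(2) by (auto simp: N'_def)
    have "x \<in> V" using xN N(3) by blast
    then have Tx: "T x $ 2 = 0" using T2[OF xN(1)] local_defining_function_frontier[OF M z(2) _ x(1)] by simp
    have TD: "T w \<in> D" if "w \<in> M" "w \<in> N'" for w
      using inM[of "T w"] \<Theta>T[of w] TQ[of w] that by (auto simp: D_def N'_def)
    have "isCont T x" using cT xN(1) N(1) by (simp add: continuous_on_eq_continuous_at)
    then have limT: "(T \<longlongrightarrow> T x) (at x within M)"
      unfolding isCont_def by (rule tendsto_within_subset) simp
    have ev: "\<forall>\<^sub>F w in at x within M. w \<in> M \<and> w \<in> N'"
      using \<open>open N'\<close> x(2) unfolding eventually_at_topological by blast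
    have "((\<lambda>w. g (T w)) \<longlongrightarrow> g (T x)) (at x within M)"
      by (rule continuous_on_tendsto_compose[OF cg limT clD[OF xN(2) Tx]])
        (use ev TD closure_subset[of D] in \<open>auto elim!: eventually_mono\<close>)
    moreover have "\<forall>\<^sub>F w in at x within M. g (T w) = \<psi> w"
      using ev by eventually_elim (use TD g(2) \<Theta>T in \<open>simp add: \<phi>_def N'_def\<close>, metis \<phi>_def)
    ultimately have "(\<psi> \<longlongrightarrow> g (T x)) (at x within M)" by (rule Lim_transform_eventually)
    then show "(\<psi> \<longlongrightarrow> g (T z)) (at x within M)" using gc[OF xN(2) Tx] by simp
  qed
qed

text \<open>A locally constant function on a connected set is constant. \<open>Lim\<close> names the
  limit, and it is determined because points of the frontier are limit points of the open set
  \<open>M\<close> lying outside it.\<close>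

lemma streamfunction_boundary_constant:
  fixes \<psi> :: "real^2 \<Rightarrow> real"
  assumes M: "open M" "connected (frontier M)" "smooth_boundary M"
    and u: "streamfunction M \<psi> u" "tangential_boundary M u"
  obtains c where "\<And>x. x \<in> frontier M \<Longrightarrow> (\<psi> \<longlongrightarrow> c) (at x within M)"
proof -
  define l where "l x = Lim (at x within M) \<psi>" for x
  have loc: "\<exists>N c. open N \<and> z \<in> N \<and> (\<forall>x\<in>frontier M. x \<in> N \<longrightarrow> (\<psi> \<longlongrightarrow> c) (at x within M))"
    if z: "z \<in> frontier M" for z
  proof -
    obtain V \<rho> where ldf: "local_defining_function M z V \<rho>" using M(3) z unfolding smooth_boundary_def by blast
    have "\<And>x. x \<in> M \<Longrightarrow> \<psi> differentiable (at x)" "\<And>x. x \<in> M \<Longrightarrow> u x = perp_grad \<psi> x"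
      "continuous_on (closure M) u" "\<And>x. x \<in> frontier M \<Longrightarrow> u x \<bullet> outward_normal M x = 0"
      using u unfolding streamfunction_def tangential_boundary_def by blast+
    from streamfunction_boundary_local[OF M(1) this z ldf] show ?thesis by metis
  qed
  have nt: "at x within M \<noteq> bot" if "x \<in> frontier M" for x
  proof -
    have "x \<notin> M" "x \<in> closure M" using that M(1) by (auto simp: frontier_def interior_open)
    then show ?thesis by (simp add: closure_def trivial_limit_within)
  qed
  have lim: "(\<psi> \<longlongrightarrow> l x) (at x within M)" if "x \<in> frontier M" for x
    using loc[OF that] that tendsto_Lim[OF nt[OF that]] unfolding l_def by metis
  have "l x = l y" if "x \<in> frontier M" "y \<in> frontier M" for x y
  proof (rule connected_local_const[OF M(2) that], intro ballI)
    fix z assume z: "z \<in> frontier M"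
    obtain N c where N: "open N" "z \<in> N" "\<forall>x\<in>frontier M. x \<in> N \<longrightarrow> (\<psi> \<longlongrightarrow> c) (at x within M)"
      using loc[OF z] by blast
    then have "l x = c" if "x \<in> frontier M" "x \<in> N" for x
      using tendsto_Lim[OF nt[OF that(1)]] that unfolding l_def by blast
    then show "\<forall>\<^sub>F b in at z within frontier M. l z = l b"
      using N(1,2) z unfolding eventually_at_topological by metis
  qed
  then have "\<exists>c. \<forall>x\<in>frontier M. l x = c" by blast
  then show ?thesis using lim that by metis
qed

section \<open>Level sets of the streamfunction\<close>

text \<open>At a point outside \<open>M\<close> the neighbourhood filter splits into its part within
  \<open>M\<close> and its part within the complement, and the limit is \<open>c\<close> along
  both.\<close>

lemma continuous_on_extend_constant:
  fixes f :: "'a::metric_space \<Rightarrow> 'b::topological_space"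
  assumes M: "open M" and f: "continuous_on M f"
    and lim: "\<And>x. x \<in> frontier M \<Longrightarrow> (f \<longlongrightarrow> c) (at x within M)"
  shows "continuous_on UNIV (\<lambda>x. if x \<in> M then f x else c)"
proof -
  let ?g = "\<lambda>x. if x \<in> M then f x else c"
  have "(?g \<longlongrightarrow> ?g x) (at x)" for x
  proof (cases "x \<in> M")
    case True
    then have "(f \<longlongrightarrow> f x) (at x)" using f M by (simp add: continuous_on_eq_continuous_at isCont_def)
    moreover have "\<forall>\<^sub>F y in at x. f y = ?g y"
      using M True unfolding eventually_at_topological by (intro exI[of _ M]) auto
    ultimately show ?thesis using True by (simp add: tendsto_cong)
  next
    case False
    have 1: "(?g \<longlongrightarrow> c) (at x within -M)"
      by (rule tendsto_eventually) (auto simp: eventually_at_filter)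
    have 2: "(?g \<longlongrightarrow> c) (at x within M)"
    proof (cases "x \<in> frontier M")
      case True
      have "\<forall>\<^sub>F y in at x within M. f y = ?g y" by (auto simp: eventually_at_filter)
      then show ?thesis using lim[OF True] by (rule Lim_transform_eventually[rotated])
    next
      case False
      then have "x \<notin> closure M" using \<open>x \<notin> M\<close> M by (simp add: frontier_def interior_open)
      then have "at x within M = bot" using \<open>x \<notin> M\<close> by (simp add: closure_def trivial_limit_within)
      then show ?thesis by simp
    qed
    have "at x = sup (at x within M) (at x within -M)"
      by (simp add: at_within_union[symmetric])
    then show ?thesis using 1 2 False by (simp add: filterlim_sup)
  qed
  then show ?thesis by (simp add: continuous_on_def)
qed

lemma interior_extremum_grad_0:
  fixes f :: "real^2 \<Rightarrow> real"
  assumes "open S" "x \<in> S" "f differentiable (at x)" "(\<forall>y\<in>S. f y \<le> f x) \<or> (\<forall>y\<in>S. f x \<le> f y)"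
  shows "grad f x = 0"
proof -
  have "(\<lambda>h. grad f x \<bullet> h) = (\<lambda>h. 0)"
    using differential_zero_maxmin[OF assms(2,1) differentiable_grad[OF assms(3)]] assms(4) by blast
  then have "grad f x \<bullet> grad f x = 0" by metis
  then show ?thesis by simp
qed

text \<open>Components of an open set are relatively closed: a point of \<open>A\<close> in the
  closure of a component has an open component of its own, which must then meet the given
  one.\<close>

lemma component_closure:
  fixes A :: "(real^2) set"
  assumes "open A" "w \<in> A" "w \<in> closure (connected_component_set A x)"
  shows "w \<in> connected_component_set A x"
proof -
  have "open (connected_component_set A w)" using assms(1) by (rule open_connected_component)
  moreover have "w \<in> connected_component_set A w" using assms(2) by simp
  ultimately have "connected_component_set A w \<inter> connected_component_set A x \<noteq> {}"
    using assms(3) open_Int_closure_eq_empty by blast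
  then show ?thesis using connected_component_nonoverlap[of A w x] assms(2)
    by (metis connected_component_eq_empty inf.idem \<open>w \<in> connected_component_set A w\<close> connected_component_overlap)
qed

section \<open>Functions with one critical point and constant boundary value\<close>

locale single_critical_point =
  fixes M :: "(real^2) set" and \<psi> :: "real^2 \<Rightarrow> real" and c :: real and x0 :: "real^2"
  assumes M: "open M" "bounded M" "connected (- M)"
    and diff: "\<And>x. x \<in> M \<Longrightarrow> \<psi> differentiable (at x)"
    and bdry: "\<And>x. x \<in> frontier M \<Longrightarrow> (\<psi> \<longlongrightarrow> c) (at x within M)"
    and crit: "x0 \<in> M" "grad \<psi> x0 = 0" "\<And>x. x \<in> M \<Longrightarrow> grad \<psi> x = 0 \<Longrightarrow> x = x0"
begin

text \<open>Extending by the boundary value puts extrema and level sets into the whole plane; for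
  \<open>b < c\<close> the complement of \<open>M\<close> becomes part of the superlevel set at
  \<open>b\<close>.\<close>

definition ext :: "real^2 \<Rightarrow> real" where "ext x = (if x \<in> M then \<psi> x else c)"

lemma continuous_ext: "continuous_on S ext"
proof -
  have "continuous_on M \<psi>"
    using diff by (simp add: continuous_at_imp_continuous_on differentiable_imp_continuous_within)
  from continuous_on_extend_constant[OF M(1) this bdry]
  have "continuous_on UNIV ext" unfolding ext_def by blast
  then show ?thesis by (rule continuous_on_subset) simp
qed

lemma ext_M [simp]: "x \<in> M \<Longrightarrow> ext x = \<psi> x" by (simp add: ext_def)

lemma extremum_unique:
  assumes "x \<in> S" "open S" "S \<subseteq> M" "(\<forall>y\<in>S. ext y \<le> ext x) \<or> (\<forall>y\<in>S. ext x \<le> ext y)"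
  shows "x = x0"
proof (rule crit(3))
  show "x \<in> M" using assms by blast
  have "(\<forall>y\<in>S. \<psi> y \<le> \<psi> x) \<or> (\<forall>y\<in>S. \<psi> x \<le> \<psi> y)"
    using assms ext_M by (metis subsetD)
  then show "grad \<psi> x = 0" using assms diff by (intro interior_extremum_grad_0[of S]) auto
qed

text \<open>An extremum of \<open>ext\<close> with a value other than \<open>c\<close> lies in
  \<open>M\<close> and hence is \<open>x0\<close>, so the maximum and the minimum cannot both differ
  from \<open>c\<close>. A second interior point with the value \<open>c\<close> would again be an
  extremum. If \<psi> were constant, every point would be critical and \<open>M\<close> a single
  point.\<close>

lemma sign_dichotomy: "(\<forall>x\<in>M. \<psi> x < c) \<or> (\<forall>x\<in>M. \<psi> x > c)"
proof -
  have cl: "compact (closure M)" "closure M \<noteq> {}" using M(2) crit(1) closure_subset[of M] by auto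
  obtain a where a: "a \<in> closure M" "\<And>y. y \<in> closure M \<Longrightarrow> ext y \<le> ext a"
    using continuous_attains_sup[OF cl continuous_ext] by blast
  obtain b where b: "b \<in> closure M" "\<And>y. y \<in> closure M \<Longrightarrow> ext b \<le> ext y"
    using continuous_attains_inf[OF cl continuous_ext] by blast
  have a': "a = x0" if "ext a \<noteq> c"
  proof (rule extremum_unique[OF _ M(1) order_refl])
    show "a \<in> M" using that by (auto simp: ext_def split: if_splits)
  qed (use a closure_subset in blast)
  have b': "b = x0" if "ext b \<noteq> c"
  proof (rule extremum_unique[OF _ M(1) order_refl])
    show "b \<in> M" using that by (auto simp: ext_def split: if_splits)
  qed (use b closure_subset in blast)
  have notall: "\<exists>x\<in>M. \<psi> x \<noteq> c"
  proof (rule ccontr)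
    assume "\<not> ?thesis"
    then have "x = x0" if "x \<in> M" for x
      using that by (intro extremum_unique[OF that M(1) order_refl]) auto
    then have "M = {x0}" using crit(1) by blast
    then show False using M(1) not_open_singleton by blast
  qed
  then obtain x1 where x1: "x1 \<in> M" "ext x1 \<noteq> c" by auto
  have x1c: "x1 \<in> closure M" using x1 closure_subset by blast
  show ?thesis
  proof (cases "ext a > c")
    case True
    then have ax: "a = x0" using a' by simp
    have bc: "ext b \<ge> c" using b' ax a(2)[OF b(1)] True by force
    have "\<psi> x > c" if "x \<in> M" for x
    proof -
      have xc: "x \<in> closure M" using that closure_subset by blast
      have "ext x \<noteq> c"
      proof
        assume "ext x = c"
        have "ext x \<le> ext y" if "y \<in> M" for y
          using b(2)[OF subsetD[OF closure_subset that]] bc \<open>ext x = c\<close> by linarith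
        then have "x = x0" by (intro extremum_unique[OF that M(1) order_refl]) blast
        then show False using ax True \<open>ext x = c\<close> by simp
      qed
      then show ?thesis using b(2)[OF xc] bc that by simp
    qed
    then show ?thesis by blast
  next
    case False
    then have bx: "b = x0" "ext b < c" using b' x1 a(2)[OF x1c] b(2)[OF x1c] by force+
    have "\<psi> x < c" if "x \<in> M" for x
    proof -
      have xc: "x \<in> closure M" using that closure_subset by blast
      have "ext x \<noteq> c"
      proof
        assume "ext x = c"
        have "ext y \<le> ext x" if "y \<in> M" for y
          using a(2)[OF subsetD[OF closure_subset that]] False \<open>ext x = c\<close> by linarith
        then have "x = x0" by (intro extremum_unique[OF that M(1) order_refl]) blast
        then show False using bx \<open>ext x = c\<close> by simp
      qed
      then show ?thesis using a(2)[OF xc] False that by simp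
    qed
    then show ?thesis by blast
  qed
qed

end

locale single_minimum = single_critical_point +
  assumes below: "\<And>x. x \<in> M \<Longrightarrow> \<psi> x < c"
begin

lemma ext_less: "b \<le> c \<Longrightarrow> {x. ext x < b} = {x \<in> M. \<psi> x < b}"
  by (auto simp: ext_def)

lemma ext_le: "b < c \<Longrightarrow> {x. ext x \<le> b} = {x \<in> M. \<psi> x \<le> b}"
  by (auto simp: ext_def)

lemma compact_sublevel:
  assumes "b < c" shows "compact {x \<in> M. \<psi> x \<le> b}"
proof -
  have "closed {x. ext x \<le> b}" by (intro closed_Collect_le continuous_ext continuous_on_const)
  then have "closed {x \<in> M. \<psi> x \<le> b}" by (simp only: ext_le[OF assms])
  then show ?thesis using M(2) by (auto simp: compact_eq_bounded_closed intro: bounded_subset)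
qed

lemma open_sublevel: "b \<le> c \<Longrightarrow> open {x \<in> M. \<psi> x < b}"
  by (simp only: ext_less[symmetric]) (intro open_Collect_less continuous_ext continuous_on_const)

lemma minimum: "x \<in> M \<Longrightarrow> \<psi> x0 \<le> \<psi> x" and minimum_strict: "x \<in> M \<Longrightarrow> x \<noteq> x0 \<Longrightarrow> \<psi> x0 < \<psi> x"
proof -
  have cl: "compact (closure M)" "closure M \<noteq> {}" using M(2) crit(1) closure_subset[of M] by auto
  obtain b where b: "b \<in> closure M" "\<And>y. y \<in> closure M \<Longrightarrow> ext b \<le> ext y"
    using continuous_attains_inf[OF cl continuous_ext] by blast
  have le: "ext b \<le> \<psi> x" if "x \<in> M" for x using b(2)[of x] that closure_subset by force
  have "b \<in> M" using le[OF crit(1)] below[OF crit(1)] by (auto simp: ext_def split: if_splits)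
  then have bx: "b = x0" using le by (intro extremum_unique[OF _ M(1) order_refl]) auto
  show min: "\<psi> x0 \<le> \<psi> x" if "x \<in> M" for x using le[OF that] bx crit(1) by simp
  show "\<psi> x0 < \<psi> x" if "x \<in> M" "x \<noteq> x0"
  proof (rule ccontr)
    assume "\<not> ?thesis"
    then have "\<psi> x = \<psi> x0" using min[OF that(1)] by simp
    then have "x = x0" using min that(1) by (intro extremum_unique[OF _ M(1) order_refl]) auto
    then show False using that by simp
  qed
qed

text \<open>Away from \<open>x0\<close> there is no local extremum, so values on both sides occur
  arbitrarily close by; in the topology of the level sets this takes the place of the implicit
  function theorem.\<close>

lemma regular_neighbours:
  assumes "x \<in> M" "x \<noteq> x0" "open N" "x \<in> N"
  shows "\<exists>y\<in>N. ext y < ext x" "\<exists>y\<in>N. ext x < ext y"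
proof -
  have "\<not> ((\<forall>y\<in>N\<inter>M. ext y \<le> ext x) \<or> (\<forall>y\<in>N\<inter>M. ext x \<le> ext y))"
    using extremum_unique[of x "N \<inter> M"] assms M(1) by (auto simp del: ext_M)
  then show "\<exists>y\<in>N. ext y < ext x" "\<exists>y\<in>N. ext x < ext y" unfolding de_Morgan_disj by (meson Int_iff not_le)+
qed

text \<open>The level set is the frontier of the superlevel set \<open>E\<close>, and in the plane
  an open connected set with connected complement has a connected frontier. The sublevel set is
  connected as each of its components contains a minimum, which must be \<open>x0\<close>.
  \<open>E\<close> is connected as each of its components leaves \<open>M\<close>, and the connected
  complement of \<open>M\<close> lies in \<open>E\<close>.\<close>

lemma connected_level_set:
  assumes b: "b < c" shows "connected {x \<in> M. \<psi> x = b}"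
proof (cases "\<psi> x0 < b")
  case False
  then have "{x \<in> M. \<psi> x = b} \<subseteq> {x0}" using minimum_strict by force
  then have "{x \<in> M. \<psi> x = b} = {} \<or> {x \<in> M. \<psi> x = b} = {x0}" by (rule subset_singletonD)
  then show ?thesis by (elim disjE; simp only: connected_empty connected_sing)
next
  case True
  define A S E where "A = {x. ext x < b}" and "S = {x. ext x \<le> b}" and "E = {x. ext x > b}"
  have AM: "A \<subseteq> M" and SM: "S \<subseteq> M" using b by (auto simp: A_def S_def ext_def split: if_splits)
  have oA: "open A" unfolding A_def by (intro open_Collect_less continuous_ext continuous_on_const)
  have oE: "open E" unfolding E_def by (intro open_Collect_less continuous_ext continuous_on_const)
  have x0A: "x0 \<in> A" using True crit(1) by (simp add: A_def)
  have cA: "connected_component A x x0" if x: "x \<in> A" for x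
  proof -
    let ?D = "connected_component_set A x"
    have DA: "?D \<subseteq> A" by (rule connected_component_subset)
    have "bounded ?D" using M(2) DA AM by (meson bounded_subset order_trans)
    then have cpD: "compact (closure ?D)" by simp
    have xD: "x \<in> closure ?D" using x closure_subset[of ?D] connected_component_refl_eq by blast
    then have neD: "closure ?D \<noteq> {}" by (metis empty_iff)
    \<comment> \<open>The minimum over the closure of a component is below \<open>b\<close>, so it
      lies in \<open>A\<close> and thus in the component itself, which is open.\<close>
    obtain w where w: "w \<in> closure ?D" "\<And>y. y \<in> closure ?D \<Longrightarrow> ext w \<le> ext y"
      using continuous_attains_inf[OF cpD neD continuous_ext] by metis
    have "ext w < b" using w(2)[OF xD] x by (simp add: A_def del: ext_M)
    then have "w \<in> ?D" using component_closure[OF oA _ w(1)] by (simp add: A_def)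
    moreover have "w = x0"
    proof (rule extremum_unique[of w ?D])
      show "open ?D" by (rule open_connected_component[OF oA])
      show "?D \<subseteq> M" using DA AM by blast
      show "(\<forall>y\<in>?D. ext y \<le> ext w) \<or> (\<forall>y\<in>?D. ext w \<le> ext y)"
        using w(2) closure_subset[of ?D] by (intro disjI2 ballI) (rule w(2), blast)
    qed fact
    ultimately show ?thesis by simp
  qed
  have "connected A"
    unfolding connected_iff_connected_component
    using cA by (meson connected_component_sym connected_component_trans)
  \<comment> \<open>Points of the level \<open>b\<close> have smaller values arbitrarily near, so
    passing from \<open>A\<close> to \<open>S\<close> adds only limit points and preserves
    connectedness.\<close>
  moreover have "S \<subseteq> closure A"
  proof
    fix x assume x: "x \<in> S"
    show "x \<in> closure A"
    proof (cases "ext x < b")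
      case True
      then have "x \<in> A" by (simp add: A_def)
      then show ?thesis by (rule subsetD[OF closure_subset])
    next
      case False
      then have eq: "ext x = b" using x by (simp add: S_def)
      then have "x \<noteq> x0" using x0A by (auto simp: A_def)
      show ?thesis unfolding closure_iff_nhds_not_empty
      proof (intro allI impI)
        fix U V assume "V \<subseteq> U" "open V" "x \<in> V"
        have "x \<in> M" using x SM by blast
        then obtain y where "y \<in> V" "ext y < ext x"
          using regular_neighbours(1)[OF _ \<open>x \<noteq> x0\<close> \<open>open V\<close> \<open>x \<in> V\<close>] by blast
        then have "y \<in> A" "y \<in> U" using eq \<open>V \<subseteq> U\<close> by (auto simp: A_def)
        then show "A \<inter> U \<noteq> {}" by blast
      qed
    qed
  qed
  moreover have "A \<subseteq> S" by (auto simp: A_def S_def)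
  ultimately have conS: "connected S" by (meson connected_intermediate_closure)
  have ME: "- M \<subseteq> E" using b by (auto simp: E_def ext_def)
  have cE: "\<exists>y. y \<notin> M \<and> connected_component E x y" if x: "x \<in> E" for x
  proof (rule ccontr)
    let ?D = "connected_component_set E x"
    \<comment> \<open>A component of \<open>E\<close> inside \<open>M\<close> would attain its
      maximum at an interior critical point, hence at \<open>x0\<close>; but \<open>x0\<close> lies
      in \<open>A\<close>.\<close>
    assume "\<not> ?thesis"
    then have DM: "?D \<subseteq> M" by blast
    have "bounded ?D" using M(2) DM by (rule bounded_subset)
    then have cpD: "compact (closure ?D)" by simp
    have xD: "x \<in> closure ?D" using x closure_subset[of ?D] connected_component_refl_eq by blast
    then have neD: "closure ?D \<noteq> {}" by (metis empty_iff)
    obtain w where w: "w \<in> closure ?D" "\<And>y. y \<in> closure ?D \<Longrightarrow> ext y \<le> ext w"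
      using continuous_attains_sup[OF cpD neD continuous_ext] by metis
    have wE: "w \<in> E" using w(2)[OF xD] x by (simp add: E_def del: ext_M)
    then have "w \<in> ?D" using component_closure[OF oE _ w(1)] by blast
    moreover have "w = x0"
    proof (rule extremum_unique[of w ?D])
      show "open ?D" by (rule open_connected_component[OF oE])
      show "(\<forall>y\<in>?D. ext y \<le> ext w) \<or> (\<forall>y\<in>?D. ext w \<le> ext y)"
        using w(2) closure_subset[of ?D] by (intro disjI1 ballI) (rule w(2), blast)
    qed fact+
    ultimately show False using x0A wE by (simp add: A_def E_def)
  qed
  have "connected E"
    unfolding connected_iff_connected_component
  proof (intro ballI)
    fix x y assume "x \<in> E" "y \<in> E"
    then obtain x' y' where x': "x' \<notin> M" "connected_component E x x'" "y' \<notin> M" "connected_component E y y'"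
      using cE by metis
    have "connected_component E x' y'"
      using connected_component_of_subset[of "-M" x' y' E] M(3) ME x'
      unfolding connected_iff_connected_component by blast
    then show "connected_component E x y"
      using x' by (meson connected_component_sym connected_component_trans)
  qed
  moreover have "- E = S" by (auto simp: E_def S_def)
  ultimately have "connected (frontier E)" using conS by (simp add: connected_frontier_simple)
  moreover have "frontier E = {x \<in> M. \<psi> x = b}"
  proof
    show "frontier E \<subseteq> {x \<in> M. \<psi> x = b}"
    proof
      fix x assume "x \<in> frontier E"
      then have x: "x \<in> closure E" "x \<notin> E" using oE by (simp_all add: frontier_def interior_open)
      have "closed {x. b \<le> ext x}" by (intro closed_Collect_le continuous_ext continuous_on_const)
      then have "closure E \<subseteq> {x. b \<le> ext x}" by (rule closure_minimal[rotated]) (auto simp: E_def)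
      then have "ext x = b" using x by (auto simp: E_def)
      then show "x \<in> {x \<in> M. \<psi> x = b}" using b by (auto simp: ext_def split: if_splits)
    qed
    show "{x \<in> M. \<psi> x = b} \<subseteq> frontier E"
    proof
      fix x assume x: "x \<in> {x \<in> M. \<psi> x = b}"
      then have "x \<noteq> x0" using True by auto
      have "x \<in> closure E" unfolding closure_iff_nhds_not_empty
      proof (intro allI impI)
        fix U V assume "V \<subseteq> U" "open V" "x \<in> V"
        moreover have "x \<in> M" "ext x = b" using x by auto
        ultimately obtain y where "y \<in> V" "ext x < ext y"
          using regular_neighbours(2)[OF _ \<open>x \<noteq> x0\<close> \<open>open V\<close> \<open>x \<in> V\<close>] by blast
        then have "y \<in> E" "y \<in> U" using \<open>ext x = b\<close> \<open>V \<subseteq> U\<close> by (auto simp: E_def)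
        then show "E \<inter> U \<noteq> {}" by blast
      qed
      then show "x \<in> frontier E" using x oE by (simp add: frontier_def interior_open E_def)
    qed
  qed
  ultimately show ?thesis by simp
qed

text \<open>Here the local statement in charts and the connectedness of level sets combine. The
  level of \<open>x0\<close> has no regular chart, but it consists of \<open>x0\<close>
  alone.\<close>

lemma constant_on_level_sets:
  assumes C1: "C_on 1 M \<psi>" and B: "\<And>x. x \<in> M \<Longrightarrow> (B has_derivative (\<lambda>h. w x * (grad \<psi> x \<bullet> h))) (at x)"
    and x: "x \<in> M" "y \<in> M" "\<psi> x = \<psi> y"
  shows "w x = w y"
proof (cases "x = x0")
  case True
  then have "y = x0" using minimum_strict[of y] x by force
  then show ?thesis using True by simp
next
  case False
  let ?L = "{z \<in> M. \<psi> z = \<psi> x}"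
  have "connected ?L" using below[OF x(1)] by (rule connected_level_set)
  then show ?thesis
  proof (rule connected_local_const)
    show "x \<in> ?L" "y \<in> ?L" using x by auto
    show "\<forall>z\<in>?L. \<forall>\<^sub>F z' in at z within ?L. w z = w z'"
    proof
      fix z assume z: "z \<in> ?L"
      have "z \<noteq> x0" using minimum_strict[OF x(1) False] z by auto
      then have "grad \<psi> z \<noteq> 0" using crit(3) z by blast
      then obtain N where N: "open N" "z \<in> N" "N \<subseteq> M" "\<And>x y. x \<in> N \<Longrightarrow> y \<in> N \<Longrightarrow> \<psi> x = \<psi> y \<Longrightarrow> w x = w y"
        using factor_constant_on_level_sets[OF M(1) C1 _ _ B] z by blast
      then show "\<forall>\<^sub>F z' in at z within ?L. w z = w z'"
        unfolding eventually_at_topological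
      proof (intro exI[of _ N] conjI ballI impI)
        fix z' assume "z' \<in> N" "z' \<in> ?L"
        then have "\<psi> z = \<psi> z'" using z by simp
        then show "w z = w z'" by (rule N(4)[OF N(2) \<open>z' \<in> N\<close>])
      qed (rule N)+
    qed
  qed
qed

end

section \<open>The Dirichlet problem\<close>

lemma second_derivative_at_maximum:
  fixes f p :: "real \<Rightarrow> real"
  assumes "d > 0" and f: "\<And>t. \<bar>t\<bar> < d \<Longrightarrow> (f has_real_derivative p t) (at t)"
    and p: "(p has_real_derivative q) (at 0)" and max: "\<And>t. \<bar>t\<bar> < d \<Longrightarrow> f t \<le> f 0"
  shows "q \<le> 0"
proof (rule ccontr)
  assume "\<not> q \<le> 0"
  have p0: "p 0 = 0" by (rule DERIV_local_max[OF f[of 0] \<open>d > 0\<close>]) (use \<open>d > 0\<close> max in auto)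
  obtain d' where d': "d' > 0" "\<And>h. 0 < h \<Longrightarrow> h < d' \<Longrightarrow> p h > 0"
    using DERIV_pos_inc_right[OF p] \<open>\<not> q \<le> 0\<close> p0 by auto
  define t where "t = min d d' / 2"
  have t: "0 < t" "t < d" "t < d'" using \<open>d > 0\<close> d'(1) by (auto simp: t_def)
  obtain z where z: "0 < z" "z < t" "f t - f 0 = (t - 0) * p z"
    using MVT2[OF t(1), of f p] f t by auto
  have "p z > 0" using d' z t by auto
  then have "f t > f 0" using z t by (simp add: algebra_simps) 
  then show False using max[of t] t by simp
qed

text \<open>Maximum principle: a small multiple of the squared norm makes the Laplacian positive,
  which no interior maximum allows, while it stays too small to move the maximum to the
  boundary.\<close>

lemma subharmonic_le_0:
  fixes \<phi> :: "real^2 \<Rightarrow> real"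
  assumes M: "open M" "bounded M" and C: "C_on 2 M \<phi>" "continuous_on (closure M) \<phi>"
    and lap: "\<And>x. x \<in> M \<Longrightarrow> laplacian \<phi> x = 0" and out: "\<And>x. x \<notin> M \<Longrightarrow> \<phi> x = 0"
  shows "\<phi> x \<le> 0"
proof (rule ccontr)
  assume pos: "\<not> \<phi> x \<le> 0"
  then have x: "x \<in> M" using out by force
  obtain R where R: "R > 0" "\<And>y. y \<in> closure M \<Longrightarrow> norm y \<le> R"
    using bounded_closure[OF M(2)] unfolding bounded_pos by blast
  \<comment> \<open>Chosen so that the added term stays below \<open>\<phi> x / 2\<close> on the
    closure of \<open>M\<close>.\<close>
  define \<epsilon> where "\<epsilon> = \<phi> x / (2 * R\<^sup>2)"
  have eps: "\<epsilon> > 0" "\<epsilon> * R\<^sup>2 < \<phi> x" using pos R(1) by (auto simp: \<epsilon>_def)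
  define g where "g y = \<phi> y + \<epsilon> * (norm y)\<^sup>2" for y
  have cg: "continuous_on (closure M) g" unfolding g_def by (intro continuous_intros C)
  have cl: "compact (closure M)" "closure M \<noteq> {}" "x \<in> closure M" using M(2) x closure_subset[of M] by auto
  obtain w where w: "w \<in> closure M" "\<And>y. y \<in> closure M \<Longrightarrow> g y \<le> g w"
    using continuous_attains_sup[OF cl(1,2) cg] by blast
  have wM: "w \<in> M"
  proof (rule ccontr)
    assume "w \<notin> M"
    then have "g w = \<epsilon> * (norm w)\<^sup>2" using out by (simp add: g_def)
    also have "\<dots> \<le> \<epsilon> * R\<^sup>2" using R(2)[OF w(1)] eps(1) by (intro mult_left_mono power_mono) auto
    also have "\<dots> < \<phi> x" by fact
    also have "\<dots> \<le> g x" using eps(1) by (simp add: g_def)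
    finally show False using w(2)[OF cl(3)] by simp
  qed
  obtain d where d: "d > 0" "ball w d \<subseteq> M" using M(1) wM openE by blast
  \<comment> \<open>The restriction of \<open>g\<close> to each coordinate line through
    \<open>w\<close> has a maximum there; summing the two inequalities contradicts a vanishing
    Laplacian.\<close>
  have "partial i (partial i \<phi>) w + 2 * \<epsilon> \<le> 0" for i
  proof (rule second_derivative_at_maximum[OF d(1)])
    let ?e = "axis i 1 :: real^2"
    have inM: "w + t *\<^sub>R ?e \<in> M" if "\<bar>t\<bar> < d" for t
      using d(2) that by (auto simp: dist_norm norm_axis_1)
    have nsq: "(norm (w + t *\<^sub>R ?e))\<^sup>2 = (norm w)\<^sup>2 + 2 * (t * w $ i) + t * t" for t
      by (simp add: power2_norm_eq_inner inner_add_left inner_add_right inner_axis inner_axis' inner_axis_axis algebra_simps)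
    show "((\<lambda>t. \<phi> (w + t *\<^sub>R ?e) + \<epsilon> * ((norm w)\<^sup>2 + 2 * (t * w $ i) + t * t)) has_real_derivative
       (partial i \<phi> (w + t *\<^sub>R ?e) + \<epsilon> * (2 * w $ i + 2 * t))) (at t)" if "\<bar>t\<bar> < d" for t
    proof -
      have "\<phi> differentiable (at (w + t *\<^sub>R ?e))" using C(1) inM[OF that] by (simp add: C_on_2)
      note has_real_derivative_along_axis[OF this]
      then show ?thesis by (auto intro!: derivative_eq_intros)
    qed
    have "partial i \<phi> differentiable (at (w + 0 *\<^sub>R ?e))" using C(1) wM by (simp add: C_on_2 C_on_1)
    from has_real_derivative_along_axis[OF this]
    show "((\<lambda>t. partial i \<phi> (w + t *\<^sub>R ?e) + \<epsilon> * (2 * w $ i + 2 * t)) has_real_derivative 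
       partial i (partial i \<phi>) w + 2 * \<epsilon>) (at 0)"
      by (auto intro!: derivative_eq_intros)
    show "\<phi> (w + t *\<^sub>R ?e) + \<epsilon> * ((norm w)\<^sup>2 + 2 * (t * w $ i) + t * t) \<le>
      \<phi> (w + 0 *\<^sub>R ?e) + \<epsilon> * ((norm w)\<^sup>2 + 2 * (0 * w $ i) + 0 * 0)" if "\<bar>t\<bar> < d" for t
    proof -
      have "w + t *\<^sub>R ?e \<in> closure M" using inM[OF that] closure_subset by blast
      from w(2)[OF this] show ?thesis unfolding g_def nsq by simp
    qed
  qed
  from this[of 1] this[of 2] lap[OF wM] eps(1) show False by (simp add: laplacian_def sum_2)
qed

lemma partial_minus:
  "f differentiable (at x) \<Longrightarrow> partial i (\<lambda>x. - f x) x = - partial i f x"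
  by (rule partial_bounded_linear[OF bounded_linear_minus[OF bounded_linear_ident]])

lemma laplacian_bounded_linear:
  assumes "open M" "C_on 2 M f" "bounded_linear L" "x \<in> M"
  shows "laplacian (\<lambda>x. L (f x)) x = L (laplacian f x)"
proof -
  interpret bounded_linear L by fact
  have "partial i (partial i (\<lambda>x. L (f x))) x = L (partial i (partial i f) x)" for i
  proof -
    have "partial i (partial i (\<lambda>x. L (f x))) x = partial i (\<lambda>x. L (partial i f x)) x"
      using assms by (intro partial_cong_open[of M]) (auto intro!: partial_bounded_linear simp: C_on_2)
    also have "\<dots> = L (partial i (partial i f) x)"
      using assms by (intro partial_bounded_linear) (auto simp: C_on_2 C_on_1)
    finally show ?thesis .
  qed
  then show ?thesis by (simp add: laplacian_def sum_2 add)
qed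

lemma laplacian_diff:
  assumes "open M" "C_on 2 M f" "C_on 2 M g" "x \<in> M"
  shows "laplacian (\<lambda>x. f x - g x) x = laplacian f x - laplacian g x"
proof -
  have "partial i (partial i (\<lambda>x. f x - g x)) x = partial i (partial i f) x - partial i (partial i g) x" for i
  proof -
    have "partial i (partial i (\<lambda>x. f x - g x)) x = partial i (\<lambda>x. partial i f x - partial i g x) x"
      using assms by (intro partial_cong_open[of M]) (auto intro!: partial_diff simp: C_on_2)
    also have "\<dots> = partial i (partial i f) x - partial i (partial i g) x"
      using assms by (intro partial_diff) (auto simp: C_on_2 C_on_1)
    finally show ?thesis .
  qed
  then show ?thesis by (simp add: laplacian_def sum_2)
qed

text \<open>This uniqueness is what gives the definite description in
  \<open>inv_dirichlet_laplacian\<close> its value once a solution is exhibited.\<close>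

lemma dirichlet_unique:
  fixes f g :: "real^2 \<Rightarrow> real"
  assumes M: "open M" "bounded M" 
    and f: "C_on 2 M f" "continuous_on (closure M) f" "\<And>x. x \<notin> M \<Longrightarrow> f x = 0"
    and g: "C_on 2 M g" "continuous_on (closure M) g" "\<And>x. x \<notin> M \<Longrightarrow> g x = 0"
    and lap: "\<And>x. x \<in> M \<Longrightarrow> laplacian f x = laplacian g x"
  shows "f = g"
proof
  fix x
  have le: "f x - g x \<le> 0" if 
    f: "C_on 2 M f" "continuous_on (closure M) f" "\<And>x. x \<notin> M \<Longrightarrow> f x = 0"
    and g: "C_on 2 M g" "continuous_on (closure M) g" "\<And>x. x \<notin> M \<Longrightarrow> g x = 0"
    and lap: "\<And>x. x \<in> M \<Longrightarrow> laplacian f x = laplacian g x" for f g :: "real^2 \<Rightarrow> real"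
    by (rule subharmonic_le_0[OF M, of "\<lambda>x. f x - g x"])
      (use that M laplacian_diff[OF M(1) f(1) g(1)] in \<open>auto intro!: C_on_diff continuous_intros\<close>)
  from le[OF f g lap] le[OF g f lap[symmetric]] show "f x = g x" by simp
qed

text \<open>For nonzero \<omega> the function \<open>(\<psi> - c) / \<omega>\<close>, continued by
  0, solves the Dirichlet problem with right side 1. For \<omega> = 0 uniqueness forces \<psi> =
  \<open>c\<close>, and both sides vanish, whether or not \<open>u_star\<close> stems from a
  solution.\<close>

lemma constant_vorticity_imp_u_star:
  fixes \<psi> :: "real^2 \<Rightarrow> real"
  assumes M: "open M" "bounded M" and C: "C_on 2 M \<psi>"
    and bdry: "\<And>x. x \<in> frontier M \<Longrightarrow> (\<psi> \<longlongrightarrow> c) (at x within M)"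
    and lap: "\<And>x. x \<in> M \<Longrightarrow> laplacian \<psi> x = \<omega>" and x: "x \<in> M"
  shows "perp_grad \<psi> x = \<omega> *\<^sub>R u_star M x"
proof -
  \<comment> \<open>The factor \<open>a\<close> allows for both cases: it is
    \<open>1 / \<omega>\<close> in general and 1 when \<omega> vanishes.\<close>
  define \<phi> where "\<phi> a x = (if x \<in> M then a * (\<psi> x - c) else 0)" for a x
  have C\<psi>: "C_on 2 M (\<lambda>x. \<psi> x - c)" by (rule C_on_diff[OF M(1) C C_on_const])
  have cont: "continuous_on M \<psi>" using C by (rule C_on_continuous_on)
  have C\<phi>: "C_on 2 M (\<phi> a)" for a
    by (rule C_on_cong[OF M(1) C_on_bounded_linear[OF bounded_linear_mult_right M(1) C\<psi>, of a]]) (simp add: \<phi>_def)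
  have c\<phi>: "continuous_on (closure M) (\<phi> a)" for a
  proof -
    have "continuous_on UNIV (\<lambda>x. if x \<in> M then a * (\<psi> x - c) else 0)"
    proof (rule continuous_on_extend_constant[OF M(1)])
      fix x assume "x \<in> frontier M"
      then have "((\<lambda>x. a * (\<psi> x - c)) \<longlongrightarrow> a * (c - c)) (at x within M)"
        by (intro tendsto_intros bdry)
      then show "((\<lambda>x. a * (\<psi> x - c)) \<longlongrightarrow> 0) (at x within M)" by simp
    qed (intro continuous_intros cont)
    then show ?thesis unfolding \<phi>_def by (rule continuous_on_subset) simp
  qed
  have lap\<phi>: "laplacian (\<phi> a) x = a * \<omega>" if "x \<in> M" for a x
  proof -
    have "laplacian (\<phi> a) x = laplacian (\<lambda>x. a * (\<psi> x - c)) x"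
    proof -
      have "partial i (partial i (\<phi> a)) x = partial i (partial i (\<lambda>x. a * (\<psi> x - c))) x" for i
        by (rule partial_cong_open[OF M(1) that], rule partial_cong_open[OF M(1)]) (auto simp: \<phi>_def)
      then show ?thesis by (simp add: laplacian_def)
    qed
    also have "\<dots> = a * laplacian (\<lambda>x. \<psi> x - c) x"
      by (rule laplacian_bounded_linear[OF M(1) C\<psi> bounded_linear_mult_right that])
    also have "laplacian (\<lambda>x. \<psi> x - c) x = laplacian \<psi> x - laplacian (\<lambda>x. c) x"
      by (rule laplacian_diff[OF M(1) C C_on_const that])
    also have "laplacian (\<lambda>x. c) x = 0"
    proof -
      have "partial i (\<lambda>x. c) = (\<lambda>x. 0)" for i by auto
      then show ?thesis by (simp add: laplacian_def)
    qed
    finally show ?thesis using lap[OF that] by simp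
  qed
  have pg: "perp_grad (\<phi> a) x = a *\<^sub>R perp_grad \<psi> x" for a
  proof -
    have d: "\<psi> differentiable (at x)" using C x by (simp add: C_on_2)
    have "partial i (\<phi> a) x = a * partial i \<psi> x" for i
    proof -
      have "partial i (\<phi> a) x = partial i (\<lambda>x. a * (\<psi> x - c)) x"
        by (rule partial_cong_open[OF M(1) x]) (simp add: \<phi>_def)
      also have "\<dots> = a * partial i (\<lambda>x. \<psi> x - c) x"
        by (rule partial_bounded_linear[OF bounded_linear_mult_right]) (use d in auto)
      also have "\<dots> = a * partial i \<psi> x" using d by (simp add: partial_diff)
      finally show ?thesis .
    qed
    then show ?thesis by (simp add: vec_eq_iff forall_2)
  qed
  show ?thesis
  proof (cases "\<omega> = 0")
    case True
    have zero: "partial i (\<lambda>x. 0::real) = (\<lambda>x. 0)" for i by auto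
    have "\<phi> 1 = (\<lambda>x. 0)"
      by (rule dirichlet_unique[OF M C\<phi> c\<phi>]) (use lap\<phi> True in \<open>auto simp: \<phi>_def laplacian_def zero\<close>)
    then have "perp_grad (\<phi> 1) x = 0" by (simp add: vec_eq_iff forall_2)
    then show ?thesis using pg[of 1] True by simp
  next
    case False
    have "inv_dirichlet_laplacian M (\<lambda>_. 1) = \<phi> (1 / \<omega>)"
      unfolding inv_dirichlet_laplacian_def
    proof (rule the_equality)
      show *: "C_on 2 M (\<phi> (1 / \<omega>)) \<and> continuous_on (closure M) (\<phi> (1 / \<omega>)) \<and>
        (\<forall>x\<in>M. laplacian (\<phi> (1 / \<omega>)) x = 1) \<and> (\<forall>x. x \<notin> M \<longrightarrow> \<phi> (1 / \<omega>) x = 0)"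
        using C\<phi> c\<phi> lap\<phi> False by (auto simp: \<phi>_def)
      fix f :: "real^2 \<Rightarrow> real" assume "C_on 2 M f \<and> continuous_on (closure M) f \<and>
        (\<forall>x\<in>M. laplacian f x = 1) \<and> (\<forall>x. x \<notin> M \<longrightarrow> f x = 0)"
      with * show "f = \<phi> (1 / \<omega>)" by (intro dirichlet_unique[OF M]) auto
    qed
    then show ?thesis using pg[of "1 / \<omega>"] False by (simp add: u_star_def)
  qed
qed

section \<open>Compactly supported products\<close>

lemma C_on_Un:
  assumes "open S" "open T" shows "C_on k S f \<Longrightarrow> C_on k T f \<Longrightarrow> C_on k (S \<union> T) f"
proof (induction k arbitrary: f)
  case 0
  then show ?case using continuous_on_open_Un[OF assms] by simp
next
  case (Suc k)
  have "C_on k (S \<union> T) (partial i f)" for i by (rule Suc.IH) (use Suc.prems in simp_all)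
  moreover have "\<forall>x\<in>S \<union> T. f differentiable (at x)" using Suc.prems by auto
  ultimately show ?case by simp
qed

lemma C_on_UNIV_cutoff:
  assumes M: "open M" and K: "compact K" "K \<subseteq> M" and f: "C_on k M f" and 0: "\<And>x. x \<notin> K \<Longrightarrow> f x = 0"
  shows "C_on k UNIV f"
proof -
  have oK: "open (- K)" using K(1) compact_imp_closed by blast
  have "C_on k (- K) f"
    by (rule C_on_cong[OF oK C_on_const]) (use 0 in auto)
  moreover have "M \<union> - K = UNIV" using K(2) by blast
  ultimately show ?thesis using C_on_Un[OF M oK f] by metis
qed

lemma partial_outside_support:
  assumes K: "compact K" and 0: "\<And>x. x \<notin> K \<Longrightarrow> h x = 0" and x: "x \<notin> K"
  shows "partial i h x = 0"
proof -
  have "partial i h x = partial i (\<lambda>x. 0) x"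
    by (rule partial_cong_open[of "- K"]) (use K compact_imp_closed 0 x in auto)
  then show ?thesis by simp
qed

lemma integrable_compact_support:
  fixes f :: "real^2 \<Rightarrow> real"
  assumes K: "compact K" "K \<subseteq> M" and f: "continuous_on M f" and 0: "\<And>x. x \<notin> K \<Longrightarrow> f x = 0"
  shows "integrable lborel f"
proof -
  have "integrable lborel (\<lambda>x. indicator K x *\<^sub>R f x)"
    by (rule borel_integrable_compact[OF K(1) continuous_on_subset[OF f K(2)]])
  moreover have "(\<lambda>x. indicator K x *\<^sub>R f x) = f" using 0 by (force simp: indicator_def)
  ultimately show ?thesis by simp
qed

text \<open>The values of \<open>f\<close> outside \<open>M\<close> are arbitrary; the product
  \<open>h * f\<close> vanishes off \<open>K\<close> all the same and is therefore of class
  \<open>C_on 1\<close> on the whole plane.\<close>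

lemma integration_by_parts:
  fixes h f :: "real^2 \<Rightarrow> real"
  assumes M: "open M" and K: "compact K" "K \<subseteq> M" and h: "C_on 1 M h" "\<And>x. x \<notin> K \<Longrightarrow> h x = 0" and f: "C_on 1 M f"
  shows "integrable lborel (\<lambda>x. h x * partial i f x)" "integrable lborel (\<lambda>x. partial i h x * f x)"
    "(\<integral>x. h x * partial i f x \<partial>lborel) = - (\<integral>x. partial i h x * f x \<partial>lborel)"
proof -
  have cont: "continuous_on M h" "continuous_on M f" "continuous_on M (partial i h)" "continuous_on M (partial i f)"
    using C_on_continuous_on[OF h(1)] C_on_continuous_on[OF f] h(1) f by (simp_all add: C_on_1)
  have p0: "partial i h x = 0" if "x \<notin> K" for x
    by (rule partial_outside_support[OF K(1) h(2) that])
  show 1: "integrable lborel (\<lambda>x. h x * partial i f x)"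
    by (rule integrable_compact_support[OF K]) (use cont h(2) in \<open>auto intro: continuous_intros\<close>)
  show 2: "integrable lborel (\<lambda>x. partial i h x * f x)"
    by (rule integrable_compact_support[OF K]) (use cont p0 in \<open>auto intro: continuous_intros\<close>)
  have 0: "h x * f x = 0" if "x \<notin> K" for x using h(2)[OF that] by simp
  have hf: "C_on 1 UNIV (\<lambda>x. h x * f x)"
    by (rule C_on_UNIV_cutoff[OF M K C_on_mult[OF M h(1) f] 0])
  have "partial i (\<lambda>x. h x * f x) x = h x * partial i f x + partial i h x * f x" for x
  proof (cases "x \<in> M")
    case True
    then show ?thesis using h(1) f by (simp add: C_on_1 partial_mult)
  next
    case False
    then have "x \<notin> K" using K(2) by blast
    then show ?thesis using partial_outside_support[OF K(1) 0] h(2) p0 by simp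
  qed
  moreover have "(\<integral>x. partial i (\<lambda>x. h x * f x) x \<partial>lborel) = 0"
    using integral_partial_eq_0(2)[OF hf K(1) 0] .
  ultimately show "(\<integral>x. h x * partial i f x \<partial>lborel) = - (\<integral>x. partial i h x * f x \<partial>lborel)"
    using 1 2 by simp
qed

section \<open>Testing the Navier--Stokes equations along streamlines\<close>

definition curl :: "(real^2 \<Rightarrow> real^2) \<Rightarrow> real^2 \<Rightarrow> real" where
  "curl v x = partial 1 v x $ 2 - partial 2 v x $ 1"

text \<open>\<open>B\<close> is the Bernoulli function: convection plus pressure gradient is
  \<open>grad B\<close> plus \<open>curl v\<close> times \<open>v\<close> rotated by a right angle.
  It serves the viscous identity and the Euler equations alike.\<close>

lemma bernoulli:
  fixes v :: "real^2 \<Rightarrow> real^2"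
  assumes M: "open M" and v: "C_on 1 M v" and q: "C_on 1 M q"
  defines "B \<equiv> \<lambda>x. (v x $ 1 * v x $ 1 + v x $ 2 * v x $ 2) / 2 + q x"
  shows "C_on 1 M B"
    and "x \<in> M \<Longrightarrow> partial i B x = v x $ 1 * partial i v x $ 1 + v x $ 2 * partial i v x $ 2 + partial i q x"
proof -
  have vn: "C_on 1 M (\<lambda>x. v x $ j)" for j by (rule C_on_nth[OF M v])
  have Bv: "C_on 1 M (\<lambda>x. (v x $ 1 * v x $ 1 + v x $ 2 * v x $ 2) / 2)"
    using C_on_bounded_linear[OF bounded_linear_divide M] C_on_add[OF M C_on_mult[OF M vn vn] C_on_mult[OF M vn vn]] by blast
  show "C_on 1 M B" unfolding B_def by (rule C_on_add[OF M Bv q])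
  show "partial i B x = v x $ 1 * partial i v x $ 1 + v x $ 2 * partial i v x $ 2 + partial i q x" if x: "x \<in> M"
  proof -
    have dv: "v differentiable (at x)" using v x by (simp add: C_on_1)
    have d: "(\<lambda>x. v x $ j) differentiable (at x)" for j using dv by (rule differentiable_nth)
    have "partial i (\<lambda>x. (v x $ 1 * v x $ 1 + v x $ 2 * v x $ 2) / 2) x = 
      partial i (\<lambda>x. v x $ 1 * v x $ 1 + v x $ 2 * v x $ 2) x / 2"
      by (rule partial_bounded_linear[OF bounded_linear_divide]) (intro derivative_intros differentiable_add differentiable_mult d)
    also have "\<dots> = v x $ 1 * partial i v x $ 1 + v x $ 2 * partial i v x $ 2"
      using d by (simp add: partial_add partial_mult partial_nth[OF dv] differentiable_mult)
    finally show ?thesis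
      unfolding B_def using q Bv x by (subst partial_add) (auto simp: C_on_1)
  qed
qed

text \<open>The pressure and the convection term drop out because their sum is \<open>v \<bullet> \<nabla>B\<close> against a function
  constant along the streamlines of \<open>v\<close>.\<close>

lemma navier_stokes_vorticity_identity:
  fixes v :: "real^2 \<Rightarrow> real^2" and h :: "real^2 \<Rightarrow> real"
  assumes M: "open M" and K: "compact K" "K \<subseteq> M" and h: "C_on 1 M h" "\<And>x. x \<notin> K \<Longrightarrow> h x = 0"
    and ns: "stationary_navier_stokes M \<nu> v q" "\<nu> \<noteq> 0"
    and hv: "\<And>x. x \<in> M \<Longrightarrow> v x $ 1 * partial 1 h x + v x $ 2 * partial 2 h x = 0"
  shows "(\<integral>x. curl v x * (h x * curl v x + v x $ 2 * partial 1 h x - v x $ 1 * partial 2 h x) \<partial>lborel) = 0"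
proof -
  have v: "C_on 2 M v" and q: "C_on 1 M q" 
    and eq: "\<And>x. x \<in> M \<Longrightarrow> convection v v x = - grad q x + \<nu> *\<^sub>R laplacian v x" 
    and div: "\<And>x. x \<in> M \<Longrightarrow> partial 1 v x $ 1 + partial 2 v x $ 2 = 0"
    using ns(1) unfolding stationary_navier_stokes_def by (auto simp: divergence_def sum_2)
  have v1: "C_on 1 M v" by (rule C_on_le[OF v]) simp
  have vn2: "C_on 2 M (\<lambda>x. v x $ j)" and vn: "C_on 1 M (\<lambda>x. v x $ j)" for j using C_on_nth[OF M] v v1 by blast+
  have dv: "v differentiable (at x)" "partial i v differentiable (at x)" if "x \<in> M" for x i
    using v that by (simp_all add: C_on_2 C_on_1)
  have pv: "partial i (\<lambda>x. v x $ j) x = partial i v x $ j" if "x \<in> M" for x i j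
    by (rule partial_nth[OF dv(1)[OF that]])
  have ppv: "partial i (partial k (\<lambda>x. v x $ j)) x = partial i (partial k v) x $ j" if "x \<in> M" for x i j k
  proof -
    have "partial i (partial k (\<lambda>x. v x $ j)) x = partial i (\<lambda>x. partial k v x $ j) x"
      by (rule partial_cong_open[OF M that pv])
    then show ?thesis using partial_nth[OF dv(2)[OF that]] by simp
  qed
  have hj: "C_on 1 M (\<lambda>x. h x * v x $ j)" "\<And>x. x \<notin> K \<Longrightarrow> h x * v x $ j = 0" for j
    using C_on_mult[OF M h(1) vn] h(2) by auto
  have phj: "partial i (\<lambda>x. h x * v x $ j) x = h x * partial i v x $ j + partial i h x * v x $ j" if "x \<in> M" for x i j
    using partial_mult[of h x "\<lambda>x. v x $ j" i] h(1) vn that pv by (simp add: C_on_1)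
  have ibp: "integrable lborel (\<lambda>x. h x * v x $ j * partial i f x)" 
    "integrable lborel (\<lambda>x. partial i (\<lambda>x. h x * v x $ j) x * f x)"
    "(\<integral>x. h x * v x $ j * partial i f x \<partial>lborel) = - (\<integral>x. partial i (\<lambda>x. h x * v x $ j) x * f x \<partial>lborel)"
    if "C_on 1 M f" for f i j
    using integration_by_parts[OF M K hj(1) hj(2) that] by blast+
  define B where "B x = (v x $ 1 * v x $ 1 + v x $ 2 * v x $ 2) / 2 + q x" for x
  have B: "C_on 1 M B" unfolding B_def by (rule bernoulli(1)[OF M v1 q])
  have pB: "partial i B x = v x $ 1 * partial i v x $ 1 + v x $ 2 * partial i v x $ 2 + partial i q x" if "x \<in> M" for x i
    unfolding B_def by (rule bernoulli(2)[OF M v1 q that])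
  have energy: "(\<integral>x. h x * v x $ 1 * partial 1 B x \<partial>lborel) + (\<integral>x. h x * v x $ 2 * partial 2 B x \<partial>lborel) = 0"
  proof -
    have "(\<integral>x. h x * v x $ 1 * partial 1 B x \<partial>lborel) + (\<integral>x. h x * v x $ 2 * partial 2 B x \<partial>lborel)
      = - (\<integral>x. partial 1 (\<lambda>x. h x * v x $ 1) x * B x + partial 2 (\<lambda>x. h x * v x $ 2) x * B x \<partial>lborel)"
      using ibp[OF B] by simp
    also have "(\<lambda>x. partial 1 (\<lambda>x. h x * v x $ 1) x * B x + partial 2 (\<lambda>x. h x * v x $ 2) x * B x) = (\<lambda>x. 0)"
    proof
      fix x
      show "partial 1 (\<lambda>x. h x * v x $ 1) x * B x + partial 2 (\<lambda>x. h x * v x $ 2) x * B x = 0"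
      proof (cases "x \<in> M")
        case True
        have "partial 1 (\<lambda>x. h x * v x $ 1) x + partial 2 (\<lambda>x. h x * v x $ 2) x
          = h x * (partial 1 v x $ 1 + partial 2 v x $ 2) + (v x $ 1 * partial 1 h x + v x $ 2 * partial 2 h x)"
          using True by (simp add: phj algebra_simps)
        also have "\<dots> = 0" using div[OF True] hv[OF True] by simp
        finally show ?thesis by (simp only: distrib_right[symmetric] mult_zero_left)
      next
        case False
        then have "x \<notin> K" using K(2) by blast
        then show ?thesis using partial_outside_support[OF K(1) hj(2)] by simp
      qed
    qed
    finally show ?thesis by simp
  qed
  define \<zeta> where "\<zeta> = curl v"
  have pvn: "C_on 1 M (\<lambda>x. partial i v x $ j)" for i j
    using C_on_nth[OF M, of 1 "partial i v" j] v by (simp add: C_on_2)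
  have \<zeta>: "C_on 1 M \<zeta>" unfolding \<zeta>_def curl_def by (rule C_on_diff[OF M pvn pvn])
  have p\<zeta>: "partial i \<zeta> x = partial i (partial 1 v) x $ 2 - partial i (partial 2 v) x $ 1" if "x \<in> M" for x i
    unfolding \<zeta>_def curl_def using pvn dv(2)[OF that] that by (subst partial_diff) (auto simp: C_on_1 partial_nth)
  have comm: "partial 1 (partial 2 v) x $ j = partial 2 (partial 1 v) x $ j" if "x \<in> M" for x j
    using partial_commute[OF M vn2 that, of 1 2 j] ppv[OF that] by simp
  have ddiv: "partial i (partial 1 v) x $ 1 + partial i (partial 2 v) x $ 2 = 0" if "x \<in> M" for x i
  proof -
    have "partial i (\<lambda>x. partial 1 v x $ 1 + partial 2 v x $ 2) x = partial i (\<lambda>x. 0) x"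
      by (rule partial_cong_open[OF M that div])
    moreover have "partial i (\<lambda>x. partial 1 v x $ 1 + partial 2 v x $ 2) x
       = partial i (partial 1 v) x $ 1 + partial i (partial 2 v) x $ 2"
      using pvn dv(2)[OF that] that by (subst partial_add) (auto simp: C_on_1 partial_nth)
    ultimately show ?thesis by simp
  qed
  \<comment> \<open>For a divergence-free field the Laplacian is the perpendicular gradient of the
    curl.\<close>
  have lap: "laplacian v x $ 1 = - partial 2 \<zeta> x" "laplacian v x $ 2 = partial 1 \<zeta> x" if "x \<in> M" for x
    using comm[OF that, of 1] comm[OF that, of 2] ddiv[OF that, of 1] ddiv[OF that, of 2]
    by (simp_all add: p\<zeta>[OF that] laplacian_def sum_2)
  \<comment> \<open>The momentum equation tested with \<open>h * v\<close>: the part of the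
    convection not contained in \<open>grad B\<close> is orthogonal to \<open>v\<close> and
    disappears.\<close>
  have key: "\<nu> * (h x * v x $ 2 * partial 1 \<zeta> x - h x * v x $ 1 * partial 2 \<zeta> x) =
      h x * v x $ 1 * partial 1 B x + h x * v x $ 2 * partial 2 B x" for x
  proof (cases "x \<in> M")
    case True
    have c: "convection v v x $ j = v x $ 1 * partial 1 v x $ j + v x $ 2 * partial 2 v x $ j" for j
      by (simp add: convection_def sum_2)
    have "\<nu> * laplacian v x $ j = v x $ 1 * partial 1 v x $ j + v x $ 2 * partial 2 v x $ j + partial j q x" for j
      using arg_cong[OF eq[OF True], of "\<lambda>a. a $ j"] by (simp add: c)
    from this[of 1] this[of 2] have "- \<nu> * partial 2 \<zeta> x = v x $ 1 * partial 1 v x $ 1 + v x $ 2 * partial 2 v x $ 1 + partial 1 q x"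
      "\<nu> * partial 1 \<zeta> x = v x $ 1 * partial 1 v x $ 2 + v x $ 2 * partial 2 v x $ 2 + partial 2 q x"
      using lap[OF True] by simp_all
    then show ?thesis unfolding pB[OF True] by algebra
  next
    case False
    then have "x \<notin> K" using K(2) by blast
    then show ?thesis using h(2) by simp
  qed
  have "\<nu> * ((\<integral>x. h x * v x $ 2 * partial 1 \<zeta> x \<partial>lborel) - (\<integral>x. h x * v x $ 1 * partial 2 \<zeta> x \<partial>lborel))
    = (\<integral>x. \<nu> * (h x * v x $ 2 * partial 1 \<zeta> x - h x * v x $ 1 * partial 2 \<zeta> x) \<partial>lborel)"
    using ibp[OF \<zeta>] by simp
  also have "\<dots> = 0" unfolding key using ibp[OF B] energy by simp
  finally have "(\<integral>x. h x * v x $ 2 * partial 1 \<zeta> x \<partial>lborel) - (\<integral>x. h x * v x $ 1 * partial 2 \<zeta> x \<partial>lborel) = 0"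
    using ns(2) by simp
  \<comment> \<open>Moving the derivative off \<zeta> leaves only first derivatives of the velocity,
    so the identity can survive the limit.\<close>
  then have "(\<integral>x. partial 1 (\<lambda>x. h x * v x $ 2) x * \<zeta> x - partial 2 (\<lambda>x. h x * v x $ 1) x * \<zeta> x \<partial>lborel) = 0"
    using ibp[OF \<zeta>] by simp
  moreover have "partial 1 (\<lambda>x. h x * v x $ 2) x * \<zeta> x - partial 2 (\<lambda>x. h x * v x $ 1) x * \<zeta> x
    = curl v x * (h x * curl v x + v x $ 2 * partial 1 h x - v x $ 1 * partial 2 h x)" for x
  proof (cases "x \<in> M")
    case True
    show ?thesis unfolding phj[OF True] \<zeta>_def curl_def by (simp add: algebra_simps)
  next
    case False
    then have "x \<notin> K" using K(2) by blast
    then show ?thesis using partial_outside_support[OF K(1) hj(2)] partial_outside_support[OF K(1) h(2)] h(2) by simp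
  qed
  ultimately show ?thesis by simp
qed

section \<open>The inviscid limit\<close>

lemma set_integrable_compact:
  fixes f :: "real^2 \<Rightarrow> real"
  shows "compact K \<Longrightarrow> continuous_on K f \<Longrightarrow> set_integrable lborel K f"
  unfolding set_integrable_def by (rule borel_integrable_compact)

text \<open>The integrand is quadratic in \<zeta> with uniformly convergent coefficients, so
  convergence of \<zeta> in the square mean suffices.\<close>

lemma set_integral_limit_L2:
  fixes \<zeta> X Y :: "nat \<Rightarrow> real^2 \<Rightarrow> real"
  assumes K: "compact K"
    and cont: "\<And>n. continuous_on K (\<zeta> n)" "continuous_on K \<omega>" 
      "\<And>n. continuous_on K (X n)" "continuous_on K X'" "\<And>n. continuous_on K (Y n)" "continuous_on K Y'"
    and X: "uniform_limit K X X' sequentially" and Y: "uniform_limit K Y Y' sequentially"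
    and L2: "(\<lambda>n. LINT x:K|lborel. (\<zeta> n x - \<omega> x)\<^sup>2) \<longlonglongrightarrow> 0"
    and zero: "\<forall>\<^sub>F n in sequentially. (LINT x:K|lborel. \<zeta> n x * (X n x * \<zeta> n x + Y n x)) = 0"
  shows "(LINT x:K|lborel. \<omega> x * (X' x * \<omega> x + Y' x)) = 0"
proof -
  let ?I = "\<lambda>f. LINT x:K|lborel. f x"
  have "bounded (\<omega> ` K)" "bounded (X' ` K)" "bounded (Y' ` K)"
    using cont K by (simp_all add: compact_imp_bounded compact_continuous_image)
  then obtain C1 C2 C3 where "\<And>x. x \<in> K \<Longrightarrow> \<bar>\<omega> x\<bar> \<le> C1" "\<And>x. x \<in> K \<Longrightarrow> \<bar>X' x\<bar> \<le> C2" "\<And>x. x \<in> K \<Longrightarrow> \<bar>Y' x\<bar> \<le> C3"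
    unfolding bounded_iff by (metis imageI real_norm_def)
  moreover define C where "C = max 1 (max C1 (max C2 C3))"
  ultimately have C: "C \<ge> 1" "\<And>x. x \<in> K \<Longrightarrow> \<bar>\<omega> x\<bar> \<le> C" "\<And>x. x \<in> K \<Longrightarrow> \<bar>X' x\<bar> \<le> C" "\<And>x. x \<in> K \<Longrightarrow> \<bar>Y' x\<bar> \<le> C"
    by (force simp: C_def)+
  define V where "V = measure lborel K"
  \<comment> \<open>\<open>A\<close> and \<open>A2\<close> collect the coefficients of \<eta> and of
    \<open>(d x)\<^sup>2 / \<eta>\<close> in the pointwise estimate of the difference of the
    integrands.\<close>
  define A where "A = 2 * C * C + 6 * C * C"
  define A2 where "A2 = 8 * C * C"
  let ?J = "\<lambda>x. \<omega> x * (X' x * \<omega> x + Y' x)"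
  have est: "\<bar>?I ?J\<bar> \<le> \<eta> * (A * V + A2)" if \<eta>: "0 < \<eta>" "\<eta> \<le> 1" for \<eta>
  proof -
    have "\<forall>\<^sub>F n in sequentially. ?I (\<lambda>x. (\<zeta> n x - \<omega> x)\<^sup>2) < \<eta>\<^sup>2"
      using order_tendstoD(2)[OF L2] \<eta> by simp
    moreover have "\<forall>\<^sub>F n in sequentially. \<forall>x\<in>K. dist (X n x) (X' x) < \<eta>" "\<forall>\<^sub>F n in sequentially. \<forall>x\<in>K. dist (Y n x) (Y' x) < \<eta>"
      using X Y \<eta> unfolding uniform_limit_iff by blast+
    ultimately have "\<forall>\<^sub>F n in sequentially. \<bar>?I ?J\<bar> \<le> \<eta> * (A * V + A2)"
      using zero
    proof eventually_elim
      case (elim n)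
      define d where "d x = \<zeta> n x - \<omega> x" for x
      have cd: "continuous_on K d" unfolding d_def by (intro continuous_intros cont)
      let ?Jn = "\<lambda>x. \<zeta> n x * (X n x * \<zeta> n x + Y n x)"
      have iJ: "set_integrable lborel K ?J" "set_integrable lborel K ?Jn" 
        by (intro set_integrable_compact K continuous_intros cont)+
      have id: "set_integrable lborel K (\<lambda>x. \<eta> * A + (A2 / \<eta>) * (d x)\<^sup>2)"
        by (intro set_integrable_compact K continuous_intros cd)
      have "?I ?J = ?I (\<lambda>x. ?J x - ?Jn x)" using iJ elim(4) by (simp add: set_integral_diff)
      also have "\<bar>\<dots>\<bar> \<le> ?I (\<lambda>x. \<eta> * A + (A2 / \<eta>) * (d x)\<^sup>2)"
      proof -
        have "\<bar>?J x - ?Jn x\<bar> \<le> \<eta> * A + (A2 / \<eta>) * (d x)\<^sup>2" if x: "x \<in> K" for x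
        proof -
          define a b where "a = X n x - X' x" and "b = Y n x - Y' x"
          have ab: "\<bar>a\<bar> \<le> \<eta>" "\<bar>b\<bar> \<le> \<eta>" using elim(2,3) x by (auto simp: a_def b_def dist_real_def)
          have z: "\<zeta> n x = \<omega> x + d x" by (simp add: d_def)
          \<comment> \<open>Expansion around the limit: two terms carry the coefficient errors
            \<open>a\<close> and \<open>b\<close>, the others at least one factor
            \<open>d x\<close>.\<close>
          have "?Jn x - ?J x = a * (\<omega> x * \<omega> x) + b * \<omega> x + (X' x + a) * (2 * \<omega> x * d x + (d x)\<^sup>2) + (Y' x + b) * d x"
            unfolding z a_def b_def by (simp add: algebra_simps power2_eq_square)
          moreover have "\<bar>a * (\<omega> x * \<omega> x)\<bar> \<le> \<eta> * (C * C)"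
            unfolding abs_mult using ab C x by (intro mult_mono) auto
          moreover have "\<bar>b * \<omega> x\<bar> \<le> \<eta> * (C * C)"
          proof -
            have "\<bar>b * \<omega> x\<bar> \<le> \<eta> * C" unfolding abs_mult using ab C x by (intro mult_mono) auto
            also have "\<dots> \<le> \<eta> * (C * C)" using \<eta> C(1) by simp
            finally show ?thesis .
          qed
          moreover have "\<bar>(X' x + a) * (2 * \<omega> x * d x + (d x)\<^sup>2)\<bar> \<le> (2 * C) * (2 * C * \<bar>d x\<bar> + (d x)\<^sup>2)"
          proof -
            have "\<bar>X' x + a\<bar> \<le> 2 * C" using C(3)[OF x] ab(1) \<eta>(2) C(1) by linarith
            moreover have "\<bar>2 * \<omega> x * d x + (d x)\<^sup>2\<bar> \<le> 2 * C * \<bar>d x\<bar> + (d x)\<^sup>2"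
              using mult_right_mono[OF C(2)[OF x], of "\<bar>d x\<bar>"] abs_mult[of "\<omega> x" "d x"]
              by (intro order_trans[OF abs_triangle_ineq] add_mono) auto
            ultimately show ?thesis unfolding abs_mult using C(1) by (intro mult_mono) auto
          qed
          moreover have "\<bar>(Y' x + b) * d x\<bar> \<le> (2 * C * C) * \<bar>d x\<bar>"
          proof -
            have "\<bar>Y' x + b\<bar> \<le> 2 * C" using C(4)[OF x] ab(2) \<eta>(2) C(1) by linarith
            also have "\<dots> \<le> 2 * C * C" using C(1) by simp
            finally show ?thesis unfolding abs_mult by (intro mult_right_mono) auto
          qed
          ultimately have 1: "\<bar>?Jn x - ?J x\<bar> \<le> 2 * \<eta> * (C * C) + 6 * (C * C) * \<bar>d x\<bar> + 2 * C * (d x)\<^sup>2"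
            by (simp add: algebra_simps)
          \<comment> \<open>This turns the linear error into a small constant plus a multiple of the
            squared error, the only quantity whose integral is controlled.\<close>
          have 2: "\<bar>d x\<bar> \<le> \<eta> + (d x)\<^sup>2 / \<eta>"
          proof (cases "\<bar>d x\<bar> \<le> \<eta>")
            case False
            then have "\<eta> * \<bar>d x\<bar> \<le> \<bar>d x\<bar> * \<bar>d x\<bar>" using \<eta> by (intro mult_right_mono) auto
            then have "\<bar>d x\<bar> \<le> (d x)\<^sup>2 / \<eta>" using \<eta> by (simp add: field_simps power2_eq_square abs_mult_self_eq)
            then show ?thesis using \<eta> by linarith
          qed (use \<eta> in \<open>simp add: add_increasing2\<close>)
          have 3: "6 * (C * C) * \<bar>d x\<bar> \<le> 6 * (C * C) * (\<eta> + (d x)\<^sup>2 / \<eta>)"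
            using 2 by (intro mult_left_mono) auto
          have "2 * C * (d x)\<^sup>2 \<le> 2 * C * C * ((d x)\<^sup>2 / \<eta>)"
          proof (rule mult_mono)
            show "(d x)\<^sup>2 \<le> (d x)\<^sup>2 / \<eta>" using \<eta> by (simp add: field_simps mult_left_le_one_le)
          qed (use C(1) in auto)
          moreover have "\<eta> * A + A2 * t = 2 * \<eta> * (C * C) + 6 * (C * C) * (\<eta> + t) + 2 * C * C * t" for t
            unfolding A_def A2_def by (simp add: algebra_simps)
          ultimately have "\<bar>?Jn x - ?J x\<bar> \<le> \<eta> * A + A2 * ((d x)\<^sup>2 / \<eta>)"
            using 1 3 by (simp only:)
          then show ?thesis by (simp add: abs_minus_commute)
        qed
        then show ?thesis
          using set_integral_norm_bound[of lborel K "\<lambda>x. ?J x - ?Jn x"] 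
            set_integral_mono[of lborel K "\<lambda>x. \<bar>?J x - ?Jn x\<bar>" "\<lambda>x. \<eta> * A + (A2 / \<eta>) * (d x)\<^sup>2"] iJ id
          by (force simp: set_integrable_abs)
      qed
      also have "\<dots> = \<eta> * A * V + (A2 / \<eta>) * ?I (\<lambda>x. (d x)\<^sup>2)"
      proof -
        have "set_integrable lborel K (\<lambda>x. \<eta> * A)" "set_integrable lborel K (\<lambda>x. (A2 / \<eta>) * (d x)\<^sup>2)"
          by (intro set_integrable_compact K continuous_intros cd)+
        moreover have "?I (\<lambda>x. \<eta> * A) = \<eta> * A * V"
          using K by (simp add: V_def set_lebesgue_integral_def)
        ultimately show ?thesis by (simp add: set_integral_add)
      qed
      also have "\<dots> \<le> \<eta> * A * V + (A2 / \<eta>) * \<eta>\<^sup>2"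
        using elim(1) \<eta> C(1) by (intro add_left_mono mult_left_mono) (auto simp: d_def A2_def)
      also have "\<dots> = \<eta> * (A * V + A2)" using \<eta> by (simp add: field_simps power2_eq_square)
      finally show ?case .
    qed
    then show ?thesis by (simp add: eventually_sequentially) (metis order_refl)
  qed
  show ?thesis
  proof (rule ccontr)
    assume ne: "?I ?J \<noteq> 0"
    define D where "D = A * V + A2"
    have D: "D > 0" using C(1) by (auto simp: D_def A_def A2_def V_def intro!: add_nonneg_pos)
    define \<eta> where "\<eta> = min 1 (\<bar>?I ?J\<bar> / (2 * D))"
    have "0 < \<eta>" "\<eta> \<le> 1" using ne D by (auto simp: \<eta>_def)
    from est[OF this] have "\<bar>?I ?J\<bar> \<le> \<eta> * D" by (simp add: D_def)
    also have "\<dots> \<le> (\<bar>?I ?J\<bar> / (2 * D)) * D" using D by (intro mult_right_mono) (auto simp: \<eta>_def)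
    also have "\<dots> = \<bar>?I ?J\<bar> / 2" using D by simp
    finally show False using ne by simp
  qed
qed

section \<open>Constancy of the vorticity\<close>

lemma C_on_perp_grad:
  assumes "open M" "C_on 2 M \<psi>" shows "C_on 1 M (perp_grad \<psi>)"
proof -
  have C: "C_on 1 M (partial i \<psi>)" for i using assms(2) by (simp add: C_on_2)
  have "C_on 1 M (\<lambda>x. partial 1 \<psi> x *\<^sub>R axis 2 1 - partial 2 \<psi> x *\<^sub>R axis 1 (1::real) :: real^2)"
    by (intro C_on_diff C_on_scaleR C_on_const C assms(1))
  moreover have "perp_grad \<psi> = (\<lambda>x. partial 1 \<psi> x *\<^sub>R axis 2 1 - partial 2 \<psi> x *\<^sub>R axis 1 1)"
    by (auto simp: vec_eq_iff forall_2 axis_def)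
  ultimately show ?thesis by simp
qed

lemma partial_perp_grad:
  assumes "open M" "C_on 2 M \<psi>" "x \<in> M"
  shows "partial i (perp_grad \<psi>) x $ 1 = - partial i (partial 2 \<psi>) x"
    "partial i (perp_grad \<psi>) x $ 2 = partial i (partial 1 \<psi>) x"
proof -
  have d: "perp_grad \<psi> differentiable (at x)" using C_on_perp_grad[OF assms(1,2)] assms(3) by (simp add: C_on_1)
  have d2: "partial j \<psi> differentiable (at x)" for j using assms(2,3) by (simp add: C_on_2 C_on_1)
  show "partial i (perp_grad \<psi>) x $ 1 = - partial i (partial 2 \<psi>) x"
    using partial_nth[OF d, of i 1] partial_minus[OF d2] by simp
  show "partial i (perp_grad \<psi>) x $ 2 = partial i (partial 1 \<psi>) x"
    using partial_nth[OF d, of i 2] by simp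
qed

lemma divergence_perp_grad:
  fixes \<psi> :: "real^2 \<Rightarrow> real"
  assumes "open M" "C_on 2 M \<psi>" "x \<in> M" shows "divergence (perp_grad \<psi>) x = 0"
  using partial_perp_grad[OF assms] partial_commute[OF assms, of 1 2] by (simp add: divergence_def sum_2)

lemma curl_perp_grad:
  assumes "open M" "C_on 2 M \<psi>" "x \<in> M" shows "curl (perp_grad \<psi>) x = laplacian \<psi> x"
  using partial_perp_grad[OF assms] by (simp add: curl_def laplacian_def sum_2)

section \<open>A continuously differentiable step function of the level\<close>

lemma has_real_derivative_pos_part_sq:
  "((\<lambda>x::real. (max 0 x)\<^sup>2) has_real_derivative 2 * max 0 x) (at x)"
proof (cases "x = 0")
  case True
  have "((\<lambda>y::real. (max 0 y)\<^sup>2 / y) \<longlongrightarrow> 0) (at 0)"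
  proof (rule Lim_null_comparison[of _ "\<lambda>y. \<bar>y\<bar>"])
    show "\<forall>\<^sub>F y in at 0. norm ((max 0 y)\<^sup>2 / y) \<le> \<bar>y\<bar>" for y :: real
      by (intro always_eventually allI) (auto simp: max_def power2_eq_square)
    show "((\<lambda>y::real. \<bar>y\<bar>) \<longlongrightarrow> 0) (at 0)" by (intro tendsto_eq_intros) auto
  qed
  then show ?thesis using True by (simp add: has_field_derivative_iff)
next
  case False
  show ?thesis
  proof (cases "x > 0")
    case True
    have "((\<lambda>x. x\<^sup>2) has_real_derivative 2 * max 0 x) (at x)"
      using True by (auto intro!: derivative_eq_intros)
    then show ?thesis
      by (rule has_field_derivative_transform_within_open[of _ _ _ "{0<..}"]) (use True in auto)
  next
    case neg: False
    have "((\<lambda>x. 0) has_real_derivative 2 * max 0 x) (at x)"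
      using neg by (auto intro!: derivative_eq_intros)
    then show ?thesis
      by (rule has_field_derivative_transform_within_open[of _ _ _ "{..<0}"]) (use False neg in auto)
  qed
qed

text \<open>Falls from 1 at \<open>b\<close> to 0 at \<open>b + \<epsilon>\<close>. Only one
  continuous derivative is asked of the cutoff, so squares of positive parts suffice; for positive
  \<epsilon> the two squares never vanish together.\<close>

definition step :: "real \<Rightarrow> real \<Rightarrow> real \<Rightarrow> real" where
  "step b \<epsilon> t = (max 0 (b + \<epsilon> - t))\<^sup>2 / ((max 0 (b + \<epsilon> - t))\<^sup>2 + (max 0 (t - b))\<^sup>2)"

text \<open>The quotient rule after cancellation, in a form that displays the sign.\<close>

definition step' :: "real \<Rightarrow> real \<Rightarrow> real \<Rightarrow> real" where
  "step' b \<epsilon> t = - 2 * (max 0 (b + \<epsilon> - t) * (max 0 (t - b))\<^sup>2 + (max 0 (b + \<epsilon> - t))\<^sup>2 * max 0 (t - b)) /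
     ((max 0 (b + \<epsilon> - t))\<^sup>2 + (max 0 (t - b))\<^sup>2)\<^sup>2"

lemma step_denom: "\<epsilon> > 0 \<Longrightarrow> (max 0 (b + \<epsilon> - t))\<^sup>2 + (max 0 (t - b))\<^sup>2 > (0::real)"
  by (cases "t < b + \<epsilon>") (auto intro: add_pos_nonneg add_nonneg_pos)

lemma step_derivative:
  assumes "\<epsilon> > 0" shows "(step b \<epsilon> has_real_derivative step' b \<epsilon> t) (at t)"
proof -
  have 1: "((\<lambda>t. (max 0 (b + \<epsilon> - t))\<^sup>2) has_real_derivative - (2 * max 0 (b + \<epsilon> - t))) (at t)"
  proof -
    have "((\<lambda>t. b + \<epsilon> - t) has_real_derivative -1) (at t)" by (auto intro!: derivative_eq_intros)
    from DERIV_chain2[OF has_real_derivative_pos_part_sq this] show ?thesis by simp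
  qed
  have 2: "((\<lambda>t. (max 0 (t - b))\<^sup>2) has_real_derivative 2 * max 0 (t - b)) (at t)"
  proof -
    have "((\<lambda>t. t - b) has_real_derivative 1) (at t)" by (auto intro!: derivative_eq_intros)
    from DERIV_chain2[OF has_real_derivative_pos_part_sq this] show ?thesis by simp
  qed
  show ?thesis
    unfolding step_def[abs_def] step'_def
    by (rule derivative_eq_intros 1 2 refl)+ (use step_denom[OF assms, of b t] in \<open>auto simp: power2_eq_square algebra_simps\<close>)
qed

lemma step_continuous: "\<epsilon> > 0 \<Longrightarrow> continuous_on UNIV (step b \<epsilon>)" "\<epsilon> > 0 \<Longrightarrow> continuous_on UNIV (step' b \<epsilon>)"
  unfolding step_def[abs_def] step'_def[abs_def] using step_denom
  by (intro continuous_intros; force)+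

lemma step_props:
  assumes "\<epsilon> > 0"
  shows "t \<le> b \<Longrightarrow> step b \<epsilon> t = 1" "t \<ge> b + \<epsilon> \<Longrightarrow> step b \<epsilon> t = 0" "0 \<le> step b \<epsilon> t" "step b \<epsilon> t \<le> 1"
    "step' b \<epsilon> t \<le> 0" "t \<le> b \<or> t \<ge> b + \<epsilon> \<Longrightarrow> step' b \<epsilon> t = 0" "b < t \<Longrightarrow> t < b + \<epsilon> \<Longrightarrow> step' b \<epsilon> t < 0"
proof -
  note d = step_denom[OF assms, of b t]
  show "t \<le> b \<Longrightarrow> step b \<epsilon> t = 1" "t \<ge> b + \<epsilon> \<Longrightarrow> step b \<epsilon> t = 0"
    using assms by (auto simp: step_def max_def)
  show "0 \<le> step b \<epsilon> t" by (simp add: step_def)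
  show "step b \<epsilon> t \<le> 1" unfolding step_def using d by (subst divide_le_eq_1) auto
  show "step' b \<epsilon> t \<le> 0" unfolding step'_def by (intro divide_nonpos_nonneg mult_nonpos_nonneg) auto
  show "t \<le> b \<or> t \<ge> b + \<epsilon> \<Longrightarrow> step' b \<epsilon> t = 0" by (auto simp: step'_def max_def)
  show "step' b \<epsilon> t < 0" if "b < t" "t < b + \<epsilon>"
  proof -
    have "max 0 (b + \<epsilon> - t) * (max 0 (t - b))\<^sup>2 + (max 0 (b + \<epsilon> - t))\<^sup>2 * max 0 (t - b) > 0"
      using that by (intro add_pos_pos mult_pos_pos zero_less_power) auto
    then have "- 2 * (max 0 (b + \<epsilon> - t) * (max 0 (t - b))\<^sup>2 + (max 0 (b + \<epsilon> - t))\<^sup>2 * max 0 (t - b)) < 0"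
      by (intro mult_neg_pos) simp_all
    then show ?thesis unfolding step'_def by (rule divide_neg_pos) (use zero_less_power[OF d, of 2] in blast)
  qed
qed

text \<open>The integral yields zero almost everywhere only; on an open set continuity does the
  rest, since nonempty open sets are not negligible.\<close>

lemma integral_zero_imp_zero_on_open:
  fixes f :: "real^2 \<Rightarrow> real"
  assumes K: "compact K" "continuous_on K f" and nn: "\<And>x. x \<in> K \<Longrightarrow> f x \<ge> 0"
    and 0: "(LINT x:K|lborel. f x) = 0" and S: "open S" "S \<subseteq> K" "x \<in> S"
  shows "f x = 0"
proof (rule ccontr)
  assume ne: "f x \<noteq> 0"
  have int: "integrable lborel (\<lambda>x. indicator K x *\<^sub>R f x)" by (rule borel_integrable_compact[OF K])
  have "AE x in lborel. indicator K x *\<^sub>R f x = 0"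
    using integral_nonneg_eq_0_iff_AE[OF int] 0 nn by (auto simp: set_lebesgue_integral_def indicator_def)
  moreover have "{x \<in> space lborel. indicator K x *\<^sub>R f x \<noteq> 0} \<in> sets lborel"
    by (rule borel_measurable_neq[OF borel_measurable_integrable[OF int] borel_measurable_const])
  ultimately have N: "{x \<in> space lborel. indicator K x *\<^sub>R f x \<noteq> 0} \<in> null_sets lborel"
    using AE_iff_null[of lborel "\<lambda>x. indicator K x *\<^sub>R f x = 0"] by blast
  have "continuous_on S f" using K(2) S(2) by (rule continuous_on_subset)
  then have op: "open (S \<inter> f -` (- {0}))"
    using S(1) by (intro continuous_open_preimage) auto
  have "S \<inter> f -` (- {0}) \<subseteq> {x \<in> space lborel. indicator K x *\<^sub>R f x \<noteq> 0}"
    using S(2) by (auto simp: indicator_def)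
  then have "S \<inter> f -` (- {0}) \<in> null_sets lborel"
    using N op by (intro null_sets_subset[OF N]) auto
  then have "negligible (S \<inter> f -` (- {0}))"
    using null_sets_completionI negligible_iff_null_sets by blast
  then have "S \<inter> f -` (- {0}) = {}" using op open_not_negligible by blast
  then show False using ne S(3) by blast
qed

context single_minimum
begin

text \<open>\<Psi> is controlled only where \<psi> is at most \<open>b'\<close>, so
  \<open>g (\<Psi> x)\<close> may revive near the boundary of \<open>M\<close> and is replaced by 0
  from the level \<open>b'\<close> on. Between the levels \<open>(b + b') / 2\<close> and
  \<open>b'\<close> the closeness to \<psi> forces \<Psi> above \<open>b\<close>, where
  \<open>g\<close> vanishes, so the two pieces overlap in 0 and glue.\<close>

lemma cutoff:
  assumes C1: "C_on 1 M \<psi>" and b: "b < b'" "b' < c"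
    and g: "\<And>t. (g has_real_derivative g' t) (at t)" "continuous_on UNIV g'" "\<forall>t\<ge>b. g t = 0"
    and \<Psi>: "C_on 1 M \<Psi>" "\<forall>x\<in>M. \<psi> x \<le> b' \<longrightarrow> \<bar>\<Psi> x - \<psi> x\<bar> < (b' - b) / 2"
  defines "h \<equiv> \<lambda>x. if x \<in> M \<and> \<psi> x < b' then g (\<Psi> x) else 0"
  shows "C_on 1 M h" "x \<notin> {x \<in> M. \<psi> x \<le> (b + b') / 2} \<Longrightarrow> h x = 0"
    "x \<in> M \<Longrightarrow> \<psi> x \<le> b' \<Longrightarrow> h x = g (\<Psi> x)"
    "x \<in> M \<Longrightarrow> \<psi> x \<le> b' \<Longrightarrow> partial i h x = g' (\<Psi> x) * partial i \<Psi> x"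
proof -
  define K where "K = {x \<in> M. \<psi> x \<le> (b + b') / 2}"
  have cK: "compact K" unfolding K_def by (rule compact_sublevel) (use b in simp)
  have g'0: "g' t = 0" if "t > b" for t
  proof -
    have "((\<lambda>t. 0) has_real_derivative g' t) (at t)"
      by (rule has_field_derivative_transform_within_open[OF g(1), of "{b<..}"]) (use that g(3) in auto)
    then show ?thesis using DERIV_unique[OF _ DERIV_const] by blast
  qed
  have far: "\<Psi> x > b" if "x \<in> M" "\<psi> x \<le> b'" "\<psi> x > (b + b') / 2" for x
  proof -
    have "- (\<Psi> x - \<psi> x) < (b' - b) / 2" using \<Psi>(2) that(1,2) unfolding abs_less_iff by blast
    then show ?thesis using that(3) by (simp add: field_simps)
  qed
  have h0: "h x = 0" if "x \<notin> K" for x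
    using far[of x] that g(3) by (auto simp: h_def K_def)
  then show "x \<notin> {x \<in> M. \<psi> x \<le> (b + b') / 2} \<Longrightarrow> h x = 0" by (simp add: K_def)
  let ?A = "{x \<in> M. \<psi> x < b'}"
  have oA: "open ?A" by (rule open_sublevel) (use b in simp)
  have AM: "?A \<subseteq> M" by blast
  have gA: "C_on 1 ?A (\<lambda>x. g (\<Psi> x))"
    by (rule C_on_compose_1[OF C_on_subset[OF \<Psi>(1) AM] g(1,2)])
  have "C_on 1 ?A h"
    by (rule C_on_cong[OF oA gA]) (simp add: h_def)
  moreover have oB: "open (M - K)" using M(1) cK by (simp add: open_Diff compact_imp_closed)
  moreover have "C_on 1 (M - K) h"
    by (rule C_on_cong[OF oB C_on_const]) (use h0 in auto)
  moreover have "?A \<union> (M - K) = M" using b by (auto simp: K_def)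
  ultimately show "C_on 1 M h" using C_on_Un[OF oA oB, of 1 h] by simp
  \<comment> \<open>On the level \<open>b'\<close> itself \<open>h\<close> is 0 by definition, while
    \<open>g (\<Psi> x)\<close> is 0 because \<Psi> exceeds \<open>b\<close> there.\<close>
  show hx: "h x = g (\<Psi> x)" if "x \<in> M" "\<psi> x \<le> b'" for x
  proof (cases "\<psi> x < b'")
    case False
    then have "\<Psi> x > b" using far[OF that] b that by simp
    then show ?thesis using False g(3) by (simp add: h_def)
  qed (use that in \<open>simp add: h_def\<close>)
  show "partial i h x = g' (\<Psi> x) * partial i \<Psi> x" if x: "x \<in> M" "\<psi> x \<le> b'" for x i
  proof (cases "\<psi> x < b'")
    case True
    then have xA: "x \<in> ?A" using x by blast
    have "partial i h x = partial i (\<lambda>x. g (\<Psi> x)) x"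
      by (rule partial_cong_open[OF oA xA]) (simp add: h_def)
    also have "\<dots> = g' (\<Psi> x) * partial i \<Psi> x"
      by (rule partial_compose[OF _ g(1)]) (use \<Psi>(1) x in \<open>simp add: C_on_1\<close>)
    finally show ?thesis .
  next
    case False
    then have "\<Psi> x > b" using far[OF x] b x by simp
    moreover have "x \<notin> K" using False b by (simp add: K_def)
    ultimately show ?thesis using partial_outside_support[OF cK h0] g'0 by simp
  qed
qed

text \<open>The integral of the divergence of \<open>h\<close> times \<open>grad \<psi>\<close>
  vanishes for a compactly supported \<open>h\<close>; here \<open>cutoff\<close> is used with
  \<Psi> = \<psi>.\<close>

lemma flux_identity:
  assumes C2: "C_on 2 M \<psi>" and b: "b < b'" "b' < c"
    and g: "\<And>t. (g has_real_derivative g' t) (at t)" "continuous_on UNIV g'" "\<forall>t\<ge>b. g t = 0"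
  shows "(LINT x:{x \<in> M. \<psi> x \<le> b'}|lborel. g (\<psi> x) * laplacian \<psi> x + g' (\<psi> x) * (norm (perp_grad \<psi> x))\<^sup>2) = 0"
proof -
  have C1: "C_on 1 M \<psi>" by (rule C_on_le[OF C2]) simp
  have Cp: "C_on 1 M (partial i \<psi>)" for i using C2 by (simp add: C_on_2)
  define h where "h = (\<lambda>x. if x \<in> M \<and> \<psi> x < b' then g (\<psi> x) else 0)"
  define K where "K = {x \<in> M. \<psi> x \<le> (b + b') / 2}"
  have cK: "compact K" unfolding K_def by (rule compact_sublevel) (use b in simp)
  have KM: "K \<subseteq> M" by (auto simp: K_def)
  have near: "\<forall>x\<in>M. \<psi> x \<le> b' \<longrightarrow> \<bar>\<psi> x - \<psi> x\<bar> < (b' - b) / 2" using b by simp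
  note cut = cutoff[OF C1 b g C1 near, folded K_def]
  have h1: "C_on 1 M h" unfolding h_def by (rule cut(1))
  have h2: "h x = 0" if "x \<notin> K" for x unfolding h_def by (rule cut(2)[OF that])
  have h3: "h x = g (\<psi> x)" if "x \<in> M" "\<psi> x \<le> b'" for x unfolding h_def by (rule cut(3)[OF that])
  have h4: "partial i h x = g' (\<psi> x) * partial i \<psi> x" if "x \<in> M" "\<psi> x \<le> b'" for x i
    unfolding h_def by (rule cut(4)[OF that])
  note h = h1 h2 h3 h4
  have ibp: "integrable lborel (\<lambda>x. h x * partial i (partial j \<psi>) x)" "integrable lborel (\<lambda>x. partial i h x * partial j \<psi> x)"
    "(\<integral>x. h x * partial i (partial j \<psi>) x \<partial>lborel) = - (\<integral>x. partial i h x * partial j \<psi> x \<partial>lborel)" for i j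
    using integration_by_parts[OF M(1) cK KM h(1,2) Cp] by blast+
  have "0 = (\<integral>x. (h x * partial 1 (partial 1 \<psi>) x + h x * partial 2 (partial 2 \<psi>) x)
     + (partial 1 h x * partial 1 \<psi> x + partial 2 h x * partial 2 \<psi> x) \<partial>lborel)"
    using ibp by simp
  also have "\<dots> = (LINT x:{x \<in> M. \<psi> x \<le> b'}|lborel. g (\<psi> x) * laplacian \<psi> x + g' (\<psi> x) * (norm (perp_grad \<psi> x))\<^sup>2)"
    unfolding set_lebesgue_integral_def
  proof (rule Bochner_Integration.integral_cong[OF refl])
    fix x
    show "(h x * partial 1 (partial 1 \<psi>) x + h x * partial 2 (partial 2 \<psi>) x)
     + (partial 1 h x * partial 1 \<psi> x + partial 2 h x * partial 2 \<psi> x) =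
     indicator {x \<in> M. \<psi> x \<le> b'} x *\<^sub>R (g (\<psi> x) * laplacian \<psi> x + g' (\<psi> x) * (norm (perp_grad \<psi> x))\<^sup>2)"
    proof (cases "x \<in> M \<and> \<psi> x \<le> b'")
      case True
      have nsq: "(norm (perp_grad \<psi> x))\<^sup>2 = partial 1 \<psi> x * partial 1 \<psi> x + partial 2 \<psi> x * partial 2 \<psi> x"
        by (simp add: power2_norm_eq_inner inner_2)
      from True show ?thesis
        by (simp add: h(3,4) nsq laplacian_def sum_2 algebra_simps)
    next
      case False
      then have "x \<notin> K" using b by (auto simp: K_def)
      then show ?thesis using False h(2) partial_outside_support[OF cK h(2)] by simp
    qed
  qed
  finally show ?thesis by simp
qed

end

section \<open>Passing to the limit in the vorticity identity\<close>

text \<open>The \<kappa> are merely nonzero: when \<psi> exceeds its boundary value, all flows are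
  reversed, and this makes the viscosities negative.\<close>

locale inviscid_limit = single_minimum +
  fixes v :: "nat \<Rightarrow> real^2 \<Rightarrow> real^2" and \<kappa> :: "nat \<Rightarrow> real" and q :: "nat \<Rightarrow> real^2 \<Rightarrow> real"
  assumes C2: "C_on 2 M \<psi>" and sc: "simply_connected M"
    and ns: "\<And>n. stationary_navier_stokes M (\<kappa> n) (v n) (q n)" "\<And>n. \<kappa> n \<noteq> 0"
    and unif: "\<And>K. compact K \<Longrightarrow> K \<subseteq> M \<Longrightarrow> uniform_limit K v (perp_grad \<psi>) sequentially"
    and L2: "\<And>K. compact K \<Longrightarrow> K \<subseteq> M \<Longrightarrow>
      (\<lambda>n. LINT x:K|lborel. (curl (v n) x - laplacian \<psi> x)\<^sup>2) \<longlonglongrightarrow> 0"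
begin

abbreviation \<omega> :: "real^2 \<Rightarrow> real" where "\<omega> \<equiv> laplacian \<psi>"

lemma C1: "C_on 1 M \<psi>" by (rule C_on_le[OF C2]) simp

lemma continuous_\<omega>: "continuous_on M \<omega>"
  unfolding laplacian_def[abs_def] sum_2 using C2 by (intro continuous_intros) (auto simp: C_on_2 C_on_1)

lemma continuous_perp_grad: "continuous_on M (perp_grad \<psi>)"
  by (rule C_on_continuous_on[OF C_on_perp_grad[OF M(1) C2]])

lemma continuous_\<psi>: "continuous_on M \<psi>" by (rule C_on_continuous_on[OF C1])

text \<open>The cut-off \<open>g (\<Psi> n x)\<close> is constant along the streamlines of
  \<open>v n\<close>, so the viscous identity holds for it; uniform convergence of \<Psi> and
  \<open>v\<close> together with square-mean convergence of the curls carries it to the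
  limit.\<close>

lemma limit_identity:
  assumes b: "b < b'" "b' < c"
    and g: "\<And>t. (g has_real_derivative g' t) (at t)" "continuous_on UNIV g'" "\<forall>t\<ge>b. g t = 0"
  shows "(LINT x:{x \<in> M. \<psi> x \<le> b'}|lborel. \<omega> x * (g (\<psi> x) * \<omega> x + g' (\<psi> x) * (norm (perp_grad \<psi> x))\<^sup>2)) = 0"
proof -
  define K where "K = {x \<in> M. \<psi> x \<le> b'}"
  have cK: "compact K" unfolding K_def by (rule compact_sublevel[OF b(2)])
  have KM: "K \<subseteq> M" by (auto simp: K_def)
  define K0 where "K0 = {x \<in> M. \<psi> x \<le> (b + b') / 2}"
  have cK0: "compact K0" unfolding K0_def by (rule compact_sublevel) (use b in simp)
  have K0M: "K0 \<subseteq> M" by (auto simp: K0_def)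
  have v2: "C_on 2 M (v n)" for n
    using ns(1)[of n] unfolding stationary_navier_stokes_def by blast
  have divv: "divergence (v n) x = 0" if "x \<in> M" for n x
    using ns(1)[of n] that unfolding stationary_navier_stokes_def by blast
  have v1: "C_on 1 M (v n)" for n by (rule C_on_le[OF v2]) simp
  have u1: "C_on 1 M (perp_grad \<psi>)" by (rule C_on_perp_grad[OF M(1) C2])
  obtain K' C where K': "compact K'" "K' \<subseteq> M"
    and sf: "\<And>w. C_on 1 M w \<Longrightarrow> (\<And>x. x \<in> M \<Longrightarrow> divergence w x = 0) \<Longrightarrow>
      \<exists>\<phi>. (\<forall>x\<in>M. \<phi> differentiable (at x) \<and> perp_grad \<phi> x = w x) \<and>
          (\<forall>e. (\<forall>y\<in>K'. norm (w y) \<le> e) \<longrightarrow> (\<forall>x\<in>K. \<bar>\<phi> x\<bar> \<le> C * e))"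
    by (rule streamfunction_exists[OF M(1) sc M(2) cK KM]) blast
  have "\<exists>\<phi>. (\<forall>x\<in>M. \<phi> differentiable (at x) \<and> perp_grad \<phi> x = v n x - perp_grad \<psi> x) \<and>
          (\<forall>e. (\<forall>y\<in>K'. norm (v n y - perp_grad \<psi> y) \<le> e) \<longrightarrow> (\<forall>x\<in>K. \<bar>\<phi> x\<bar> \<le> C * e))" for n
  proof (rule sf)
    show "C_on 1 M (\<lambda>x. v n x - perp_grad \<psi> x)" by (rule C_on_diff[OF M(1) v1 u1])
    show "divergence (\<lambda>x. v n x - perp_grad \<psi> x) x = 0" if "x \<in> M" for x
    proof -
      have "v n differentiable (at x)" "perp_grad \<psi> differentiable (at x)"
        using v1 u1 that unfolding C_on_1 by blast+
      moreover have "divergence (v n) x = 0" by (rule divv[OF that])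
      ultimately show ?thesis
        using divergence_perp_grad[OF M(1) C2 that] by (simp add: divergence_def sum_2 partial_diff)
    qed
  qed
  then obtain \<phi> where \<phi>: "\<And>n x. x \<in> M \<Longrightarrow> \<phi> n differentiable (at x)"
    "\<And>n x. x \<in> M \<Longrightarrow> perp_grad (\<phi> n) x = v n x - perp_grad \<psi> x"
    "\<And>n e x. \<forall>y\<in>K'. norm (v n y - perp_grad \<psi> y) \<le> e \<Longrightarrow> x \<in> K \<Longrightarrow> \<bar>\<phi> n x\<bar> \<le> C * e"
    by metis
  \<comment> \<open>Adding the correction to \<psi>, rather than taking an unrelated streamfunction
    of \<open>v n\<close>, selects the additive constant for which \<Psi> converges to
    \<psi>.\<close>
  define \<Psi> where "\<Psi> n x = \<psi> x + \<phi> n x" for n x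
  have \<Psi>d: "\<Psi> n differentiable (at x)" if "x \<in> M" for n x
    unfolding \<Psi>_def using \<phi>(1)[OF that] diff[OF that] by (simp add: differentiable_add)
  have \<Psi>p: "partial i (\<Psi> n) x = partial i \<psi> x + partial i (\<phi> n) x" if "x \<in> M" for n x i
    unfolding \<Psi>_def using \<phi>(1)[OF that] diff[OF that] by (simp add: partial_add)
  have \<Psi>v: "partial 1 (\<Psi> n) x = v n x $ 2" "partial 2 (\<Psi> n) x = - v n x $ 1" if "x \<in> M" for n x
    using \<phi>(2)[OF that, of n] \<Psi>p[OF that] by (simp_all add: vec_eq_iff forall_2)
  have \<Psi>1: "C_on 1 M (\<Psi> n)" for n
    unfolding C_on_1
  proof (intro conjI ballI allI)
    fix i :: 2
    have cv: "continuous_on M (\<lambda>x. v n x $ j)" for j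
      by (rule C_on_continuous_on[OF C_on_nth[OF M(1) v1]])
    show "continuous_on M (partial i (\<Psi> n))"
    proof (cases "i = 1")
      case True
      show ?thesis unfolding True by (rule continuous_on_eq[OF cv[of 2]]) (simp add: \<Psi>v)
    next
      case False
      then have i: "i = 2" using exhaust_2[of i] by blast
      show ?thesis unfolding i by (rule continuous_on_eq[OF continuous_on_minus[OF cv[of 1]]]) (simp add: \<Psi>v)
    qed
  qed (rule \<Psi>d)
  have ul\<Psi>: "uniform_limit K \<Psi> \<psi> sequentially"
  proof (rule uniform_limitI)
    fix \<epsilon> :: real assume e: "\<epsilon> > 0"
    \<comment> \<open>The absolute value and the 1 are there because \<open>C\<close> comes without
      a sign.\<close>
    define e' where "e' = \<epsilon> / (\<bar>C\<bar> + 1)"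
    have e': "e' > 0" using e by (simp add: e'_def add_nonneg_pos)
    have "\<forall>\<^sub>F n in sequentially. \<forall>y\<in>K'. dist (v n y) (perp_grad \<psi> y) < e'"
      using unif[OF K'] e' unfolding uniform_limit_iff by blast
    then show "\<forall>\<^sub>F n in sequentially. \<forall>x\<in>K. dist (\<Psi> n x) (\<psi> x) < \<epsilon>"
    proof eventually_elim
      case (elim n)
      show ?case
      proof
        fix x assume "x \<in> K"
        then have "\<bar>\<phi> n x\<bar> \<le> C * e'" using elim by (intro \<phi>(3)) (auto simp: dist_norm less_imp_le)
        also have "\<dots> \<le> \<bar>C\<bar> * e'" using e' by (intro mult_right_mono) auto
        also have "\<dots> < (\<bar>C\<bar> + 1) * e'" using e' by (intro mult_strict_right_mono) auto
        also have "\<dots> = \<epsilon>" by (simp add: e'_def)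
        finally show "dist (\<Psi> n x) (\<psi> x) < \<epsilon>" by (simp add: \<Psi>_def dist_real_def)
      qed
    qed
  qed
  have c\<psi>: "continuous_on K \<psi>" by (rule continuous_on_subset[OF continuous_\<psi> KM])
  have c\<Psi>: "continuous_on K (\<Psi> n)" for n by (rule continuous_on_subset[OF C_on_continuous_on[OF \<Psi>1] KM])
  have cu: "continuous_on K (perp_grad \<psi>)" by (rule continuous_on_subset[OF continuous_perp_grad KM])
  have cv: "continuous_on K (v n)" for n by (rule continuous_on_subset[OF C_on_continuous_on[OF v1] KM])
  have c\<zeta>: "continuous_on K (curl (v n))" for n
    unfolding curl_def[abs_def] using v1[of n]
    by (intro continuous_on_diff continuous_on_component continuous_on_subset[OF _ KM]) (auto simp: C_on_1)
  have c\<omega>: "continuous_on K \<omega>" by (rule continuous_on_subset[OF continuous_\<omega> KM])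
  obtain R where R: "\<And>x. x \<in> K \<Longrightarrow> \<bar>\<psi> x\<bar> \<le> R"
    using compact_imp_bounded[OF compact_continuous_image[OF c\<psi> cK]] unfolding bounded_iff by force
  \<comment> \<open>The functions \<open>g\<close> and \<open>g'\<close> are uniformly continuous
    only on bounded sets, so all values of \<Psi> must eventually lie in a common one.\<close>
  have ev: "\<forall>\<^sub>F n in sequentially. \<forall>x\<in>K. \<Psi> n x \<in> cball 0 (R + 1)"
  proof -
    have "\<forall>\<^sub>F n in sequentially. \<forall>x\<in>K. dist (\<Psi> n x) (\<psi> x) < 1"
      using ul\<Psi> unfolding uniform_limit_iff by simp
    then show ?thesis
    proof eventually_elim
      case (elim n)
      show ?case
      proof
        fix x assume "x \<in> K"
        then have "\<bar>\<Psi> n x - \<psi> x\<bar> < 1" "\<bar>\<psi> x\<bar> \<le> R" using elim R by (auto simp: dist_real_def)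
        then show "\<Psi> n x \<in> cball 0 (R + 1)" by simp
      qed
    qed
  qed
  have comp: "uniform_limit K (\<lambda>n x. f (\<Psi> n x)) (\<lambda>x. f (\<psi> x)) sequentially" if "continuous_on UNIV f" for f :: "real \<Rightarrow> real"
    by (rule uniform_limit_compose_uniformly_continuous_on[OF ul\<Psi>
          compact_uniformly_continuous[OF continuous_on_subset[OF that subset_UNIV] compact_cball] ev closed_cball])
  have cg: "continuous_on UNIV g" using g(1) by (intro continuous_at_imp_continuous_on) (auto intro: DERIV_isCont)
  have bdu: "bounded (perp_grad \<psi> ` K)" using compact_imp_bounded[OF compact_continuous_image[OF cu cK]] .
  have ulv: "uniform_limit K (\<lambda>n x. v n x \<bullet> v n x) (\<lambda>x. perp_grad \<psi> x \<bullet> perp_grad \<psi> x) sequentially"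
    by (rule bounded_bilinear.bounded_uniform_limit[OF bounded_bilinear_inner unif[OF cK KM] unif[OF cK KM] bdu bdu])
  have cg'\<psi>: "continuous_on K (\<lambda>x. g' (\<psi> x))" by (rule continuous_on_compose2[OF g(2) c\<psi>]) simp
  have ulY: "uniform_limit K (\<lambda>n x. g' (\<Psi> n x) * (v n x \<bullet> v n x)) (\<lambda>x. g' (\<psi> x) * (perp_grad \<psi> x \<bullet> perp_grad \<psi> x)) sequentially"
    by (rule uniform_lim_mult[OF comp[OF g(2)] ulv])
      (intro compact_imp_bounded compact_continuous_image cK cg'\<psi> continuous_intros cu)+
  have "(LINT x:K|lborel. \<omega> x * (g (\<psi> x) * \<omega> x + g' (\<psi> x) * (perp_grad \<psi> x \<bullet> perp_grad \<psi> x))) = 0"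
  proof (rule set_integral_limit_L2[OF cK c\<zeta> c\<omega> _ _ _ _ comp[OF cg] ulY L2[OF cK KM]])
    show "continuous_on K (\<lambda>x. g (\<Psi> n x))" for n by (rule continuous_on_compose2[OF cg c\<Psi>]) simp
    show "continuous_on K (\<lambda>x. g (\<psi> x))" by (rule continuous_on_compose2[OF cg c\<psi>]) simp
    show "continuous_on K (\<lambda>x. g' (\<Psi> n x) * (v n x \<bullet> v n x))" for n
      by (intro continuous_intros cv continuous_on_compose2[OF g(2) c\<Psi>]) simp
    show "continuous_on K (\<lambda>x. g' (\<psi> x) * (perp_grad \<psi> x \<bullet> perp_grad \<psi> x))"
      by (intro continuous_intros cu cg'\<psi>)
    have "\<forall>\<^sub>F n in sequentially. \<forall>x\<in>K. dist (\<Psi> n x) (\<psi> x) < (b' - b) / 2"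
      using ul\<Psi>[unfolded uniform_limit_iff, rule_format, of "(b' - b) / 2"] b(1) by simp
    then show "\<forall>\<^sub>F n in sequentially. (LINT x:K|lborel. curl (v n) x * (g (\<Psi> n x) * curl (v n) x + g' (\<Psi> n x) * (v n x \<bullet> v n x))) = 0"
    proof eventually_elim
      case (elim n)
      have near: "\<forall>x\<in>M. \<psi> x \<le> b' \<longrightarrow> \<bar>\<Psi> n x - \<psi> x\<bar> < (b' - b) / 2"
        using elim by (simp add: K_def dist_real_def)
      define h where "h = (\<lambda>x. if x \<in> M \<and> \<psi> x < b' then g (\<Psi> n x) else 0)"
      note cut = cutoff[OF C1 b g \<Psi>1[of n] near, folded K0_def]
      have h1: "C_on 1 M h" unfolding h_def by (rule cut(1))
      have h2: "h x = 0" if "x \<notin> K0" for x unfolding h_def by (rule cut(2)[OF that])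
      have h3: "h x = g (\<Psi> n x)" if "x \<in> M" "\<psi> x \<le> b'" for x unfolding h_def by (rule cut(3)[OF that])
      have h4: "partial i h x = g' (\<Psi> n x) * partial i (\<Psi> n) x" if "x \<in> M" "\<psi> x \<le> b'" for x i
        unfolding h_def by (rule cut(4)[OF that])
      note h = h1 h2 h3 h4
      have p0: "partial i h x = 0" if "x \<notin> K0" for i x
        by (rule partial_outside_support[OF cK0 h(2) that])
      have "(\<integral>x. curl (v n) x * (h x * curl (v n) x + v n x $ 2 * partial 1 h x - v n x $ 1 * partial 2 h x) \<partial>lborel) = 0"
      proof (rule navier_stokes_vorticity_identity[OF M(1) cK0 K0M h(1,2) ns])
        fix x assume x: "x \<in> M"
        \<comment> \<open>By the chain rule \<open>grad h\<close> is parallel to the gradient of the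
          streamfunction of \<open>v n\<close>, hence orthogonal to \<open>v n\<close>.\<close>
        show "v n x $ 1 * partial 1 h x + v n x $ 2 * partial 2 h x = 0"
        proof (cases "\<psi> x \<le> b'")
          case True
          then show ?thesis using h(4)[OF x True] \<Psi>v[OF x] by simp
        next
          case False
          then have "x \<notin> K0" using b by (simp add: K0_def)
          then show ?thesis using p0 by simp
        qed
      qed
      also have "(\<lambda>x. curl (v n) x * (h x * curl (v n) x + v n x $ 2 * partial 1 h x - v n x $ 1 * partial 2 h x)) =
        (\<lambda>x. indicator K x *\<^sub>R (curl (v n) x * (g (\<Psi> n x) * curl (v n) x + g' (\<Psi> n x) * (v n x \<bullet> v n x))))"
      proof
        fix x
        show "curl (v n) x * (h x * curl (v n) x + v n x $ 2 * partial 1 h x - v n x $ 1 * partial 2 h x) =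
          indicator K x *\<^sub>R (curl (v n) x * (g (\<Psi> n x) * curl (v n) x + g' (\<Psi> n x) * (v n x \<bullet> v n x)))"
        proof (cases "x \<in> K")
          case True
          then have x: "x \<in> M" "\<psi> x \<le> b'" by (auto simp: K_def)
          show ?thesis using True h(3,4)[OF x] \<Psi>v[OF x(1)] by (simp add: inner_2 algebra_simps)
        next
          case False
          then have "x \<notin> K0" using b by (auto simp: K_def K0_def)
          then show ?thesis using False p0 h(2) by simp
        qed
      qed
      finally show ?case by (simp add: set_lebesgue_integral_def)
    qed
  qed
  then show ?thesis by (simp add: K_def power2_norm_eq_inner)
qed


text \<open>The step equals 1 on the level \<open>b\<close> itself, so the limit set is the closed
  sublevel set; the integrands are dominated by the absolute value of \<open>f\<close>.\<close>

lemma step_limit: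
  assumes b: "b < b'" "b' < c" and f: "continuous_on {x \<in> M. \<psi> x \<le> b'} f"
    and \<epsilon>: "\<And>n. \<epsilon> n > 0" "\<epsilon> \<longlonglongrightarrow> 0"
  shows "(\<lambda>n. LINT x:{x \<in> M. \<psi> x \<le> b'}|lborel. f x * step b (\<epsilon> n) (\<psi> x))
    \<longlonglongrightarrow> (LINT x:{x \<in> M. \<psi> x \<le> b}|lborel. f x)"
proof -
  define K where "K = {x \<in> M. \<psi> x \<le> b'}"
  define Kb where "Kb = {x \<in> M. \<psi> x \<le> b}"
  have cK: "compact K" "compact Kb" unfolding K_def Kb_def by (intro compact_sublevel; use b in simp)+
  have KbK: "Kb \<subseteq> K" using b by (auto simp: K_def Kb_def)
  have KM: "K \<subseteq> M" by (auto simp: K_def)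
  have fK: "continuous_on K f" using f by (simp add: K_def)
  have c\<psi>: "continuous_on K \<psi>" by (rule continuous_on_subset[OF continuous_\<psi> KM])
  have cs: "continuous_on K (\<lambda>x. f x * step b (\<epsilon> n) (\<psi> x))" for n
    by (intro continuous_intros fK continuous_on_compose2[OF step_continuous(1)[OF \<epsilon>(1)] c\<psi>]) simp
  have "(\<lambda>n. \<integral>x. indicator K x *\<^sub>R (f x * step b (\<epsilon> n) (\<psi> x)) \<partial>lborel) \<longlonglongrightarrow> (\<integral>x. indicator Kb x *\<^sub>R f x \<partial>lborel)"
  proof (rule integral_dominated_convergence[where w="\<lambda>x. indicator K x *\<^sub>R \<bar>f x\<bar>"])
    show "(\<lambda>x. indicator Kb x *\<^sub>R f x) \<in> borel_measurable lborel"
      using borel_integrable_compact[OF cK(2) continuous_on_subset[OF fK KbK]] by (rule borel_measurable_integrable)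
    show "(\<lambda>x. indicator K x *\<^sub>R (f x * step b (\<epsilon> n) (\<psi> x))) \<in> borel_measurable lborel" for n
      using borel_integrable_compact[OF cK(1) cs] by (rule borel_measurable_integrable)
    show "integrable lborel (\<lambda>x. indicator K x *\<^sub>R \<bar>f x\<bar>)"
      by (intro borel_integrable_compact cK continuous_intros fK)
    show "AE x in lborel. norm (indicator K x *\<^sub>R (f x * step b (\<epsilon> n) (\<psi> x))) \<le> indicator K x *\<^sub>R \<bar>f x\<bar>" for n
      using step_props(3,4)[OF \<epsilon>(1)] by (intro AE_I2) (auto simp: indicator_def abs_mult mult_left_le)
    show "AE x in lborel. (\<lambda>n. indicator K x *\<^sub>R (f x * step b (\<epsilon> n) (\<psi> x))) \<longlonglongrightarrow> indicator Kb x *\<^sub>R f x"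
    proof (rule AE_I2)
      fix x
      show "(\<lambda>n. indicator K x *\<^sub>R (f x * step b (\<epsilon> n) (\<psi> x))) \<longlonglongrightarrow> indicator Kb x *\<^sub>R f x"
      proof (cases "x \<in> K \<and> x \<notin> Kb")
        case True
        then have gt: "\<psi> x - b > 0" by (auto simp: K_def Kb_def)
        have "\<forall>\<^sub>F n in sequentially. \<epsilon> n < \<psi> x - b" by (rule order_tendstoD(2)[OF \<epsilon>(2) gt])
        then have "\<forall>\<^sub>F n in sequentially. indicator K x *\<^sub>R (f x * step b (\<epsilon> n) (\<psi> x)) = indicator Kb x *\<^sub>R f x"
          by eventually_elim (use True step_props(2)[OF \<epsilon>(1)] in simp)
        then show ?thesis by (rule tendsto_eventually)
      next
        case False
        then have "indicator K x *\<^sub>R (f x * step b (\<epsilon> n) (\<psi> x)) = indicator Kb x *\<^sub>R f x" for n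
          using KbK step_props(1)[OF \<epsilon>(1), of "\<psi> x" b n] by (auto simp: indicator_def Kb_def)
        then show ?thesis by (simp only: tendsto_const)
      qed
    qed
  qed
  then show ?thesis by (simp add: set_lebesgue_integral_def K_def Kb_def)
qed

text \<open>The first part expresses a smoothed integral of \<omega> by a nonnegative density
  carried by a shell. The second subtracts \<open>a\<close> times the flux identity from the limit
  identity, so that the density gets multiplied by \<open>\<omega> x - a\<close>, which is small on
  the shell when \<open>a\<close> is the value on the inner level.\<close>

lemma step_flux:
  assumes b: "b < b'" "b' < c" and \<epsilon>: "\<epsilon> > 0" "b + \<epsilon> < b'"
  defines "K \<equiv> {x \<in> M. \<psi> x \<le> b'}"
  shows "(LINT x:K|lborel. \<omega> x * step b \<epsilon> (\<psi> x)) = (LINT x:K|lborel. - step' b \<epsilon> (\<psi> x) * (norm (perp_grad \<psi> x))\<^sup>2)"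
    and "(LINT x:K|lborel. (\<omega> x - a) * \<omega> x * step b \<epsilon> (\<psi> x)) =
      (LINT x:K|lborel. (\<omega> x - a) * (- step' b \<epsilon> (\<psi> x) * (norm (perp_grad \<psi> x))\<^sup>2))"
    and "set_integrable lborel K (\<lambda>x. (\<omega> x - a) * (- step' b \<epsilon> (\<psi> x) * (norm (perp_grad \<psi> x))\<^sup>2))"
    and "set_integrable lborel K (\<lambda>x. - step' b \<epsilon> (\<psi> x) * (norm (perp_grad \<psi> x))\<^sup>2)"
    and "set_integrable lborel K (\<lambda>x. \<omega> x * step b \<epsilon> (\<psi> x))"
    and "continuous_on K (\<lambda>x. - step' b \<epsilon> (\<psi> x) * (norm (perp_grad \<psi> x))\<^sup>2)"
proof -
  have cK: "compact K" unfolding K_def by (rule compact_sublevel[OF b(2)])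
  have KM: "K \<subseteq> M" by (auto simp: K_def)
  note cont = continuous_on_subset[OF continuous_\<psi> KM] continuous_on_subset[OF continuous_perp_grad KM]
    continuous_on_subset[OF continuous_\<omega> KM]
  have c1: "continuous_on K (\<lambda>x. step b \<epsilon> (\<psi> x))" "continuous_on K (\<lambda>x. step' b \<epsilon> (\<psi> x))"
    by (rule continuous_on_compose2[OF step_continuous(1)[OF \<epsilon>(1)] cont(1)], simp,
        rule continuous_on_compose2[OF step_continuous(2)[OF \<epsilon>(1)] cont(1)], simp)
  show "continuous_on K (\<lambda>x. - step' b \<epsilon> (\<psi> x) * (norm (perp_grad \<psi> x))\<^sup>2)"
    by (intro continuous_intros c1 cont)
  have i1: "set_integrable lborel K (\<lambda>x. \<omega> x * step b \<epsilon> (\<psi> x))"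
    and i2: "set_integrable lborel K (\<lambda>x. step' b \<epsilon> (\<psi> x) * (norm (perp_grad \<psi> x))\<^sup>2)"
    and i3: "set_integrable lborel K (\<lambda>x. \<omega> x * \<omega> x * step b \<epsilon> (\<psi> x))"
    and i4: "set_integrable lborel K (\<lambda>x. \<omega> x * (step' b \<epsilon> (\<psi> x) * (norm (perp_grad \<psi> x))\<^sup>2))"
    by (intro set_integrable_compact cK continuous_intros c1 cont)+
  then show "set_integrable lborel K (\<lambda>x. \<omega> x * step b \<epsilon> (\<psi> x))" by simp
  show i5: "set_integrable lborel K (\<lambda>x. (\<omega> x - a) * (- step' b \<epsilon> (\<psi> x) * (norm (perp_grad \<psi> x))\<^sup>2))"
    by (intro set_integrable_compact cK continuous_intros c1 cont)
  have i6: "set_integrable lborel K (\<lambda>x. (\<omega> x - a) * \<omega> x * step b \<epsilon> (\<psi> x))"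
    by (intro set_integrable_compact cK continuous_intros c1 cont)
  show i7: "set_integrable lborel K (\<lambda>x. - step' b \<epsilon> (\<psi> x) * (norm (perp_grad \<psi> x))\<^sup>2)"
    by (intro set_integrable_compact cK continuous_intros c1 cont)
  have zero: "\<forall>t\<ge>b + \<epsilon>. step b \<epsilon> t = 0" using step_props(2)[OF \<epsilon>(1)] by blast
  have F: "(LINT x:K|lborel. step b \<epsilon> (\<psi> x) * \<omega> x + step' b \<epsilon> (\<psi> x) * (norm (perp_grad \<psi> x))\<^sup>2) = 0"
    unfolding K_def
    by (rule flux_identity[OF C2 \<epsilon>(2) b(2) step_derivative[OF \<epsilon>(1)] step_continuous(2)[OF \<epsilon>(1)] zero])
  have L: "(LINT x:K|lborel. \<omega> x * (step b \<epsilon> (\<psi> x) * \<omega> x + step' b \<epsilon> (\<psi> x) * (norm (perp_grad \<psi> x))\<^sup>2)) = 0"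
    unfolding K_def
    by (rule limit_identity[OF \<epsilon>(2) b(2) step_derivative[OF \<epsilon>(1)] step_continuous(2)[OF \<epsilon>(1)] zero])
  have "(LINT x:K|lborel. \<omega> x * step b \<epsilon> (\<psi> x)) - (LINT x:K|lborel. - step' b \<epsilon> (\<psi> x) * (norm (perp_grad \<psi> x))\<^sup>2)
    = (LINT x:K|lborel. \<omega> x * step b \<epsilon> (\<psi> x) - - step' b \<epsilon> (\<psi> x) * (norm (perp_grad \<psi> x))\<^sup>2)"
    by (rule set_integral_diff(2)[OF i1 i7, symmetric])
  also have "\<dots> = 0" using F by (simp add: mult.commute)
  finally show "(LINT x:K|lborel. \<omega> x * step b \<epsilon> (\<psi> x)) = (LINT x:K|lborel. - step' b \<epsilon> (\<psi> x) * (norm (perp_grad \<psi> x))\<^sup>2)"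
    by simp
  have iF: "set_integrable lborel K (\<lambda>x. step b \<epsilon> (\<psi> x) * \<omega> x + step' b \<epsilon> (\<psi> x) * (norm (perp_grad \<psi> x))\<^sup>2)"
    "set_integrable lborel K (\<lambda>x. \<omega> x * (step b \<epsilon> (\<psi> x) * \<omega> x + step' b \<epsilon> (\<psi> x) * (norm (perp_grad \<psi> x))\<^sup>2))"
    by (intro set_integrable_compact cK continuous_intros c1 cont)+
  have "(LINT x:K|lborel. (\<omega> x - a) * \<omega> x * step b \<epsilon> (\<psi> x)) -
      (LINT x:K|lborel. (\<omega> x - a) * (- step' b \<epsilon> (\<psi> x) * (norm (perp_grad \<psi> x))\<^sup>2))
    = (LINT x:K|lborel. (\<omega> x - a) * \<omega> x * step b \<epsilon> (\<psi> x) - (\<omega> x - a) * (- step' b \<epsilon> (\<psi> x) * (norm (perp_grad \<psi> x))\<^sup>2))"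
    by (rule set_integral_diff(2)[OF i6 i5, symmetric])
  also have "\<dots> = (LINT x:K|lborel. \<omega> x * (step b \<epsilon> (\<psi> x) * \<omega> x + step' b \<epsilon> (\<psi> x) * (norm (perp_grad \<psi> x))\<^sup>2)
      - a * (step b \<epsilon> (\<psi> x) * \<omega> x + step' b \<epsilon> (\<psi> x) * (norm (perp_grad \<psi> x))\<^sup>2))"
    by (rule arg_cong[where f="set_lebesgue_integral lborel K"]) (simp add: fun_eq_iff algebra_simps)
  also have "\<dots> = 0"
    using set_integral_diff(2)[OF iF(2) set_integrable_mult_right[of a, OF iF(1)]] F L by simp
  finally show "(LINT x:K|lborel. (\<omega> x - a) * \<omega> x * step b \<epsilon> (\<psi> x)) =
      (LINT x:K|lborel. (\<omega> x - a) * (- step' b \<epsilon> (\<psi> x) * (norm (perp_grad \<psi> x))\<^sup>2))"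
    by simp
qed

end

section \<open>Mean values of the vorticity over sublevel sets\<close>

locale inviscid_limit_euler = inviscid_limit +
  assumes levels: "\<And>x y. x \<in> M \<Longrightarrow> y \<in> M \<Longrightarrow> \<psi> x = \<psi> y \<Longrightarrow> \<omega> x = \<omega> y"
begin

text \<open>Continuity of \<omega> uniformly along a whole level: points violating the bound in ever
  thinner shells would accumulate, by compactness, at a point of the level of \<open>y\<close>,
  where \<omega> has the value \<open>\<omega> y\<close>.\<close>

lemma thin_shell:
  assumes y: "y \<in> M" and \<eta>: "\<eta> > 0"
  shows "\<exists>\<delta>>0. \<forall>x\<in>M. \<psi> y \<le> \<psi> x \<longrightarrow> \<psi> x \<le> \<psi> y + \<delta> \<longrightarrow> \<bar>\<omega> x - \<omega> y\<bar> \<le> \<eta>"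
proof (rule ccontr)
  assume "\<not> ?thesis"
  then have ex: "\<exists>x. x \<in> M \<and> \<psi> y \<le> \<psi> x \<and> \<psi> x \<le> \<psi> y + \<delta> \<and> \<bar>\<omega> x - \<omega> y\<bar> > \<eta>" if "\<delta> > 0" for \<delta>
    using that by (meson not_le)
  \<comment> \<open>Any level strictly between that of \<open>y\<close> and \<open>c\<close> would
    do; it keeps the shells in a compact part of \<open>M\<close>.\<close>
  define b' where "b' = (\<psi> y + c) / 2"
  have b: "\<psi> y < b'" "b' < c" using below[OF y] by (auto simp: b'_def)
  define \<delta> where "\<delta> n = (b' - \<psi> y) * inverse (real (Suc n))" for n
  have \<delta>: "\<delta> n > 0" "\<psi> y + \<delta> n \<le> b'" for n
  proof -
    show "\<delta> n > 0" using b(1) by (simp add: \<delta>_def)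
    have "\<delta> n \<le> (b' - \<psi> y) * 1" unfolding \<delta>_def using b(1) by (intro mult_left_mono) (auto simp: divide_simps)
    then show "\<psi> y + \<delta> n \<le> b'" by simp
  qed
  have \<delta>0: "\<delta> \<longlonglongrightarrow> 0"
    using tendsto_mult[OF tendsto_const LIMSEQ_inverse_real_of_nat] by (simp add: \<delta>_def[abs_def])
  obtain x where x: "\<And>n. x n \<in> M \<and> \<psi> y \<le> \<psi> (x n) \<and> \<psi> (x n) \<le> \<psi> y + \<delta> n \<and> \<bar>\<omega> (x n) - \<omega> y\<bar> > \<eta>"
    using ex[OF \<delta>(1)] by metis
  let ?K = "{x \<in> M. \<psi> x \<le> b'}"
  have xK: "\<forall>n. x n \<in> ?K" using x \<delta>(2) by (metis (mono_tags, lifting) mem_Collect_eq order_trans)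
  have "seq_compact ?K" using compact_sublevel[OF b(2)] by (rule compact_imp_seq_compact)
  from seq_compactE[OF this xK] obtain l r where l: "l \<in> ?K" "strict_mono (r :: nat \<Rightarrow> nat)" "(x \<circ> r) \<longlonglongrightarrow> l"
    by blast
  have lM: "l \<in> M" using l by simp
  have "isCont \<psi> l" "isCont \<omega> l"
    using continuous_\<psi> continuous_\<omega> M(1) lM by (simp_all add: continuous_on_eq_continuous_at)
  then have lim: "(\<lambda>n. \<psi> (x (r n))) \<longlonglongrightarrow> \<psi> l" "(\<lambda>n. \<omega> (x (r n))) \<longlonglongrightarrow> \<omega> l"
    using l(3) isCont_tendsto_compose unfolding o_def by blast+
  have "(\<lambda>n. \<psi> y + \<delta> (r n)) \<longlonglongrightarrow> \<psi> y + 0"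
    using LIMSEQ_subseq_LIMSEQ[OF \<delta>0 l(2)] by (intro tendsto_intros) (simp add: o_def)
  then have "\<psi> l \<le> \<psi> y + 0" using lim(1) x by (intro LIMSEQ_le) auto
  moreover have "\<psi> y \<le> \<psi> l" using lim(1) x by (intro LIMSEQ_le_const) auto
  ultimately have "\<omega> l = \<omega> y" using levels[OF lM y] by simp
  moreover have "\<eta> \<le> \<bar>\<omega> l - \<omega> y\<bar>"
    by (rule LIMSEQ_le_const[OF tendsto_rabs[OF tendsto_diff[OF lim(2) tendsto_const]]]) (use x less_imp_le in blast)
  ultimately show False using \<eta> by simp
qed

text \<open>The density \<open>?D n\<close> sits on a shell above the level of \<open>y\<close>,
  where \<omega> differs little from \<open>\<omega> y\<close>, and its mass stays bounded as the
  shell shrinks; hence the right side of the second identity in \<open>step_flux\<close> tends to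
  0.\<close>

lemma level_average:
  assumes y: "y \<in> M"
  shows "(LINT x:{x \<in> M. \<psi> x \<le> \<psi> y}|lborel. (\<omega> x - \<omega> y) * \<omega> x) = 0"
    and "(LINT x:{x \<in> M. \<psi> x \<le> \<psi> y}|lborel. \<omega> x) \<ge> 0"
proof -
  define b where "b = \<psi> y"
  define b' where "b' = (b + c) / 2"
  have b: "b < b'" "b' < c" using below[OF y] by (auto simp: b'_def b_def)
  define K where "K = {x \<in> M. \<psi> x \<le> b'}"
  have cK: "compact K" unfolding K_def by (rule compact_sublevel[OF b(2)])
  have KM: "K \<subseteq> M" by (auto simp: K_def)
  have c\<omega>: "continuous_on K \<omega>" by (rule continuous_on_subset[OF continuous_\<omega> KM])
  \<comment> \<open>Half the gap at most, so that the shell ends strictly below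
    \<open>b'\<close>.\<close>
  define \<epsilon> where "\<epsilon> n = (b' - b) / 2 * inverse (real (Suc n))" for n
  have e: "\<epsilon> n > 0" "b + \<epsilon> n < b'" for n
  proof -
    show "\<epsilon> n > 0" using b(1) by (simp add: \<epsilon>_def)
    have "\<epsilon> n \<le> (b' - b) / 2 * 1" unfolding \<epsilon>_def using b(1) by (intro mult_left_mono) (auto simp: divide_simps)
    also have "\<dots> < b' - b" using b(1) by simp
    finally show "b + \<epsilon> n < b'" by simp
  qed
  have e0: "\<epsilon> \<longlonglongrightarrow> 0"
    using tendsto_mult[OF tendsto_const LIMSEQ_inverse_real_of_nat] by (simp add: \<epsilon>_def[abs_def])
  let ?D = "\<lambda>n x. - step' b (\<epsilon> n) (\<psi> x) * (norm (perp_grad \<psi> x))\<^sup>2"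
  have D0: "?D n x \<ge> 0" for n x using step_props(5)[OF e(1)] by (intro mult_nonneg_nonneg) auto
  note sf = step_flux[OF b e, folded K_def]
  have lim1: "(\<lambda>n. LINT x:K|lborel. \<omega> x * step b (\<epsilon> n) (\<psi> x)) \<longlonglongrightarrow> (LINT x:{x \<in> M. \<psi> x \<le> b}|lborel. \<omega> x)"
    unfolding K_def by (rule step_limit[OF b c\<omega>[unfolded K_def] e(1) e0])
  have lim2: "(\<lambda>n. LINT x:K|lborel. (\<omega> x - \<omega> y) * \<omega> x * step b (\<epsilon> n) (\<psi> x)) \<longlonglongrightarrow> (LINT x:{x \<in> M. \<psi> x \<le> b}|lborel. (\<omega> x - \<omega> y) * \<omega> x)"
    unfolding K_def by (rule step_limit[OF b _ e(1) e0]) (intro continuous_intros c\<omega>[unfolded K_def])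
  have "(LINT x:K|lborel. ?D n x) \<ge> 0" for n
    unfolding set_lebesgue_integral_def by (rule Bochner_Integration.integral_nonneg) (use D0 in \<open>simp add: indicator_def\<close>)
  then show "(LINT x:{x \<in> M. \<psi> x \<le> \<psi> y}|lborel. \<omega> x) \<ge> 0"
    using LIMSEQ_le_const[OF lim1] sf(1) by (auto simp: b_def)
  \<comment> \<open>A bound for the mass of \<open>?D n\<close> independent of \<open>n\<close>,
    because that mass is an integral of \<omega> against a step between 0 and 1.\<close>
  define C where "C = (LINT x:K|lborel. \<bar>\<omega> x\<bar>)"
  have C0: "C \<ge> 0" unfolding C_def set_lebesgue_integral_def by (rule Bochner_Integration.integral_nonneg) (simp add: indicator_def)
  have "(\<lambda>n. LINT x:K|lborel. (\<omega> x - \<omega> y) * ?D n x) \<longlonglongrightarrow> 0"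
    unfolding tendsto_iff
  proof (intro allI impI)
    fix \<rho> :: real assume \<rho>: "\<rho> > 0"
    define \<eta> where "\<eta> = \<rho> / (C + 1)"
    have \<eta>: "\<eta> > 0" "\<eta> * C < \<rho>" using \<rho> C0 by (auto simp: \<eta>_def divide_simps algebra_simps add_nonneg_pos)
    obtain \<delta> where \<delta>: "\<delta> > 0" "\<And>x. x \<in> M \<Longrightarrow> \<psi> y \<le> \<psi> x \<Longrightarrow> \<psi> x \<le> \<psi> y + \<delta> \<Longrightarrow> \<bar>\<omega> x - \<omega> y\<bar> \<le> \<eta>"
      using thin_shell[OF y \<eta>(1)] by blast
    have "\<forall>\<^sub>F n in sequentially. \<epsilon> n < \<delta>" by (rule order_tendstoD(2)[OF e0 \<delta>(1)])
    then show "\<forall>\<^sub>F n in sequentially. dist (LINT x:K|lborel. (\<omega> x - \<omega> y) * ?D n x) 0 < \<rho>"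
    proof eventually_elim
      case (elim n)
      have pw: "\<bar>(\<omega> x - \<omega> y) * ?D n x\<bar> \<le> \<eta> * ?D n x" if "x \<in> K" for x
      proof (cases "b \<le> \<psi> x \<and> \<psi> x \<le> b + \<epsilon> n")
        case True
        then have "\<bar>\<omega> x - \<omega> y\<bar> \<le> \<eta>" using that KM elim by (intro \<delta>(2)) (auto simp: b_def)
        then have "\<bar>\<omega> x - \<omega> y\<bar> * ?D n x \<le> \<eta> * ?D n x" using D0 by (rule mult_right_mono)
        then show ?thesis using abs_mult[of "\<omega> x - \<omega> y" "?D n x"] abs_of_nonneg[OF D0[of n x]] by simp
      next
        case False
        then have "step' b (\<epsilon> n) (\<psi> x) = 0" by (intro step_props(6)[OF e(1)]) auto
        then show ?thesis by simp
      qed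
      have iD: "set_integrable lborel K (\<lambda>x. \<eta> * ?D n x)" by (rule set_integrable_mult_right) (rule sf(4))
      have "\<bar>LINT x:K|lborel. (\<omega> x - \<omega> y) * ?D n x\<bar> \<le> (LINT x:K|lborel. \<bar>(\<omega> x - \<omega> y) * ?D n x\<bar>)"
        using set_integral_norm_bound[OF sf(3)] by simp
      also have "\<dots> \<le> (LINT x:K|lborel. \<eta> * ?D n x)"
        by (rule set_integral_mono[OF set_integrable_abs[OF sf(3)] iD pw])
      also have "\<dots> = \<eta> * (LINT x:K|lborel. \<omega> x * step b (\<epsilon> n) (\<psi> x))"
        unfolding sf(1) by (rule set_integral_mult_right)
      also have "(LINT x:K|lborel. \<omega> x * step b (\<epsilon> n) (\<psi> x)) \<le> C"
        unfolding C_def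
      proof (rule set_integral_mono[OF sf(5)])
        show "set_integrable lborel K (\<lambda>x. \<bar>\<omega> x\<bar>)" by (intro set_integrable_compact cK continuous_intros c\<omega>)
        fix x
        have "\<omega> x * step b (\<epsilon> n) (\<psi> x) \<le> \<bar>\<omega> x\<bar> * step b (\<epsilon> n) (\<psi> x)"
          using step_props(3)[OF e(1)] by (intro mult_right_mono) auto
        also have "\<dots> \<le> \<bar>\<omega> x\<bar> * 1" using step_props(4)[OF e(1)] by (intro mult_left_mono) auto
        finally show "\<omega> x * step b (\<epsilon> n) (\<psi> x) \<le> \<bar>\<omega> x\<bar>" by simp
      qed
      finally show ?case using \<eta> by (simp add: mult_left_mono)
    qed
  qed
  then have "(\<lambda>n. LINT x:K|lborel. (\<omega> x - \<omega> y) * \<omega> x * step b (\<epsilon> n) (\<psi> x)) \<longlonglongrightarrow> 0"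
    unfolding sf(2) .
  from LIMSEQ_unique[OF lim2 this]
  show "(LINT x:{x \<in> M. \<psi> x \<le> \<psi> y}|lborel. (\<omega> x - \<omega> y) * \<omega> x) = 0" by (simp add: b_def)
qed

text \<open>The mean value identity reads \<open>\<integral> \<omega>\<^sup>2 = \<omega>(y)
  \<integral> \<omega>\<close> over the sublevel set, and the last integral is nonnegative. So
  \<open>\<omega> y \<le> 0\<close> forces \<omega> to vanish below \<open>y\<close>; then the flux
  through a lower shell vanishes, and with it the gradient at points other than
  \<open>x0\<close>.\<close>

lemma vorticity_pos:
  assumes y: "y \<in> M" "y \<noteq> x0"
  shows "\<omega> y > 0"
proof (rule ccontr)
  assume "\<not> \<omega> y > 0"
  define b where "b = \<psi> y"
  define K where "K = {x \<in> M. \<psi> x \<le> b}"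
  have cK: "compact K" unfolding K_def b_def by (rule compact_sublevel[OF below[OF y(1)]])
  have KM: "K \<subseteq> M" by (auto simp: K_def)
  have c\<omega>: "continuous_on K \<omega>" by (rule continuous_on_subset[OF continuous_\<omega> KM])
  have i: "set_integrable lborel K (\<lambda>x. \<omega> x * \<omega> x)" "set_integrable lborel K \<omega>"
    by (intro set_integrable_compact cK continuous_intros c\<omega>)+
  have "(LINT x:K|lborel. (\<omega> x - \<omega> y) * \<omega> x) = (LINT x:K|lborel. \<omega> x * \<omega> x - \<omega> y * \<omega> x)"
    by (simp add: algebra_simps)
  also have "\<dots> = (LINT x:K|lborel. \<omega> x * \<omega> x) - \<omega> y * (LINT x:K|lborel. \<omega> x)"
    using set_integral_diff(2)[OF i(1) set_integrable_mult_right[of "\<omega> y", OF i(2)]] by simp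
  finally have "(LINT x:K|lborel. \<omega> x * \<omega> x) = \<omega> y * (LINT x:K|lborel. \<omega> x)"
    using level_average(1)[OF y(1)] by (simp add: K_def b_def)
  also have "\<dots> \<le> 0" using level_average(2)[OF y(1)] \<open>\<not> \<omega> y > 0\<close>
    by (intro mult_nonpos_nonneg) (auto simp: K_def b_def)
  finally have "(LINT x:K|lborel. \<omega> x * \<omega> x) \<le> 0" .
  moreover have "(LINT x:K|lborel. \<omega> x * \<omega> x) \<ge> 0"
    unfolding set_lebesgue_integral_def by (rule Bochner_Integration.integral_nonneg) (simp add: indicator_def)
  ultimately have int0: "(LINT x:K|lborel. \<omega> x * \<omega> x) = 0" by simp
  let ?S = "{x \<in> M. \<psi> x < b}"
  have oS: "open ?S" by (rule open_sublevel) (use below[OF y(1)] in \<open>simp add: b_def\<close>)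
  have SK: "?S \<subseteq> K" by (auto simp: K_def)
  have \<omega>0: "\<omega> x = 0" if "x \<in> ?S" for x
    using integral_zero_imp_zero_on_open[OF cK _ _ int0 oS SK that] c\<omega> by (auto intro: continuous_intros)
  have "open (M - {x0})" "y \<in> M - {x0}" using M(1) y by auto
  then obtain x where x: "x \<in> M" "x \<noteq> x0" "\<psi> x < b"
    using regular_neighbours(1)[OF y, of "M - {x0}"] y by (auto simp: b_def)
  \<comment> \<open>The shell of width \<open>2 * \<delta>\<close> is centred at the level of
    \<open>x\<close>, where \<open>step'\<close> is strictly negative, and its upper end stays below
    \<open>b\<close>.\<close>
  define \<delta> where "\<delta> = (b - \<psi> x) / 2"
  have \<delta>: "\<delta> > 0" "\<psi> x + \<delta> < b" "(\<psi> x - \<delta>) + 2 * \<delta> < b" "\<psi> x - \<delta> < b" "b < c"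
    using x(3) below[OF y(1)] by (auto simp: \<delta>_def b_def field_simps)
  have \<delta>2: "0 < 2 * \<delta>" using \<delta>(1) by simp
  let ?D = "\<lambda>z. - step' (\<psi> x - \<delta>) (2 * \<delta>) (\<psi> z) * (norm (perp_grad \<psi> z))\<^sup>2"
  note sf = step_flux[OF \<delta>(4,5) \<delta>2 \<delta>(3), folded K_def]
  have "\<omega> z * step (\<psi> x - \<delta>) (2 * \<delta>) (\<psi> z) = 0" if "z \<in> K" for z
  proof (cases "\<psi> z < b")
    case True then show ?thesis using \<omega>0 that KM by auto
  next
    case False
    then show ?thesis using step_props(2)[OF \<delta>2, of "\<psi> x - \<delta>" "\<psi> z"] \<delta>(3) by simp
  qed
  then have "(LINT z:K|lborel. \<omega> z * step (\<psi> x - \<delta>) (2 * \<delta>) (\<psi> z)) = (LINT z:K|lborel. 0)"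
    unfolding set_lebesgue_integral_def by (intro Bochner_Integration.integral_cong) (auto simp: indicator_def)
  then have "(LINT z:K|lborel. ?D z) = 0" using sf(1) by simp
  moreover have "?D z \<ge> 0" for z using step_props(5)[OF \<delta>2] by (intro mult_nonneg_nonneg) auto
  ultimately have "?D x = 0"
    using integral_zero_imp_zero_on_open[OF cK sf(6) _ _ oS SK] x by blast
  moreover have "step' (\<psi> x - \<delta>) (2 * \<delta>) (\<psi> x) < 0" using \<delta>(1) by (intro step_props(7)[OF \<delta>2]) auto
  ultimately have "perp_grad \<psi> x = 0" by simp
  then have "grad \<psi> x = 0" by (simp add: vec_eq_iff forall_2)
  then show False using crit(3) x by blast
qed

text \<open>At an extremum the factor \<open>\<omega> x - \<omega> z\<close> has one sign on the
  sublevel set, and \<omega> is nonnegative, so the vanishing mean makes their product vanish. Away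
  from \<open>x0\<close> the factor \<omega> can be cancelled.\<close>

lemma extremal_level_value:
  assumes z: "z \<in> M" and ext: "(\<forall>x\<in>M. \<psi> x \<le> \<psi> z \<longrightarrow> \<omega> x \<le> \<omega> z) \<or> (\<forall>x\<in>M. \<psi> x \<le> \<psi> z \<longrightarrow> \<omega> z \<le> \<omega> x)"
  shows "\<omega> z = \<omega> x0"
proof (cases "z = x0")
  case False
  define K where "K = {x \<in> M. \<psi> x \<le> \<psi> z}"
  have cK: "compact K" unfolding K_def by (rule compact_sublevel[OF below[OF z]])
  have KM: "K \<subseteq> M" by (auto simp: K_def)
  have c\<omega>: "continuous_on K \<omega>" by (rule continuous_on_subset[OF continuous_\<omega> KM])
  let ?S = "{x \<in> M. \<psi> x < \<psi> z}"
  have oS: "open ?S" by (rule open_sublevel) (use below[OF z] in simp)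
  have SK: "?S \<subseteq> K" by (auto simp: K_def)
  have x0S: "x0 \<in> ?S" using minimum_strict[OF z False] crit(1) by simp
  have avg: "(LINT x:K|lborel. (\<omega> x - \<omega> z) * \<omega> x) = 0" using level_average(1)[OF z] by (simp add: K_def)
  have cf: "continuous_on K (\<lambda>x. (\<omega> x - \<omega> z) * \<omega> x)" by (intro continuous_intros c\<omega>)
  have \<omega>nn: "\<omega> x \<ge> 0" if "x \<in> M" for x
  proof (cases "x = x0")
    case True
    show ?thesis
    proof (rule ccontr)
      assume neg: "\<not> \<omega> x \<ge> 0"
      have "open (M \<inter> \<omega> -` {..<0})" using continuous_open_preimage[OF continuous_\<omega> M(1) open_lessThan] .
      moreover have "x0 \<in> M \<inter> \<omega> -` {..<0}" using neg True crit(1) by simp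
      moreover have "M \<inter> \<omega> -` {..<0} \<subseteq> {x0}" using vorticity_pos by force
      ultimately have "open {x0}" by (metis empty_iff subset_singletonD)
      then show False using not_open_singleton by blast
    qed
  qed (use vorticity_pos[OF that] in simp)
  have "(\<omega> x - \<omega> z) * \<omega> x = 0" if x: "x \<in> ?S" for x
    using ext
  proof
    assume "\<forall>x\<in>M. \<psi> x \<le> \<psi> z \<longrightarrow> \<omega> z \<le> \<omega> x"
    then have "(\<omega> x - \<omega> z) * \<omega> x \<ge> 0" if "x \<in> K" for x
      using that \<omega>nn by (intro mult_nonneg_nonneg) (auto simp: K_def)
    from integral_zero_imp_zero_on_open[OF cK cf this avg oS SK x] show ?thesis .
  next
    assume "\<forall>x\<in>M. \<psi> x \<le> \<psi> z \<longrightarrow> \<omega> x \<le> \<omega> z"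
    then have nn: "- ((\<omega> x - \<omega> z) * \<omega> x) \<ge> 0" if "x \<in> K" for x
      using that \<omega>nn by (simp add: K_def mult_nonpos_nonneg)
    have "(LINT x:K|lborel. - ((\<omega> x - \<omega> z) * \<omega> x)) = 0"
      using avg unfolding set_lebesgue_integral_def by simp
    from integral_zero_imp_zero_on_open[OF cK continuous_on_minus[OF cf] nn this oS SK x] show ?thesis by simp
  qed
  then have S: "\<omega> x = \<omega> z" if "x \<in> ?S" "x \<noteq> x0" for x
    using that vorticity_pos[of x] by (metis (mono_tags, lifting) diff_eq_diff_eq diff_self less_irrefl mem_Collect_eq mult_eq_0_iff)
  show ?thesis
  proof (rule ccontr)
    assume ne: "\<omega> z \<noteq> \<omega> x0"
    have "continuous_on ?S \<omega>" by (rule continuous_on_subset[OF continuous_\<omega>]) auto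
    \<comment> \<open>The equality holds off \<open>x0\<close> so far. A different value at
      \<open>x0\<close> would make the single point \<open>x0\<close> an open set.\<close>
    then have "open (?S \<inter> \<omega> -` (- {\<omega> z}))" using oS by (intro continuous_open_preimage) auto
    moreover have "?S \<inter> \<omega> -` (- {\<omega> z}) = {x0}" using S ne x0S by force
    ultimately show False using not_open_singleton by metis
  qed
qed simp

theorem constant_vorticity:
  assumes y: "y \<in> M" shows "\<omega> y = \<omega> x0"
proof -
  define K where "K = {x \<in> M. \<psi> x \<le> \<psi> y}"
  have cK: "compact K" unfolding K_def by (rule compact_sublevel[OF below[OF y]])
  have KM: "K \<subseteq> M" and yK: "y \<in> K" and Kne: "K \<noteq> {}" using y by (auto simp: K_def)
  have c\<omega>: "continuous_on K \<omega>" by (rule continuous_on_subset[OF continuous_\<omega> KM])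
  obtain z1 where z1: "z1 \<in> K" "\<And>x. x \<in> K \<Longrightarrow> \<omega> x \<le> \<omega> z1" using continuous_attains_sup[OF cK Kne c\<omega>] by blast
  obtain z2 where z2: "z2 \<in> K" "\<And>x. x \<in> K \<Longrightarrow> \<omega> z2 \<le> \<omega> x" using continuous_attains_inf[OF cK Kne c\<omega>] by blast
  have "\<omega> z1 = \<omega> x0" using z1 by (intro extremal_level_value) (auto simp: K_def)
  moreover have "\<omega> z2 = \<omega> x0" using z2 by (intro extremal_level_value) (auto simp: K_def)
  ultimately show ?thesis using z1(2)[OF yK] z2(2)[OF yK] by simp
qed

end

section \<open>Smooth bump functions\<close>

text \<open>A family closed under differentiation: a derivative changes only \<open>k\<close> and
  \<open>P\<close>, which proves smoothness of all orders by one induction. For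
  \<open>k = 0\<close>, \<open>P = 1\<close> and small \<open>s\<close> it approximates the
  indicator of the open interval.\<close>

definition bump :: "real \<Rightarrow> real \<Rightarrow> real \<Rightarrow> nat \<Rightarrow> real poly \<Rightarrow> real \<Rightarrow> real" where
  "bump a b s k P t = (if a < t \<and> t < b then
     poly P t / ((t - a) * (b - t)) ^ k * exp (- s / ((t - a) * (b - t))) else 0)"

text \<open>A single term of the exponential series bounds \<open>exp (s / w)\<close> from
  below.\<close>

lemma exp_neg_inverse_le:
  fixes w s :: real
  assumes "w > 0" "s > 0"
  shows "exp (- s / w) \<le> fact m * w ^ m / s ^ m"
proof -
  define x where "x = s / w"
  have x: "x > 0" using assms by (simp add: x_def)
  have "(\<Sum>n\<in>{m}. x ^ n /\<^sub>R fact n) \<le> (\<Sum>n. x ^ n /\<^sub>R fact n)"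
    using x by (intro sum_le_suminf summable_exp_generic) auto
  then have "x ^ m / fact m \<le> exp x" by (simp add: exp_def divide_inverse mult.commute)
  then have "inverse (exp x) \<le> inverse (x ^ m / fact m)" using x by (intro le_imp_inverse_le) auto
  then show ?thesis using assms by (simp add: x_def exp_minus[symmetric] power_divide mult.commute)
qed

text \<open>Quadratic vanishing at both ends is all that is needed for the derivative to exist there
  and to be 0.\<close>

lemma bump_quadratic_bound:
  assumes "a < b" "s > 0"
  obtains C where "\<And>t. \<bar>bump a b s k P t\<bar> \<le> C * (t - a)\<^sup>2" "\<And>t. \<bar>bump a b s k P t\<bar> \<le> C * (t - b)\<^sup>2"
proof -
  have "continuous_on {a..b} (poly P)" by (intro continuous_intros)
  from compact_imp_bounded[OF compact_continuous_image[OF this compact_Icc]]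
  obtain B where B: "\<And>t. t \<in> {a..b} \<Longrightarrow> \<bar>poly P t\<bar> \<le> B" unfolding bounded_iff by force
  have B0: "B \<ge> 0" using B[of a] assms by auto
  \<comment> \<open>The power \<open>k + 2\<close> cancels the pole of order \<open>k\<close> and
    leaves the square of the distance factor.\<close>
  define D where "D = B * (fact (k + 2) / s ^ (k + 2))"
  have D0: "D \<ge> 0" using B0 assms by (simp add: D_def)
  have bd: "\<bar>bump a b s k P t\<bar> \<le> D * ((t - a) * (b - t))\<^sup>2" if t: "a < t" "t < b" for t
  proof -
    define w where "w = (t - a) * (b - t)"
    have w: "w > 0" using t by (simp add: w_def)
    have "\<bar>bump a b s k P t\<bar> = \<bar>poly P t\<bar> * (exp (- s / w) / w ^ k)"
      using t w by (simp add: bump_def w_def[symmetric] abs_mult)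
    also have "\<dots> \<le> B * ((fact (k + 2) * w ^ (k + 2) / s ^ (k + 2)) / w ^ k)"
      using B[of t] t w exp_neg_inverse_le[OF w assms(2), of "k + 2"] B0
      by (intro mult_mono divide_right_mono) auto
    also have "\<dots> = D * w\<^sup>2" using w by (simp add: D_def power_add power2_eq_square)
    finally show ?thesis by (simp add: w_def)
  qed
  define C where "C = D * (b - a)\<^sup>2"
  have C0: "C \<ge> 0" using D0 by (simp add: C_def)
  show ?thesis
  proof (rule that[of C])
    fix t
    show "\<bar>bump a b s k P t\<bar> \<le> C * (t - a)\<^sup>2"
    proof (cases "a < t \<and> t < b")
      case True
      have "((t - a) * (b - t))\<^sup>2 \<le> ((t - a) * (b - a))\<^sup>2"
        using True by (intro power_mono mult_left_mono) auto
      then have "D * ((t - a) * (b - t))\<^sup>2 \<le> D * ((t - a) * (b - a))\<^sup>2" using D0 by (rule mult_left_mono)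
      also have "\<dots> = C * (t - a)\<^sup>2" by (simp add: C_def power_mult_distrib)
      finally show ?thesis using bd True by force
    next
      case False
      then show ?thesis using C0 by (auto simp: bump_def)
    qed
    show "\<bar>bump a b s k P t\<bar> \<le> C * (t - b)\<^sup>2"
    proof (cases "a < t \<and> t < b")
      case True
      have "((t - a) * (b - t))\<^sup>2 \<le> ((b - a) * (b - t))\<^sup>2"
        using True by (intro power_mono mult_right_mono) auto
      then have "D * ((t - a) * (b - t))\<^sup>2 \<le> D * ((b - a) * (b - t))\<^sup>2" using D0 by (rule mult_left_mono)
      also have "\<dots> = C * (t - b)\<^sup>2" by (simp add: C_def power_mult_distrib power2_commute[of b t])
      finally show ?thesis using bd True by force
    next
      case False
      then show ?thesis using C0 by (auto simp: bump_def)
    qed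
  qed
qed

lemma has_derivative_0_if_quadratic:
  fixes f :: "real \<Rightarrow> real"
  assumes "\<And>t. \<bar>f t\<bar> \<le> C * (t - a)\<^sup>2"
  shows "(f has_real_derivative 0) (at a)"
proof -
  have fa: "f a = 0" using assms[of a] by simp
  have "((\<lambda>y. (f y - f a) / (y - a)) \<longlongrightarrow> 0) (at a)"
  proof (rule Lim_null_comparison[of _ "\<lambda>y. \<bar>C\<bar> * \<bar>y - a\<bar>"])
    show "\<forall>\<^sub>F y in at a. norm ((f y - f a) / (y - a)) \<le> \<bar>C\<bar> * \<bar>y - a\<bar>"
    proof (intro always_eventually allI)
      fix y
      have "\<bar>f y\<bar> \<le> \<bar>C\<bar> * \<bar>y - a\<bar> * \<bar>y - a\<bar>"
        using assms[of y] mult_right_mono[OF abs_ge_self[of C], of "(y - a)\<^sup>2"]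
        by (simp add: power2_eq_square mult.assoc)
      then show "norm ((f y - f a) / (y - a)) \<le> \<bar>C\<bar> * \<bar>y - a\<bar>"
        using fa by (cases "y = a") (auto simp: divide_le_eq abs_mult)
    qed
    have "((\<lambda>y. \<bar>C\<bar> * \<bar>y - a\<bar>) \<longlongrightarrow> \<bar>C\<bar> * \<bar>a - a\<bar>) (at a)" by (intro tendsto_intros)
    then show "((\<lambda>y. \<bar>C\<bar> * \<bar>y - a\<bar>) \<longlongrightarrow> 0) (at a)" by simp
  qed
  then show ?thesis by (simp add: has_field_derivative_iff)
qed

text \<open>The numerator obtained by differentiating \<open>P / w ^ k * exp (- s / w)\<close> and
  bringing everything over the denominator \<open>w ^ (k + 2)\<close>.\<close>

definition bump_deriv_poly :: "real \<Rightarrow> real \<Rightarrow> real \<Rightarrow> nat \<Rightarrow> real poly \<Rightarrow> real poly" where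
  "bump_deriv_poly a b s k P =
     (let w = [:- a, 1:] * [:b, - 1:] in pderiv P * w\<^sup>2 - smult (real k) (P * pderiv w * w) + smult s (P * pderiv w))"

lemma bump_derivative:
  assumes ab: "a < b" "s > 0"
  shows "(bump a b s k P has_real_derivative bump a b s (k + 2) (bump_deriv_poly a b s k P) t) (at t)"
proof -
  obtain C where C: "\<And>t. \<bar>bump a b s k P t\<bar> \<le> C * (t - a)\<^sup>2" "\<And>t. \<bar>bump a b s k P t\<bar> \<le> C * (t - b)\<^sup>2"
    using bump_quadratic_bound[OF ab] by blast
  consider "a < t" "t < b" | "t = a" | "t = b" | "t < a \<or> t > b" by linarith
  then show ?thesis
  proof cases
    case 1
    define w where "w t = (t - a) * (b - t)" for t
    define w' where "w' = (b - t) - (t - a)"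
    have w: "w t > 0" using 1 by (simp add: w_def)
    have dw: "(w has_real_derivative w') (at t)"
      unfolding w_def[abs_def] w'_def by (auto intro!: derivative_eq_intros)
    have "((\<lambda>t. poly P t / w t ^ k * exp (- s / w t)) has_real_derivative
        (poly (pderiv P) t * w t ^ k - poly P t * (real k * w t ^ (k - 1) * w')) / (w t ^ k * w t ^ k) * exp (- s / w t)
        + poly P t / w t ^ k * (exp (- s / w t) * (s * w' / (w t * w t)))) (at t)"
      using w by (auto intro!: derivative_eq_intros dw simp: field_simps)
    moreover have "(poly (pderiv P) t * w t ^ k - poly P t * (real k * w t ^ (k - 1) * w')) / (w t ^ k * w t ^ k) * exp (- s / w t)
        + poly P t / w t ^ k * (exp (- s / w t) * (s * w' / (w t * w t)))
       = bump a b s (k + 2) (bump_deriv_poly a b s k P) t"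
    proof -
      \<comment> \<open>Removes the truncated subtraction \<open>k - 1\<close>; for
        \<open>k = 0\<close> both sides are 0.\<close>
      have kw: "real k * w t ^ (k - 1) = real k * w t ^ k / w t" using w by (cases k) auto
      define W where "W = [:- a, 1:] * [:b, - 1:]"
      have pw: "poly W t = w t" "poly (pderiv W) t = w'"
        by (simp_all add: W_def w_def w'_def pderiv_mult pderiv_pCons algebra_simps)
      have P': "poly (bump_deriv_poly a b s k P) t = poly (pderiv P) t * (w t)\<^sup>2 - real k * (poly P t * w' * w t) + s * (poly P t * w')"
        unfolding bump_deriv_poly_def Let_def W_def[symmetric] by (simp only: poly_add poly_diff poly_mult poly_smult poly_power pw)
      have "bump a b s (k + 2) (bump_deriv_poly a b s k P) t
        = poly (bump_deriv_poly a b s k P) t / w t ^ (k + 2) * exp (- s / w t)"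
        using 1 by (simp add: bump_def w_def)
      also have "\<dots> = (poly (pderiv P) t / w t ^ k - real k * poly P t * w' / (w t ^ k * w t) + s * poly P t * w' / (w t ^ k * (w t * w t))) * exp (- s / w t)"
        unfolding P' using w by (simp add: field_simps power2_eq_square)
      finally have rhs: "bump a b s (k + 2) (bump_deriv_poly a b s k P) t = \<dots>" .
      have alg: "(A * W - p * (kk * W / x * y)) / (W * W) * E + p / W * (E * (s * y / (x * x)))
        = (A / W - kk * p * y / (W * x) + s * p * y / (W * (x * x))) * E" if "W \<noteq> 0" "x \<noteq> 0" for A W p kk x y E :: real
        using that by (simp add: field_simps)
      show ?thesis unfolding kw rhs by (rule alg) (use w in auto)
    qed
    ultimately have "((\<lambda>t. poly P t / w t ^ k * exp (- s / w t)) has_real_derivative bump a b s (k + 2) (bump_deriv_poly a b s k P) t) (at t)"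
      by simp
    then show ?thesis
      by (rule has_field_derivative_transform_within_open[of _ _ _ "{a<..<b}"]) (use 1 in \<open>auto simp: bump_def w_def\<close>)
  next
    case 2
    have "bump a b s (k + 2) (bump_deriv_poly a b s k P) a = 0" by (simp add: bump_def)
    then show ?thesis using has_derivative_0_if_quadratic[OF C(1)] unfolding 2 by simp
  next
    case 3
    have "bump a b s (k + 2) (bump_deriv_poly a b s k P) b = 0" by (simp add: bump_def)
    then show ?thesis using has_derivative_0_if_quadratic[OF C(2)] unfolding 3 by simp
  next
    case 4
    have "((\<lambda>t. 0) has_real_derivative 0) (at t)" by simp
    then have "(bump a b s k P has_real_derivative 0) (at t)"
      by (rule has_field_derivative_transform_within_open[of _ _ _ "- {a..b}"]) (use 4 in \<open>auto simp: bump_def\<close>)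
    then show ?thesis using 4 by (auto simp: bump_def)
  qed
qed

text \<open>Either partial derivative is again such a product, so the induction runs over
  \<open>j\<close> with all parameters left free.\<close>

lemma bump_product:
  fixes p q :: "real^2"
  assumes "p $ 1 < q $ 1" "p $ 2 < q $ 2" "s > 0"
  shows "C_on j UNIV (\<lambda>x. bump (p $ 1) (q $ 1) s k1 P1 (x $ 1) * bump (p $ 2) (q $ 2) s k2 P2 (x $ 2))"
proof (induction j arbitrary: k1 P1 k2 P2)
  case 0
  have cb: "continuous_on UNIV (bump a b s k P)" if "a < b" for a b k P
    using bump_derivative[OF that assms(3)] by (intro continuous_at_imp_continuous_on) (auto intro: DERIV_isCont)
  have cc: "continuous_on UNIV (\<lambda>x::real^2. bump (p $ i) (q $ i) s k P (x $ i))" if "p $ i < q $ i" for i k P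
    by (rule continuous_on_compose2[OF cb[OF that]]) (intro continuous_intros, simp)
  show ?case unfolding C_on.simps by (intro continuous_on_mult cc assms)
next
  case (Suc j)
  let ?f = "\<lambda>x::real^2. bump (p $ 1) (q $ 1) s k1 P1 (x $ 1)" and ?g = "\<lambda>x::real^2. bump (p $ 2) (q $ 2) s k2 P2 (x $ 2)"
  have der: "((\<lambda>x::real^2. bump (p $ i) (q $ i) s k P (x $ i)) has_derivative
      (\<lambda>h. bump (p $ i) (q $ i) s (k + 2) (bump_deriv_poly (p $ i) (q $ i) s k P) (x $ i) * h $ i)) (at x)"
    if "p $ i < q $ i" for i k P x
    using has_derivative_compose[OF bounded_linear_imp_has_derivative[OF bounded_linear_vec_nth]
      bump_derivative[OF that assms(3), unfolded has_field_derivative_def]] .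
  have d: "((\<lambda>x. ?f x * ?g x) has_derivative (\<lambda>h. 
     ?f x * (bump (p $ 2) (q $ 2) s (k2 + 2) (bump_deriv_poly (p $ 2) (q $ 2) s k2 P2) (x $ 2) * h $ 2) +
     bump (p $ 1) (q $ 1) s (k1 + 2) (bump_deriv_poly (p $ 1) (q $ 1) s k1 P1) (x $ 1) * h $ 1 * ?g x)) (at x)" for x
    by (rule has_derivative_mult[OF der[OF assms(1)] der[OF assms(2)]])
  have p: "partial 1 (\<lambda>x. ?f x * ?g x) = (\<lambda>x. bump (p $ 1) (q $ 1) s (k1 + 2) (bump_deriv_poly (p $ 1) (q $ 1) s k1 P1) (x $ 1) * ?g x)"
    "partial 2 (\<lambda>x. ?f x * ?g x) = (\<lambda>x. ?f x * bump (p $ 2) (q $ 2) s (k2 + 2) (bump_deriv_poly (p $ 2) (q $ 2) s k2 P2) (x $ 2))"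
    using partial_eq[OF d] by (auto simp: axis_def)
  have "C_on j UNIV (partial i (\<lambda>x. ?f x * ?g x))" for i
  proof (cases "i = 1")
    case True
    show ?thesis unfolding True p by (rule Suc.IH)
  next
    case False
    then have i: "i = 2" using exhaust_2[of i] by blast
    show ?thesis unfolding i p by (rule Suc.IH)
  qed
  moreover have "(\<lambda>x. ?f x * ?g x) differentiable (at x)" for x using d unfolding differentiable_def by blast
  ultimately show ?case by simp
qed

lemma test_function_bump:
  fixes p q :: "real^2"
  assumes "p $ 1 < q $ 1" "p $ 2 < q $ 2" "s > 0" "cbox p q \<subseteq> U"
  shows "test_function U (\<lambda>x. bump (p $ 1) (q $ 1) s 0 1 (x $ 1) * bump (p $ 2) (q $ 2) s 0 1 (x $ 2))"
  unfolding test_function_def smooth_on_def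
proof (intro conjI allI exI)
  show "C_on k UNIV (\<lambda>x. bump (p $ 1) (q $ 1) s 0 1 (x $ 1) * bump (p $ 2) (q $ 2) s 0 1 (x $ 2))" for k
    by (rule bump_product[OF assms(1-3)])
  show "compact (cbox p q)" "cbox p q \<subseteq> U" using assms(4) by auto
  show "x \<notin> cbox p q \<longrightarrow> bump (p $ 1) (q $ 1) s 0 1 (x $ 1) * bump (p $ 2) (q $ 2) s 0 1 (x $ 2) = 0" for x
    by (auto simp: bump_def mem_box_cart forall_2)
qed

section \<open>The fundamental lemma of the calculus of variations\<close>

text \<open>Smooth bumps with parameter \<open>inverse (Suc n)\<close> lie between 0 and 1 and tend
  to the indicator of the open box, so the vanishing passes from test functions to boxes by
  dominated convergence.\<close>

lemma integral_box_eq_0: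
  fixes f :: "real^2 \<Rightarrow> 'b::euclidean_space"
  assumes f: "locally_integrable_on f U" and box: "cbox p q \<subseteq> U"
    and test: "\<And>\<phi>. test_function U \<phi> \<Longrightarrow> (LINT x:U|lebesgue. \<phi> x *\<^sub>R f x) = 0"
  shows "(LINT x:box p q|lebesgue. f x) = 0"
proof (cases "p $ 1 < q $ 1 \<and> p $ 2 < q $ 2")
  case False
  then have "box p q = {}" by (force simp: set_eq_iff mem_box_cart forall_2)
  then show ?thesis by (simp add: set_lebesgue_integral_def)
next
  case True
  define \<phi> where "\<phi> n x = bump (p $ 1) (q $ 1) (inverse (Suc n)) 0 1 (x $ 1) * bump (p $ 2) (q $ 2) (inverse (Suc n)) 0 1 (x $ 2)" for n :: nat and x :: "real^2"
  have \<phi>t: "test_function U (\<phi> n)" for n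
    unfolding \<phi>_def[abs_def] by (rule test_function_bump) (use True box in auto)
  have b01: "0 \<le> bump a b s 0 1 t" "s > 0 \<Longrightarrow> bump a b s 0 1 t \<le> 1" for a b s t
    by (auto simp: bump_def intro!: divide_nonneg_pos)
  have \<phi>01: "0 \<le> \<phi> n x" "\<phi> n x \<le> 1" for n x
    unfolding \<phi>_def using b01 by (auto intro!: mult_le_one)
  have \<phi>0: "\<phi> n x = 0" if "x \<notin> box p q" for n x
    using that by (auto simp: \<phi>_def bump_def mem_box_cart forall_2)
  have \<phi>lim: "(\<lambda>n. \<phi> n x) \<longlonglongrightarrow> 1" if "x \<in> box p q" for x
  proof -
    have b1: "(\<lambda>n. bump a b (inverse (Suc n)) 0 1 t) \<longlonglongrightarrow> 1" if "a < t" "t < b" for a b t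
    proof -
      have "(\<lambda>n. exp (- inverse (real (Suc n)) / ((t - a) * (b - t)))) \<longlonglongrightarrow> exp (- 0 / ((t - a) * (b - t)))"
        by (intro tendsto_intros LIMSEQ_inverse_real_of_nat) (use that in auto)
      then show ?thesis using that by (simp add: bump_def)
    qed
    have "(\<lambda>n. \<phi> n x) \<longlonglongrightarrow> 1 * 1"
      unfolding \<phi>_def by (intro tendsto_mult b1) (use that in \<open>auto simp: mem_box_cart\<close>)
    then show ?thesis by simp
  qed
  have c\<phi>: "\<phi> n \<in> borel_measurable lebesgue" for n
  proof -
    have "C_on 0 UNIV (\<phi> n)" using \<phi>t[of n] unfolding test_function_def smooth_on_def by blast
    then have "\<phi> n \<in> borel_measurable borel" by (auto intro: borel_measurable_continuous_onI)
    then show ?thesis by (simp add: borel_measurable_if_I measurable_completion)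
  qed
  have fint: "integrable lebesgue (\<lambda>x. indicator (cbox p q) x *\<^sub>R f x)"
    using f box unfolding locally_integrable_on_def set_integrable_def by simp
  have fbox: "integrable lebesgue (\<lambda>x. indicator (box p q) x *\<^sub>R f x)"
    using set_integrable_subset[of lebesgue "cbox p q" f "box p q"] fint box_subset_cbox[of p q]
    by (simp add: set_integrable_def)
  have eq: "indicator U x *\<^sub>R (\<phi> n x *\<^sub>R f x) = \<phi> n x *\<^sub>R (indicator (box p q) x *\<^sub>R f x)" for n x
    using \<phi>0[of x n] box box_subset_cbox[of p q] by (cases "x \<in> box p q") (auto simp: indicator_def)
  have "(\<lambda>n. \<integral>x. \<phi> n x *\<^sub>R (indicator (box p q) x *\<^sub>R f x) \<partial>lebesgue) \<longlonglongrightarrow> (\<integral>x. indicator (box p q) x *\<^sub>R f x \<partial>lebesgue)"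
  proof (rule integral_dominated_convergence[where w="\<lambda>x. norm (indicator (box p q) x *\<^sub>R f x)"])
    show "(\<lambda>x. indicator (box p q) x *\<^sub>R f x) \<in> borel_measurable lebesgue" using fbox by (rule borel_measurable_integrable)
    then show "(\<lambda>x. \<phi> n x *\<^sub>R (indicator (box p q) x *\<^sub>R f x)) \<in> borel_measurable lebesgue" for n
      by (rule borel_measurable_scaleR[OF c\<phi>])
    show "integrable lebesgue (\<lambda>x. norm (indicator (box p q) x *\<^sub>R f x))" using fbox by (rule integrable_norm)
    show "AE x in lebesgue. (\<lambda>n. \<phi> n x *\<^sub>R (indicator (box p q) x *\<^sub>R f x)) \<longlonglongrightarrow> indicator (box p q) x *\<^sub>R f x"
    proof (rule AE_I2)
      fix x
      show "(\<lambda>n. \<phi> n x *\<^sub>R (indicator (box p q) x *\<^sub>R f x)) \<longlonglongrightarrow> indicator (box p q) x *\<^sub>R f x"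
        using tendsto_scaleR[OF \<phi>lim tendsto_const, of x "f x"] by (cases "x \<in> box p q") auto
    qed
    show "AE x in lebesgue. norm (\<phi> n x *\<^sub>R (indicator (box p q) x *\<^sub>R f x)) \<le> norm (indicator (box p q) x *\<^sub>R f x)" for n
    proof (rule AE_I2)
      fix x
      have "\<bar>\<phi> n x\<bar> * norm (indicator (box p q) x *\<^sub>R f x) \<le> 1 * norm (indicator (box p q) x *\<^sub>R f x)"
        using \<phi>01[of n x] by (intro mult_right_mono) auto
      then show "norm (\<phi> n x *\<^sub>R (indicator (box p q) x *\<^sub>R f x)) \<le> norm (indicator (box p q) x *\<^sub>R f x)"
        by (simp only: norm_scaleR[of "\<phi> n x"] mult_1)
    qed
  qed
  moreover have "(\<integral>x. \<phi> n x *\<^sub>R (indicator (box p q) x *\<^sub>R f x) \<partial>lebesgue) = 0" for n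
    using test[OF \<phi>t[of n]] unfolding set_lebesgue_integral_def eq .
  ultimately have "(\<lambda>n. 0 :: 'b) \<longlonglongrightarrow> (\<integral>x. indicator (box p q) x *\<^sub>R f x \<partial>lebesgue)" by (simp only:)
  from LIMSEQ_unique[OF this tendsto_const] show ?thesis unfolding set_lebesgue_integral_def .
qed

lemma sigma_finite_lebesgue: "sigma_finite_measure (lebesgue :: 'a::euclidean_space measure)"
proof
  show "\<exists>A. countable A \<and> A \<subseteq> sets (lebesgue :: 'a measure) \<and> \<Union>A = space lebesgue \<and> (\<forall>a\<in>A. emeasure lebesgue a \<noteq> (\<infinity> :: ennreal))"
  proof (intro exI[of _ "range (\<lambda>n. cball (0::'a) (real n))"] conjI ballI)
    show "\<Union> (range (\<lambda>n. cball (0::'a) (real n))) = space lebesgue"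
      using real_arch_simple by (auto simp: set_eq_iff)
    fix a assume "a \<in> range (\<lambda>n. cball (0::'a) (real n))"
    then have "compact a" by auto
    then show "emeasure lebesgue a \<noteq> \<infinity>"
      using emeasure_compact_finite[of a] by (simp add: compact_imp_closed borel_closed emeasure_completion less_top[symmetric])
  qed auto
qed

text \<open>Open boxes are closed under intersection and generate the Borel sets, so vanishing
  integrals spread to all Borel sets, and to Lebesgue sets up to null sets; an integrable function
  with all integrals zero is zero almost everywhere.\<close>

lemma AE_eq_0_on_box:
  fixes f :: "real^2 \<Rightarrow> 'b::euclidean_space"
  assumes int: "set_integrable lebesgue (box p q) f"
    and 0: "\<And>a b. cbox a b \<subseteq> cbox p q \<Longrightarrow> (LINT x:box a b|lebesgue. f x) = 0"
  shows "AE x in lebesgue. x \<in> box p q \<longrightarrow> f x = 0"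
proof -
  \<comment> \<open>Extension by zero turns the claim into one about all measurable sets of the
    plane.\<close>
  define F where "F x = indicator (box p q) x *\<^sub>R f x" for x
  have F: "integrable lebesgue F" using int by (simp add: F_def[abs_def] set_integrable_def)
  have FA: "integrable lebesgue (\<lambda>x. indicator A x *\<^sub>R F x)" if "A \<in> sets lebesgue" for A
    using F that by (rule integrable_mult_indicator[rotated])
  have F0: "integral\<^sup>L lebesgue F = 0"
    using 0[of p q] by (simp add: F_def[abs_def] set_lebesgue_integral_def)
  have borel: "(\<integral>x. indicator A x *\<^sub>R F x \<partial>lebesgue) = 0" if A: "A \<in> sets borel" for A
  proof -
    have Asig: "A \<in> sigma_sets UNIV (range (\<lambda>(a, b). box a b))"
      using A by (simp add: borel_eq_box sets_measure_of)
    have ist: "Int_stable (range (\<lambda>(a, b). box a b :: (real^2) set))"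
      by (auto simp: Int_stable_def box_Int_box)
    have pw: "range (\<lambda>(a, b). box a b :: (real^2) set) \<subseteq> Pow UNIV" by simp
    from Asig show ?thesis
    proof (induction A rule: sigma_sets_induct_disjoint[OF ist pw, consumes 1, case_names basic empty compl union])
      case (basic B)
      then obtain a b where B: "B = box a b" by auto
      show ?case
      proof (cases "box a b \<inter> box p q = {}")
        case True
        then have "indicator B x *\<^sub>R F x = 0" for x by (auto simp: F_def B indicator_def)
        then show ?thesis by (simp only: Bochner_Integration.integral_zero)
      next
        case False
        \<comment> \<open>The assumption speaks of closed boxes; for nonempty open boxes, taking
          closures turns the inclusion of the intersection into that of the closed boxes.\<close>
        obtain c d where cd: "box a b \<inter> box p q = box c d" using box_Int_box[of a b p q] by blast
        then have "closure (box c d) \<subseteq> closure (box p q)" by (intro closure_mono) blast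
        moreover have "box c d \<noteq> {}" "box p q \<noteq> {}" using cd False by auto
        ultimately have "cbox c d \<subseteq> cbox p q" by (simp add: closure_box)
        moreover have "indicator B x *\<^sub>R F x = indicator (box c d) x *\<^sub>R f x" for x
          unfolding cd[symmetric] by (simp add: F_def B indicator_inter_arith)
        ultimately show ?thesis using 0 by (simp add: set_lebesgue_integral_def)
      qed
    next
      case empty
      then show ?case by simp
    next
      case (compl B)
      then have B: "B \<in> sets lebesgue" by (auto simp: borel_eq_box sets_measure_of)
      have "indicator (UNIV - B) x *\<^sub>R F x = F x - indicator B x *\<^sub>R F x" for x by (auto simp: indicator_def)
      then show ?case using F0 compl.IH Bochner_Integration.integral_diff[OF F FA[OF B]] by simp
    next
      case (union B)
      have B: "B i \<in> sets lebesgue" for i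
      proof -
        have "B i \<in> sigma_sets UNIV (range (\<lambda>(a, b). box a b))" using union(2) by blast
        then have "B i \<in> sets (borel :: (real^2) measure)" unfolding borel_eq_box by (simp add: sets_measure_of)
        then show ?thesis by simp
      qed
      have "set_integrable lebesgue (\<Union>i. B i) F"
        unfolding set_integrable_def using B by (intro FA) auto
      moreover have "B i \<inter> B j = {}" if "i \<noteq> j" for i j
        using union(1) that by (auto simp: disjoint_family_on_def)
      ultimately have "set_lebesgue_integral lebesgue (\<Union> (range B)) F = (\<Sum>i. set_lebesgue_integral lebesgue (B i) F)"
        using B by (intro lebesgue_integral_countable_add)
      then show ?case using union.IH by (simp add: set_lebesgue_integral_def)
    qed
  qed
  have leb: "(\<integral>x. indicator A x *\<^sub>R F x \<partial>lebesgue) = 0" if A: "A \<in> sets lebesgue" for A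
  proof -
    obtain S N N' where S: "A = S \<union> N" "N \<subseteq> N'" "N' \<in> null_sets lborel" "S \<in> sets lborel"
      using A by (elim sets_completionE) blast
    have N': "AE x in lebesgue. x \<notin> N'" using S(3) by (intro AE_not_in null_sets_completionI)
    have "(\<integral>x. indicator A x *\<^sub>R F x \<partial>lebesgue) = (\<integral>x. indicator S x *\<^sub>R F x \<partial>lebesgue)"
    proof (rule integral_cong_AE)
      show "AE x in lebesgue. indicator A x *\<^sub>R F x = indicator S x *\<^sub>R F x"
        using N' by eventually_elim (use S in \<open>auto simp: indicator_def\<close>)
      show "(\<lambda>x. indicator A x *\<^sub>R F x) \<in> borel_measurable lebesgue" using FA[OF A] by (rule borel_measurable_integrable)
      show "(\<lambda>x. indicator S x *\<^sub>R F x) \<in> borel_measurable lebesgue"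
        using FA[of S] S(4) by (auto intro: borel_measurable_integrable)
    qed
    then show ?thesis using borel S(4) by simp
  qed
  have "AE x in lebesgue. F x = 0"
  proof (rule sigma_finite_measure.density_unique_banach[OF sigma_finite_lebesgue F])
    show "integrable lebesgue (\<lambda>x. 0 :: 'b)" by simp
    show "set_lebesgue_integral lebesgue A F = set_lebesgue_integral lebesgue A (\<lambda>x. 0)" if "A \<in> sets lebesgue" for A
      using leb[OF that] by (simp add: set_lebesgue_integral_def)
  qed
  then show ?thesis by eventually_elim (auto simp: F_def indicator_def)
qed

text \<open>\<open>U\<close> is a union of countably many closed boxes, whose boundaries are
  negligible.\<close>

lemma fundamental_lemma:
  fixes f :: "real^2 \<Rightarrow> 'b::euclidean_space"
  assumes U: "open U" and f: "locally_integrable_on f U"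
    and test: "\<And>\<phi>. test_function U \<phi> \<Longrightarrow> (LINT x:U|lebesgue. \<phi> x *\<^sub>R f x) = 0"
  shows "AE x in lebesgue. x \<in> U \<longrightarrow> f x = 0"
proof -
  obtain D where D: "countable D" "D \<subseteq> Pow U" "\<And>X. X \<in> D \<Longrightarrow> \<exists>a b. X = cbox a b" "\<Union>D = U"
    using open_countable_Union_open_cbox[OF U] by metis
  have "AE x in lebesgue. x \<in> X \<longrightarrow> f x = 0" if XD: "X \<in> D" for X
  proof -
    obtain p q where X: "X = cbox p q" using D(3)[OF XD] by blast
    have pq: "cbox p q \<subseteq> U" using D(2) XD X by blast
    have "set_integrable lebesgue (cbox p q) f" using f pq unfolding locally_integrable_on_def by simp
    then have "set_integrable lebesgue (box p q) f"
      by (rule set_integrable_subset) (use box_subset_cbox in auto)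
    then have 1: "AE x in lebesgue. x \<in> box p q \<longrightarrow> f x = 0"
      by (rule AE_eq_0_on_box) (use integral_box_eq_0[OF f _ test] pq in blast)
    have "negligible (cbox p q - box p q)" by (rule negligible_frontier_interval)
    then have "AE x in lebesgue. x \<notin> cbox p q - box p q"
      by (intro AE_not_in) (simp add: negligible_iff_null_sets)
    with 1 show ?thesis by eventually_elim (auto simp: X)
  qed
  then have "AE x in lebesgue. \<forall>X\<in>D. x \<in> X \<longrightarrow> f x = 0"
    unfolding AE_ball_countable[OF D(1)] by blast
  then show ?thesis by eventually_elim (use D(4) in blast)
qed

section \<open>A pointwise Sobolev bound\<close>

lemma vector_2_axis: "(vector [a, b] :: real^2) = a *\<^sub>R axis 1 1 + b *\<^sub>R axis 2 1"
  by (simp add: vec_eq_iff forall_2 axis_def)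

lemma Basis_vec2: "(Basis :: (real^2) set) = {axis 1 1, axis 2 1}"
  by (auto simp: Basis_vec_def UNIV_2)

lemma axis_neq: "axis 1 1 \<noteq> (axis 2 1 :: real^2)"
  by (simp add: axis_eq_axis)

lemma measurable_vector_2: "(\<lambda>(a, b). vector [a, b] :: real^2) \<in> lborel \<Otimes>\<^sub>M lborel \<rightarrow>\<^sub>M borel"
proof -
  have "(\<lambda>(a, b). vector [a, b] :: real^2) \<in> borel_measurable (borel \<Otimes>\<^sub>M borel)"
    unfolding borel_prod vector_2_axis split_beta' by (intro borel_measurable_continuous_onI continuous_intros)
  then show ?thesis by (simp cong: measurable_cong_sets sets_pair_measure_cong)
qed

text \<open>Lebesgue measure is determined by its values on boxes; this makes iterated integrals
  available on \<open>real^2\<close>.\<close>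

lemma lborel_vector_2: "(lborel :: (real^2) measure) = distr (lborel \<Otimes>\<^sub>M lborel) borel (\<lambda>(a, b). vector [a, b])"
proof (rule lborel_eqI)
  fix l u :: "real^2"
  assume le: "\<And>b. b \<in> Basis \<Longrightarrow> l \<bullet> b \<le> u \<bullet> b"
  have lu: "l $ 1 \<le> u $ 1" "l $ 2 \<le> u $ 2"
    using le[of "axis 1 1"] le[of "axis 2 1"] by (auto simp: Basis_vec2 inner_axis)
  have "(\<lambda>(a, b). vector [a, b] :: real^2) -` box l u \<inter> space (lborel \<Otimes>\<^sub>M lborel) = {l $ 1<..<u $ 1} \<times> {l $ 2<..<u $ 2}"
    by (auto simp: mem_box_cart forall_2 space_pair_measure)
  then have "emeasure (distr (lborel \<Otimes>\<^sub>M lborel) borel (\<lambda>(a, b). vector [a, b])) (box l u)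
    = emeasure (lborel \<Otimes>\<^sub>M lborel) ({l $ 1<..<u $ 1} \<times> {l $ 2<..<u $ 2})"
    by (simp add: emeasure_distr measurable_vector_2)
  also have "\<dots> = ennreal (u $ 1 - l $ 1) * ennreal (u $ 2 - l $ 2)"
    using lu by (simp add: lborel.emeasure_pair_measure_Times)
  also have "\<dots> = ennreal (\<Prod>b\<in>Basis. (u - l) \<bullet> b)"
    using lu by (simp add: Basis_vec2 axis_neq inner_axis ennreal_mult)
  finally show "emeasure (distr (lborel \<Otimes>\<^sub>M lborel) borel (\<lambda>(a, b). vector [a, b])) (box l u) = ennreal (\<Prod>b\<in>Basis. (u - l) \<bullet> b)" .
qed simp

lemma nn_integral_vector_2:
  assumes f: "f \<in> borel_measurable borel"
  shows "(\<integral>\<^sup>+x. f x \<partial>(lborel :: (real^2) measure)) = (\<integral>\<^sup>+a. \<integral>\<^sup>+b. f (vector [a, b]) \<partial>lborel \<partial>lborel)"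
proof -
  have "(\<lambda>p. f (case p of (a, b) \<Rightarrow> vector [a, b])) \<in> borel_measurable (lborel \<Otimes>\<^sub>M lborel)"
    using measurable_compose[OF measurable_vector_2 f] .
  from lborel.nn_integral_fst[OF this]
  have "(\<integral>\<^sup>+a. \<integral>\<^sup>+b. f (vector [a, b]) \<partial>lborel \<partial>lborel) = (\<integral>\<^sup>+p. f (case p of (a, b) \<Rightarrow> vector [a, b]) \<partial>(lborel \<Otimes>\<^sub>M lborel))"
    by simp
  also have "\<dots> = (\<integral>\<^sup>+x. f x \<partial>distr (lborel \<Otimes>\<^sub>M lborel) borel (\<lambda>(a, b). vector [a, b]))"
    using f by (subst nn_integral_distr[OF measurable_vector_2]) auto
  also have "\<dots> = (\<integral>\<^sup>+x. f x \<partial>lborel)" by (simp only: lborel_vector_2[symmetric])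
  finally show ?thesis ..
qed

lemma nn_integral_interval_continuous:
  fixes g :: "real \<Rightarrow> real"
  assumes "continuous_on {a..b} g" "\<And>t. t \<in> {a..b} \<Longrightarrow> g t \<ge> 0"
  shows "(\<integral>\<^sup>+t. indicator {a..b} t * ennreal (g t) \<partial>lborel) = ennreal (integral {a..b} g)"
proof -
  have i: "set_integrable lborel {a..b} g"
    unfolding set_integrable_def by (rule borel_integrable_compact[OF compact_Icc assms(1)])
  have "(\<integral>\<^sup>+t. indicator {a..b} t * ennreal (g t) \<partial>lborel) = (\<integral>\<^sup>+t. ennreal (indicator {a..b} t *\<^sub>R g t) \<partial>lborel)"
    by (intro nn_integral_cong) (simp add: indicator_def)
  also have "\<dots> = ennreal (\<integral>t. indicator {a..b} t *\<^sub>R g t \<partial>lborel)"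
    using i assms(2) by (intro nn_integral_eq_integral) (auto simp: set_integrable_def indicator_def)
  also have "(\<integral>t. indicator {a..b} t *\<^sub>R g t \<partial>lborel) = integral {a..b} g"
    using set_borel_integral_eq_integral(2)[OF i] by (simp add: set_lebesgue_integral_def)
  finally show ?thesis .
qed

text \<open>For each \<open>s\<close> the value at \<open>x\<close> is bounded by that at
  \<open>s\<close> plus the integral of the derivative; integrating over \<open>s\<close> removes
  the dependence on a particular point.\<close>

lemma sobolev_1d:
  fixes f f' :: "real \<Rightarrow> 'b::euclidean_space"
  assumes d: "0 < \<delta>" and f: "\<And>t. t \<in> {x..x+\<delta>} \<Longrightarrow> (f has_vector_derivative f' t) (at t)"
    and f': "continuous_on {x..x+\<delta>} f'"
  shows "ennreal (\<delta> * norm (f x)) \<le> (\<integral>\<^sup>+t. indicator {x..x+\<delta>} t * ennreal (norm (f t) + \<delta> * norm (f' t)) \<partial>lborel)"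
proof -
  let ?I = "{x..x+\<delta>}"
  have cf: "continuous_on ?I f"
    using f by (meson continuous_at_imp_continuous_on has_vector_derivative_continuous)
  define J where "J = integral ?I (\<lambda>t. norm (f' t))"
  have iJ: "(\<lambda>t. norm (f' t)) integrable_on ?I" and iN: "(\<lambda>t. norm (f t)) integrable_on ?I"
    by (intro integrable_continuous_real continuous_intros f' cf)+
  have pw: "norm (f x) \<le> norm (f s) + J" if s: "s \<in> ?I" for s
  proof -
    have sub: "{x..s} \<subseteq> ?I" using s by auto
    have "(f' has_integral (f s - f x)) {x..s}"
      using s f sub by (intro fundamental_theorem_of_calculus) (auto intro: has_vector_derivative_at_within)
    then have "norm (f s - f x) \<le> integral {x..s} (\<lambda>t. norm (f' t))"
      using continuous_on_subset[OF f' sub]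
      by (metis integral_unique integral_norm_bound_integral integrable_continuous_real continuous_on_norm order_refl)
    also have "\<dots> \<le> J" unfolding J_def
      using sub iJ integrable_continuous_real[OF continuous_on_norm[OF continuous_on_subset[OF f' sub]]]
      by (intro integral_subset_le) auto
    finally show ?thesis using norm_triangle_ineq2[of "f x" "f s"] by (simp add: norm_minus_commute)
  qed
  have "\<delta> * norm (f x) = integral ?I (\<lambda>s. norm (f x))" using d by simp
  also have "\<dots> \<le> integral ?I (\<lambda>s. norm (f s) + J)"
    using pw iN by (intro integral_le integrable_add) auto
  also have "\<dots> = integral ?I (\<lambda>s. norm (f s)) + \<delta> * J"
    using iN d by (subst integral_add) auto
  also have "\<dots> = integral ?I (\<lambda>s. norm (f s) + \<delta> * norm (f' s))"
    using iN iJ by (subst integral_add) (auto simp: J_def intro: integrable_on_mult_right)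
  finally have "ennreal (\<delta> * norm (f x)) \<le> ennreal (integral ?I (\<lambda>s. norm (f s) + \<delta> * norm (f' s)))"
    by (rule ennreal_leI)
  also have "\<dots> = (\<integral>\<^sup>+t. indicator ?I t * ennreal (norm (f t) + \<delta> * norm (f' t)) \<partial>lborel)"
    using d by (intro nn_integral_interval_continuous[symmetric] continuous_intros cf f') auto
  finally show ?thesis .
qed

text \<open>The one-dimensional bound is used along the first axis, and then along the second for
  both \<open>w\<close> and \<open>partial 1 w\<close>; the only second derivative this creates is
  the mixed one. Side length at most 1 lets the powers of \<delta> on the right be dropped.\<close>

lemma sobolev_square:
  fixes w :: "real^2 \<Rightarrow> 'b::euclidean_space"
  assumes S: "C_on 2 S w" and Q: "cbox p (p + vector [\<delta>, \<delta>]) \<subseteq> S" and d: "0 < \<delta>" "\<delta> \<le> 1"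
  shows "ennreal (\<delta> * \<delta> * norm (w p)) \<le> (\<integral>\<^sup>+x. indicator (cbox p (p + vector [\<delta>, \<delta>])) x *
    ennreal (norm (w x) + norm (partial 1 w x) + norm (partial 2 w x) + norm (partial 2 (partial 1 w) x)) \<partial>lborel)"
proof -
  define Q where "Q = cbox p (p + vector [\<delta>, \<delta>])"
  define s where "s x = norm (w x) + norm (partial 1 w x) + norm (partial 2 w x) + norm (partial 2 (partial 1 w) x)" for x
  let ?I = "{p $ 1..p $ 1 + \<delta>}" and ?J = "{p $ 2..p $ 2 + \<delta>}"
  have QS: "Q \<subseteq> S" using Q by (simp add: Q_def)
  have inQ: "vector [a, b] \<in> Q \<longleftrightarrow> a \<in> ?I \<and> b \<in> ?J" for a b
    by (auto simp: Q_def mem_box_cart forall_2)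
  have c: "continuous_on Q w" "continuous_on Q (partial i w)" "continuous_on Q (partial j (partial i w))" for i j
    using S C_on_continuous_on[OF S] C_on_continuous_on[of 1 S "partial i w"] 
    by (auto simp: C_on_2 C_on_1 intro: continuous_on_subset[OF _ QS])
  have dw: "w differentiable (at x)" "partial i w differentiable (at x)" if "x \<in> Q" for x i
    using S that QS by (auto simp: C_on_2 C_on_1)
  have cv: "continuous_on A (\<lambda>t. vector [f t, g t] :: real^2)" if "continuous_on A f" "continuous_on A g" for A f and g :: "real \<Rightarrow> real"
    unfolding vector_2_axis by (intro continuous_intros that)
  have ax: "(vector [a, b] :: real^2) = vector [0, b] + a *\<^sub>R axis 1 1" "(vector [a, b] :: real^2) = vector [a, 0] + b *\<^sub>R axis 2 1" for a b
    by (simp_all add: vector_2_axis)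
  have d1: "((\<lambda>a. f (vector [a, b])) has_vector_derivative partial 1 f (vector [a, b])) (at a)"
    if "f differentiable (at (vector [a, b]))" for f :: "real^2 \<Rightarrow> 'b" and a b
    using has_vector_derivative_along_axis[of f "vector [0, b]" a 1] that by (simp only: ax(1)[symmetric])
  have d2: "((\<lambda>b. f (vector [a, b])) has_vector_derivative partial 2 f (vector [a, b])) (at b)"
    if "f differentiable (at (vector [a, b]))" for f :: "real^2 \<Rightarrow> 'b" and a b
    using has_vector_derivative_along_axis[of f "vector [a, 0]" b 2] that by (simp only: ax(2)[symmetric])
  have ms: "(\<lambda>x. indicator Q x * ennreal (s x)) \<in> borel_measurable borel"
  proof -
    have "continuous_on Q s" unfolding s_def by (intro continuous_intros c)
    then have "(\<lambda>x. indicator Q x *\<^sub>R s x) \<in> borel_measurable borel"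
      by (intro borel_measurable_continuous_on_indicator) (simp_all add: Q_def)
    then have "(\<lambda>x. ennreal (indicator Q x *\<^sub>R s x)) \<in> borel_measurable borel" by measurable
    moreover have "ennreal (indicator Q x *\<^sub>R s x) = indicator Q x * ennreal (s x)" for x by (simp add: indicator_def)
    ultimately show ?thesis by simp
  qed
  have b0: "p $ 2 \<in> ?J" using d by simp
  have col: "ennreal (\<delta> * (norm (w (vector [a, p $ 2])) + \<delta> * norm (partial 1 w (vector [a, p $ 2]))))
     \<le> (\<integral>\<^sup>+b. indicator ?J b * ennreal (s (vector [a, b])) \<partial>lborel)" if a: "a \<in> ?I" for a
  proof -
    have cw: "continuous_on ?J (\<lambda>b. w (vector [a, b]))" "continuous_on ?J (\<lambda>b. partial i w (vector [a, b]))"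
       "continuous_on ?J (\<lambda>b. partial 2 (partial 1 w) (vector [a, b]))" for i
      by (rule continuous_on_compose2[OF c(1)] continuous_on_compose2[OF c(2)] continuous_on_compose2[OF c(3)],
          intro cv continuous_intros, use a inQ in force)+
    have 1: "ennreal (\<delta> * norm (w (vector [a, p $ 2]))) \<le>
      (\<integral>\<^sup>+b. indicator ?J b * ennreal (norm (w (vector [a, b])) + \<delta> * norm (partial 2 w (vector [a, b]))) \<partial>lborel)"
      by (rule sobolev_1d[OF d(1) _ cw(2)]) (use a in \<open>intro d2 dw, simp add: inQ\<close>)
    have 2: "ennreal (\<delta> * norm (partial 1 w (vector [a, p $ 2]))) \<le>
      (\<integral>\<^sup>+b. indicator ?J b * ennreal (norm (partial 1 w (vector [a, b])) + \<delta> * norm (partial 2 (partial 1 w) (vector [a, b]))) \<partial>lborel)"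
      by (rule sobolev_1d[OF d(1) _ cw(3)]) (use a in \<open>intro d2 dw, simp add: inQ\<close>)
    have meas: "(\<lambda>b. indicator ?J b * ennreal (g b)) \<in> borel_measurable lborel" if "continuous_on ?J g" for g
    proof -
      have "(\<lambda>x. indicator ?J x *\<^sub>R g x) \<in> borel_measurable borel"
        using that by (intro borel_measurable_continuous_on_indicator) simp_all
      then have "(\<lambda>x. ennreal (indicator ?J x *\<^sub>R g x)) \<in> borel_measurable borel" by measurable
      moreover have "ennreal (indicator ?J x *\<^sub>R g x) = indicator ?J x * ennreal (g x)" for x by (simp add: indicator_def)
      ultimately show ?thesis by simp
    qed
    have "\<delta> * (norm (w (vector [a, p $ 2])) + \<delta> * norm (partial 1 w (vector [a, p $ 2])))
      \<le> \<delta> * norm (w (vector [a, p $ 2])) + \<delta> * norm (partial 1 w (vector [a, p $ 2]))"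
      using d by (simp add: distrib_left mult_left_le_one_le)
    then have "ennreal (\<delta> * (norm (w (vector [a, p $ 2])) + \<delta> * norm (partial 1 w (vector [a, p $ 2]))))
      \<le> ennreal (\<delta> * norm (w (vector [a, p $ 2]))) + ennreal (\<delta> * norm (partial 1 w (vector [a, p $ 2])))"
      using d by (simp add: ennreal_plus[symmetric] ennreal_leI del: ennreal_plus)
    also have "\<dots> \<le> (\<integral>\<^sup>+b. indicator ?J b * ennreal (norm (w (vector [a, b])) + \<delta> * norm (partial 2 w (vector [a, b])))
       + indicator ?J b * ennreal (norm (partial 1 w (vector [a, b])) + \<delta> * norm (partial 2 (partial 1 w) (vector [a, b]))) \<partial>lborel)"
    proof -
      have m1: "(\<lambda>b. indicator ?J b * ennreal (norm (w (vector [a, b])) + \<delta> * norm (partial 2 w (vector [a, b])))) \<in> borel_measurable lborel"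
        by (rule meas) (intro continuous_intros cw)
      have m2: "(\<lambda>b. indicator ?J b * ennreal (norm (partial 1 w (vector [a, b])) + \<delta> * norm (partial 2 (partial 1 w) (vector [a, b])))) \<in> borel_measurable lborel"
        by (rule meas) (intro continuous_intros cw)
      show ?thesis unfolding nn_integral_add[OF m1 m2] by (intro add_mono 1 2)
    qed
    also have "\<dots> \<le> (\<integral>\<^sup>+b. indicator ?J b * ennreal (s (vector [a, b])) \<partial>lborel)"
    proof (intro nn_integral_mono)
      fix b
      let ?A = "norm (w (vector [a, b])) + \<delta> * norm (partial 2 w (vector [a, b]))"
      let ?B = "norm (partial 1 w (vector [a, b])) + \<delta> * norm (partial 2 (partial 1 w) (vector [a, b]))"
      have "?A + ?B \<le> s (vector [a, b])"
        using d mult_left_le_one_le[of "norm (partial 2 w (vector [a, b]))" \<delta>]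
          mult_left_le_one_le[of "norm (partial 2 (partial 1 w) (vector [a, b]))" \<delta>] by (simp add: s_def)
      then have "ennreal ?A + ennreal ?B \<le> ennreal (s (vector [a, b]))"
        using d by (simp add: ennreal_plus[symmetric] ennreal_leI del: ennreal_plus)
      then show "indicator ?J b * ennreal ?A + indicator ?J b * ennreal ?B \<le> indicator ?J b * ennreal (s (vector [a, b]))"
        by (simp add: indicator_def del: ennreal_plus)
    qed
    finally show ?thesis .
  qed
  have cw: "continuous_on ?I (\<lambda>a. partial 1 w (vector [a, p $ 2]))" "continuous_on ?I (\<lambda>a. w (vector [a, p $ 2]))"
    by (rule continuous_on_compose2[OF c(1)] continuous_on_compose2[OF c(2)],
        intro cv continuous_intros, use b0 inQ in force)+
  have pp: "vector [p $ 1, p $ 2] = p" by (simp add: vec_eq_iff forall_2)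
  have row: "ennreal (\<delta> * norm (w p)) \<le> (\<integral>\<^sup>+a. indicator ?I a * ennreal (norm (w (vector [a, p $ 2])) + \<delta> * norm (partial 1 w (vector [a, p $ 2]))) \<partial>lborel)"
    using sobolev_1d[OF d(1) _ cw(1), of "\<lambda>a. w (vector [a, p $ 2])"] d1 dw(1) inQ b0 by (simp add: pp)
  have mI: "(\<lambda>a. indicator ?I a * ennreal (norm (w (vector [a, p $ 2])) + \<delta> * norm (partial 1 w (vector [a, p $ 2])))) \<in> borel_measurable lborel"
  proof -
    have "(\<lambda>a. indicator ?I a *\<^sub>R (norm (w (vector [a, p $ 2])) + \<delta> * norm (partial 1 w (vector [a, p $ 2])))) \<in> borel_measurable borel"
      by (intro borel_measurable_continuous_on_indicator continuous_intros cw) simp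
    then have "(\<lambda>a. ennreal (indicator ?I a *\<^sub>R (norm (w (vector [a, p $ 2])) + \<delta> * norm (partial 1 w (vector [a, p $ 2]))))) \<in> borel_measurable borel" by measurable
    moreover have "ennreal (indicator ?I a *\<^sub>R y) = indicator ?I a * ennreal y" for a y by (simp add: indicator_def)
    ultimately show ?thesis by simp
  qed
  have "ennreal (\<delta> * \<delta> * norm (w p)) = ennreal \<delta> * ennreal (\<delta> * norm (w p))"
    using d by (simp add: ennreal_mult mult.assoc)
  also have "\<dots> \<le> ennreal \<delta> * (\<integral>\<^sup>+a. indicator ?I a * ennreal (norm (w (vector [a, p $ 2])) + \<delta> * norm (partial 1 w (vector [a, p $ 2]))) \<partial>lborel)"
    by (intro mult_left_mono row) simp
  also have "\<dots> = (\<integral>\<^sup>+a. ennreal \<delta> * (indicator ?I a * ennreal (norm (w (vector [a, p $ 2])) + \<delta> * norm (partial 1 w (vector [a, p $ 2])))) \<partial>lborel)"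
    by (rule nn_integral_cmult[OF mI, symmetric])
  also have "\<dots> \<le> (\<integral>\<^sup>+a. \<integral>\<^sup>+b. indicator Q (vector [a, b]) * ennreal (s (vector [a, b])) \<partial>lborel \<partial>lborel)"
  proof (intro nn_integral_mono)
    fix a
    show "ennreal \<delta> * (indicator ?I a * ennreal (norm (w (vector [a, p $ 2])) + \<delta> * norm (partial 1 w (vector [a, p $ 2]))))
      \<le> (\<integral>\<^sup>+b. indicator Q (vector [a, b]) * ennreal (s (vector [a, b])) \<partial>lborel)"
    proof (cases "a \<in> ?I")
      case True
      have "indicator Q (vector [a, b]) = (indicator ?J b :: ennreal)" for b using True inQ by (simp add: indicator_def)
      then show ?thesis using col[OF True] True d by (simp add: ennreal_mult[symmetric] del: ennreal_plus)
    qed simp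
  qed
  also have "\<dots> = (\<integral>\<^sup>+x. indicator Q x * ennreal (s x) \<partial>lborel)"
    by (rule nn_integral_vector_2[OF ms, symmetric])
  finally show ?thesis by (simp add: Q_def s_def)
qed

text \<open>Instead of the Cauchy--Schwarz inequality,
  \<open>norm y \<le> t + (norm y)\<^sup>2 / t\<close> passes from the norm to its square; the free
  parameter \<open>t\<close> is chosen later to balance the two terms.\<close>

lemma sobolev_pointwise:
  fixes w :: "real^2 \<Rightarrow> 'b::euclidean_space"
  assumes S: "C_on 2 S w" and Q: "cbox p (p + vector [\<delta>, \<delta>]) \<subseteq> U" "U \<subseteq> S" and d: "0 < \<delta>" "\<delta> \<le> 1" and t: "t > 0" and e: "e \<ge> 0"
    and L2: "(\<integral>\<^sup>+x\<in>U. ennreal ((norm (w x))\<^sup>2) \<partial>lborel) \<le> ennreal e"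
      "(\<integral>\<^sup>+x\<in>U. ennreal ((norm (partial 1 w x))\<^sup>2) \<partial>lborel) \<le> ennreal e"
      "(\<integral>\<^sup>+x\<in>U. ennreal ((norm (partial 2 w x))\<^sup>2) \<partial>lborel) \<le> ennreal e"
      "(\<integral>\<^sup>+x\<in>U. ennreal ((norm (partial 2 (partial 1 w) x))\<^sup>2) \<partial>lborel) \<le> ennreal e"
  shows "norm (w p) \<le> 4 * t + 4 * e / (t * (\<delta> * \<delta>))"
proof -
  define Q where "Q = cbox p (p + vector [\<delta>, \<delta>])"
  have QU: "Q \<subseteq> U" using Q by (simp add: Q_def)
  have QS: "Q \<subseteq> S" using Q by (auto simp: Q_def)
  have c: "continuous_on Q w" "continuous_on Q (partial i w)" "continuous_on Q (partial j (partial i w))" for i j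
    using S C_on_continuous_on[OF S] C_on_continuous_on[of 1 S "partial i w"] 
    by (auto simp: C_on_2 C_on_1 intro: continuous_on_subset[OF _ QS])
  have emQ: "emeasure lborel Q = ennreal (\<delta> * \<delta>)"
    unfolding Q_def using d
    by (subst emeasure_lborel_cbox_eq) (auto simp: Basis_vec2 axis_neq inner_axis inner_add_left)
  have meas: "(\<lambda>x. indicator Q x * ennreal (g x)) \<in> borel_measurable lborel" if "continuous_on Q g" for g
  proof -
    have "(\<lambda>x. indicator Q x *\<^sub>R g x) \<in> borel_measurable borel"
      using that by (intro borel_measurable_continuous_on_indicator) (simp_all add: Q_def)
    then have "(\<lambda>x. ennreal (indicator Q x *\<^sub>R g x)) \<in> borel_measurable borel" by measurable
    moreover have "ennreal (indicator Q x *\<^sub>R g x) = indicator Q x * ennreal (g x)" for x by (simp add: indicator_def)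
    ultimately show ?thesis by simp
  qed
  have single: "(\<integral>\<^sup>+x. indicator Q x * ennreal (norm (f x)) \<partial>lborel) \<le> ennreal (t * (\<delta> * \<delta>) + e / t)"
    if cf: "continuous_on Q f" and f: "(\<integral>\<^sup>+x\<in>U. ennreal ((norm (f x))\<^sup>2) \<partial>lborel) \<le> ennreal e" for f :: "real^2 \<Rightarrow> 'b"
  proof -
    have pw: "norm y \<le> t + (norm y)\<^sup>2 / t" for y :: 'b
    proof (cases "norm y \<le> t")
      case True then show ?thesis using t by (simp add: add_increasing2)
    next
      case False
      then have "t * norm y \<le> norm y * norm y" by (intro mult_right_mono) auto
      then have "norm y \<le> (norm y)\<^sup>2 / t" using t by (simp add: field_simps power2_eq_square)
      then show ?thesis using t by simp
    qed
    have "(\<integral>\<^sup>+x. indicator Q x * ennreal (norm (f x)) \<partial>lborel)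
      \<le> (\<integral>\<^sup>+x. ennreal t * indicator Q x + ennreal (1 / t) * (indicator Q x * ennreal ((norm (f x))\<^sup>2)) \<partial>lborel)"
    proof (intro nn_integral_mono)
      fix x
      have "ennreal (norm (f x)) \<le> ennreal (t + (norm (f x))\<^sup>2 / t)" by (rule ennreal_leI[OF pw])
      also have "\<dots> = ennreal t + ennreal (1 / t) * ennreal ((norm (f x))\<^sup>2)"
        using t by (simp add: ennreal_mult[symmetric] ennreal_plus)
      finally show "indicator Q x * ennreal (norm (f x)) \<le> ennreal t * indicator Q x + ennreal (1 / t) * (indicator Q x * ennreal ((norm (f x))\<^sup>2))"
        by (simp add: indicator_def)
    qed
    also have "\<dots> = ennreal t * emeasure lborel Q + ennreal (1 / t) * (\<integral>\<^sup>+x. indicator Q x * ennreal ((norm (f x))\<^sup>2) \<partial>lborel)"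
    proof -
      have mQ: "Q \<in> sets lborel" by (simp add: Q_def)
      have m: "(\<lambda>x. indicator Q x * ennreal ((norm (f x))\<^sup>2)) \<in> borel_measurable lborel"
        by (intro meas continuous_intros cf)
      show ?thesis using m mQ by (subst nn_integral_add) (auto simp: nn_integral_cmult nn_integral_cmult_indicator)
    qed
    also have "\<dots> \<le> ennreal t * ennreal (\<delta> * \<delta>) + ennreal (1 / t) * ennreal e"
    proof (intro add_mono mult_left_mono)
      have "(\<integral>\<^sup>+x. indicator Q x * ennreal ((norm (f x))\<^sup>2) \<partial>lborel) \<le> (\<integral>\<^sup>+x\<in>U. ennreal ((norm (f x))\<^sup>2) \<partial>lborel)"
        using QU by (intro nn_integral_mono) (auto simp: indicator_def)
      then show "(\<integral>\<^sup>+x. indicator Q x * ennreal ((norm (f x))\<^sup>2) \<partial>lborel) \<le> ennreal e" using f by (rule order_trans)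
    qed (simp_all add: emQ)
    also have "\<dots> = ennreal (t * (\<delta> * \<delta>) + e / t)" using t d e by (simp add: ennreal_mult[symmetric] ennreal_plus[symmetric] del: ennreal_plus)
    finally show ?thesis .
  qed
  let ?N = "\<lambda>f. \<integral>\<^sup>+x. indicator Q x * ennreal (norm (f x :: 'b)) \<partial>lborel"
  have "ennreal (\<delta> * \<delta> * norm (w p)) \<le> (\<integral>\<^sup>+x. indicator Q x *
    ennreal (norm (w x) + norm (partial 1 w x) + norm (partial 2 w x) + norm (partial 2 (partial 1 w) x)) \<partial>lborel)"
    using sobolev_square[OF S _ d] QS unfolding Q_def by blast
  also have "\<dots> = (\<integral>\<^sup>+x. indicator Q x * ennreal (norm (w x)) + (indicator Q x * ennreal (norm (partial 1 w x)) 
     + (indicator Q x * ennreal (norm (partial 2 w x)) + indicator Q x * ennreal (norm (partial 2 (partial 1 w) x)))) \<partial>lborel)"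
    by (intro nn_integral_cong) (simp add: indicator_def add.assoc ennreal_plus)
  also have "\<dots> = ?N w + (?N (partial 1 w) + (?N (partial 2 w) + ?N (partial 2 (partial 1 w))))"
  proof -
    have m: "(\<lambda>x. indicator Q x * ennreal (norm (w x))) \<in> borel_measurable lborel"
      "(\<lambda>x. indicator Q x * ennreal (norm (partial i w x))) \<in> borel_measurable lborel"
      "(\<lambda>x. indicator Q x * ennreal (norm (partial j (partial i w) x))) \<in> borel_measurable lborel" for i j
      by (intro meas continuous_intros c)+
    show ?thesis by (simp only: nn_integral_add borel_measurable_add m)
  qed
  also have "\<dots> \<le> ennreal (t * (\<delta> * \<delta>) + e / t) + (ennreal (t * (\<delta> * \<delta>) + e / t) + (ennreal (t * (\<delta> * \<delta>) + e / t) + ennreal (t * (\<delta> * \<delta>) + e / t)))"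
    by (intro add_mono single c L2)
  also have "\<dots> = ennreal (4 * (t * (\<delta> * \<delta>) + e / t))"
    using t d e by (simp add: ennreal_plus[symmetric] del: ennreal_plus)
  finally have "\<delta> * \<delta> * norm (w p) \<le> 4 * (t * (\<delta> * \<delta>) + e / t)"
    using t d e by (subst (asm) ennreal_le_iff) auto
  then have "norm (w p) \<le> 4 * (t * (\<delta> * \<delta>) + e / t) / (\<delta> * \<delta>)" using d by (simp add: field_simps)
  also have "\<dots> = 4 * t + 4 * e / (t * (\<delta> * \<delta>))" using d t by (simp add: field_simps)
  finally show ?thesis .
qed

section \<open>Classical and weak derivatives\<close>

lemma locally_integrable_on_continuous:
  fixes f :: "real^2 \<Rightarrow> 'b::euclidean_space"
  assumes "continuous_on U f" shows "locally_integrable_on f U"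
  unfolding locally_integrable_on_def set_integrable_def
proof (intro allI impI)
  fix K assume K: "compact K \<and> K \<subseteq> U"
  have "integrable lborel (\<lambda>x. indicator K x *\<^sub>R f x)"
    using K by (intro borel_integrable_compact continuous_on_subset[OF assms]) auto
  then show "integrable lebesgue (\<lambda>x. indicator K x *\<^sub>R f x)"
    using borel_measurable_integrable by (subst integrable_completion) auto
qed

lemma test_function_partial:
  assumes "test_function U \<phi>" shows "test_function U (partial i \<phi>)"
proof -
  obtain K where K: "compact K" "K \<subseteq> U" "\<And>x. x \<notin> K \<Longrightarrow> \<phi> x = 0" and S: "\<And>k. C_on k UNIV \<phi>"
    using assms unfolding test_function_def smooth_on_def by blast
  have "C_on k UNIV (partial i \<phi>)" for k using S[of "Suc k"] by simp
  moreover have "partial i \<phi> x = 0" if "x \<notin> K" for x by (rule partial_outside_support[OF K(1,3) that])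
  ultimately show ?thesis unfolding test_function_def smooth_on_def using K(1,2) by blast
qed

lemma test_function_C_on:
  assumes "test_function U \<phi>" shows "C_on k S \<phi>"
  using assms C_on_subset[of k UNIV \<phi> S] unfolding test_function_def smooth_on_def by blast

lemma test_function_integrable:
  fixes f :: "real^2 \<Rightarrow> 'b::euclidean_space"
  assumes f: "locally_integrable_on f U" and \<phi>: "test_function U \<phi>"
  shows "set_integrable lebesgue U (\<lambda>x. \<phi> x *\<^sub>R f x)"
proof -
  obtain K where K: "compact K" "K \<subseteq> U" "\<And>x. x \<notin> K \<Longrightarrow> \<phi> x = 0"
    using \<phi> unfolding test_function_def by blast
  have c: "continuous_on UNIV \<phi>" using test_function_C_on[OF \<phi>, of 0 UNIV] by simp
  have m: "\<phi> \<in> borel_measurable lebesgue"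
    using borel_measurable_continuous_onI[OF c] by (simp add: measurable_completion)
  obtain B where B: "\<And>x. x \<in> K \<Longrightarrow> \<bar>\<phi> x\<bar> \<le> B"
    using compact_imp_bounded[OF compact_continuous_image[OF continuous_on_subset[OF c subset_UNIV] K(1)]]
    unfolding bounded_iff by force
  have i: "integrable lebesgue (\<lambda>x. indicator K x *\<^sub>R f x)"
    using f K unfolding locally_integrable_on_def set_integrable_def by blast
  have "integrable lebesgue (\<lambda>x. \<phi> x *\<^sub>R (indicator K x *\<^sub>R f x))"
  proof (rule Bochner_Integration.integrable_bound[OF integrable_scaleR_right[OF i, of B]])
    show "(\<lambda>x. \<phi> x *\<^sub>R (indicator K x *\<^sub>R f x)) \<in> borel_measurable lebesgue"
      by (rule borel_measurable_scaleR[OF m borel_measurable_integrable[OF i]])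
    show "AE x in lebesgue. norm (\<phi> x *\<^sub>R (indicator K x *\<^sub>R f x)) \<le> norm (B *\<^sub>R (indicator K x *\<^sub>R f x))"
    proof (rule AE_I2)
      fix x
      show "norm (\<phi> x *\<^sub>R (indicator K x *\<^sub>R f x)) \<le> norm (B *\<^sub>R (indicator K x *\<^sub>R f x))"
        using B[of x] by (cases "x \<in> K") (auto intro!: mult_right_mono)
    qed
  qed
  moreover have "\<phi> x *\<^sub>R (indicator K x *\<^sub>R f x) = indicator U x *\<^sub>R (\<phi> x *\<^sub>R f x)" for x
    using K by (auto simp: indicator_def)
  ultimately show ?thesis unfolding set_integrable_def by (simp only:)
qed

lemma locally_integrable_on_diff:
  fixes f g :: "real^2 \<Rightarrow> 'b::euclidean_space"
  shows "locally_integrable_on f U \<Longrightarrow> locally_integrable_on g U \<Longrightarrow> locally_integrable_on (\<lambda>x. f x - g x) U"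
  unfolding locally_integrable_on_def by (simp add: set_integral_diff(1))

lemma integration_by_parts_test:
  fixes w :: "real^2 \<Rightarrow> real^2"
  assumes U: "open U" and w: "C_on 1 U w" and \<phi>: "test_function U \<phi>"
  shows "(LINT x:U|lebesgue. partial i \<phi> x *\<^sub>R w x) = - (LINT x:U|lebesgue. \<phi> x *\<^sub>R partial i w x)"
proof -
  obtain K where K: "compact K" "K \<subseteq> U" "\<And>x. x \<notin> K \<Longrightarrow> \<phi> x = 0"
    using \<phi> unfolding test_function_def by blast
  have p0: "partial i \<phi> x = 0" if "x \<notin> K" for x by (rule partial_outside_support[OF K(1,3) that])
  have \<phi>1: "C_on 1 U \<phi>" by (rule test_function_C_on[OF \<phi>])
  have cw: "continuous_on U w" "continuous_on U (partial i w)" using C_on_continuous_on[OF w] w by (simp_all add: C_on_1)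
  have i1: "integrable lebesgue (\<lambda>x. indicator U x *\<^sub>R (partial i \<phi> x *\<^sub>R w x))"
    using test_function_integrable[OF locally_integrable_on_continuous[OF cw(1)] test_function_partial[OF \<phi>]] by (simp add: set_integrable_def)
  have i2: "integrable lebesgue (\<lambda>x. indicator U x *\<^sub>R (\<phi> x *\<^sub>R partial i w x))"
    using test_function_integrable[OF locally_integrable_on_continuous[OF cw(2)] \<phi>] by (simp add: set_integrable_def)
  have comp: "(\<integral>x. F x \<partial>lebesgue) $ j = (\<integral>x. F x $ j \<partial>lborel)"
    if "integrable lebesgue F" "(\<lambda>x. F x $ j) \<in> borel_measurable borel" for F :: "real^2 \<Rightarrow> real^2" and j
    using integral_bounded_linear[OF bounded_linear_vec_nth that(1), of j] that(2) by (simp add: integral_completion)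
  have "(LINT x:U|lebesgue. partial i \<phi> x *\<^sub>R w x) $ j = - (LINT x:U|lebesgue. \<phi> x *\<^sub>R partial i w x) $ j" for j
  proof -
    have wj: "C_on 1 U (\<lambda>x. w x $ j)" by (rule C_on_nth[OF U w])
    have ibp: "integrable lborel (\<lambda>x. \<phi> x * partial i (\<lambda>x. w x $ j) x)" "integrable lborel (\<lambda>x. partial i \<phi> x * w x $ j)"
      "(\<integral>x. \<phi> x * partial i (\<lambda>x. w x $ j) x \<partial>lborel) = - (\<integral>x. partial i \<phi> x * w x $ j \<partial>lborel)"
      using integration_by_parts[OF U K(1,2) \<phi>1 K(3) wj] by blast+
    have m: "(\<lambda>x. \<phi> x * partial i (\<lambda>x. w x $ j) x) \<in> borel_measurable borel" "(\<lambda>x. partial i \<phi> x * w x $ j) \<in> borel_measurable borel"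
      using borel_measurable_integrable[OF ibp(1)] borel_measurable_integrable[OF ibp(2)] by simp_all
    have e1: "(indicator U x *\<^sub>R (partial i \<phi> x *\<^sub>R w x)) $ j = partial i \<phi> x * w x $ j" for x
      using p0[of x] K(2) by (cases "x \<in> K") (auto simp: indicator_def)
    have e2: "(indicator U x *\<^sub>R (\<phi> x *\<^sub>R partial i w x)) $ j = \<phi> x * partial i (\<lambda>x. w x $ j) x" for x
    proof (cases "x \<in> K")
      case True
      then have "x \<in> U" using K by blast
      then show ?thesis using w by (simp add: partial_nth C_on_1)
    qed (use K(3) in simp)
    have "(LINT x:U|lebesgue. partial i \<phi> x *\<^sub>R w x) $ j = (\<integral>x. partial i \<phi> x * w x $ j \<partial>lborel)"
      unfolding set_lebesgue_integral_def using comp[OF i1, of j, unfolded e1, OF m(2)] .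
    moreover have "(LINT x:U|lebesgue. \<phi> x *\<^sub>R partial i w x) $ j = (\<integral>x. \<phi> x * partial i (\<lambda>x. w x $ j) x \<partial>lborel)"
      unfolding set_lebesgue_integral_def using comp[OF i2, of j, unfolded e2, OF m(1)] .
    ultimately show ?thesis using ibp(3) by simp
  qed
  then show ?thesis by (simp add: vec_eq_iff)
qed

text \<open>\<open>weak_partial\<close> is an arbitrary choice among functions that agree almost
  everywhere; this identifies any choice with a classical derivative that satisfies the same
  integration by parts.\<close>

lemma weak_eq_classical:
  fixes f g D :: "real^2 \<Rightarrow> 'b::euclidean_space"
  assumes U: "open U" and g: "has_weak_partial U \<alpha> f g" and D: "continuous_on U D"
    and cl: "\<And>\<phi>. test_function U \<phi> \<Longrightarrow> (LINT x:U|lebesgue. mpartial \<alpha> \<phi> x *\<^sub>R f x) =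
        (- 1) ^ (fst \<alpha> + snd \<alpha>) *\<^sub>R (LINT x:U|lebesgue. \<phi> x *\<^sub>R D x)"
  shows "AE x in lebesgue. x \<in> U \<longrightarrow> g x = D x"
proof -
  have gl: "locally_integrable_on g U" and Dl: "locally_integrable_on D U"
    using g locally_integrable_on_continuous[OF D] unfolding has_weak_partial_def by auto
  have "AE x in lebesgue. x \<in> U \<longrightarrow> g x - D x = 0"
  proof (rule fundamental_lemma[OF U locally_integrable_on_diff[OF gl Dl]])
    fix \<phi> assume \<phi>: "test_function U \<phi>"
    have gd: "(LINT x:U|lebesgue. mpartial \<alpha> \<phi> x *\<^sub>R f x) = (- 1) ^ (fst \<alpha> + snd \<alpha>) *\<^sub>R (LINT x:U|lebesgue. \<phi> x *\<^sub>R g x)"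
      using g \<phi> unfolding has_weak_partial_def by blast
    from trans[OF gd[symmetric] cl[OF \<phi>]] have "(LINT x:U|lebesgue. \<phi> x *\<^sub>R g x) = (LINT x:U|lebesgue. \<phi> x *\<^sub>R D x)" by simp
    then show "(LINT x:U|lebesgue. \<phi> x *\<^sub>R (g x - D x)) = 0"
      using set_integral_diff(2)[OF test_function_integrable[OF gl \<phi>] test_function_integrable[OF Dl \<phi>]]
      by (simp add: scaleR_diff_right)
  qed
  then show ?thesis by eventually_elim simp
qed

lemma weak_partial_C1:
  fixes w :: "real^2 \<Rightarrow> real^2"
  assumes U: "open U" and w: "C_on 1 U w"
  shows "has_weak_partial U (0, 0) w g \<Longrightarrow> AE x in lebesgue. x \<in> U \<longrightarrow> g x = w x"
    and "has_weak_partial U (1, 0) w g \<Longrightarrow> AE x in lebesgue. x \<in> U \<longrightarrow> g x = partial 1 w x"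
    and "has_weak_partial U (0, 1) w g \<Longrightarrow> AE x in lebesgue. x \<in> U \<longrightarrow> g x = partial 2 w x"
proof -
  have c: "continuous_on U w" "continuous_on U (partial i w)" for i
    using C_on_continuous_on[OF w] w by (simp_all add: C_on_1)
  show "has_weak_partial U (0, 0) w g \<Longrightarrow> AE x in lebesgue. x \<in> U \<longrightarrow> g x = w x"
    by (erule weak_eq_classical[OF U _ c(1)]) (simp add: mpartial_def)
  show "has_weak_partial U (1, 0) w g \<Longrightarrow> AE x in lebesgue. x \<in> U \<longrightarrow> g x = partial 1 w x"
    by (erule weak_eq_classical[OF U _ c(2)]) (simp add: mpartial_def integration_by_parts_test[OF U w])
  show "has_weak_partial U (0, 1) w g \<Longrightarrow> AE x in lebesgue. x \<in> U \<longrightarrow> g x = partial 2 w x"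
    by (erule weak_eq_classical[OF U _ c(2)]) (simp add: mpartial_def integration_by_parts_test[OF U w])
qed

text \<open>Integration by parts removes \<open>partial 1\<close> from the test function first,
  which leads to \<open>partial 2 (partial 1 w)\<close>, the very mixed derivative in the pointwise
  Sobolev bound.\<close>

lemma weak_partial_C2:
  fixes w :: "real^2 \<Rightarrow> real^2"
  assumes U: "open U" and w: "C_on 2 U w" and g: "has_weak_partial U (1, 1) w g"
  shows "AE x in lebesgue. x \<in> U \<longrightarrow> g x = partial 2 (partial 1 w) x"
proof (rule weak_eq_classical[OF U g])
  have w1: "C_on 1 U w" "C_on 1 U (partial 1 w)" using C_on_le[OF w, of 1] w by (simp_all add: C_on_2 del: C_on.simps)
  show "continuous_on U (partial 2 (partial 1 w))" using w1(2) by (simp add: C_on_1)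
  fix \<phi> assume \<phi>: "test_function U \<phi>"
  have "(LINT x:U|lebesgue. partial 1 (partial 2 \<phi>) x *\<^sub>R w x) = - (LINT x:U|lebesgue. partial 2 \<phi> x *\<^sub>R partial 1 w x)"
    by (rule integration_by_parts_test[OF U w1(1) test_function_partial[OF \<phi>]])
  also have "\<dots> = (LINT x:U|lebesgue. \<phi> x *\<^sub>R partial 2 (partial 1 w) x)"
    using integration_by_parts_test[OF U w1(2) \<phi>] by simp
  finally show "(LINT x:U|lebesgue. mpartial (1, 1) \<phi> x *\<^sub>R w x) = (- 1) ^ (fst (1::nat, 1::nat) + snd (1::nat, 1::nat)) *\<^sub>R (LINT x:U|lebesgue. \<phi> x *\<^sub>R partial 2 (partial 1 w) x)"
    by (simp add: mpartial_def)
qed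

lemma has_weak_partial_diff:
  fixes f1 f2 g1 g2 :: "real^2 \<Rightarrow> real^2"
  assumes 1: "has_weak_partial U \<alpha> f1 g1" and 2: "has_weak_partial U \<alpha> f2 g2"
    and \<alpha>: "\<And>\<phi>. test_function U \<phi> \<Longrightarrow> test_function U (mpartial \<alpha> \<phi>)"
  shows "has_weak_partial U \<alpha> (\<lambda>x. f1 x - f2 x) (\<lambda>x. g1 x - g2 x)"
proof -
  have l: "locally_integrable_on f1 U" "locally_integrable_on f2 U" "locally_integrable_on g1 U" "locally_integrable_on g2 U"
    using 1 2 unfolding has_weak_partial_def by auto
  show ?thesis
    unfolding has_weak_partial_def
  proof (intro conjI allI impI locally_integrable_on_diff l)
    fix \<phi> assume \<phi>: "test_function U \<phi>"
    have "(LINT x:U|lebesgue. mpartial \<alpha> \<phi> x *\<^sub>R (f1 x - f2 x)) = (LINT x:U|lebesgue. mpartial \<alpha> \<phi> x *\<^sub>R f1 x) - (LINT x:U|lebesgue. mpartial \<alpha> \<phi> x *\<^sub>R f2 x)"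
      unfolding scaleR_diff_right by (rule set_integral_diff(2)) (intro test_function_integrable l \<alpha> \<phi>)+
    moreover have "(LINT x:U|lebesgue. \<phi> x *\<^sub>R (g1 x - g2 x)) = (LINT x:U|lebesgue. \<phi> x *\<^sub>R g1 x) - (LINT x:U|lebesgue. \<phi> x *\<^sub>R g2 x)"
      unfolding scaleR_diff_right by (rule set_integral_diff(2)) (intro test_function_integrable l \<phi>)+
    ultimately show "(LINT x:U|lebesgue. mpartial \<alpha> \<phi> x *\<^sub>R (f1 x - f2 x)) =
        (- 1) ^ (fst \<alpha> + snd \<alpha>) *\<^sub>R (LINT x:U|lebesgue. \<phi> x *\<^sub>R (g1 x - g2 x))"
      using 1 2 \<phi> unfolding has_weak_partial_def by (simp add: scaleR_diff_right)
  qed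
qed

text \<open>Local integrability speaks of compact sets only; exhausting \<open>U\<close> by finite
  unions of closed boxes carries measurability to \<open>U\<close>.\<close>

lemma locally_integrable_on_measurable:
  fixes f :: "real^2 \<Rightarrow> 'b::euclidean_space"
  assumes U: "open U" and f: "locally_integrable_on f U"
  shows "(\<lambda>x. indicator U x *\<^sub>R f x) \<in> borel_measurable lebesgue"
proof -
  obtain D where D: "countable D" "D \<subseteq> Pow U" "\<And>X. X \<in> D \<Longrightarrow> \<exists>a b. X = cbox a b" "\<Union>D = U"
    using open_countable_Union_open_cbox[OF U] by metis
  \<comment> \<open>The empty set is inserted so that the enumerated family is nonempty even for
    empty \<open>U\<close>.\<close>
  define X where "X n = from_nat_into (insert {} D) n" for n
  have rX: "range X = insert {} D" unfolding X_def using D(1) by (simp add: range_from_nat_into)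
  define Y where "Y n = (\<Union>i<n. X i)" for n
  have "compact (X i)" for i
  proof -
    have "X i \<in> insert {} D" using rX by blast
    then show ?thesis
    proof
      assume "X i \<in> D"
      then obtain a b where "X i = cbox a b" using D(3) by metis
      then show ?thesis by simp
    qed simp
  qed
  then have cY: "compact (Y n)" for n unfolding Y_def by (intro compact_UN) auto
  have YU: "Y n \<subseteq> U" for n using rX D(2) unfolding Y_def by blast
  have lim: "(\<lambda>n. indicator (Y n) x *\<^sub>R f x) \<longlonglongrightarrow> indicator U x *\<^sub>R f x" for x
  proof (cases "x \<in> U")
    case True
    then obtain i where i: "x \<in> X i" using D(4) rX by blast
    have "\<forall>\<^sub>F n in sequentially. indicator (Y n) x *\<^sub>R f x = indicator U x *\<^sub>R f x"
      using eventually_gt_at_top[of i] by eventually_elim (use i True in \<open>auto simp: Y_def indicator_def\<close>)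
    then show ?thesis by (rule tendsto_eventually)
  next
    case False
    then have "indicator (Y n) x *\<^sub>R f x = indicator U x *\<^sub>R f x" for n using YU by (auto simp: indicator_def)
    then show ?thesis by (simp only: tendsto_const)
  qed
  have meas: "(\<lambda>x. indicator (Y n) x *\<^sub>R f x) \<in> borel_measurable lebesgue" for n
    using f cY YU unfolding locally_integrable_on_def set_integrable_def by (blast intro: borel_measurable_integrable)
  show ?thesis
    by (rule borel_measurable_LIMSEQ_metric[where f="\<lambda>n x. indicator (Y n) x *\<^sub>R f x"], rule meas, rule lim)
qed

section \<open>Convergence in the Sobolev norm\<close>

text \<open>A finite bound on the norm selects the first branch of \<open>H_norm\<close>, where weak
  derivatives exist and the chosen ones are genuine; each of the square integrals is a summand of
  the energy.\<close>

lemma H_norm_bounds: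
  fixes f :: "real^2 \<Rightarrow> real^2"
  assumes \<sigma>: "\<sigma> \<ge> 2" and H: "H_norm \<sigma> U f < ennreal \<epsilon>" and \<alpha>: "fst \<alpha> + snd \<alpha> \<le> 2"
  shows "has_weak_partial U \<alpha> f (weak_partial U \<alpha> f)"
    and "(\<integral>\<^sup>+x\<in>U. ennreal ((norm (weak_partial U \<alpha> f x))\<^sup>2) \<partial>lebesgue) \<le> ennreal (\<epsilon>\<^sup>2)"
proof -
  let ?k = "nat \<lfloor>\<sigma>\<rfloor>"
  have k: "2 \<le> ?k" using \<sigma> by linarith
  have cond: "(\<forall>\<alpha>. fst \<alpha> + snd \<alpha> \<le> ?k \<longrightarrow> (\<exists>g. has_weak_partial U \<alpha> f g)) \<and> H_energy \<sigma> U f < \<infinity>"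
    using H unfolding H_norm_def by (auto split: if_splits)
  have "fst \<alpha> + snd \<alpha> \<le> ?k" using \<alpha> k by linarith
  then have "\<exists>g. has_weak_partial U \<alpha> f g" using cond by blast
  then show "has_weak_partial U \<alpha> f (weak_partial U \<alpha> f)" unfolding weak_partial_def by (rule someI_ex)
  define E where "E = enn2real (H_energy \<sigma> U f)"
  have "ennreal (sqrt E) < ennreal \<epsilon>" using H cond unfolding H_norm_def E_def by simp
  then have "sqrt E < \<epsilon>" by (simp add: ennreal_less_iff E_def)
  then have "(sqrt E)\<^sup>2 < \<epsilon>\<^sup>2" by (intro power_strict_mono) (auto simp: E_def)
  then have "E < \<epsilon>\<^sup>2" by (simp add: E_def)
  moreover have "H_energy \<sigma> U f = ennreal E" using cond by (simp add: E_def)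
  ultimately have le: "H_energy \<sigma> U f \<le> ennreal (\<epsilon>\<^sup>2)" by (simp add: ennreal_leI)
  have fin: "finite {\<alpha>::nat \<times> nat. fst \<alpha> + snd \<alpha> \<le> ?k}"
    by (rule finite_subset[of _ "{..?k} \<times> {..?k}"]) auto
  have "(\<integral>\<^sup>+x\<in>U. ennreal ((norm (weak_partial U \<alpha> f x))\<^sup>2) \<partial>lebesgue)
    \<le> (\<Sum>\<alpha> | fst \<alpha> + snd \<alpha> \<le> ?k. \<integral>\<^sup>+x\<in>U. ennreal ((norm (weak_partial U \<alpha> f x))\<^sup>2) \<partial>lebesgue)"
    by (rule member_le_sum[OF _ _ fin]) (use \<alpha> k in auto)
  also have "\<dots> \<le> H_energy \<sigma> U f"
    unfolding H_energy_def Let_def by (rule add_increasing2[OF zero_le order_refl])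
  finally show "(\<integral>\<^sup>+x\<in>U. ennreal ((norm (weak_partial U \<alpha> f x))\<^sup>2) \<partial>lebesgue) \<le> ennreal (\<epsilon>\<^sup>2)"
    using le by (rule order_trans)
qed

lemma nn_integral_AE_transfer:
  fixes f g :: "real^2 \<Rightarrow> 'b::euclidean_space"
  assumes U: "open U" and AE: "AE x in lebesgue. x \<in> U \<longrightarrow> g x = f x" and f: "continuous_on U f"
    and b: "(\<integral>\<^sup>+x\<in>U. ennreal ((norm (g x))\<^sup>2) \<partial>lebesgue) \<le> c"
  shows "(\<integral>\<^sup>+x\<in>U. ennreal ((norm (f x))\<^sup>2) \<partial>lborel) \<le> c"
proof -
  have "(\<lambda>x. indicator U x *\<^sub>R (norm (f x))\<^sup>2) \<in> borel_measurable borel"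
    using U by (intro borel_measurable_continuous_on_indicator continuous_intros f) auto
  then have "(\<lambda>x. ennreal (indicator U x *\<^sub>R (norm (f x))\<^sup>2)) \<in> borel_measurable borel" by measurable
  moreover have "ennreal (indicator U x *\<^sub>R (norm (f x))\<^sup>2) = ennreal ((norm (f x))\<^sup>2) * indicator U x" for x by (simp add: indicator_def)
  ultimately have "(\<lambda>x. ennreal ((norm (f x))\<^sup>2) * indicator U x) \<in> borel_measurable borel" by (simp only:)
  then have m: "(\<lambda>x. ennreal ((norm (f x))\<^sup>2) * indicator U x) \<in> borel_measurable lborel" by simp
  have "(\<integral>\<^sup>+x\<in>U. ennreal ((norm (f x))\<^sup>2) \<partial>lborel) = (\<integral>\<^sup>+x\<in>U. ennreal ((norm (f x))\<^sup>2) \<partial>lebesgue)"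
    using m by (simp add: nn_integral_completion)
  also have "\<dots> = (\<integral>\<^sup>+x\<in>U. ennreal ((norm (g x))\<^sup>2) \<partial>lebesgue)"
    by (rule nn_integral_cong_AE) (use AE in eventually_elim, auto simp: indicator_def)
  finally show ?thesis using b by simp
qed

lemma H_norm_C1_bounds:
  fixes u ue :: "real^2 \<Rightarrow> real^2"
  assumes U: "open U" and C: "C_on 1 U u" "C_on 1 U ue" and \<sigma>: "\<sigma> \<ge> 2"
    and H: "H_norm \<sigma> U (\<lambda>x. u x - ue x) < ennreal \<epsilon>"
  shows "(\<integral>\<^sup>+x\<in>U. ennreal ((norm (u x - ue x))\<^sup>2) \<partial>lborel) \<le> ennreal (\<epsilon>\<^sup>2)"
    and "(\<integral>\<^sup>+x\<in>U. ennreal ((norm (partial i (\<lambda>x. u x - ue x) x))\<^sup>2) \<partial>lborel) \<le> ennreal (\<epsilon>\<^sup>2)"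
proof -
  let ?w = "\<lambda>x. u x - ue x"
  have w: "C_on 1 U ?w" by (rule C_on_diff[OF U C])
  have c: "continuous_on U ?w" "continuous_on U (partial i ?w)" for i
    using C_on_continuous_on[OF w] w by (simp_all add: C_on_1)
  note hb = H_norm_bounds[OF \<sigma> H]
  show "(\<integral>\<^sup>+x\<in>U. ennreal ((norm (?w x))\<^sup>2) \<partial>lborel) \<le> ennreal (\<epsilon>\<^sup>2)"
    by (rule nn_integral_AE_transfer[OF U weak_partial_C1(1)[OF U w hb(1)] c(1) hb(2)]) auto
  have "(\<integral>\<^sup>+x\<in>U. ennreal ((norm (partial 1 ?w x))\<^sup>2) \<partial>lborel) \<le> ennreal (\<epsilon>\<^sup>2)"
    by (rule nn_integral_AE_transfer[OF U weak_partial_C1(2)[OF U w hb(1)] c(2) hb(2)]) auto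
  moreover have "(\<integral>\<^sup>+x\<in>U. ennreal ((norm (partial 2 ?w x))\<^sup>2) \<partial>lborel) \<le> ennreal (\<epsilon>\<^sup>2)"
    by (rule nn_integral_AE_transfer[OF U weak_partial_C1(3)[OF U w hb(1)] c(2) hb(2)]) auto
  ultimately show "(\<integral>\<^sup>+x\<in>U. ennreal ((norm (partial i ?w x))\<^sup>2) \<partial>lborel) \<le> ennreal (\<epsilon>\<^sup>2)"
    using exhaust_2[of i] by auto
qed

lemma norm_diff_sq_le: "(norm (a - b))\<^sup>2 \<le> 2 * (norm a)\<^sup>2 + 2 * (norm b)\<^sup>2" for a b :: "'a::real_normed_vector"
proof -
  have "(norm (a - b))\<^sup>2 \<le> (norm a + norm b)\<^sup>2" by (intro power_mono norm_triangle_ineq4) simp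
  also have "\<dots> \<le> 2 * (norm a)\<^sup>2 + 2 * (norm b)\<^sup>2"
    using sum_squares_bound[of "norm a" "norm b"] by (simp add: power2_sum)
  finally show ?thesis .
qed

lemma nn_integral_diff_sq_le:
  fixes f g :: "real^2 \<Rightarrow> 'b::euclidean_space"
  assumes m: "(\<lambda>x. indicator U x *\<^sub>R f x) \<in> borel_measurable M" "(\<lambda>x. indicator U x *\<^sub>R g x) \<in> borel_measurable M"
    and b: "(\<integral>\<^sup>+x\<in>U. ennreal ((norm (f x))\<^sup>2) \<partial>M) \<le> ennreal c" "(\<integral>\<^sup>+x\<in>U. ennreal ((norm (g x))\<^sup>2) \<partial>M) \<le> ennreal c"
    and c: "c \<ge> 0"
  shows "(\<integral>\<^sup>+x\<in>U. ennreal ((norm (f x - g x))\<^sup>2) \<partial>M) \<le> ennreal (4 * c)"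
proof -
  have m2: "(\<lambda>x. ennreal ((norm (h x))\<^sup>2) * indicator U x) \<in> borel_measurable M"
    if "(\<lambda>x. indicator U x *\<^sub>R h x) \<in> borel_measurable M" for h :: "real^2 \<Rightarrow> 'b"
  proof -
    have "(\<lambda>x. ennreal ((norm (indicator U x *\<^sub>R h x))\<^sup>2)) \<in> borel_measurable M" using that by measurable
    moreover have "ennreal ((norm (indicator U x *\<^sub>R h x))\<^sup>2) = ennreal ((norm (h x))\<^sup>2) * indicator U x" for x
      by (simp add: indicator_def)
    ultimately show ?thesis by (simp only:)
  qed
  have "(\<integral>\<^sup>+x\<in>U. ennreal ((norm (f x - g x))\<^sup>2) \<partial>M)
    \<le> (\<integral>\<^sup>+x. ennreal 2 * (ennreal ((norm (f x))\<^sup>2) * indicator U x) + ennreal 2 * (ennreal ((norm (g x))\<^sup>2) * indicator U x) \<partial>M)"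
  proof (intro nn_integral_mono)
    fix x
    have "ennreal ((norm (f x - g x))\<^sup>2) \<le> ennreal (2 * (norm (f x))\<^sup>2 + 2 * (norm (g x))\<^sup>2)"
      by (rule ennreal_leI[OF norm_diff_sq_le])
    also have "\<dots> = ennreal 2 * ennreal ((norm (f x))\<^sup>2) + ennreal 2 * ennreal ((norm (g x))\<^sup>2)"
      by (simp add: ennreal_plus ennreal_mult)
    finally show "ennreal ((norm (f x - g x))\<^sup>2) * indicator U x \<le> ennreal 2 * (ennreal ((norm (f x))\<^sup>2) * indicator U x) + ennreal 2 * (ennreal ((norm (g x))\<^sup>2) * indicator U x)"
      by (cases "x \<in> U") simp_all
  qed
  also have "\<dots> = ennreal 2 * (\<integral>\<^sup>+x\<in>U. ennreal ((norm (f x))\<^sup>2) \<partial>M) + ennreal 2 * (\<integral>\<^sup>+x\<in>U. ennreal ((norm (g x))\<^sup>2) \<partial>M)"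
    using m2[OF m(1)] m2[OF m(2)] by (simp only: nn_integral_add nn_integral_cmult borel_measurable_times_ennreal borel_measurable_const)
  also have "\<dots> \<le> ennreal 2 * ennreal c + ennreal 2 * ennreal c"
    by (intro add_mono mult_left_mono b) simp_all
  also have "\<dots> = ennreal (4 * c)"
  proof -
    have "ennreal 2 * ennreal c = ennreal (2 * c)" by (rule ennreal_mult[symmetric]) (use c in auto)
    moreover have "ennreal (2 * c) + ennreal (2 * c) = ennreal (4 * c)"
      using c by (simp add: ennreal_plus[symmetric] del: ennreal_plus)
    ultimately show ?thesis by (simp only:)
  qed
  finally show ?thesis .
qed

text \<open>\<open>ue\<close> is only of class \<open>C_on 1\<close>, so its second weak derivatives
  have no classical counterpart. They cancel in the difference of the two flows, which is of class
  \<open>C_on 2\<close> and whose mixed derivative is therefore classical.\<close>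

lemma H_norm_cauchy_bounds:
  fixes u u' ue :: "real^2 \<Rightarrow> real^2"
  assumes U: "open U" and C: "C_on 2 U u" "C_on 2 U u'" "C_on 1 U ue" and \<sigma>: "\<sigma> \<ge> 2"
    and H: "H_norm \<sigma> U (\<lambda>x. u x - ue x) < ennreal \<epsilon>" "H_norm \<sigma> U (\<lambda>x. u' x - ue x) < ennreal \<epsilon>"
  defines "v \<equiv> \<lambda>x. u x - u' x"
  shows "(\<integral>\<^sup>+x\<in>U. ennreal ((norm (v x))\<^sup>2) \<partial>lborel) \<le> ennreal (4 * \<epsilon>\<^sup>2)"
    and "(\<integral>\<^sup>+x\<in>U. ennreal ((norm (partial i v x))\<^sup>2) \<partial>lborel) \<le> ennreal (4 * \<epsilon>\<^sup>2)"
    and "(\<integral>\<^sup>+x\<in>U. ennreal ((norm (partial 2 (partial 1 v) x))\<^sup>2) \<partial>lborel) \<le> ennreal (4 * \<epsilon>\<^sup>2)"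
proof -
  let ?w = "\<lambda>x. u x - ue x" and ?w' = "\<lambda>x. u' x - ue x"
  have C1: "C_on 1 U u" "C_on 1 U u'" using C_on_le[OF C(1)] C_on_le[OF C(2)] by (simp_all del: C_on.simps One_nat_def)
  have w: "C_on 1 U ?w" "C_on 1 U ?w'" by (rule C_on_diff[OF U C1(1) C(3)], rule C_on_diff[OF U C1(2) C(3)])
  have v2: "C_on 2 U v" unfolding v_def by (rule C_on_diff[OF U C(1,2)])
  have cm: "(\<lambda>x. indicator U x *\<^sub>R f x) \<in> borel_measurable lborel" if "continuous_on U f" for f :: "real^2 \<Rightarrow> real^2"
    using U that by (simp add: borel_measurable_continuous_on_indicator)
  have c: "continuous_on U ?w" "continuous_on U ?w'" "continuous_on U (partial i ?w)" "continuous_on U (partial i ?w')" for i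
    using C_on_continuous_on[OF w(1)] C_on_continuous_on[OF w(2)] w by (simp_all add: C_on_1)
  note b1 = H_norm_C1_bounds[OF U C1(1) C(3) \<sigma> H(1)] and b2 = H_norm_C1_bounds[OF U C1(2) C(3) \<sigma> H(2)]
  have vw: "v x = ?w x - ?w' x" for x by (simp add: v_def)
  show "(\<integral>\<^sup>+x\<in>U. ennreal ((norm (v x))\<^sup>2) \<partial>lborel) \<le> ennreal (4 * \<epsilon>\<^sup>2)"
    unfolding vw by (rule nn_integral_diff_sq_le[OF cm[OF c(1)] cm[OF c(2)] b1(1) b2(1)]) simp
  have "(\<integral>\<^sup>+x\<in>U. ennreal ((norm (partial i ?w x - partial i ?w' x))\<^sup>2) \<partial>lborel) \<le> ennreal (4 * \<epsilon>\<^sup>2)"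
    by (rule nn_integral_diff_sq_le[OF cm[OF c(3)] cm[OF c(4)] b1(2) b2(2)]) simp
  moreover have "partial i v x = partial i ?w x - partial i ?w' x" if "x \<in> U" for x
  proof -
    have "partial i (\<lambda>x. ?w x - ?w' x) x = partial i ?w x - partial i ?w' x"
      using w that by (intro partial_diff) (auto simp: C_on_1)
    then show ?thesis by (simp add: v_def)
  qed
  ultimately show "(\<integral>\<^sup>+x\<in>U. ennreal ((norm (partial i v x))\<^sup>2) \<partial>lborel) \<le> ennreal (4 * \<epsilon>\<^sup>2)"
    by (smt (verit) indicator_simps(2) mult_zero_right nn_integral_cong)
  let ?g = "weak_partial U (1, 1) ?w" and ?g' = "weak_partial U (1, 1) ?w'"
  have \<alpha>2: "fst (1::nat, 1::nat) + snd (1::nat, 1::nat) \<le> 2" by simp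
  note hb = H_norm_bounds[OF \<sigma> H(1) \<alpha>2] and hb' = H_norm_bounds[OF \<sigma> H(2) \<alpha>2]
  have tf: "test_function U (mpartial (1, 1) \<phi>)" if "test_function U \<phi>" for \<phi>
    using that by (simp add: mpartial_def test_function_partial)
  have "has_weak_partial U (1, 1) (\<lambda>x. ?w x - ?w' x) (\<lambda>x. ?g x - ?g' x)"
    by (rule has_weak_partial_diff[OF hb(1) hb'(1) tf])
  then have "has_weak_partial U (1, 1) v (\<lambda>x. ?g x - ?g' x)" by (simp add: v_def)
  from weak_partial_C2[OF U v2 this]
  \<comment> \<open>Neither chosen weak derivative need be classical, but their difference is a weak
    derivative of \<open>v\<close>.\<close>
  have AE: "AE x in lebesgue. x \<in> U \<longrightarrow> ?g x - ?g' x = partial 2 (partial 1 v) x" .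
  have li: "locally_integrable_on ?g U" "locally_integrable_on ?g' U" using hb(1) hb'(1) unfolding has_weak_partial_def by auto
  show "(\<integral>\<^sup>+x\<in>U. ennreal ((norm (partial 2 (partial 1 v) x))\<^sup>2) \<partial>lborel) \<le> ennreal (4 * \<epsilon>\<^sup>2)"
  proof (rule nn_integral_AE_transfer[OF U AE])
    show "continuous_on U (partial 2 (partial 1 v))" using v2 by (simp add: C_on_2 C_on_1)
    show "(\<integral>\<^sup>+x\<in>U. ennreal ((norm (?g x - ?g' x))\<^sup>2) \<partial>lebesgue) \<le> ennreal (4 * \<epsilon>\<^sup>2)"
      by (rule nn_integral_diff_sq_le[OF locally_integrable_on_measurable[OF U li(1)] locally_integrable_on_measurable[OF U li(2)] hb(2) hb'(2)]) simp
  qed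
qed

lemma compact_neighbourhood:
  fixes K M :: "'a::euclidean_space set"
  assumes "compact K" "open M" "K \<subseteq> M"
  obtains e where "e > 0" "closure (\<Union>x\<in>K. ball x e) \<subseteq> M" "compact (closure (\<Union>x\<in>K. ball x e))"
proof -
  obtain d where d: "d > 0" "(\<Union>x\<in>K. ball x d) \<subseteq> M"
    using compact_subset_open_imp_ball_epsilon_subset[OF assms] by metis
  define S where "S = {x + y |x y. x \<in> K \<and> y \<in> cball (0::'a) (d/2)}"
  have S: "compact S" unfolding S_def by (rule compact_sums[OF assms(1) compact_cball])
  have "(\<Union>x\<in>K. ball x (d/2)) \<subseteq> S"
  proof
    fix y assume "y \<in> (\<Union>x\<in>K. ball x (d/2))"
    then obtain x where "x \<in> K" "dist x y < d/2" by auto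
    then have "y = x + (y - x)" "y - x \<in> cball 0 (d/2)" by (auto simp: dist_norm norm_minus_commute)
    then show "y \<in> S" unfolding S_def using \<open>x \<in> K\<close> by blast
  qed
  then have cl: "closure (\<Union>x\<in>K. ball x (d/2)) \<subseteq> S" using S by (intro closure_minimal compact_imp_closed)
  have "S \<subseteq> M"
  proof
    fix z assume "z \<in> S"
    then obtain x y where "z = x + y" "x \<in> K" "norm y \<le> d/2" unfolding S_def by auto
    then have "z \<in> ball x d" using d(1) by (simp add: dist_norm)
    then show "z \<in> M" using d(2) \<open>x \<in> K\<close> by blast
  qed
  moreover have "compact (closure (\<Union>x\<in>K. ball x (d/2)))"
    using compact_imp_bounded[OF S] cl by (metis bounded_subset closed_closure compact_eq_bounded_closed)
  ultimately show ?thesis using that[of "d/2"] d(1) cl by auto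
qed

section \<open>From Sobolev convergence to convergence of velocities and curls\<close>

locale sobolev_convergence =
  fixes M :: "(real^2) set" and \<sigma> :: real and u :: "nat \<Rightarrow> real^2 \<Rightarrow> real^2" and ue :: "real^2 \<Rightarrow> real^2"
  assumes M: "open M" and \<sigma>: "\<sigma> \<ge> 2" and u: "\<And>n. C_on 2 M (u n)" and ue: "C_on 1 M ue"
    and conv: "\<And>U. open U \<Longrightarrow> compact (closure U) \<Longrightarrow> closure U \<subseteq> M \<Longrightarrow>
      (\<lambda>n. H_norm \<sigma> U (\<lambda>x. u n x - ue x)) \<longlonglongrightarrow> 0"
begin

lemma u1: "C_on 1 M (u n)" by (rule C_on_le[OF u]) simp

lemma H_small:
  assumes "open U" "compact (closure U)" "closure U \<subseteq> M" "\<epsilon> > 0"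
  shows "\<forall>\<^sub>F n in sequentially. H_norm \<sigma> U (\<lambda>x. u n x - ue x) < ennreal \<epsilon>"
  by (rule order_tendstoD(2)[OF conv[OF assms(1-3)]]) (use assms(4) in simp)

lemma curl_convergence:
  assumes K: "compact K" "K \<subseteq> M"
  shows "(\<lambda>n. LINT x:K|lborel. (curl (u n) x - curl ue x)\<^sup>2) \<longlonglongrightarrow> 0"
proof -
  obtain e where e: "e > 0" "closure (\<Union>x\<in>K. ball x e) \<subseteq> M" "compact (closure (\<Union>x\<in>K. ball x e))"
    using compact_neighbourhood[OF K(1) M K(2)] by metis
  define U where "U = (\<Union>x\<in>K. ball x e)"
  have oU: "open U" and KU: "K \<subseteq> U" and UM: "U \<subseteq> M"
    using e(1,2) closure_subset[of U] by (auto simp: U_def)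
  have C: "C_on 1 U (u n)" "C_on 1 U ue" for n using C_on_subset[OF u1 UM] C_on_subset[OF ue UM] by blast+
  show ?thesis
    unfolding tendsto_iff
  proof (intro allI impI)
    fix \<delta> :: real assume \<delta>: "\<delta> > 0"
    \<comment> \<open>The difference of the two components costs a factor 4, which leaves half of
      \<delta>.\<close>
    define \<epsilon> where "\<epsilon> = sqrt (\<delta> / 8)"
    have \<epsilon>: "\<epsilon> > 0" "4 * \<epsilon>\<^sup>2 < \<delta>" using \<delta> by (auto simp: \<epsilon>_def)
    have "\<forall>\<^sub>F n in sequentially. H_norm \<sigma> U (\<lambda>x. u n x - ue x) < ennreal \<epsilon>"
      by (rule H_small) (use e \<epsilon> oU in \<open>auto simp: U_def\<close>)
    then show "\<forall>\<^sub>F n in sequentially. dist (LINT x:K|lborel. (curl (u n) x - curl ue x)\<^sup>2) 0 < \<delta>"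
    proof eventually_elim
      case (elim n)
      let ?w = "\<lambda>x. u n x - ue x"
      have w: "C_on 1 U ?w" by (rule C_on_diff[OF oU C])
      note b = H_norm_C1_bounds(2)[OF oU C \<sigma> elim]
      define f g where "f x = partial 1 ?w x $ 2" and "g x = partial 2 ?w x $ 1" for x
      have cf: "continuous_on U f" "continuous_on U g"
        using w unfolding f_def g_def by (auto intro!: continuous_on_component simp: C_on_1)
      have m: "(\<lambda>x. indicator U x *\<^sub>R h x) \<in> borel_measurable lborel" if "continuous_on U h" for h :: "real^2 \<Rightarrow> real"
        using oU that by (simp add: borel_measurable_continuous_on_indicator del: real_scaleR_def)
      have le: "(\<integral>\<^sup>+x\<in>U. ennreal ((norm (h x $ j))\<^sup>2) \<partial>lborel) \<le> c" if "(\<integral>\<^sup>+x\<in>U. ennreal ((norm (h x))\<^sup>2) \<partial>lborel) \<le> c" for h :: "real^2 \<Rightarrow> real^2" and j c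
      proof (rule order_trans[OF nn_integral_mono that])
        fix x
        have "(norm (h x $ j))\<^sup>2 \<le> (norm (h x))\<^sup>2" by (intro power_mono) (simp_all add: component_le_norm_cart)
        then show "ennreal ((norm (h x $ j))\<^sup>2) * indicator U x \<le> ennreal ((norm (h x))\<^sup>2) * indicator U x"
          by (intro mult_right_mono ennreal_leI) auto
      qed
      have fg: "(\<integral>\<^sup>+x\<in>U. ennreal ((norm (f x - g x))\<^sup>2) \<partial>lborel) \<le> ennreal (4 * \<epsilon>\<^sup>2)"
        by (rule nn_integral_diff_sq_le[OF m[OF cf(1)] m[OF cf(2)]]) (use le[OF b] in \<open>simp_all add: f_def g_def\<close>)
      have eq: "curl (u n) x - curl ue x = f x - g x" if "x \<in> U" for x
        using C that by (simp add: curl_def f_def g_def partial_diff C_on_1)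
      have i: "set_integrable lborel K (\<lambda>x. (f x - g x)\<^sup>2)"
        by (intro set_integrable_compact K continuous_intros continuous_on_subset[OF cf(1) KU] continuous_on_subset[OF cf(2) KU])
      have LI: "(LINT x:K|lborel. (curl (u n) x - curl ue x)\<^sup>2) = (LINT x:K|lborel. (f x - g x)\<^sup>2)"
        unfolding set_lebesgue_integral_def using eq KU
        by (intro Bochner_Integration.integral_cong) (auto simp: indicator_def)
      have "ennreal (LINT x:K|lborel. (f x - g x)\<^sup>2) = (\<integral>\<^sup>+x. ennreal (indicator K x *\<^sub>R (f x - g x)\<^sup>2) \<partial>lborel)"
        using i unfolding set_lebesgue_integral_def set_integrable_def
        by (intro nn_integral_eq_integral[symmetric]) (auto simp: indicator_def)
      also have "\<dots> \<le> (\<integral>\<^sup>+x\<in>U. ennreal ((norm (f x - g x))\<^sup>2) \<partial>lborel)"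
        using KU by (intro nn_integral_mono) (auto simp: indicator_def)
      also have "\<dots> \<le> ennreal (4 * \<epsilon>\<^sup>2)" by (rule fg)
      finally have "(LINT x:K|lborel. (f x - g x)\<^sup>2) \<le> 4 * \<epsilon>\<^sup>2" by (subst (asm) ennreal_le_iff) auto
      moreover have "(LINT x:K|lborel. (f x - g x)\<^sup>2) \<ge> 0"
        unfolding set_lebesgue_integral_def by (rule Bochner_Integration.integral_nonneg) (simp add: indicator_def)
      ultimately show ?case using \<epsilon>(2) by (simp add: LI)
    qed
  qed
qed

text \<open>The Sobolev bound applies to differences of two approximating flows but not to the
  distance from \<open>ue\<close>, hence a Cauchy property. It is stated on an open set around
  \<open>K\<close> because the limit is identified by means of small balls.\<close>

lemma uniform_cauchy:
  assumes K: "compact K" "K \<subseteq> M"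
  obtains V U where "open V" "K \<subseteq> V" "V \<subseteq> U" "open U" "compact (closure U)" "closure U \<subseteq> M"
    "\<And>\<eta>. \<eta> > 0 \<Longrightarrow> \<exists>N. \<forall>n\<ge>N. \<forall>m\<ge>N. \<forall>p\<in>V. norm (u n p - u m p) \<le> \<eta>"
proof -
  obtain e where e: "e > 0" "closure (\<Union>x\<in>K. ball x e) \<subseteq> M" "compact (closure (\<Union>x\<in>K. ball x e))"
    using compact_neighbourhood[OF K(1) M K(2)] by metis
  define U where "U = (\<Union>x\<in>K. ball x e)"
  define V where "V = (\<Union>x\<in>K. ball x (e/2))"
  have oU: "open U" and UM: "U \<subseteq> M" using e(1,2) closure_subset[of U] by (auto simp: U_def)
  \<comment> \<open>A square of side \<delta> with a corner in \<open>V\<close> reaches no further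
    than \<open>2 * \<delta>\<close>, so it stays in \<open>U\<close>.\<close>
  define \<delta> where "\<delta> = min 1 (e / 4)"
  have \<delta>: "0 < \<delta>" "\<delta> \<le> 1" "\<delta> \<le> e / 4" using e(1) by (auto simp: \<delta>_def)
  have box: "cbox p (p + vector [\<delta>, \<delta>]) \<subseteq> U" if "p \<in> V" for p
  proof
    fix y assume y: "y \<in> cbox p (p + vector [\<delta>, \<delta>])"
    obtain x where x: "x \<in> K" "dist x p < e/2" using \<open>p \<in> V\<close> by (auto simp: V_def)
    have "norm (y - p) \<le> \<bar>(y - p) $ 1\<bar> + \<bar>(y - p) $ 2\<bar>"
      using norm_le_l1_cart[of "y - p"] by (simp add: sum_2)
    also have "\<dots> \<le> \<delta> + \<delta>" using y by (auto simp: mem_box_cart forall_2)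
    also have "\<dots> \<le> e/2" using \<delta>(3) by simp
    finally have "dist p y \<le> e/2" by (simp add: dist_norm norm_minus_commute)
    then have "dist x y < e" using x(2) dist_triangle[of x y p] by linarith
    then show "y \<in> U" using x(1) by (auto simp: U_def)
  qed
  show ?thesis
  proof (rule that[of V U])
    show "open V" "K \<subseteq> V" "V \<subseteq> U" "open U" "compact (closure U)" "closure U \<subseteq> M"
      using e oU by (auto simp: U_def V_def)
    fix \<eta> :: real assume \<eta>: "\<eta> > 0"
    \<comment> \<open>The choices of \<open>t\<close> and \<epsilon> make each of the two terms of
      the Sobolev bound equal to \<open>\<eta> / 2\<close>.\<close>
    define t where "t = \<eta> / 8"
    define \<epsilon> where "\<epsilon> = sqrt (\<eta> * t * (\<delta> * \<delta>) / 32)"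
    have t: "t > 0" using \<eta> by (simp add: t_def)
    have \<epsilon>: "\<epsilon> > 0" "\<epsilon>\<^sup>2 = \<eta> * t * (\<delta> * \<delta>) / 32" using \<eta> t \<delta> by (auto simp: \<epsilon>_def)
    have "\<forall>\<^sub>F n in sequentially. H_norm \<sigma> U (\<lambda>x. u n x - ue x) < ennreal \<epsilon>"
      by (rule H_small) (use e \<epsilon> oU in \<open>auto simp: U_def\<close>)
    then obtain N where N: "\<And>n. n \<ge> N \<Longrightarrow> H_norm \<sigma> U (\<lambda>x. u n x - ue x) < ennreal \<epsilon>"
      unfolding eventually_sequentially by blast
    have "norm (u n p - u m p) \<le> \<eta>" if nm: "n \<ge> N" "m \<ge> N" and p: "p \<in> V" for n m p
    proof -
      let ?v = "\<lambda>x. u n x - u m x"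
      have CU: "C_on 2 U (u n)" "C_on 2 U (u m)" "C_on 1 U ue"
        using C_on_subset[OF u UM] C_on_subset[OF ue UM] by blast+
      note hb = H_norm_cauchy_bounds[OF oU CU \<sigma> N[OF nm(1)] N[OF nm(2)]]
      have "norm (?v p) \<le> 4 * t + 4 * (4 * \<epsilon>\<^sup>2) / (t * (\<delta> * \<delta>))"
        by (rule sobolev_pointwise[OF C_on_diff[OF oU CU(1,2)] box[OF p] order_refl \<delta>(1,2) t _ hb(1) hb(2) hb(2) hb(3)]) simp
      also have "4 * (4 * \<epsilon>\<^sup>2) / (t * (\<delta> * \<delta>)) = \<eta> / 2"
        unfolding \<epsilon>(2) using t \<delta>(1) by (simp add: field_simps)
      also have "4 * t + \<eta> / 2 = \<eta>" by (simp add: t_def)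
      finally show ?thesis .
    qed
    then show "\<exists>N. \<forall>n\<ge>N. \<forall>m\<ge>N. \<forall>p\<in>V. norm (u n p - u m p) \<le> \<eta>" by blast
  qed
qed

text \<open>Were \<open>u n\<close> far from \<open>ue\<close> at one point, it would be far on a
  ball by continuity; the Cauchy bound keeps every later flow at distance at least
  \<open>\<eta> / 4\<close> on that ball, against convergence in the square mean.\<close>

lemma uniform_convergence:
  assumes K: "compact K" "K \<subseteq> M"
  shows "uniform_limit K u ue sequentially"
proof (rule uniform_limitI)
  fix \<eta> :: real assume \<eta>: "\<eta> > 0"
  obtain V U where V: "open V" "K \<subseteq> V" "V \<subseteq> U" and U: "open U" "compact (closure U)" "closure U \<subseteq> M"
    and cauchy: "\<And>\<eta>. \<eta> > 0 \<Longrightarrow> \<exists>N. \<forall>n\<ge>N. \<forall>m\<ge>N. \<forall>p\<in>V. norm (u n p - u m p) \<le> \<eta>"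
    using uniform_cauchy[OF K] by metis
  have UM: "U \<subseteq> M" using U(3) closure_subset by blast
  obtain N where N: "\<And>n m p. n \<ge> N \<Longrightarrow> m \<ge> N \<Longrightarrow> p \<in> V \<Longrightarrow> norm (u n p - u m p) \<le> \<eta> / 4"
    using cauchy[of "\<eta> / 4"] \<eta> by auto
  have "norm (u n x - ue x) \<le> \<eta> / 2" if n: "n \<ge> N" and x: "x \<in> K" for n x
  proof (rule ccontr)
    assume "\<not> norm (u n x - ue x) \<le> \<eta> / 2"
    then have gt: "norm (u n x - ue x) > \<eta> / 2" by simp
    have "continuous_on V (\<lambda>y. norm (u n y - ue y))"
      using C_on_continuous_on[OF u1] C_on_continuous_on[OF ue] V(3) UM
      by (intro continuous_intros) (auto intro: continuous_on_subset)
    then have "open (V \<inter> (\<lambda>y. norm (u n y - ue y)) -` {\<eta> / 2<..})"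
      using V(1) by (intro continuous_open_preimage) auto
    moreover have "x \<in> V \<inter> (\<lambda>y. norm (u n y - ue y)) -` {\<eta> / 2<..}" using gt x V(2) by auto
    ultimately obtain r where r: "r > 0" "ball x r \<subseteq> V \<inter> (\<lambda>y. norm (u n y - ue y)) -` {\<eta> / 2<..}"
      using openE by blast
    define c where "c = measure lborel (ball x r)"
    have fin: "emeasure lborel (ball x r) \<noteq> \<infinity>"
      using emeasure_bounded_finite[OF bounded_ball[of x r]] by simp
    then have em: "emeasure lborel (ball x r) = ennreal c" unfolding c_def by (simp add: emeasure_eq_ennreal_measure)
    have "c > 0"
    proof (rule ccontr)
      assume "\<not> c > 0"
      then have "c = 0" by (simp add: c_def less_le)
      then have "ball x r \<in> null_sets lborel" using em by (intro null_setsI) auto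
      then have "negligible (ball x r)" using null_sets_completionI negligible_iff_null_sets by blast
      then show False using open_not_negligible[of "ball x r"] r(1) by simp
    qed
    \<comment> \<open>Its square is half of what a deviation by \<open>\<eta> / 4\<close> on the
      whole ball would contribute.\<close>
    define \<epsilon> where "\<epsilon> = sqrt ((\<eta> / 4)\<^sup>2 * c / 2)"
    have \<epsilon>: "\<epsilon> > 0" "\<epsilon>\<^sup>2 < (\<eta> / 4)\<^sup>2 * c" using \<eta> \<open>c > 0\<close> by (auto simp: \<epsilon>_def)
    obtain m where m: "m \<ge> N" "H_norm \<sigma> U (\<lambda>x. u m x - ue x) < ennreal \<epsilon>"
      using eventually_conj[OF H_small[OF U \<epsilon>(1)] eventually_ge_at_top[of N]]
      by (auto dest: eventually_happens)
    have far: "norm (u m y - ue y) \<ge> \<eta> / 4" if y: "y \<in> ball x r" for y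
    proof -
      have "norm (u n y - ue y) > \<eta> / 2" "y \<in> V" using r(2) y by auto
      moreover have "norm (u n y - u m y) \<le> \<eta> / 4" by (rule N[OF n m(1) \<open>y \<in> V\<close>])
      moreover have "norm (u n y - ue y) \<le> norm (u n y - u m y) + norm (u m y - ue y)"
        using norm_triangle_ineq[of "u n y - u m y" "u m y - ue y"] by simp
      ultimately show ?thesis by linarith
    qed
    have "ennreal ((\<eta> / 4)\<^sup>2 * c) = (\<integral>\<^sup>+y. ennreal ((\<eta> / 4)\<^sup>2) * indicator (ball x r) y \<partial>lborel)"
      using \<open>c > 0\<close> by (simp add: nn_integral_cmult_indicator em ennreal_mult)
    also have "\<dots> \<le> (\<integral>\<^sup>+y\<in>U. ennreal ((norm (u m y - ue y))\<^sup>2) \<partial>lborel)"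
    proof (intro nn_integral_mono)
      fix y
      show "ennreal ((\<eta> / 4)\<^sup>2) * indicator (ball x r) y \<le> ennreal ((norm (u m y - ue y))\<^sup>2) * indicator U y"
      proof (cases "y \<in> ball x r")
        case True
        then have "y \<in> U" using r(2) V(3) by auto
        moreover have "(\<eta> / 4)\<^sup>2 \<le> (norm (u m y - ue y))\<^sup>2" using far[OF True] \<eta> by (intro power_mono) auto
        ultimately show ?thesis using True by (simp add: ennreal_leI)
      qed simp
    qed
    also have "\<dots> \<le> ennreal (\<epsilon>\<^sup>2)"
      by (rule H_norm_C1_bounds(1)[OF U(1) C_on_subset[OF u1 UM] C_on_subset[OF ue UM] \<sigma> m(2)])
    finally show False using \<epsilon>(2) by (subst (asm) ennreal_le_iff) auto
  qed
  then show "\<forall>\<^sub>F n in sequentially. \<forall>x\<in>K. dist (u n x) (ue x) < \<eta>"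
    unfolding eventually_sequentially dist_norm using \<eta> by (intro exI[of _ N]) fastforce
qed

end

section \<open>Steady Euler flows\<close>

lemma C_on_2_streamfunction:
  assumes M: "open M" and sf: "streamfunction M \<psi> u" and u: "C_on 1 M u"
  shows "C_on 2 M \<psi>"
proof -
  have p: "partial 1 \<psi> x = u x $ 2" "partial 2 \<psi> x = - u x $ 1" if "x \<in> M" for x
    using sf that unfolding streamfunction_def by (auto simp: vec_eq_iff forall_2)
  have "C_on 1 M (partial 1 \<psi>)"
    by (rule C_on_cong[OF M C_on_nth[OF M u, of 2]]) (simp add: p)
  moreover have "C_on 1 M (partial 2 \<psi>)"
    by (rule C_on_cong[OF M C_on_minus[OF M C_on_nth[OF M u, of 1]]]) (simp add: p)
  ultimately have "C_on 1 M (partial i \<psi>)" for i using exhaust_2[of i] by (cases "i = 1") auto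
  then show ?thesis using sf unfolding C_on_2 streamfunction_def by blast
qed

lemma euler_bernoulli_derivative:
  assumes M: "open M" and u: "C_on 1 M u" and q: "C_on 1 M q" and eq: "\<And>x. x \<in> M \<Longrightarrow> convection u u x = - grad q x"
    and \<psi>: "\<And>x. x \<in> M \<Longrightarrow> u x = perp_grad \<psi> x" and x: "x \<in> M"
  shows "((\<lambda>x. (u x $ 1 * u x $ 1 + u x $ 2 * u x $ 2) / 2 + q x) has_derivative (\<lambda>h. curl u x * (grad \<psi> x \<bullet> h))) (at x)"
proof -
  let ?B = "\<lambda>x. (u x $ 1 * u x $ 1 + u x $ 2 * u x $ 2) / 2 + q x"
  note B = bernoulli[OF M u q]
  have "?B differentiable (at x)" using B(1) x by (simp add: C_on_1)
  then have 1: "(?B has_derivative (\<lambda>h. grad ?B x \<bullet> h)) (at x)" by (rule differentiable_grad)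
  have p: "partial 1 \<psi> x = u x $ 2" "partial 2 \<psi> x = - u x $ 1" using \<psi>[OF x] by (simp_all add: vec_eq_iff forall_2)
  have "u x $ 1 * partial 1 u x $ j + u x $ 2 * partial 2 u x $ j = - partial j q x" for j
    using arg_cong[OF eq[OF x], of "\<lambda>a. a $ j"] by (simp add: convection_def sum_2)
  from this[of 1] this[of 2] have "grad ?B x = curl u x *\<^sub>R grad \<psi> x"
    unfolding vec_eq_iff forall_2 using B(2)[OF x] by (simp add: p curl_def algebra_simps)
  with 1 show ?thesis by simp
qed

lemma constant_vorticity_if_minimum:
  fixes v :: "nat \<Rightarrow> real^2 \<Rightarrow> real^2"
  assumes min: "single_minimum M \<psi> c x0" and sc: "simply_connected M" and C2: "C_on 2 M \<psi>"
    and u: "\<And>x. x \<in> M \<Longrightarrow> u x = perp_grad \<psi> x" "C_on 1 M u"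
    and q: "C_on 1 M q" and euler: "\<And>x. x \<in> M \<Longrightarrow> convection u u x = - grad q x"
    and ns: "\<And>n. stationary_navier_stokes M (\<kappa> n) (v n) (p n)" "\<And>n. \<kappa> n \<noteq> 0"
    and unif: "\<And>K. compact K \<Longrightarrow> K \<subseteq> M \<Longrightarrow> uniform_limit K v u sequentially"
    and L2: "\<And>K. compact K \<Longrightarrow> K \<subseteq> M \<Longrightarrow> (\<lambda>n. LINT x:K|lborel. (curl (v n) x - curl u x)\<^sup>2) \<longlonglongrightarrow> 0"
    and y: "y \<in> M"
  shows "laplacian \<psi> y = laplacian \<psi> x0"
proof -
  interpret single_minimum M \<psi> c x0 by fact
  have curl: "curl u x = laplacian \<psi> x" if "x \<in> M" for x
  proof -
    have "partial i u x = partial i (perp_grad \<psi>) x" for i by (rule partial_cong_open[OF M(1) that u(1)])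
    then have "curl u x = curl (perp_grad \<psi>) x" by (simp add: curl_def)
    then show ?thesis using curl_perp_grad[OF M(1) C2 that] by simp
  qed
  interpret inviscid_limit M \<psi> c x0 v \<kappa> p
  proof
    fix K assume K: "compact K" "K \<subseteq> M"
    show "uniform_limit K v (perp_grad \<psi>) sequentially"
      using unif[OF K] uniform_limit_cong'[of K v v u "perp_grad \<psi>" sequentially] u(1) K(2) by (metis subsetD)
    have "(LINT x:K|lborel. (curl (v n) x - curl u x)\<^sup>2) = (LINT x:K|lborel. (curl (v n) x - laplacian \<psi> x)\<^sup>2)" for n
      unfolding set_lebesgue_integral_def using curl K(2)
      by (intro Bochner_Integration.integral_cong) (auto simp: indicator_def)
    then show "(\<lambda>n. LINT x:K|lborel. (curl (v n) x - laplacian \<psi> x)\<^sup>2) \<longlonglongrightarrow> 0" using L2[OF K] by simp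
  qed (use C2 sc ns in auto)
  interpret inviscid_limit_euler M \<psi> c x0 v \<kappa> p
  proof
    fix x y assume xy: "x \<in> M" "y \<in> M" "\<psi> x = \<psi> y"
    have "((\<lambda>x. (u x $ 1 * u x $ 1 + u x $ 2 * u x $ 2) / 2 + q x) has_derivative (\<lambda>h. laplacian \<psi> x * (grad \<psi> x \<bullet> h))) (at x)"
      if "x \<in> M" for x
      using euler_bernoulli_derivative[OF M(1) u(2) q euler u(1) that] curl[OF that] by simp
    then show "laplacian \<psi> x = laplacian \<psi> y" by (rule constant_on_level_sets[OF C1 _ xy])
  qed
  show ?thesis by (rule constant_vorticity[OF y])
qed

text \<open>Convection is quadratic and the viscous term linear, so reversing the flow with the same
  pressure reverses the sign of the viscosity.\<close>

lemma stationary_navier_stokes_uminus: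
  assumes M: "open M" and ns: "stationary_navier_stokes M \<nu> v q"
  shows "stationary_navier_stokes M (- \<nu>) (\<lambda>x. - v x) q"
proof -
  have v: "C_on 2 M v" using ns unfolding stationary_navier_stokes_def by blast
  have d: "v differentiable (at x)" if "x \<in> M" for x using v that by (simp add: C_on_2)
  have p: "partial i (\<lambda>x. - v x) x = - partial i v x" if "x \<in> M" for x i by (rule partial_minus[OF d[OF that]])
  have "convection (\<lambda>x. - v x) (\<lambda>x. - v x) x = convection v v x" "divergence (\<lambda>x. - v x) x = - divergence v x" if "x \<in> M" for x
    using p[OF that] by (simp_all add: convection_def divergence_def sum_2)
  moreover have "laplacian (\<lambda>x. - v x) x = - laplacian v x" if "x \<in> M" for x
    by (rule laplacian_bounded_linear[OF M v bounded_linear_minus[OF bounded_linear_ident] that])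
  ultimately show ?thesis using ns C_on_minus[OF M v] unfolding stationary_navier_stokes_def by simp
qed

text \<open>For bounded open sets of the complex plane simple connectedness entails a connected
  complement; the identification with \<open>real^2\<close> carries this over.\<close>

lemma connected_complement:
  fixes M :: "(real^2) set"
  assumes "open M" "bounded M" "simply_connected M"
  shows "connected (- M)"
proof -
  have "simply_connected (toC ` M)"
    using assms(3) homeomorphic_simply_connected_eq[of M "toC ` M"] homeomorphism_toC[of M] unfolding homeomorphic_def by blast
  then have "connected (- (toC ` M))"
    using simply_connected_iff_simple[OF open_toC[OF assms(1)] bounded_linear_image[OF assms(2) bounded_linear_toC]] by blast
  then have "connected (ofC ` (- (toC ` M)))"
    by (rule connected_continuous_image[OF linear_continuous_on[OF bounded_linear_ofC]])
  moreover have "ofC ` (- (toC ` M)) = - M"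
  proof (intro equalityI subsetI)
    fix x assume "x \<in> ofC ` (- (toC ` M))"
    then show "x \<in> - M" by (metis ComplD ComplI imageE imageI toC_ofC(1))
  next
    fix x assume "x \<in> - M"
    then have "toC x \<in> - (toC ` M)" by (metis ComplD ComplI imageE toC_ofC(2))
    then show "x \<in> ofC ` (- (toC ` M))" by (metis imageI toC_ofC(2))
  qed
  ultimately show ?thesis by simp
qed

theorem theorem2:
  fixes M :: "(real^2) set"
    and \<psi> :: "real^2 \<Rightarrow> real" and u\<^sub>e :: "real^2 \<Rightarrow> real^2" and q\<^sub>e :: "real^2 \<Rightarrow> real"
    and u :: "real \<Rightarrow> real^2 \<Rightarrow> real^2" and q :: "real \<Rightarrow> real^2 \<Rightarrow> real"
    and p \<sigma> :: real
  assumes domain: "open M" "connected M" "M \<noteq> {}" "bounded M" "simply_connected M"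
      "smooth_boundary M"
    and psi: "p > 1" "W_space 4 p M \<psi>"
    and euler: "streamfunction M \<psi> u\<^sub>e" "steady_euler M u\<^sub>e q\<^sub>e" "tangential_boundary M u\<^sub>e"
    and single_stagnation: "\<exists>!x. x \<in> M \<and> u\<^sub>e x = 0"
    and nondegenerate: "\<forall>x\<in>M. u\<^sub>e x \<noteq> 0 \<longrightarrow> period M \<psi> differentiable (at (\<psi> x))"
    and navier_stokes: "\<forall>\<nu>>0. stationary_navier_stokes M \<nu> (u \<nu>) (q \<nu>)"
    and sigma: "\<sigma> > 5/2"
    and convergence: "\<forall>U. open U \<and> compact (closure U) \<and> closure U \<subseteq> M \<longrightarrow>
      ((\<lambda>\<nu>. H_norm \<sigma> U (\<lambda>x. u \<nu> x - u\<^sub>e x)) \<longlongrightarrow> 0) (at_right 0)"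
  shows "\<exists>\<omega>\<^sub>0::real. \<forall>x\<in>M. u\<^sub>e x = \<omega>\<^sub>0 *\<^sub>R u_star M x"
proof -
  have ue1: "C_on 1 M u\<^sub>e" and qe: "C_on 1 M q\<^sub>e" and eu: "\<And>x. x \<in> M \<Longrightarrow> convection u\<^sub>e u\<^sub>e x = - grad q\<^sub>e x"
    using euler(2) unfolding steady_euler_def by blast+
  have \<psi>d: "\<And>x. x \<in> M \<Longrightarrow> \<psi> differentiable (at x)" and up: "\<And>x. x \<in> M \<Longrightarrow> u\<^sub>e x = perp_grad \<psi> x"
    using euler(1) unfolding streamfunction_def by blast+
  have C2: "C_on 2 M \<psi>" by (rule C_on_2_streamfunction[OF domain(1) euler(1) ue1])
  have cM: "connected (- M)" by (rule connected_complement[OF domain(1,4,5)])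
  have "connected (frontier M)" by (rule connected_frontier_simple[OF domain(2) cM])
  then obtain c where c: "\<And>x. x \<in> frontier M \<Longrightarrow> (\<psi> \<longlongrightarrow> c) (at x within M)"
    using streamfunction_boundary_constant[OF domain(1) _ domain(6) euler(1,3)] by metis
  obtain x0 where x0: "x0 \<in> M" "u\<^sub>e x0 = 0" "\<And>x. x \<in> M \<Longrightarrow> u\<^sub>e x = 0 \<Longrightarrow> x = x0"
    using single_stagnation by blast
  have crit: "grad \<psi> x = 0 \<longleftrightarrow> u\<^sub>e x = 0" if "x \<in> M" for x
    using up[OF that] by (auto simp: vec_eq_iff forall_2)
  interpret single_critical_point M \<psi> c x0
  proof (unfold_locales, rule domain(1), rule domain(4), rule cM)
    show "\<psi> differentiable (at x)" if "x \<in> M" for x by (rule \<psi>d[OF that])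
    show "(\<psi> \<longlongrightarrow> c) (at x within M)" if "x \<in> frontier M" for x by (rule c[OF that])
    show "x0 \<in> M" "grad \<psi> x0 = 0" using x0 crit by blast+
    show "x = x0" if "x \<in> M" "grad \<psi> x = 0" for x using x0(3) crit that by blast
  qed
  \<comment> \<open>One sequence of positive viscosities tending to 0 is enough to pass to the
    limit.\<close>
  define \<nu> where "\<nu> n = inverse (real (Suc n))" for n
  have \<nu>: "\<nu> n > 0" for n by (simp add: \<nu>_def)
  have "filterlim \<nu> (at_right 0) sequentially"
    using LIMSEQ_inverse_real_of_nat \<nu> by (simp add: filterlim_at \<nu>_def[abs_def])
  then have conv: "(\<lambda>n. H_norm \<sigma> U (\<lambda>x. u (\<nu> n) x - u\<^sub>e x)) \<longlonglongrightarrow> 0"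
    if "open U" "compact (closure U)" "closure U \<subseteq> M" for U
    using convergence that filterlim_compose[of "\<lambda>\<nu>. H_norm \<sigma> U (\<lambda>x. u \<nu> x - u\<^sub>e x)" "nhds 0"] by blast
  define v where "v n = u (\<nu> n)" for n
  have ns: "stationary_navier_stokes M (\<nu> n) (v n) (q (\<nu> n))" for n
    using navier_stokes \<nu> by (simp add: v_def)
  have v2: "C_on 2 M (v n)" for n using ns unfolding stationary_navier_stokes_def by blast
  interpret sob: sobolev_convergence M \<sigma> v u\<^sub>e
    by unfold_locales (use domain(1) sigma v2 ue1 conv in \<open>auto simp: v_def\<close>)
  have lap: "laplacian \<psi> y = laplacian \<psi> x0" if y: "y \<in> M" for y
    using sign_dichotomy
  proof
    assume "\<forall>x\<in>M. \<psi> x < c"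
    then have "single_minimum M \<psi> c x0" by unfold_locales blast
    then show ?thesis
    proof (rule constant_vorticity_if_minimum[OF _ domain(5) C2])
      show "u\<^sub>e x = perp_grad \<psi> x" "convection u\<^sub>e u\<^sub>e x = - grad q\<^sub>e x" if "x \<in> M" for x
        by (fact up[OF that] eu[OF that])+
      show "stationary_navier_stokes M (\<nu> n) (v n) (q (\<nu> n))" "\<nu> n \<noteq> 0" for n
        using ns[of n] \<nu>[of n] by auto
      show "uniform_limit K v u\<^sub>e sequentially" "(\<lambda>n. LINT x:K|lborel. (curl (v n) x - curl u\<^sub>e x)\<^sup>2) \<longlonglongrightarrow> 0"
        if "compact K" "K \<subseteq> M" for K by (fact sob.uniform_convergence[OF that] sob.curl_convergence[OF that])+
    qed (fact ue1 qe y)+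
  next
    \<comment> \<open>Here the stagnation point is a maximum. Changing the signs of \<psi> and of
      all velocities reduces this to a minimum; the pressures stay, the viscosities become negative,
      and the squared curl difference is unchanged.\<close>
    assume gt: "\<forall>x\<in>M. \<psi> x > c"
    let ?\<psi> = "\<lambda>x. - \<psi> x"
    have p: "partial i ?\<psi> x = - partial i \<psi> x" if "x \<in> M" for i x by (rule partial_minus[OF \<psi>d[OF that]])
    have g: "grad ?\<psi> x = 0 \<longleftrightarrow> grad \<psi> x = 0" if "x \<in> M" for x using p[OF that] by (simp add: vec_eq_iff)
    have min: "single_minimum M ?\<psi> (- c) x0"
    proof unfold_locales
      show "open M" "bounded M" "connected (- M)" by (fact domain(1) domain(4) cM)+
      show "?\<psi> differentiable (at x)" if "x \<in> M" for x
        by (rule differentiable_bounded_linear[OF bounded_linear_minus[OF bounded_linear_ident] \<psi>d[OF that]])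
      show "(?\<psi> \<longlongrightarrow> - c) (at x within M)" if "x \<in> frontier M" for x by (rule tendsto_minus[OF c[OF that]])
      show "x0 \<in> M" "grad ?\<psi> x0 = 0" using x0 crit g by blast+
      show "x = x0" if "x \<in> M" "grad ?\<psi> x = 0" for x using x0(3) crit g that by blast
      show "?\<psi> x < - c" if "x \<in> M" for x using gt that by simp
    qed
    have u': "- u\<^sub>e x = perp_grad ?\<psi> x" if "x \<in> M" for x using up[OF that] p[OF that] by (simp add: vec_eq_iff forall_2)
    have pu: "partial i (\<lambda>x. - u\<^sub>e x) x = - partial i u\<^sub>e x" if "x \<in> M" for i x
      using ue1 that by (intro partial_minus) (simp add: C_on_1)
    have eu': "convection (\<lambda>x. - u\<^sub>e x) (\<lambda>x. - u\<^sub>e x) x = - grad q\<^sub>e x" if "x \<in> M" for x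
      using eu[OF that] pu[OF that] by (simp add: convection_def)
    have pv: "partial i (\<lambda>x. - v n x) x = - partial i (v n) x" if "x \<in> M" for i x n
      using C_on_le[OF v2, of 1 n] that by (intro partial_minus) (simp add: C_on_1)
    have "laplacian ?\<psi> y = laplacian ?\<psi> x0"
    proof (rule constant_vorticity_if_minimum[OF min domain(5) C_on_minus[OF domain(1) C2]])
      show "- u\<^sub>e x = perp_grad ?\<psi> x" "convection (\<lambda>x. - u\<^sub>e x) (\<lambda>x. - u\<^sub>e x) x = - grad q\<^sub>e x" if "x \<in> M" for x
        by (fact u'[OF that] eu'[OF that])+
      show "stationary_navier_stokes M (- \<nu> n) (\<lambda>x. - v n x) (q (\<nu> n))" for n
        by (rule stationary_navier_stokes_uminus[OF domain(1) ns])
      show "- \<nu> n \<noteq> 0" for n using \<nu>[of n] by simp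
      show "C_on 1 M (\<lambda>x. - u\<^sub>e x)" by (rule C_on_minus[OF domain(1) ue1])
      show "C_on 1 M q\<^sub>e" "y \<in> M" by (fact qe y)+
      fix K assume K: "compact K" "K \<subseteq> M"
      show "uniform_limit K (\<lambda>n x. - v n x) (\<lambda>x. - u\<^sub>e x) sequentially"
        using sob.uniform_convergence[OF K] by (rule uniform_limit_uminus)
      have "(curl (\<lambda>x. - v n x) x - curl (\<lambda>x. - u\<^sub>e x) x)\<^sup>2 = (curl (v n) x - curl u\<^sub>e x)\<^sup>2" if "x \<in> M" for n x
        using pu[OF that] pv[OF that] by (simp add: curl_def power2_eq_square algebra_simps)
      then have "(LINT x:K|lborel. (curl (\<lambda>x. - v n x) x - curl (\<lambda>x. - u\<^sub>e x) x)\<^sup>2) = (LINT x:K|lborel. (curl (v n) x - curl u\<^sub>e x)\<^sup>2)" for n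
        unfolding set_lebesgue_integral_def using K(2)
        by (intro Bochner_Integration.integral_cong) (auto simp: indicator_def)
      then show "(\<lambda>n. LINT x:K|lborel. (curl (\<lambda>x. - v n x) x - curl (\<lambda>x. - u\<^sub>e x) x)\<^sup>2) \<longlonglongrightarrow> 0"
        using sob.curl_convergence[OF K] by simp
    qed
    moreover have "laplacian ?\<psi> x = - laplacian \<psi> x" if "x \<in> M" for x
      by (rule laplacian_bounded_linear[OF domain(1) C2 bounded_linear_minus[OF bounded_linear_ident] that])
    ultimately show ?thesis using y x0(1) by simp
  qed
  have "u\<^sub>e x = laplacian \<psi> x0 *\<^sub>R u_star M x" if "x \<in> M" for x
    using constant_vorticity_imp_u_star[OF domain(1,4) C2 c lap that] up[OF that] by simp
  then show ?thesis by blast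
qed

end
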